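(* Let $m\ge 2$, $n\ge 1$ be integers, let $\theta_1,\dots,\theta_m>0$ and $\omega_1,\dots,\omega_m>0$ be real numbers with $\sum_{i=1}^m\omega_i=n$, and let $\|\cdot\|$ be a norm on $\mathbb{R}^n$. For $u=(u_{ij})\in M_{m,n}(\mathbb{T})$, $\mathbf{x}=(x_1,\dots,x_m)\in\mathbb{T}^m$ and $T>0$, let $\Delta_T(u,\mathbf{x})$ be the number of $(\mathbf{p},\mathbf{q})\in\mathbb{Z}^m\times(\mathbb{Z}^n\setminus\{\mathbf{0}\})$ with $0<\|\mathbf{q}\|<T$ and $$\Big|p_i+\sum_{j=1}^n u_{ij}q_j+x_i\Big|<\theta_i\|\mathbf{q}\|^{-\omega_i},\qquad i=1,\dots,m.$$ Assume that $(u,\mathbf{x})$ is uniformly distributed on $\mathbb{T}^{mn}\times\mathbb{T}^m$. Then, as $T\to\infty$, $$\frac{\Delta_T(u,\mathbf{x})-\sigma_{m,n}^2\log T}{\sigma_{m,n}\sqrt{\log T}}\Longrightarrow \mathcal{N}(0,1)\quad\text{in distribution},$$ where $\sigma_{m,n}>0$ is given by $$\sigma_{m,n}^2=2^m\Big(\prod_{i=1}^m\theta_i\Big)\,n\,\mathrm{vol}_n .$$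
   Context: $\mathbb{T}=\mathbb{R}/\mathbb{Z}$, and $M_{m,n}(\mathbb{T})$ is identified with $\mathbb{T}^{mn}$; the count $\Delta_T(u,\mathbf{x})$ does not depend on the choice of real representatives of the entries of $u$ and $\mathbf{x}$. $\mathrm{vol}_n$ denotes the Euclidean volume (Lebesgue measure) of the unit ball $\{z\in\mathbb{R}^n:\|z\|\le 1\}$ of the norm $\|\cdot\|$. $\mathcal{N}(0,1)$ is the standard normal distribution. *)

theory Defs
  imports "HOL-Probability.Probability"
begin

definition is_norm :: "('a::real_vector \<Rightarrow> real) \<Rightarrow> bool" where
  "is_norm N \<longleftrightarrow>
     (\<forall>x. 0 \<le> N x) \<and> (\<forall>x. N x = 0 \<longleftrightarrow> x = 0) \<and>
     (\<forall>c x. N (c *\<^sub>R x) = \<bar>c\<bar> * N x) \<and>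
     (\<forall>x y. N (x + y) \<le> N x + N y)"

abbreviation of_int_vec :: "int ^ 'n \<Rightarrow> real ^ 'n" where
  "of_int_vec q \<equiv> (\<chi> j. real_of_int (q $ j))"

definition vol_unit_ball :: "(real ^ 'n \<Rightarrow> real) \<Rightarrow> real" where
  "vol_unit_ball N = measure lborel {z. N z \<le> 1}"

definition solutions ::
  "(real ^ 'n \<Rightarrow> real) \<Rightarrow> real ^ 'm \<Rightarrow> real ^ 'm \<Rightarrow> real ^ 'n ^ 'm \<Rightarrow> real ^ 'm \<Rightarrow> real
     \<Rightarrow> ((int ^ 'm) \<times> (int ^ 'n)) set" where
  "solutions N \<theta> \<omega> u x T =
     {(p, q). q \<noteq> 0 \<and> 0 < N (of_int_vec q) \<and> N (of_int_vec q) < T \<and>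
        (\<forall>i. \<bar>real_of_int (p $ i) + (\<Sum>j\<in>UNIV. u $ i $ j * real_of_int (q $ j)) + x $ i\<bar>
              < \<theta> $ i * N (of_int_vec q) powr (- (\<omega> $ i)))}"

text \<open>The arguments \<open>u\<close> and \<open>x\<close> are real representatives of points of the tori; the count does
  not depend on their choice (\<open>Delta_periodic\<close>). For a norm \<open>N\<close> the set counted is
  finite (\<open>finite_solutions\<close>), so \<^const>\<open>card\<close> is the genuine number of solutions.\<close>

definition Delta ::
  "(real ^ 'n \<Rightarrow> real) \<Rightarrow> real ^ 'm \<Rightarrow> real ^ 'm \<Rightarrow> real ^ 'n ^ 'm \<Rightarrow> real ^ 'm \<Rightarrow> real \<Rightarrow> nat" where
  "Delta N \<theta> \<omega> u x T = card (solutions N \<theta> \<omega> u x T)"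

definition sigma_const :: "(real ^ 'n \<Rightarrow> real) \<Rightarrow> real ^ 'm \<Rightarrow> real" where
  "sigma_const N \<theta> =
     sqrt (2 ^ CARD('m) * (\<Prod>i\<in>UNIV. \<theta> $ i) * real CARD('n) * vol_unit_ball N)"

text \<open>The torus is represented by its half-open fundamental cube, on which Haar probability measure
  is Lebesgue measure.\<close>

definition torus_cube :: "((real ^ 'n ^ 'm) \<times> (real ^ 'm)) set" where
  "torus_cube = {(u, x). (\<forall>i j. u $ i $ j \<in> {0..<1}) \<and> (\<forall>i. x $ i \<in> {0..<1})}"

definition torus_measure :: "((real ^ 'n ^ 'm) \<times> (real ^ 'm)) measure" where
  "torus_measure = uniform_measure lborel torus_cube"

text \<open>\<^const>\<open>weak_conv_m\<close> is convergence in distribution along sequences of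
  measures; this is the same notion along an arbitrary filter.\<close>

definition weak_conv_along :: "('i \<Rightarrow> real measure) \<Rightarrow> real measure \<Rightarrow> 'i filter \<Rightarrow> bool" where
  "weak_conv_along M_fam M F \<longleftrightarrow>
     (\<forall>x. isCont (cdf M) x \<longrightarrow> ((\<lambda>t. cdf (M_fam t) x) \<longlongrightarrow> cdf M x) F)"

lemma weak_conv_along_sequentially: "weak_conv_along M_seq M sequentially \<longleftrightarrow> weak_conv_m M_seq M"
  by (simp add: weak_conv_along_def weak_conv_m_def weak_conv_def)

lemma sets_torus_cube [measurable]: "torus_cube \<in> sets (borel :: ((real ^ 'n ^ 'm) \<times> (real ^ 'm)) measure)"
proof -
  have eq: "torus_cube = {v \<in> space (borel :: ((real ^ 'n ^ 'm) \<times> (real ^ 'm)) measure).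
      (\<forall>i j. 0 \<le> fst v $ i $ j \<and> fst v $ i $ j < 1) \<and> (\<forall>i. 0 \<le> snd v $ i \<and> snd v $ i < 1)}"
    by (auto simp: torus_cube_def)
  have [measurable]: "(\<lambda>v :: (real ^ 'n ^ 'm) \<times> (real ^ 'm). fst v $ i $ j) \<in> borel_measurable borel" for i j
    by (intro borel_measurable_continuous_onI continuous_intros)
  have [measurable]: "(\<lambda>v :: (real ^ 'n ^ 'm) \<times> (real ^ 'm). snd v $ i) \<in> borel_measurable borel" for i
    by (intro borel_measurable_continuous_onI continuous_intros)
  show ?thesis unfolding eq by measurable
qed

lemma emeasure_torus_cube: "emeasure lborel (torus_cube :: ((real ^ 'n ^ 'm) \<times> (real ^ 'm)) set) = 1"
proof -
  let ?C = "torus_cube :: ((real ^ 'n ^ 'm) \<times> (real ^ 'm)) set"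
  have comp: "(\<forall>b\<in>Basis. P (v \<bullet> b)) \<longleftrightarrow> (\<forall>i j. P (fst v $ i $ j)) \<and> (\<forall>i. P (snd v $ i))"
    for P and v :: "(real ^ 'n ^ 'm) \<times> (real ^ 'm)"
    by (auto simp: Basis_prod_def Basis_vec_def inner_axis' inner_prod_def ball_Un inner_axis)
  have "box 0 One \<subseteq> ?C"
  proof
    fix v :: "(real ^ 'n ^ 'm) \<times> (real ^ 'm)" assume "v \<in> box 0 One"
    then have "\<forall>b\<in>Basis. v \<bullet> b \<in> {0..<1}"
      by (auto simp: mem_box less_imp_le)
    then show "v \<in> ?C"
      using comp[of "\<lambda>t. t \<in> {0..<1}" v] by (auto simp: torus_cube_def case_prod_beta mem_Times_iff)
  qed
  then have 1: "1 \<le> emeasure lborel ?C"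
    using emeasure_mono[of "box 0 One" ?C lborel] by simp
  have "?C \<subseteq> cbox 0 One"
  proof
    fix v assume "v \<in> ?C"
    then have "\<forall>b\<in>Basis. v \<bullet> b \<in> {0..<1}"
      using comp[of "\<lambda>t. t \<in> {0..<1}" v] by (auto simp: torus_cube_def case_prod_beta mem_Times_iff)
    then show "v \<in> cbox 0 One"
      by (auto simp: mem_box less_imp_le)
  qed
  then have "emeasure lborel ?C \<le> 1"
    using emeasure_mono[of ?C "cbox 0 One" lborel] by simp
  with 1 show ?thesis by simp
qed

lemma prob_space_torus_measure: "prob_space torus_measure"
  unfolding torus_measure_def
  by (rule prob_space_uniform_measure) (simp_all add: emeasure_torus_cube)

lemma Delta_periodic:
  fixes a :: "int ^ 'n ^ 'm" and b :: "int ^ 'm"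
  shows "Delta N \<theta> \<omega> (u + (\<chi> i j. real_of_int (a $ i $ j))) (x + of_int_vec b) T = Delta N \<theta> \<omega> u x T"
proof -
  let ?s = "\<lambda>q :: int ^ 'n. (\<chi> i. (\<Sum>j\<in>UNIV. a $ i $ j * q $ j) + b $ i) :: int ^ 'm"
  let ?f = "\<lambda>(p, q). (p + ?s q, q)"
  let ?A = "solutions N \<theta> \<omega> (u + (\<chi> i j. real_of_int (a $ i $ j))) (x + of_int_vec b) T"
  let ?B = "solutions N \<theta> \<omega> u x T"
  have eq: "real_of_int ((p + ?s q) $ i) + (\<Sum>j\<in>UNIV. u $ i $ j * real_of_int (q $ j)) + x $ i =
     real_of_int (p $ i) + (\<Sum>j\<in>UNIV. (u + (\<chi> i j. real_of_int (a $ i $ j))) $ i $ j * real_of_int (q $ j))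
       + (x + of_int_vec b) $ i" for p q i
    by (simp only: vector_add_component vec_lambda_beta of_int_add of_int_sum of_int_mult
        distrib_right sum.distrib add.assoc add.commute add.left_commute)
  have mem: "?f pq \<in> ?B \<longleftrightarrow> pq \<in> ?A" for pq
  proof (cases pq)
    case (Pair p q)
    show ?thesis
      unfolding Pair solutions_def case_prod_conv mem_Collect_eq eq[of p q] ..
  qed
  have "bij_betw ?f ?A ?B"
  proof (rule bij_betwI[where g = "\<lambda>(p, q). (p - ?s q, q)"])
    show "?f \<in> ?A \<rightarrow> ?B" using mem by blast
    show "(\<lambda>(p, q). (p - ?s q, q)) \<in> ?B \<rightarrow> ?A"
    proof
      fix pq assume pq: "pq \<in> ?B"
      have "?f ((\<lambda>(p, q). (p - ?s q, q)) pq) = pq" by (cases pq) simp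
      with pq have "?f ((\<lambda>(p, q). (p - ?s q, q)) pq) \<in> ?B" by (simp only:)
      then show "(\<lambda>(p, q). (p - ?s q, q)) pq \<in> ?A" by (rule mem[THEN iffD1])
    qed
  qed auto
  then show ?thesis
    unfolding Delta_def by (rule bij_betw_same_card)
qed

lemma is_norm_lower_bound:
  fixes N :: "real ^ 'n \<Rightarrow> real"
  assumes "is_norm N"
  obtains c where "c > 0" "\<And>z. c * norm z \<le> N z"
proof -
  have nn: "0 \<le> N x" and z: "N x = 0 \<longleftrightarrow> x = 0" and h: "N (r *\<^sub>R x) = \<bar>r\<bar> * N x"
    and t: "N (x + y) \<le> N x + N y" for x y r
    using assms by (auto simp: is_norm_def)
  define K where "K = (\<Sum>b\<in>Basis. N b)"
  have K: "N x \<le> K * norm x" for x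
  proof -
    have fin: "N (\<Sum>b\<in>B. (x \<bullet> b) *\<^sub>R b) \<le> (\<Sum>b\<in>B. \<bar>x \<bullet> b\<bar> * N b)" if "finite B" for B
      using that
    proof induction
      case empty then show ?case using z[of 0] by simp
    next
      case (insert b B)
      then show ?case using t[of "(x \<bullet> b) *\<^sub>R b" "\<Sum>b\<in>B. (x \<bullet> b) *\<^sub>R b"] by (simp add: h)
    qed
    have "N x \<le> (\<Sum>b\<in>Basis. \<bar>x \<bullet> b\<bar> * N b)"
      using fin[of Basis] by (simp add: euclidean_representation)
    also have "\<dots> \<le> (\<Sum>b\<in>Basis. norm x * N b)"
      by (intro sum_mono mult_right_mono nn) (simp add: Basis_le_norm)
    finally show ?thesis by (simp add: K_def sum_distrib_left mult.commute)
  qed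
  have diff: "\<bar>N x - N y\<bar> \<le> K * norm (x - y)" for x y
  proof -
    have "N x \<le> N y + N (x - y)" using t[of y "x - y"] by simp
    moreover have "N y \<le> N x + N (y - x)" using t[of x "y - x"] by simp
    moreover have "N (y - x) = N (x - y)" using h[of "-1" "x - y"] by simp
    ultimately show ?thesis using K[of "x - y"] by linarith
  qed
  have "K \<ge> 0" by (simp add: K_def sum_nonneg nn)
  have "K-lipschitz_on UNIV N"
    by (rule lipschitz_onI) (use diff \<open>K \<ge> 0\<close> in \<open>auto simp: dist_norm\<close>)
  then have cont: "continuous_on (sphere 0 1) N"
    using lipschitz_on_continuous_on continuous_on_subset by blast
  have "sphere (0 :: real ^ 'n) 1 \<noteq> {}" by simp
  then obtain w where w: "w \<in> sphere 0 1" "\<And>y. y \<in> sphere 0 1 \<Longrightarrow> N w \<le> N y"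
    using continuous_attains_inf[OF compact_sphere _ cont] by blast
  have "N w > 0" using w(1) nn[of w] z[of w] by (auto simp: less_le)
  moreover have "N w * norm y \<le> N y" for y
  proof (cases "y = 0")
    case True then show ?thesis using z[of 0] by simp
  next
    case False
    then have "N w \<le> N ((1 / norm y) *\<^sub>R y)" by (intro w(2)) simp
    then show ?thesis using False by (simp add: h field_simps)
  qed
  ultimately show ?thesis using that by blast
qed

lemma finite_int_vec_bounded: "finite {p :: int ^ 'm. \<forall>i. \<bar>p $ i\<bar> \<le> B}"
proof -
  have "finite {f :: 'm \<Rightarrow> int. \<forall>i. f i \<in> {-B..B}}"
    using finite_PiE[of "UNIV :: 'm set" "\<lambda>_. {-B..B}"] by (simp add: PiE_def Pi_def)
  then have "finite (vec_lambda ` {f :: 'm \<Rightarrow> int. \<forall>i. f i \<in> {-B..B}})" by simp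
  moreover have "{p :: int ^ 'm. \<forall>i. \<bar>p $ i\<bar> \<le> B} \<subseteq> vec_lambda ` {f :: 'm \<Rightarrow> int. \<forall>i. f i \<in> {-B..B}}"
  proof
    fix p :: "int ^ 'm" assume "p \<in> {p. \<forall>i. \<bar>p $ i\<bar> \<le> B}"
    then have "vec_nth p \<in> {f. \<forall>i. f i \<in> {-B..B}}" by (auto simp: abs_le_iff minus_le_iff)
    then have "vec_lambda (vec_nth p) \<in> vec_lambda ` {f :: 'm \<Rightarrow> int. \<forall>i. f i \<in> {-B..B}}" by (rule imageI)
    then show "p \<in> vec_lambda ` {f :: 'm \<Rightarrow> int. \<forall>i. f i \<in> {-B..B}}" by simp
  qed
  ultimately show ?thesis by (rule rev_finite_subset)
qed

lemma finite_solutions: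
  fixes N :: "real ^ 'n \<Rightarrow> real" and u :: "real ^ 'n ^ 'm"
  assumes "is_norm N"
  shows "finite (solutions N \<theta> \<omega> u x T)"
proof -
  obtain c where c: "c > 0" "\<And>z. c * norm z \<le> N z"
    using is_norm_lower_bound[OF assms] by blast
  define Q where "Q = {q :: int ^ 'n. \<forall>j. \<bar>q $ j\<bar> \<le> \<lceil>T / c\<rceil>}"
  have Q: "q \<in> Q" if "N (of_int_vec q) < T" for q
    unfolding Q_def mem_Collect_eq
  proof
    fix j
    have "c * \<bar>real_of_int (q $ j)\<bar> \<le> c * norm (of_int_vec q)"
      using component_le_norm_cart[of "of_int_vec q" j] c(1) by (intro mult_left_mono) auto
    also have "\<dots> < T" using c(2)[of "of_int_vec q"] that by linarith
    finally have "\<bar>real_of_int (q $ j)\<bar> \<le> T / c" using c(1) by (simp add: field_simps)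
    then show "\<bar>q $ j\<bar> \<le> \<lceil>T / c\<rceil>" by linarith
  qed
  define R where "R q i = \<bar>\<theta> $ i * N (of_int_vec q) powr (- (\<omega> $ i))\<bar> +
      \<bar>(\<Sum>j\<in>UNIV. u $ i $ j * real_of_int (q $ j)) + x $ i\<bar>" for q i
  define P where "P q = {p :: int ^ 'm. \<forall>i. \<bar>p $ i\<bar> \<le> \<lceil>\<Sum>i\<in>UNIV. R q i\<rceil>}" for q
  have "solutions N \<theta> \<omega> u x T \<subseteq> (\<Union>q\<in>Q. (\<lambda>p. (p, q)) ` P q)"
  proof (clarify)
    fix p q assume pq: "(p, q) \<in> solutions N \<theta> \<omega> u x T"
    then have "q \<in> Q" by (intro Q) (simp add: solutions_def)
    moreover have "p \<in> P q" unfolding P_def mem_Collect_eq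
    proof
      fix i
      have "\<bar>real_of_int (p $ i) + (\<Sum>j\<in>UNIV. u $ i $ j * real_of_int (q $ j)) + x $ i\<bar>
              < \<theta> $ i * N (of_int_vec q) powr (- (\<omega> $ i))"
        using pq by (simp add: solutions_def)
      then have "\<bar>real_of_int (p $ i)\<bar> \<le> R q i" unfolding R_def by linarith
      also have "\<dots> \<le> (\<Sum>i\<in>UNIV. R q i)" by (rule member_le_sum) (auto simp: R_def)
      finally show "\<bar>p $ i\<bar> \<le> \<lceil>\<Sum>i\<in>UNIV. R q i\<rceil>" by linarith
    qed
    ultimately show "(p, q) \<in> (\<Union>q\<in>Q. (\<lambda>p. (p, q)) ` P q)" by blast
  qed
  moreover have "finite (\<Union>q\<in>Q. (\<lambda>p. (p, q)) ` P q)"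
    by (intro finite_UN_I finite_imageI) (simp_all add: Q_def P_def finite_int_vec_bounded)
  ultimately show ?thesis by (rule finite_subset)
qed

lemma borel_measurable_Delta:
  fixes N :: "real ^ 'n \<Rightarrow> real" and \<theta> \<omega> :: "real ^ 'm"
  assumes "is_norm N"
  shows "(\<lambda>(u, x). real (Delta N \<theta> \<omega> u x T)) \<in> borel_measurable torus_measure"
proof -
  let ?M = "borel :: ((real ^ 'n ^ 'm) \<times> (real ^ 'm)) measure"
  let ?K = "count_space UNIV :: ((int ^ 'm) \<times> (int ^ 'n)) measure"
  let ?S = "\<lambda>v. solutions N \<theta> \<omega> (fst v) (snd v) T"
  interpret K: sigma_finite_measure ?K
    by (rule sigma_finite_measure_count_space_countable) simp
  have set: "{v. z \<in> ?S v} \<in> sets ?M" for z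
  proof (cases z)
    case (Pair p q)
    have "open {v :: (real ^ 'n ^ 'm) \<times> (real ^ 'm).
        \<bar>real_of_int (p $ i) + (\<Sum>j\<in>UNIV. fst v $ i $ j * real_of_int (q $ j)) + snd v $ i\<bar>
        < \<theta> $ i * N (of_int_vec q) powr (- (\<omega> $ i))}" for i
      by (intro open_Collect_less continuous_intros)
    then have "open (\<Inter>i. {v :: (real ^ 'n ^ 'm) \<times> (real ^ 'm).
        \<bar>real_of_int (p $ i) + (\<Sum>j\<in>UNIV. fst v $ i $ j * real_of_int (q $ j)) + snd v $ i\<bar>
        < \<theta> $ i * N (of_int_vec q) powr (- (\<omega> $ i))})" (is "open ?I")
      by (intro open_INT) auto
    moreover have "{v. z \<in> ?S v} =
        (if q \<noteq> 0 \<and> 0 < N (of_int_vec q) \<and> N (of_int_vec q) < T then ?I else {})"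
      unfolding Pair solutions_def mem_Collect_eq case_prod_conv by auto
    ultimately have "open {v. z \<in> ?S v}" by simp
    then show ?thesis by simp
  qed
  have "(\<lambda>v. indicator (?S v) z :: ennreal) \<in> borel_measurable ?M" for z
  proof -
    have "(\<lambda>v. indicator (?S v) z :: ennreal) = indicator {v. z \<in> ?S v}"
      by (auto simp: indicator_def)
    then show ?thesis using set[of z] by simp
  qed
  then have "(\<lambda>(z, v). indicator (?S v) z :: ennreal) \<in> borel_measurable (?K \<Otimes>\<^sub>M ?M)"
    by (intro measurable_pair_measure_countable1) auto
  then have "(\<lambda>(v, z). indicator (?S v) z :: ennreal) \<in> borel_measurable (?M \<Otimes>\<^sub>M ?K)"
    by (subst (asm) measurable_pair_swap_iff) (simp add: case_prod_beta)
  then have "(\<lambda>v. \<integral>\<^sup>+ z. indicator (?S v) z \<partial>?K) \<in> borel_measurable ?M"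
    by (rule K.borel_measurable_nn_integral)
  moreover have "(\<integral>\<^sup>+ z. indicator (?S v) z \<partial>?K) = ennreal (real (card (?S v)))" for v
    using finite_solutions[OF assms, of \<theta> \<omega> "fst v" "snd v" T]
    by (simp add: ennreal_of_nat_eq_real_of_nat)
  ultimately have "(\<lambda>v. ennreal (real (card (?S v)))) \<in> borel_measurable ?M" by simp
  then have "(\<lambda>v. enn2real (ennreal (real (card (?S v))))) \<in> borel_measurable ?M"
    by measurable
  then show ?thesis
    by (simp add: Delta_def case_prod_unfold torus_measure_def measurable_def uniform_measure_def)
qed

end

theory Submission
 imports Defs "HOL-Real_Asymp.Real_Asymp"
begin

text \<open>
  Fix \<open>u\<close> and think of the base point \<open>x\<close> as the source of randomness. With \<open>q\<close> fixed, the inequalities ask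
  that \<open>u q + x\<close> lies in a box of volume \<open>v q = A / N(q)^n\<close> about the origin of the torus. Over the pair
  \<open>(u, x)\<close> these events are pairwise independent, since \<open>u q + x\<close> and \<open>u (q' - q)\<close> are independent and uniform,
  and counting lattice points in norm balls shows that the expected number of hits up to \<open>T\<close> is
  \<open>\<sigma>\<^sup>2 log T + O(1)\<close>. The limit theorem is proved by the method of blocks on the scale \<open>K = log T\<close>: the
  frequencies with \<open>j L + g \<le> log N(q) < (j + 1) L\<close> form block \<open>j\<close>, and the gaps of logarithmic length \<open>g\<close> are
  discarded, which costs little in mean square by pairwise independence (\<open>truncation\<close>).

  Given \<open>u\<close>, different blocks are almost independent in \<open>x\<close> (\<open>block_decoupling\<close>). The hits of early blocks
  depend on \<open>x\<close> at a coarse scale only. The hits of a later block are almost invariant under the translations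
  \<open>x \<mapsto> x + u r\<close> with \<open>N(r)\<close> much smaller than the frequencies of that block, because such a translation just
  renames \<open>q\<close> as \<open>q + r\<close> and \<open>v\<close> varies slowly. For most \<open>u\<close> the points \<open>u r\<close> are well distributed in the torus,
  again by pairwise independence, so averaging over the translations replaces the early factor by its mean
  (\<open>decoupling\<close>). Hence the characteristic function given \<open>u\<close> is close to a product over the blocks.

  Each factor of the product is expanded to second order, which needs third moments of blocks
  (\<open>third_moment_le\<close>) and the variance of a block given \<open>u\<close>. That variance equals the sum of \<open>v - v\<^sup>2\<close> plus a term
  \<open>cov_sum\<close> that depends on \<open>u\<close>, and the sum of these terms over all blocks must be \<open>o(K)\<close> in mean. Both facts follow
  from one estimate on correlations: for nonzero integer vectors \<open>r, r'\<close> the products \<open>u r\<close> and \<open>u r'\<close> are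
  independent unless \<open>r\<close> and \<open>r'\<close> are parallel, and for \<open>r = c r0\<close>, \<open>r' = c' r0\<close> with coprime \<open>c, c'\<close> the dependence
  decays with \<open>|c c'|\<close> (\<open>two_point_excess\<close>; here \<open>m \<ge> 2\<close> is essential). Parallel pairs are rare enough for the
  total to be \<open>O(K)\<close> (\<open>Xi_total_le\<close>). With \<open>L = K^(1/5)\<close> and \<open>g = K^(1/10)\<close> all errors vanish in the limit
  (\<open>char_tendsto\<close>), and Levy's continuity theorem concludes.\<close>

section \<open>Functions on the circle\<close>

definition circ :: "real measure" where
 "circ = density lborel (\<lambda>x. ennreal (indicator {0..<1} x))"

lemma sets_circ [measurable_cong, simp]: "sets circ = sets borel"
 and space_circ [simp]: "space circ = UNIV"
 by (simp_all add: circ_def)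

lemma emeasure_circ: "A \<in> sets borel ==> emeasure circ A = emeasure lborel ({0..<1} \<inter> A)"
 unfolding circ_def
 by (subst emeasure_density)
  (auto simp: ennreal_indicator indicator_inter_arith[symmetric] nn_integral_indicator)

lemma prob_space_circ: "prob_space circ"
 by (rule prob_spaceI) (simp add: emeasure_circ)

interpretation circ: prob_space circ by (rule prob_space_circ)

lemma integral_circ:
 fixes f :: "real => real"
 assumes "f \<in> borel_measurable borel"
 shows "integral\<^sup>L circ f = (\<integral>x. indicator {0..<1} x * f x \<partial>lborel)"
 unfolding circ_def using assms by (subst integral_density) auto

text \<open>Functions on the circle are represented by their periodic lifts, so that translations and integer
  dilations are ordinary substitutions.\<close>
definition circle_fun :: "(real => real) => bool" where
 "circle_fun f \<longleftrightarrow> f \<in> borel_measurable borel \<and> (\<forall>x. f (x + 1) = f x) \<and> (\<forall>x. 0 \<le> f x \<and> f x \<le> 1)"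

lemma circle_fun_measurable [measurable_dest]: "circle_fun f ==> f \<in> borel_measurable borel"
 and circle_fun_nonneg: "circle_fun f ==> 0 \<le> f x"
 and circle_fun_le_1: "circle_fun f ==> f x \<le> 1"
 by (auto simp: circle_fun_def)

lemma circle_fun_add_int:
 assumes "circle_fun f" shows "f (x + of_int k) = f x"
proof -
 have 1: "f (x + of_nat n) = f x" for n x
 proof (induction n)
  case (Suc n)
  have "f (x + of_nat (Suc n)) = f ((x + of_nat n) + 1)" by (simp add: ac_simps)
  then show ?case using assms Suc by (simp only: circle_fun_def)
 qed simp
 show ?thesis
 proof (cases k)
  case (nonneg n) then show ?thesis using 1[of x n] by simp
 next
  case (neg n) then show ?thesis using 1[of "x + of_int k" "Suc n"] by simp
 qed
qed

lemma circle_fun_affine: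
 assumes "circle_fun f" shows "circle_fun (\<lambda>y. f (s + of_int k * y))"
 unfolding circle_fun_def
proof (intro conjI allI)
 show "(\<lambda>y. f (s + of_int k * y)) \<in> borel_measurable borel"
  using circle_fun_measurable[OF assms] by measurable
 show "f (s + of_int k * (x + 1)) = f (s + of_int k * x)" for x
  using circle_fun_add_int[OF assms, of "s + of_int k * x" k] by (simp add: algebra_simps)
qed (use assms in \<open>auto simp: circle_fun_def\<close>)

lemma circle_fun_shift: "circle_fun f ==> circle_fun (\<lambda>y. f (s + y))"
 using circle_fun_affine[of f s 1] by simp

lemma circle_fun_mult: "circle_fun f ==> circle_fun h ==> circle_fun (\<lambda>y. f y * h y)"
 by (auto simp: circle_fun_def intro: mult_le_one)

lemma integrable_circ:
 fixes f :: "real => real"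
 assumes "f \<in> borel_measurable borel" "!!x. 0 \<le> f x \<and> f x \<le> 1"
 shows "integrable circ f"
 by (rule circ.integrable_const_bound[where B = 1])
  (use assms in \<open>auto intro!: AE_I2 simp: measurable_cong_sets[OF sets_circ]\<close>)

lemma circle_fun_integrable: "circle_fun f ==> integrable circ f"
 by (rule integrable_circ) (auto simp: circle_fun_def)

lemma circle_fun_integral_nonneg: "circle_fun f ==> 0 \<le> integral\<^sup>L circ f"
 by (intro integral_nonneg_AE AE_I2) (auto simp: circle_fun_def)

lemma integrable_interval:
 fixes f :: "real => real"
 assumes "f \<in> borel_measurable borel" "!!x. 0 \<le> f x \<and> f x \<le> 1"
 shows "integrable lborel (\<lambda>x. indicator {a..<b} x * f x)"
proof -
 have "emeasure lborel {a..<b} < \<infinity>" by (rule emeasure_bounded_finite) simp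
 then have "integrable lborel (\<lambda>x. indicator {a..<b} x *\<^sub>R f x)"
  using assms by (intro integrableI_bounded_set_indicator[where B = 1]) (auto intro!: AE_I2)
 then show ?thesis by simp
qed

lemma integral_circ_shift:
 assumes f: "circle_fun f" shows "(\<integral>y. f (s + y) \<partial>circ) = integral\<^sup>L circ f"
proof -
 have fm[measurable]: "f \<in> borel_measurable borel" using f by (rule circle_fun_measurable)
 have f01: "!!x. 0 \<le> f x \<and> f x \<le> 1" using f by (auto simp: circle_fun_def)
 define t where "t = frac s"
 have t: "0 \<le> t" "t < 1" by (auto simp: t_def frac_ge_0 frac_lt_1)
 have "f (s + y) = f (t + y)" for y
  using circle_fun_add_int[OF f, of "t + y" "\<lfloor>s\<rfloor>"] by (simp add: t_def frac_def algebra_simps)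
 then have "(\<integral>y. f (s + y) \<partial>circ) = (\<integral>y. indicator {0..<1} y * f (t + y) \<partial>lborel)"
  by (simp add: integral_circ)
 also have "... = (\<integral>y. indicator {t..<1+t} y * f y \<partial>lborel)"
  by (subst (2) lborel_integral_real_affine[where c = 1 and t = t])
   (auto intro!: Bochner_Integration.integral_cong simp: indicator_def)
 also have "... = (\<integral>y. indicator {t..<1} y * f y + indicator {1..<1+t} y * f y \<partial>lborel)"
  using t by (intro Bochner_Integration.integral_cong) (auto simp: indicator_def)
 also have "... = (\<integral>y. indicator {t..<1} y * f y \<partial>lborel) + (\<integral>y. indicator {1..<1+t} y * f y \<partial>lborel)"
  by (intro Bochner_Integration.integral_add integrable_interval fm f01)
 also have "(\<integral>y. indicator {1..<1+t} y * f y \<partial>lborel) = (\<integral>y. indicator {0..<t} y * f y \<partial>lborel)"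
  using f by (subst lborel_integral_real_affine[where c = 1 and t = 1])
   (auto intro!: Bochner_Integration.integral_cong simp: indicator_def circle_fun_def add.commute)
 also have "(\<integral>y. indicator {t..<1} y * f y \<partial>lborel) + (\<integral>y. indicator {0..<t} y * f y \<partial>lborel)
   = (\<integral>y. indicator {t..<1} y * f y + indicator {0..<t} y * f y \<partial>lborel)"
  by (intro Bochner_Integration.integral_add[symmetric] integrable_interval fm f01)
 also have "... = (\<integral>y. indicator {0..<1} y * f y \<partial>lborel)"
  using t by (intro Bochner_Integration.integral_cong) (auto simp: indicator_def)
 also have "... = integral\<^sup>L circ f" by (simp add: integral_circ)
 finally show ?thesis .
qed

lemma integral_circ_uminus:
 assumes f: "circle_fun f" shows "(\<integral>y. f (- y) \<partial>circ) = integral\<^sup>L circ f"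
proof -
 have fm[measurable]: "f \<in> borel_measurable borel" using f by (rule circle_fun_measurable)
 have per: "f (x - 1) = f x" for x
  using circle_fun_add_int[OF f, of x "-1"] by simp
 have "(\<integral>y. f (- y) \<partial>circ) = (\<integral>y. indicator {0..<1} y * f (- y) \<partial>lborel)"
  by (rule integral_circ) measurable
 also have "... = (\<integral>y. indicator {0<..1} y * f y \<partial>lborel)"
  using f by (subst lborel_integral_real_affine[where c = "-1" and t = 1])
   (auto intro!: Bochner_Integration.integral_cong simp: indicator_def per)
 also have "... = (\<integral>y. indicator {0..<1} y * f y \<partial>lborel)"
 proof (rule integral_cong_AE)
  show "AE x in lborel. indicator {0<..1} x * f x = indicator {0..<1} x * f x"
   using AE_lborel_singleton[of 0] AE_lborel_singleton[of 1]
   by eventually_elim (auto simp: indicator_def)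
 qed auto
 also have "... = integral\<^sup>L circ f" by (simp add: integral_circ)
 finally show ?thesis .
qed

lemma integral_circ_subdivide:
 fixes c :: nat
 assumes c: "c > 0" and fm[measurable]: "f \<in> borel_measurable borel" and f01: "!!x. 0 \<le> f x \<and> f x \<le> 1"
 shows "integral\<^sup>L circ f = (\<integral>z. (\<Sum>p<c. f ((z + real p) / real c)) / real c \<partial>circ)"
proof -
 have "(\<integral>y. indicator {real p / real c..<(real p + 1) / real c} y * f y \<partial>lborel)
   = (\<integral>z. f ((z + real p) / real c) \<partial>circ) / real c" for p
 proof -
  have "(\<integral>y. indicator {real p / real c..<(real p + 1) / real c} y * f y \<partial>lborel)
   = (1 / real c) * (\<integral>z. indicator {real p / real c..<(real p + 1) / real c} (real p / real c + (1 / real c) * z)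
     * f (real p / real c + (1 / real c) * z) \<partial>lborel)"
   using c by (subst lborel_integral_real_affine[where c = "1 / real c" and t = "real p / real c"]) auto
  also have "(\<integral>z. indicator {real p / real c..<(real p + 1) / real c} (real p / real c + (1 / real c) * z)
     * f (real p / real c + (1 / real c) * z) \<partial>lborel) = (\<integral>z. f ((z + real p) / real c) \<partial>circ)"
   using c by (subst integral_circ)
    (auto intro!: Bochner_Integration.integral_cong arg_cong2[where f = "(*)"] arg_cong[where f = f]
     simp: indicator_def field_simps)
  finally show ?thesis by simp
 qed
 note piece = this
 have glue: "(indicator {0..<a} y + indicator {a..<b} y :: real) = indicator {0..<b} y" if "0 \<le> a" "a \<le> b" for a b y :: real
  using that by (auto simp: indicator_def)
 have part: "(\<Sum>p<k. indicator {real p / real c..<(real p + 1) / real c} y) = (indicator {0..<real k / real c} y :: real)" for k :: nat and y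
 proof (induction k)
  case (Suc k)
  have "0 \<le> real k / real c" "real k / real c \<le> (real k + 1) / real c" using c by (auto simp: divide_right_mono)
  then have "(indicator {0..<real k / real c} y + indicator {real k / real c..<(real k + 1) / real c} y :: real)
    = indicator {0..<(real k + 1) / real c} y"
   by (intro glue) auto
  then show ?case using Suc by (simp add: add.commute)
 qed simp
 have "integral\<^sup>L circ f = (\<integral>y. (\<Sum>p<c. indicator {real p / real c..<(real p + 1) / real c} y * f y) \<partial>lborel)"
  using c part[where k = c] by (subst integral_circ) (auto simp: sum_distrib_right[symmetric])
 also have "... = (\<Sum>p<c. (\<integral>z. f ((z + real p) / real c) \<partial>circ) / real c)"
  by (subst Bochner_Integration.integral_sum) (auto intro!: integrable_interval fm simp: f01 piece)
 also have "... = (\<integral>z. (\<Sum>p<c. f ((z + real p) / real c)) / real c \<partial>circ)"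
  by (subst Bochner_Integration.integral_divide_zero, subst Bochner_Integration.integral_sum)
   (auto intro!: integrable_circ simp: f01 sum_divide_distrib)
 finally show ?thesis .
qed

text \<open>Multiplication by a nonzero integer preserves Haar measure of the circle: each of the
  \<open>|k|\<close> equal pieces of \<open>[0, 1)\<close> is stretched onto a full period.\<close>
lemma integral_circ_mult_int:
 assumes f: "circle_fun f" and k: "k \<noteq> 0"
 shows "(\<integral>y. f (s + of_int k * y) \<partial>circ) = integral\<^sup>L circ f"
proof -
 have pos: "(\<integral>y. h (real c * y) \<partial>circ) = integral\<^sup>L circ h" if h: "circle_fun h" and c: "c > 0" for h and c :: nat
 proof -
  have hm[measurable]: "h \<in> borel_measurable borel" using h by (rule circle_fun_measurable)
  have "(\<integral>y. h (real c * y) \<partial>circ) = (\<integral>z. (\<Sum>p<c. h (real c * ((z + real p) / real c))) / real c \<partial>circ)"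
   by (rule integral_circ_subdivide[OF c]) (use h in \<open>auto simp: circle_fun_def\<close>)
  also have "... = (\<integral>z. (\<Sum>p<c. h z) / real c \<partial>circ)"
   using c circle_fun_add_int[OF h, of _ "int _"] by simp
  finally show ?thesis using c by simp
 qed
 have fs: "circle_fun (\<lambda>y. f (s + y))" by (rule circle_fun_shift[OF f])
 have "(\<integral>y. f (s + of_int k * y) \<partial>circ) = (\<integral>y. f (s + y) \<partial>circ)"
 proof (cases "k > 0")
  case True
  then show ?thesis using pos[OF fs, of "nat k"] by simp
 next
  case False
  have "circle_fun (\<lambda>y. f (s - y))" using circle_fun_affine[OF f, of s "-1"] by simp
  then have "(\<integral>y. f (s - real (nat (-k)) * y) \<partial>circ) = (\<integral>y. f (s - y) \<partial>circ)"
   using pos[of "\<lambda>y. f (s - y)" "nat (-k)"] False k by simp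
  then show ?thesis using integral_circ_uminus[OF fs] False k by simp
 qed
 then show ?thesis by (simp add: integral_circ_shift[OF f])
qed

text \<open>The lifted indicator of the open arc of radius \<open>b\<close> about \<open>0\<close>. For
  \<open>b \<le> 1/2\<close> at most one \<open>p\<close> is possible, so the value is then also the number of
  such \<open>p\<close>.\<close>
definition near_int :: "real => real => real" where
 "near_int b y = (if \<exists>p::int. \<bar>of_int p + y\<bar> < b then 1 else 0)"

lemma circle_fun_near_int: "circle_fun (near_int b)"
 unfolding circle_fun_def
proof (intro conjI allI)
 have "open (\<Union>p::int. {y. \<bar>of_int p + y\<bar> < b})"
  by (intro open_UN ballI open_Collect_less continuous_intros)
 then have [measurable]: "{y. \<exists>p::int. \<bar>of_int p + y\<bar> < b} \<in> sets borel"
  by (simp add: Collect_ex_eq)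
 have "near_int b = indicator {y. \<exists>p::int. \<bar>of_int p + y\<bar> < b}"
  by (auto simp: near_int_def indicator_def)
 then show "near_int b \<in> borel_measurable borel" by simp
 show "near_int b (x + 1) = near_int b x" for x
 proof -
  have "(\<exists>p::int. \<bar>of_int p + (x + 1)\<bar> < b) \<longleftrightarrow> (\<exists>p::int. \<bar>of_int p + x\<bar> < b)"
  proof
   assume "\<exists>p::int. \<bar>of_int p + (x + 1)\<bar> < b"
   then obtain p :: int where "\<bar>of_int p + (x + 1)\<bar> < b" by blast
   then have "\<bar>of_int (p + 1) + x\<bar> < b" by (simp add: ac_simps)
   then show "\<exists>p::int. \<bar>of_int p + x\<bar> < b" by blast
  next
   assume "\<exists>p::int. \<bar>of_int p + x\<bar> < b"
   then obtain p :: int where "\<bar>of_int p + x\<bar> < b" by blast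
   then have "\<bar>of_int (p - 1) + (x + 1)\<bar> < b" by (simp add: algebra_simps)
   then show "\<exists>p::int. \<bar>of_int p + (x + 1)\<bar> < b" by blast
  qed
  then show ?thesis by (simp add: near_int_def)
 qed
qed (auto simp: near_int_def)

lemma near_int_mono: "b \<le> b' ==> near_int b y \<le> near_int b' y"
 unfolding near_int_def by (auto intro: less_le_trans)

lemma near_int_le_near_int_near:
 assumes "\<bar>y - y'\<bar> \<le> d" shows "near_int b y \<le> near_int (b + d) y'"
proof -
 have "\<bar>of_int p + y'\<bar> < b + d" if "\<bar>of_int p + y\<bar> < b" for p :: int
  using that assms by linarith
 then show ?thesis unfolding near_int_def by auto
qed

lemma integral_near_int:
 assumes "0 \<le> b" "b \<le> 1/2" shows "integral\<^sup>L circ (near_int b) = 2 * b"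
proof -
 have ind: "indicator {0..<1} y * near_int b (-1/2 + y) = indicator {1/2-b<..<1/2+b} y" for y
 proof -
  have "p = 0" if "\<bar>of_int p + (- 1/2 + y)\<bar> < b" "0 \<le> y" "y < 1" for p :: int
  proof -
   have "of_int p < (1::real)" "(-1::real) < of_int p"
    using that assms by (auto simp: abs_less_iff)
   then show ?thesis by linarith
  qed
  moreover have "\<bar>of_int 0 + (- 1/2 + y)\<bar> < b \<longleftrightarrow> 1/2-b < y \<and> y < 1/2+b" by (auto simp: abs_less_iff)
  ultimately have "(\<exists>p::int. \<bar>of_int p + (- 1/2 + y)\<bar> < b) \<longleftrightarrow> 1/2-b < y \<and> y < 1/2+b" if "0 \<le> y" "y < 1"
   using that by metis
  then show ?thesis using assms unfolding near_int_def indicator_def by auto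
 qed
 have "integral\<^sup>L circ (near_int b) = (\<integral>y. near_int b (-1/2 + y) \<partial>circ)"
  by (rule integral_circ_shift[symmetric, OF circle_fun_near_int])
 also have "... = (\<integral>y. indicator {0..<1} y * near_int b (-1/2 + y) \<partial>lborel)"
  by (intro integral_circ circle_fun_measurable circle_fun_shift circle_fun_near_int)
 also have "... = (\<integral>y. indicator {1/2-b<..<1/2+b} y \<partial>lborel)"
  by (simp only: ind)
 also have "... = 2 * b" using assms by simp
 finally show ?thesis .
qed

lemma integral_near_int_le:
 assumes "0 \<le> b" shows "integral\<^sup>L circ (near_int b) \<le> 2 * b"
proof (cases "b \<le> 1/2")
 case False
 have "integral\<^sup>L circ (near_int b) \<le> (\<integral>y. 1 \<partial>circ)"
  by (intro integral_mono circle_fun_integrable[OF circle_fun_near_int] circ.integrable_const) (auto simp: circle_fun_le_1[OF circle_fun_near_int])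
 also have "... = 1" using circ.prob_space by simp
 finally show ?thesis using False by simp
qed (use integral_near_int assms in simp)

lemma card_int_open_interval:
 assumes "0 \<le> l" shows "finite {k::int. a < of_int k \<and> of_int k < a + l} \<and>
  real (card {k::int. a < of_int k \<and> of_int k < a + l}) \<le> l + 1"
proof -
 have sub: "{k::int. a < of_int k \<and> of_int k < a + l} \<subseteq> {\<lfloor>a\<rfloor> + 1..\<lceil>a + l\<rceil> - 1}"
  by (auto; linarith)
 then have "card {k::int. a < of_int k \<and> of_int k < a + l} \<le> card {\<lfloor>a\<rfloor> + 1..\<lceil>a + l\<rceil> - 1}"
  by (intro card_mono) auto
 also have "... = nat (\<lceil>a + l\<rceil> - \<lfloor>a\<rfloor> - 1)" by simp
 finally have "card {k::int. a < of_int k \<and> of_int k < a + l} \<le> nat (\<lceil>a + l\<rceil> - \<lfloor>a\<rfloor> - 1)" .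
 moreover have "real (nat (\<lceil>a + l\<rceil> - \<lfloor>a\<rfloor> - 1)) \<le> l + 1" using assms by linarith
 ultimately show ?thesis using finite_subset[OF sub] by auto
qed

text \<open>Since \<open>c'\<close> is invertible modulo \<open>c\<close>, the points \<open>c' p / c\<close>
  run once through the multiples of \<open>1/c\<close> modulo \<open>1\<close>, and an arc of length \<open>2
  b\<close> contains at most \<open>2 b c + 1\<close> of them.\<close>
lemma sum_near_int_equidistributed:
 fixes c :: nat and c' :: int
 assumes c: "c > 0" and cop: "coprime (int c) c'" and b: "0 \<le> b"
 shows "(\<Sum>p<c. near_int b (w + of_int c' * real p / real c)) \<le> 2 * b * real c + 1"
proof -
 define G where "G = {p. p < c \<and> (\<exists>k::int. \<bar>of_int k + (w + of_int c' * real p / real c)\<bar> < b)}"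
 have "\<forall>p\<in>G. \<exists>k::int. \<bar>of_int k + (w + of_int c' * real p / real c)\<bar> < b" by (auto simp: G_def)
 then obtain k :: "nat => int" where k: "!!p. p \<in> G ==> \<bar>of_int (k p) + (w + of_int c' * real p / real c)\<bar> < b"
  by metis
 define Z where "Z = {z::int. - w * real c - b * real c < of_int z \<and> of_int z < (- w * real c - b * real c) + 2 * b * real c}"
 have Z: "finite Z" "real (card Z) \<le> 2 * b * real c + 1"
  using card_int_open_interval[of "2 * b * real c" "- w * real c - b * real c"] b unfolding Z_def by auto
 let ?h = "\<lambda>p. k p * int c + c' * int p"
 have "?h ` G \<subseteq> Z"
 proof
  fix z assume "z \<in> ?h ` G"
  then obtain p where p: "p \<in> G" "z = ?h p" by blast
  have "of_int z = (of_int (k p) + of_int c' * real p / real c) * real c" using c p by (simp add: field_simps)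
  moreover have "- w - b < of_int (k p) + of_int c' * real p / real c" "of_int (k p) + of_int c' * real p / real c < - w + b"
   using k[OF p(1)] by (auto simp: abs_less_iff)
  ultimately have "(- w - b) * real c < of_int z" "of_int z < (- w + b) * real c"
   using c by (auto intro: mult_strict_right_mono)
  then show "z \<in> Z" unfolding Z_def by (auto simp: algebra_simps)
 qed
 moreover have "inj_on ?h G"
 proof (rule inj_onI)
  fix p p' assume pp: "p \<in> G" "p' \<in> G" "?h p = ?h p'"
  have "int c * (k p' - k p) = c' * (int p - int p')" using pp(3) by (simp add: algebra_simps)
  then have "int c dvd c' * (int p - int p')" by (metis dvd_triv_left)
  then have "int c dvd int p - int p'" using cop coprime_dvd_mult_right_iff by blast
  moreover have "\<bar>int p - int p'\<bar> < int c" using pp by (auto simp: G_def)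
  ultimately show "p = p'" using zdvd_not_zless[of "\<bar>int p - int p'\<bar>" "int c"] by fastforce
 qed
 ultimately have "card G \<le> card Z" using Z(1) by (intro card_inj_on_le) auto
 moreover have "(\<Sum>p<c. near_int b (w + of_int c' * real p / real c)) = real (card G)"
 proof -
  have "(\<Sum>p<c. near_int b (w + of_int c' * real p / real c)) = (\<Sum>p\<in>{..<c}. if p \<in> G then 1 else 0)"
   by (intro sum.cong) (auto simp: near_int_def G_def)
  also have "... = real (card ({..<c} \<inter> G))" by (simp add: sum.If_cases Int_commute)
  also have "{..<c} \<inter> G = G" by (auto simp: G_def)
  finally show ?thesis .
 qed
 ultimately show ?thesis using Z(2) by simp
qed

lemma integral_near_int_near_int_le_aux:
 fixes c c' :: int
 assumes c: "c \<noteq> 0" and cop: "coprime c c'" and f: "circle_fun f" and b: "0 \<le> b"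
 shows "(\<integral>y. f (of_int c * y) * near_int b (s + of_int c' * y) \<partial>circ) \<le> (2 * b + 1 / \<bar>of_int c\<bar>) * integral\<^sup>L circ f"
proof -
 have pos: "(\<integral>y. h (real d * y) * near_int b (s + of_int d' * y) \<partial>circ) \<le> (2 * b + 1 / real d) * integral\<^sup>L circ h"
  if d: "d > 0" and cop: "coprime (int d) d'" and h: "circle_fun h" for d :: nat and d' :: int and h
 proof -
  have [measurable]: "h \<in> borel_measurable borel" using h by (rule circle_fun_measurable)
  have [measurable]: "near_int b \<in> borel_measurable borel" by (rule circle_fun_measurable[OF circle_fun_near_int])
  have h01: "0 \<le> h x" "h x \<le> 1" for x using h by (auto simp: circle_fun_def)
  have a01: "0 \<le> near_int b x" "near_int b x \<le> 1" for x by (auto simp: near_int_def)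
  have 1: "(\<Sum>p<d. h (real d * ((z + real p) / real d)) * near_int b (s + of_int d' * ((z + real p) / real d))) / real d
   \<le> (2 * b + 1 / real d) * h z" for z
  proof -
   have "h (z + real p) = h z" for p
    using circle_fun_add_int[OF h, of z "int p"] by simp
   moreover have "real d * ((z + real p) / real d) = z + real p" for p using d by simp
   ultimately have hz: "h (real d * ((z + real p) / real d)) = h z" for p by (simp only:)
   have arg: "s + of_int d' * ((z + real p) / real d) = (s + of_int d' * z / real d) + of_int d' * real p / real d" for p
    by (simp add: add_divide_distrib distrib_left)
   have "(\<Sum>p<d. h (real d * ((z + real p) / real d)) * near_int b (s + of_int d' * ((z + real p) / real d)))
    = h z * (\<Sum>p<d. near_int b ((s + of_int d' * z / real d) + of_int d' * real p / real d))"
    by (simp only: hz arg sum_distrib_left)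
   also have "... \<le> h z * (2 * b * real d + 1)"
    by (intro mult_left_mono sum_near_int_equidistributed d cop b h01)
   finally show ?thesis using d by (simp add: field_simps)
  qed
  have "(\<integral>y. h (real d * y) * near_int b (s + of_int d' * y) \<partial>circ) =
   (\<integral>z. (\<Sum>p<d. h (real d * ((z + real p) / real d)) * near_int b (s + of_int d' * ((z + real p) / real d))) / real d \<partial>circ)"
   by (rule integral_circ_subdivide[OF d]) (auto intro: mult_le_one h01 a01 mult_nonneg_nonneg)
  also have "... \<le> (\<integral>z. (2 * b + 1 / real d) * h z \<partial>circ)"
   by (intro integral_mono 1 integrable_mult_right circle_fun_integrable[OF h] Bochner_Integration.integrable_divide
      Bochner_Integration.integrable_sum integrable_circ)
    (auto intro: mult_le_one h01 a01 mult_nonneg_nonneg)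
  also have "... = (2 * b + 1 / real d) * integral\<^sup>L circ h" by simp
  finally show ?thesis .
 qed
 show ?thesis
 proof (cases "c > 0")
  case True
  then show ?thesis using pos[of "nat c" c' f] cop f by simp
 next
  case False
  have f': "circle_fun (\<lambda>y. f (- y))" using circle_fun_affine[OF f, of 0 "-1"] by simp
  have "coprime (int (nat (- c))) c'" using cop False by simp
  from pos[OF _ this f'] show ?thesis using False c integral_circ_uminus[OF f] by simp
 qed
qed

text \<open>The first factor has period \<open>1/|c|\<close>, and the shifts by multiples of
  \<open>1/c\<close> equidistribute the second one; this yields the error \<open>2 b / |c|\<close>. By
  symmetry \<open>2 b' / |c'|\<close> is possible too, and the smaller of the two is at most their geometric
  mean.\<close>
lemma integral_near_int_near_int_le:
 fixes c c' :: int
 assumes c: "c \<noteq> 0" "c' \<noteq> 0" and cop: "coprime c c'" and b: "0 \<le> b" "0 \<le> b'"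
 shows "(\<integral>y. near_int b (s + of_int c * y) * near_int b' (s' + of_int c' * y) \<partial>circ)
  \<le> 4 * b * b' + sqrt (4 * b * b' / \<bar>of_int (c * c')\<bar>)"
proof -
 let ?J = "\<integral>y. near_int b (s + of_int c * y) * near_int b' (s' + of_int c' * y) \<partial>circ"
 have cf: "circle_fun (\<lambda>y. near_int b (s + y))" for b s by (rule circle_fun_shift[OF circle_fun_near_int])
 have i: "integral\<^sup>L circ (\<lambda>y. near_int b (s + y)) \<le> 2 * b" if "0 \<le> b" for b s
  using integral_circ_shift[OF circle_fun_near_int, of b s] integral_near_int_le[OF that] by simp
 have "?J \<le> (2 * b' + 1 / \<bar>of_int c\<bar>) * (2 * b)"
  by (rule order.trans[OF integral_near_int_near_int_le_aux[OF c(1) cop cf b(2)]])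
   (intro mult_left_mono i b; use b in simp)
 then have 1: "?J - 4 * b * b' \<le> 2 * b / \<bar>of_int c\<bar>" by (simp add: algebra_simps)
 have "(\<integral>y. near_int b' (s' + of_int c' * y) * near_int b (s + of_int c * y) \<partial>circ) \<le> (2 * b + 1 / \<bar>of_int c'\<bar>) * (2 * b')"
  by (rule order.trans[OF integral_near_int_near_int_le_aux[OF c(2) _ cf b(1)]])
   (use cop in \<open>auto intro!: mult_left_mono i b simp: coprime_commute, use b in simp\<close>)
 then have 2: "?J - 4 * b * b' \<le> 2 * b' / \<bar>of_int c'\<bar>" by (simp add: algebra_simps)
 show ?thesis
 proof (cases "?J - 4 * b * b' \<le> 0")
  case True
  have "0 \<le> sqrt (4 * b * b' / \<bar>of_int (c * c')\<bar>)" using b by simp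
  with True show ?thesis by linarith
 next
  case False
  have "(?J - 4 * b * b')\<^sup>2 \<le> (2 * b / \<bar>of_int c\<bar>) * (2 * b' / \<bar>of_int c'\<bar>)"
   unfolding power2_eq_square using 1 2 False b by (intro mult_mono) auto
  also have "... = 4 * b * b' / \<bar>of_int (c * c')\<bar>" by (simp add: abs_mult)
  finally have "?J - 4 * b * b' \<le> sqrt (4 * b * b' / \<bar>of_int (c * c')\<bar>)" by (rule real_le_rsqrt)
  then show ?thesis by simp
 qed
qed

section \<open>Random rows\<close>

lemma bounded_Fubini:
 fixes F :: "'a => 'b => 'c::{banach, second_countable_topology}"
 assumes "prob_space M" "prob_space N" "(\<lambda>(x, y). F x y) \<in> borel_measurable (M \<Otimes>\<^sub>M N)" "!!x y. norm (F x y) \<le> B"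
 shows "(\<integral>x. (\<integral>y. F x y \<partial>N) \<partial>M) = (\<integral>y. (\<integral>x. F x y \<partial>M) \<partial>N)"
  and "(\<integral>x. (\<integral>y. F x y \<partial>N) \<partial>M) = (\<integral>p. F (fst p) (snd p) \<partial>(M \<Otimes>\<^sub>M N))"
proof -
 interpret M: prob_space M by fact
 interpret N: prob_space N by fact
 interpret P: pair_prob_space M N ..
 have i: "integrable (M \<Otimes>\<^sub>M N) (\<lambda>(x, y). F x y)"
  by (rule P.integrable_const_bound[where B = B]) (use assms in \<open>auto intro!: AE_I2\<close>)
 show "(\<integral>x. (\<integral>y. F x y \<partial>N) \<partial>M) = (\<integral>y. (\<integral>x. F x y \<partial>M) \<partial>N)"
  using P.Fubini_integral[of F] i by simp
 show "(\<integral>x. (\<integral>y. F x y \<partial>N) \<partial>M) = (\<integral>p. F (fst p) (snd p) \<partial>(M \<Otimes>\<^sub>M N))"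
  using P.integral_fst[of F] i by (simp add: case_prod_beta')
qed

lemma bounded_integrable:
 fixes f :: "'a => 'b::{banach, second_countable_topology}"
 assumes "prob_space M" "f \<in> borel_measurable M" "!!x. norm (f x) \<le> B"
 shows "integrable M f"
proof -
 interpret prob_space M by fact
 show ?thesis by (rule integrable_const_bound[where B = B]) (use assms in \<open>auto intro!: AE_I2\<close>)
qed

lemma integral_norm_le_const:
 fixes f :: "'a => 'b::{banach, second_countable_topology}"
 assumes "prob_space M" "f \<in> borel_measurable M" "!!x. norm (f x) \<le> B"
 shows "norm (integral\<^sup>L M f) \<le> B"
proof -
 interpret prob_space M by fact
 have "0 \<le> B" using norm_ge_zero[of "f undefined"] assms(3)[of undefined] by linarith
 have "norm (integral\<^sup>L M f) \<le> (\<integral>x. norm (f x) \<partial>M)" by (rule integral_norm_bound)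
 also have "... \<le> (\<integral>x. B \<partial>M)"
  using \<open>0 \<le> B\<close>
  by (intro integral_mono bounded_integrable[where B = B] prob_space_axioms) (use assms in auto)
 finally show ?thesis by (simp add: prob_space)
qed

lemma integral_in_unit_interval:
 fixes f :: "'a => real"
 assumes "prob_space M" "f \<in> borel_measurable M" "!!x. 0 \<le> f x \<and> f x \<le> 1"
 shows "0 \<le> integral\<^sup>L M f \<and> integral\<^sup>L M f \<le> 1"
 using integral_norm_le_const[of M f 1] assms by (auto intro!: integral_nonneg_AE AE_I2)

text \<open>Replacing one coordinate by an independent copy keeps the product law. Integrals over a whole row
  thereby reduce to integrals over one or two coordinates.\<close>
lemma integral_PiM_resample:
 fixes M :: "'i::finite => 'a measure" and F :: "('i => 'a) => real"
 assumes M: "!!i. prob_space (M i)" and F[measurable]: "F \<in> borel_measurable (PiM UNIV M)" and B: "!!w. \<bar>F w\<bar> \<le> B"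
 shows "(\<integral>w. F w \<partial>PiM UNIV M) = (\<integral>w. (\<integral>y. F (w(a := y)) \<partial>M a) \<partial>PiM UNIV M)"
proof -
 interpret product_prob_space M UNIV by (intro product_prob_spaceI M)
 have P: "prob_space (PiM UNIV M)" by (intro prob_space_PiM M)
 let ?I = "UNIV - {a}"
 have ins: "insert a ?I = UNIV" by auto
 have [measurable]: "(\<lambda>(w, y). w(a := y)) \<in> measurable (PiM UNIV M \<Otimes>\<^sub>M M a) (PiM UNIV M)"
  unfolding case_prod_beta by (rule measurable_fun_upd[where J = UNIV]) auto
 define G where "G w = (\<integral>y. F (w(a := y)) \<partial>M a)" for w
 have [measurable]: "G \<in> borel_measurable (PiM UNIV M)"
  unfolding G_def
  by (rule sigma_finite_measure.borel_measurable_lebesgue_integral[OF prob_space_imp_sigma_finite[OF M]]) measurable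
 have [measurable]: "(\<lambda>y. F (w(a := y))) \<in> borel_measurable (M a)" if "w \<in> space (PiM UNIV M)" for w
  using that by measurable
 have GB: "\<bar>G w\<bar> \<le> B" for w
 proof (cases "integrable (M a) (\<lambda>y. F (w(a := y)))")
  case True
  then show ?thesis using integral_norm_le_const[OF M, of "\<lambda>y. F (w(a := y))" a B] B by (simp add: G_def)
 next
  case False
  have "0 \<le> B" using B[of w] by linarith
  then show ?thesis using False by (simp add: G_def not_integrable_integral_eq)
 qed
 have 1: "(\<integral>w. F w \<partial>PiM UNIV M) = (\<integral>x. G x \<partial>PiM ?I M)"
  using product_integral_insert[of ?I a F] bounded_integrable[OF P F, of B] B
  unfolding ins G_def by simp
 have "(\<integral>w. G w \<partial>PiM UNIV M) = (\<integral>x. (\<integral>y. G (x(a := y)) \<partial>M a) \<partial>PiM ?I M)"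
  by (rule product_integral_insert[of ?I a G, unfolded ins])
   (use bounded_integrable[OF P, of G B] GB in auto)
 also have "... = (\<integral>x. G x \<partial>PiM ?I M)"
 proof -
  have upd: "G (x(a := y)) = G x" for x y by (simp only: G_def fun_upd_upd)
  show ?thesis unfolding upd using prob_space.prob_space[OF M, of a] by simp
 qed
 finally show ?thesis using 1 by (simp add: G_def)
qed

definition trow :: "('n::finite => real) measure" where "trow = PiM UNIV (\<lambda>_. circ)"

definition rdot :: "('n::finite => real) => int ^ 'n => real" where
 "rdot w q = (\<Sum>j\<in>UNIV. w j * of_int (q $ j))"

lemma prob_space_trow: "prob_space trow"
 unfolding trow_def by (intro prob_space_PiM prob_space_circ)

lemma rdot_measurable [measurable]: "(\<lambda>w. rdot w q) \<in> borel_measurable trow"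
proof -
 have [measurable]: "(\<lambda>w. w j) \<in> borel_measurable (PiM UNIV (\<lambda>_. circ))" for j :: "'a"
  using measurable_component_singleton[of j UNIV "\<lambda>_. circ"] by (simp add: measurable_cong_sets[OF refl sets_circ])
 show ?thesis unfolding rdot_def trow_def by measurable
qed

lemma rdot_diff: "rdot w (q' - q) = rdot w q' - rdot w q"
 by (simp add: rdot_def right_diff_distrib sum_subtractf)

lemma rdot_add: "rdot w (q' + q) = rdot w q' + rdot w q"
 by (simp add: rdot_def distrib_left sum.distrib)

lemma rdot_scale: "rdot w (\<chi> j. c * q $ j) = of_int c * rdot w q"
 by (simp add: rdot_def sum_distrib_left ac_simps)

lemma rdot_fun_upd: "rdot (w(a := y)) q = y * of_int (q $ a) + (\<Sum>j\<in>UNIV - {a}. w j * of_int (q $ j))"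
 unfolding rdot_def by (subst sum.remove[of _ a]) (auto intro!: sum.cong)

text \<open>In a coordinate where \<open>r\<close> does not vanish, the scalar product is affine with nonzero
  integer slope.\<close>
lemma integral_row_dot:
 assumes f: "circle_fun f" and r: "r \<noteq> 0"
 shows "(\<integral>w. f (s + rdot w r) \<partial>trow) = integral\<^sup>L circ f"
proof -
 have fm[measurable]: "f \<in> borel_measurable borel" using f by (rule circle_fun_measurable)
 obtain a where a: "r $ a \<noteq> 0" using r by (auto simp: vec_eq_iff)
 have "(\<integral>w. f (s + rdot w r) \<partial>trow) = (\<integral>w. (\<integral>y. f (s + rdot (w(a := y)) r) \<partial>circ) \<partial>trow)"
  unfolding trow_def
  by (rule integral_PiM_resample[where B = 1], rule prob_space_circ)
   (use f in \<open>auto simp: circle_fun_def trow_def[symmetric]\<close>)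
 also have "... = (\<integral>w. integral\<^sup>L circ f \<partial>(trow :: ('a => real) measure))"
 proof (rule Bochner_Integration.integral_cong[OF refl])
  fix w :: "'a => real"
  have "s + rdot (w(a := y)) r = (s + (\<Sum>j\<in>UNIV - {a}. w j * of_int (r $ j))) + of_int (r $ a) * y" for y
   by (simp add: rdot_fun_upd)
  then show "(\<integral>y. f (s + rdot (w(a := y)) r) \<partial>circ) = integral\<^sup>L circ f"
   by (simp only: integral_circ_mult_int[OF f a])
 qed
 also have "... = integral\<^sup>L circ f" by (simp add: prob_space.prob_space[OF prob_space_trow])
 finally show ?thesis .
qed

text \<open>An integer matrix of nonzero determinant induces a measure preserving endomorphism of the
  two-dimensional torus.\<close>
lemma integral_circ_2_nonsingular:
 fixes \<alpha> \<beta> \<gamma> \<delta> :: int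
 assumes f: "circle_fun f" and h: "circle_fun h" and det: "\<alpha> * \<delta> \<noteq> \<beta> * \<gamma>"
 shows "(\<integral>z. (\<integral>y. f (s + of_int \<alpha> * y + of_int \<beta> * z) * h (s' + of_int \<gamma> * y + of_int \<delta> * z) \<partial>circ) \<partial>circ)
  = integral\<^sup>L circ f * integral\<^sup>L circ h"
proof -
 have fm[measurable]: "f \<in> borel_measurable borel" using f by (rule circle_fun_measurable)
 have hm[measurable]: "h \<in> borel_measurable borel" using h by (rule circle_fun_measurable)
 show ?thesis
 proof (cases "\<alpha> = 0")
  case True
  then have "\<beta> \<noteq> 0" "\<gamma> \<noteq> 0" using det by auto
  have "(\<integral>y. f (s + of_int \<beta> * z) * h (s' + of_int \<gamma> * y + of_int \<delta> * z) \<partial>circ) = f (s + of_int \<beta> * z) * integral\<^sup>L circ h" for z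
  proof -
   have "(\<integral>y. h (s' + of_int \<gamma> * y + of_int \<delta> * z) \<partial>circ) = integral\<^sup>L circ h"
    using integral_circ_mult_int[OF h \<open>\<gamma> \<noteq> 0\<close>, of "s' + of_int \<delta> * z"] by (simp add: ac_simps)
   then show ?thesis by (subst Bochner_Integration.integral_mult_right_zero) simp
  qed
  then have "(\<integral>z. (\<integral>y. f (s + of_int \<alpha> * y + of_int \<beta> * z) * h (s' + of_int \<gamma> * y + of_int \<delta> * z) \<partial>circ) \<partial>circ)
   = (\<integral>z. f (s + of_int \<beta> * z) * integral\<^sup>L circ h \<partial>circ)"
   unfolding True by (simp only: of_int_0 mult_zero_left add_0_right)
  also have "... = integral\<^sup>L circ f * integral\<^sup>L circ h"
   using integral_circ_mult_int[OF f \<open>\<beta> \<noteq> 0\<close>, of s] by simp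
  finally show ?thesis .
 next
  case False
  define P where "P z = (\<integral>y. f (s + of_int \<alpha> * y + of_int \<beta> * z) * h (s' + of_int \<gamma> * y + of_int \<delta> * z) \<partial>circ)" for z
  have P: "circle_fun P" unfolding circle_fun_def
  proof (intro conjI allI)
   show "P \<in> borel_measurable borel" unfolding P_def
    by (rule circ.borel_measurable_lebesgue_integral) measurable
   fix z
   have "circle_fun (\<lambda>y. f ((s + of_int \<beta> * z) + of_int \<alpha> * y) * h ((s' + of_int \<delta> * z) + of_int \<gamma> * y))"
    by (intro circle_fun_mult circle_fun_affine f h)
   then have "0 \<le> f (s + of_int \<alpha> * y + of_int \<beta> * z) * h (s' + of_int \<gamma> * y + of_int \<delta> * z)"
    "f (s + of_int \<alpha> * y + of_int \<beta> * z) * h (s' + of_int \<gamma> * y + of_int \<delta> * z) \<le> 1" for y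
    by (auto simp: circle_fun_def ac_simps)
   then show "0 \<le> P z" "P z \<le> 1" unfolding P_def
    using integral_in_unit_interval[OF prob_space_circ, of "\<lambda>y. f (s + of_int \<alpha> * y + of_int \<beta> * z) * h (s' + of_int \<gamma> * y + of_int \<delta> * z)"]
    by (auto simp: P_def)
   have "f (s + of_int \<alpha> * y + of_int \<beta> * (z + 1)) = f (s + of_int \<alpha> * y + of_int \<beta> * z)"
    "h (s' + of_int \<gamma> * y + of_int \<delta> * (z + 1)) = h (s' + of_int \<gamma> * y + of_int \<delta> * z)" for y
    using circle_fun_add_int[OF f, of "s + of_int \<alpha> * y + of_int \<beta> * z" \<beta>]
     circle_fun_add_int[OF h, of "s' + of_int \<gamma> * y + of_int \<delta> * z" \<delta>]
    by (auto simp: algebra_simps)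
   then show "P (z + 1) = P z" unfolding P_def by simp
  qed
  let ?D = "\<alpha> * \<delta> - \<beta> * \<gamma>"
  have D: "?D \<noteq> 0" using det by simp
  have Pz: "P (0 + of_int \<alpha> * z) = (\<integral>y. f (s + of_int \<alpha> * y) * h (s' + of_int \<gamma> * y + of_int ?D * z) \<partial>circ)" for z
  proof -
   have cf: "circle_fun (\<lambda>y. f (s + of_int \<alpha> * y) * h ((s' + of_int ?D * z) + of_int \<gamma> * y))"
    by (intro circle_fun_mult circle_fun_affine f h)
   show ?thesis using integral_circ_shift[OF cf, of "of_int \<beta> * z"]
    by (simp add: P_def algebra_simps)
  qed
  have "(\<integral>z. P z \<partial>circ) = (\<integral>z. P (0 + of_int \<alpha> * z) \<partial>circ)"
   by (rule integral_circ_mult_int[OF P False, symmetric])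
  also have "... = (\<integral>z. (\<integral>y. f (s + of_int \<alpha> * y) * h (s' + of_int \<gamma> * y + of_int ?D * z) \<partial>circ) \<partial>circ)"
   by (simp only: Pz)
  also have "... = (\<integral>y. (\<integral>z. f (s + of_int \<alpha> * y) * h (s' + of_int \<gamma> * y + of_int ?D * z) \<partial>circ) \<partial>circ)"
  proof (rule bounded_Fubini(1)[OF prob_space_circ prob_space_circ, where B = 1])
   show "norm (f (s + of_int \<alpha> * y) * h (s' + of_int \<gamma> * y + of_int ?D * z)) \<le> 1" for y z
    using f h by (auto simp: circle_fun_def abs_mult intro!: mult_le_one)
  qed measurable
  also have "... = (\<integral>y. f (s + of_int \<alpha> * y) * integral\<^sup>L circ h \<partial>circ)"
   by (simp only: integral_circ_mult_int[OF h D] Bochner_Integration.integral_mult_right_zero)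
  also have "... = integral\<^sup>L circ f * integral\<^sup>L circ h"
   by (simp add: integral_circ_mult_int[OF f False])
  finally show ?thesis by (simp add: P_def)
 qed
qed

text \<open>Vectors that are not parallel have a nonzero two-by-two minor; integrating over the two
  coordinates of that minor makes the scalar products independent and uniform.\<close>
lemma integral_row_dot2_nonparallel:
 fixes r r' :: "int ^ 'n"
 assumes f: "circle_fun f" and h: "circle_fun h" and np: "r $ a * r' $ b \<noteq> r $ b * r' $ a"
 shows "(\<integral>w. f (s + rdot w r) * h (s' + rdot w r') \<partial>trow) = integral\<^sup>L circ f * integral\<^sup>L circ h"
proof -
 have fm[measurable]: "f \<in> borel_measurable borel" using f by (rule circle_fun_measurable)
 have hm[measurable]: "h \<in> borel_measurable borel" using h by (rule circle_fun_measurable)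
 have ab: "a \<noteq> b" using np by auto
 let ?F = "\<lambda>w. f (s + rdot w r) * h (s' + rdot w r')"
 have F1: "\<bar>?F w\<bar> \<le> 1" for w
  using f h by (auto simp: circle_fun_def abs_mult intro!: mult_le_one)
 have [measurable]: "(\<lambda>w. \<integral>y. ?F (w(a := y)) \<partial>circ) \<in> borel_measurable trow"
 proof (rule circ.borel_measurable_lebesgue_integral)
  have [measurable]: "(\<lambda>(w, y). w(a := y)) \<in> measurable (trow \<Otimes>\<^sub>M circ) trow"
   unfolding case_prod_beta trow_def by (rule measurable_fun_upd[where J = UNIV]) auto
  show "(\<lambda>(w, y). ?F (w(a := y))) \<in> borel_measurable (trow \<Otimes>\<^sub>M circ)" by measurable
 qed
 have "(\<integral>w. ?F w \<partial>trow) = (\<integral>w. (\<integral>y. ?F (w(a := y)) \<partial>circ) \<partial>trow)"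
  unfolding trow_def
  by (rule integral_PiM_resample[where B = 1], rule prob_space_circ)
   (use F1 in \<open>auto simp: trow_def[symmetric]\<close>)
 also have "... = (\<integral>w. (\<integral>z. (\<integral>y. ?F (w(b := z, a := y)) \<partial>circ) \<partial>circ) \<partial>trow)"
  unfolding trow_def
 proof (rule integral_PiM_resample[where B = 1], rule prob_space_circ)
  fix w :: "'n => real"
  show "\<bar>\<integral>y. ?F (w(a := y)) \<partial>circ\<bar> \<le> 1"
  proof (cases "integrable circ (\<lambda>y. ?F (w(a := y)))")
   case True
   then show ?thesis using integral_norm_le_const[OF prob_space_circ, of "\<lambda>y. ?F (w(a := y))" 1] F1 by auto
  qed (simp add: not_integrable_integral_eq)
 qed (simp add: trow_def[symmetric])
 also have "... = (\<integral>w. integral\<^sup>L circ f * integral\<^sup>L circ h \<partial>(trow :: ('n => real) measure))"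
 proof (rule Bochner_Integration.integral_cong[OF refl])
  fix w :: "'n => real"
  let ?S = "\<lambda>r. (\<Sum>j\<in>UNIV - {a} - {b}. w j * of_int (r $ j))"
  have e: "rdot (w(b := z, a := y)) r = ?S r + of_int (r $ a) * y + of_int (r $ b) * z" for r z y
  proof -
   have "(\<Sum>j\<in>UNIV - {a}. (w(b := z)) j * of_int (r $ j)) = z * of_int (r $ b) + ?S r"
    using ab by (subst sum.remove[of _ b]) (auto intro!: sum.cong)
   then show ?thesis by (simp add: rdot_fun_upd)
  qed
  have "(\<integral>z. (\<integral>y. ?F (w(b := z, a := y)) \<partial>circ) \<partial>circ) =
   (\<integral>z. (\<integral>y. f ((s + ?S r) + of_int (r $ a) * y + of_int (r $ b) * z) *
     h ((s' + ?S r') + of_int (r' $ a) * y + of_int (r' $ b) * z) \<partial>circ) \<partial>circ)"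
   by (simp only: e add.assoc)
  also have "... = integral\<^sup>L circ f * integral\<^sup>L circ h"
   by (rule integral_circ_2_nonsingular[OF f h np])
  finally show "(\<integral>z. (\<integral>y. ?F (w(b := z, a := y)) \<partial>circ) \<partial>circ) = integral\<^sup>L circ f * integral\<^sup>L circ h" .
 qed
 also have "... = integral\<^sup>L circ f * integral\<^sup>L circ h" by (simp add: prob_space.prob_space[OF prob_space_trow])
 finally show ?thesis .
qed

text \<open>For parallel vectors both scalar products are integer multiples of a single uniform variable, and
  the estimate for coprime dilations applies.\<close>
lemma integral_row_near_int2_parallel:
 fixes r0 :: "int ^ 'n" and c c' :: int
 assumes r0: "r0 \<noteq> 0" and c: "c \<noteq> 0" "c' \<noteq> 0" "coprime c c'" and b: "0 \<le> b" "0 \<le> b'"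
 shows "(\<integral>w. near_int b (s + rdot w (\<chi> j. c * r0 $ j)) * near_int b' (s' + rdot w (\<chi> j. c' * r0 $ j)) \<partial>trow)
  \<le> 4 * b * b' + sqrt (4 * b * b' / \<bar>of_int (c * c')\<bar>)"
proof -
 let ?f = "\<lambda>y. near_int b (s + of_int c * y) * near_int b' (s' + of_int c' * y)"
 have cf: "circle_fun ?f" by (intro circle_fun_mult circle_fun_affine circle_fun_near_int)
 have "(\<integral>w. ?f (0 + rdot w r0) \<partial>trow) = integral\<^sup>L circ ?f" by (rule integral_row_dot[OF cf r0])
 also have "... \<le> 4 * b * b' + sqrt (4 * b * b' / \<bar>of_int (c * c')\<bar>)"
  by (rule integral_near_int_near_int_le[OF c b])
 finally show ?thesis by (simp only: rdot_scale add_0_left)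
qed

lemma circle_fun_abs_le_1: "circle_fun f ==> \<bar>f x\<bar> \<le> 1" by (auto simp: circle_fun_def)

text \<open>Substituting \<open>y - rdot w q1\<close> for \<open>y\<close> removes the first frequency, so
  that only differences of frequencies matter.\<close>
lemma row_triple_le:
 assumes f: "circle_fun f1" "circle_fun f2" "circle_fun f3"
  and B: "!!y. (\<integral>w. f2 (y + rdot w (q2 - q1)) * f3 (y + rdot w (q3 - q1)) \<partial>trow) \<le> B"
 shows "(\<integral>w. (\<integral>y. f1 (rdot w q1 + y) * f2 (rdot w q2 + y) * f3 (rdot w q3 + y) \<partial>circ) \<partial>trow) \<le> integral\<^sup>L circ f1 * B"
  and "(!!y. (\<integral>w. f2 (y + rdot w (q2 - q1)) * f3 (y + rdot w (q3 - q1)) \<partial>trow) = B) ==>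
   (\<integral>w. (\<integral>y. f1 (rdot w q1 + y) * f2 (rdot w q2 + y) * f3 (rdot w q3 + y) \<partial>circ) \<partial>trow) = integral\<^sup>L circ f1 * B"
proof -
 note [measurable] = f[THEN circle_fun_measurable]
 have i: "(\<integral>y. f1 (rdot w q1 + y) * f2 (rdot w q2 + y) * f3 (rdot w q3 + y) \<partial>circ)
  = (\<integral>y. f1 y * (f2 (y + rdot w (q2 - q1)) * f3 (y + rdot w (q3 - q1))) \<partial>circ)" for w
 proof -
  have cf: "circle_fun (\<lambda>y. f1 y * (f2 (rdot w (q2 - q1) + y) * f3 (rdot w (q3 - q1) + y)))"
   by (intro circle_fun_mult circle_fun_shift f)
  show ?thesis using integral_circ_shift[OF cf, of "rdot w q1"]
   by (simp add: rdot_diff algebra_simps)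
 qed
 have bd: "\<bar>f2 (y + rdot w (q2 - q1)) * f3 (y + rdot w (q3 - q1))\<bar> \<le> 1" for y w
  using f by (auto simp: abs_mult circle_fun_abs_le_1 intro!: mult_le_one)
 have eq: "(\<integral>w. (\<integral>y. f1 (rdot w q1 + y) * f2 (rdot w q2 + y) * f3 (rdot w q3 + y) \<partial>circ) \<partial>trow)
  = (\<integral>y. f1 y * (\<integral>w. f2 (y + rdot w (q2 - q1)) * f3 (y + rdot w (q3 - q1)) \<partial>trow) \<partial>circ)"
 proof -
  have "(\<integral>w. (\<integral>y. f1 y * (f2 (y + rdot w (q2 - q1)) * f3 (y + rdot w (q3 - q1))) \<partial>circ) \<partial>trow)
   = (\<integral>y. (\<integral>w. f1 y * (f2 (y + rdot w (q2 - q1)) * f3 (y + rdot w (q3 - q1))) \<partial>trow) \<partial>circ)"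
  proof (rule bounded_Fubini(1)[OF prob_space_trow prob_space_circ, where B = 1])
  show "norm (f1 y * (f2 (y + rdot w (q2 - q1)) * f3 (y + rdot w (q3 - q1)))) \<le> 1" for w y
   using bd[of y w] f(1) by (auto simp: abs_mult circle_fun_abs_le_1 intro!: mult_le_one)
  qed measurable
  then show ?thesis unfolding i by (simp only: Bochner_Integration.integral_mult_right_zero)
 qed
 show "(\<integral>w. (\<integral>y. f1 (rdot w q1 + y) * f2 (rdot w q2 + y) * f3 (rdot w q3 + y) \<partial>circ) \<partial>trow) \<le> integral\<^sup>L circ f1 * B"
 proof -
  have "(\<integral>y. f1 y * (\<integral>w. f2 (y + rdot w (q2 - q1)) * f3 (y + rdot w (q3 - q1)) \<partial>trow) \<partial>circ) \<le> (\<integral>y. f1 y * B \<partial>circ)"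
  proof (rule integral_mono)
   interpret trow: prob_space "trow :: ('a => real) measure" by (rule prob_space_trow)
   show "integrable circ (\<lambda>y. f1 y * (\<integral>w. f2 (y + rdot w (q2 - q1)) * f3 (y + rdot w (q3 - q1)) \<partial>trow))"
   proof (rule bounded_integrable[OF prob_space_circ, where B = 1])
    show "norm (f1 y * (\<integral>w. f2 (y + rdot w (q2 - q1)) * f3 (y + rdot w (q3 - q1)) \<partial>trow)) \<le> 1" for y
     using integral_norm_le_const[OF prob_space_trow, of "\<lambda>w. f2 (y + rdot w (q2 - q1)) * f3 (y + rdot w (q3 - q1))" 1] bd f(1)
     by (auto simp: abs_mult circle_fun_abs_le_1 intro!: mult_le_one)
   qed measurable
  qed (use B f in \<open>auto intro!: circle_fun_integrable mult_left_mono simp: circle_fun_nonneg\<close>)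
  then show ?thesis unfolding eq by simp
 qed
 show "(\<integral>w. (\<integral>y. f1 (rdot w q1 + y) * f2 (rdot w q2 + y) * f3 (rdot w q3 + y) \<partial>circ) \<partial>trow) = integral\<^sup>L circ f1 * B"
  if "!!y. (\<integral>w. f2 (y + rdot w (q2 - q1)) * f3 (y + rdot w (q3 - q1)) \<partial>trow) = B"
  unfolding eq that by simp
qed

lemma row_pair:
 assumes f: "circle_fun f1" "circle_fun f2" and q: "q1 \<noteq> q2"
 shows "(\<integral>w. (\<integral>y. f1 (rdot w q1 + y) * f2 (rdot w q2 + y) \<partial>circ) \<partial>trow) = integral\<^sup>L circ f1 * integral\<^sup>L circ f2"
proof -
 have 1: "circle_fun (\<lambda>y. 1)" by (simp add: circle_fun_def)
 show ?thesis
  using row_triple_le(2)[where ?q1.0 = q1 and ?q2.0 = q2 and ?q3.0 = q1 and B = "integral\<^sup>L circ f2", OF f 1] q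
  by (simp add: integral_row_dot[OF f(2)])
qed

text \<open>The substitution that removes the first frequency is made in both inner integrals, which leaves
  the differences \<open>q2 - q1\<close> and \<open>q4 - q3\<close>.\<close>
lemma row_quadruple_le:
 assumes f: "circle_fun f1" "circle_fun f2" "circle_fun f3" "circle_fun f4"
  and B: "!!y y'. (\<integral>w. f2 (y + rdot w (q2 - q1)) * f4 (y' + rdot w (q4 - q3)) \<partial>trow) \<le> B"
 shows "(\<integral>w. (\<integral>y. f1 (rdot w q1 + y) * f2 (rdot w q2 + y) \<partial>circ) * (\<integral>y. f3 (rdot w q3 + y) * f4 (rdot w q4 + y) \<partial>circ) \<partial>trow)
  \<le> integral\<^sup>L circ f1 * integral\<^sup>L circ f3 * B"
proof -
 interpret trow: prob_space "trow :: ('a => real) measure" by (rule prob_space_trow)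
 note [measurable] = f[THEN circle_fun_measurable]
 note f01 = f[THEN circle_fun_nonneg] f[THEN circle_fun_abs_le_1]
 have i: "(\<integral>y. f (rdot w q + y) * g (rdot w q' + y) \<partial>circ) = (\<integral>y. f y * g (y + rdot w (q' - q)) \<partial>circ)"
  if "circle_fun f" "circle_fun g" for w f g q q'
 proof -
  have cf: "circle_fun (\<lambda>y. f y * g (rdot w (q' - q) + y))"
   by (intro circle_fun_mult circle_fun_shift that)
  show ?thesis using integral_circ_shift[OF cf, of "rdot w q"] by (simp add: rdot_diff algebra_simps)
 qed
 let ?T = "\<lambda>w y y'. f1 y * f3 y' * (f2 (y + rdot w (q2 - q1)) * f4 (y' + rdot w (q4 - q3)))"
 have T1: "\<bar>?T w y y'\<bar> \<le> 1" for w y y'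
  using f01 by (auto simp: abs_mult intro!: mult_le_one)
 have bd: "\<bar>f2 (y + rdot w (q2 - q1)) * f4 (y' + rdot w (q4 - q3))\<bar> \<le> 1" for y w y'
  using f01 by (auto simp: abs_mult intro!: mult_le_one)
 let ?K = "\<lambda>y y'. \<integral>w. f2 (y + rdot w (q2 - q1)) * f4 (y' + rdot w (q4 - q3)) \<partial>trow"
 have Kb: "\<bar>?K y y'\<bar> \<le> 1" for y y'
  using integral_norm_le_const[OF prob_space_trow, of "\<lambda>w. f2 (y + rdot w (q2 - q1)) * f4 (y' + rdot w (q4 - q3))" 1] bd by auto
 have K0: "0 \<le> ?K y y'" for y y'
  using f01 by (auto intro!: integral_nonneg_AE AE_I2)
 have B0: "0 \<le> B" using K0 B by (rule order.trans)
 have "(\<integral>w. (\<integral>y. f1 (rdot w q1 + y) * f2 (rdot w q2 + y) \<partial>circ) * (\<integral>y. f3 (rdot w q3 + y) * f4 (rdot w q4 + y) \<partial>circ) \<partial>trow)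
  = (\<integral>w. (\<integral>y. (\<integral>y'. ?T w y y' \<partial>circ) \<partial>circ) \<partial>trow)"
 proof (rule Bochner_Integration.integral_cong[OF refl])
  fix w :: "'a => real"
  have "(\<integral>y'. ?T w y y' \<partial>circ) = (f1 y * f2 (y + rdot w (q2 - q1))) * (\<integral>y'. f3 y' * f4 (y' + rdot w (q4 - q3)) \<partial>circ)" for y
   by (subst Bochner_Integration.integral_mult_right_zero[symmetric]) (simp add: ac_simps)
  then show "(\<integral>y. f1 (rdot w q1 + y) * f2 (rdot w q2 + y) \<partial>circ) * (\<integral>y. f3 (rdot w q3 + y) * f4 (rdot w q4 + y) \<partial>circ)
   = (\<integral>y. (\<integral>y'. ?T w y y' \<partial>circ) \<partial>circ)"
   by (simp add: i f)
 qed
 also have "... = (\<integral>y. (\<integral>w. (\<integral>y'. ?T w y y' \<partial>circ) \<partial>trow) \<partial>circ)"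
 proof (rule bounded_Fubini(1)[OF prob_space_trow prob_space_circ, where B = 1])
  show "(\<lambda>(w, y). \<integral>y'. ?T w y y' \<partial>circ) \<in> borel_measurable (trow \<Otimes>\<^sub>M circ)" by measurable
  show "norm (\<integral>y'. ?T w y y' \<partial>circ) \<le> 1" for w y
   by (rule integral_norm_le_const[OF prob_space_circ]) (use T1 in auto)
 qed
 also have "... = (\<integral>y. (\<integral>y'. (\<integral>w. ?T w y y' \<partial>trow) \<partial>circ) \<partial>circ)"
 proof (rule Bochner_Integration.integral_cong[OF refl])
  show "(\<integral>w. (\<integral>y'. ?T w y y' \<partial>circ) \<partial>trow) = (\<integral>y'. (\<integral>w. ?T w y y' \<partial>trow) \<partial>circ)" for y
   by (rule bounded_Fubini(1)[OF prob_space_trow prob_space_circ, where B = 1]) (use T1 in auto)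
 qed
 also have "... = (\<integral>y. f1 y * (\<integral>y'. f3 y' * ?K y y' \<partial>circ) \<partial>circ)"
 proof -
  have "(\<integral>w. ?T w y y' \<partial>trow) = f1 y * (f3 y' * ?K y y')" for y y'
   by (subst Bochner_Integration.integral_mult_right_zero) (simp add: mult.assoc)
  then show ?thesis by (simp only: Bochner_Integration.integral_mult_right_zero)
 qed
 also have "... \<le> (\<integral>y. f1 y * (B * integral\<^sup>L circ f3) \<partial>circ)"
 proof (intro integral_mono mult_left_mono)
  have bnd: "\<bar>\<integral>y'. f3 y' * ?K y y' \<partial>circ\<bar> \<le> 1" for y
  proof -
   have "norm (\<integral>y'. f3 y' * ?K y y' \<partial>circ) \<le> 1"
    by (rule integral_norm_le_const[OF prob_space_circ]) (use Kb f01 in \<open>auto simp: abs_mult intro!: mult_le_one\<close>)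
   then show ?thesis by simp
  qed
  show "integrable circ (\<lambda>y. f1 y * (\<integral>y'. f3 y' * ?K y y' \<partial>circ))"
   by (rule bounded_integrable[OF prob_space_circ, where B = 1])
    (use bnd f01 in \<open>auto simp: abs_mult intro!: mult_le_one\<close>)
  show "(\<integral>y'. f3 y' * ?K y y' \<partial>circ) \<le> B * integral\<^sup>L circ f3" for y
  proof -
   have "(\<integral>y'. f3 y' * ?K y y' \<partial>circ) \<le> (\<integral>y'. f3 y' * B \<partial>circ)"
   proof (intro integral_mono mult_left_mono B f01)
    show "integrable circ (\<lambda>y'. f3 y' * ?K y y')"
     by (rule bounded_integrable[OF prob_space_circ, where B = 1])
      (use Kb f01 in \<open>auto simp: abs_mult intro!: mult_le_one\<close>)
   qed (use f in \<open>auto intro!: circle_fun_integrable\<close>)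
   then show ?thesis by (simp add: mult.commute)
  qed
 qed (use f f01 in \<open>auto intro!: circle_fun_integrable\<close>)
 also have "... = integral\<^sup>L circ f1 * integral\<^sup>L circ f3 * B" by (simp add: ac_simps)
 finally show ?thesis .
qed

section \<open>Random affine forms on the torus\<close>

lemma borel_measurable_frac [measurable]: "(frac :: real => real) \<in> borel_measurable borel"
 unfolding frac_def by measurable

definition tmat :: "('m::finite => 'n::finite => real) measure" where
 "tmat = PiM UNIV (\<lambda>_. trow)"

lemma prob_space_tmat: "prob_space tmat"
 unfolding tmat_def by (intro prob_space_PiM prob_space_trow)

lemma trow_component_measurable [measurable]: "(\<lambda>x. x i) \<in> borel_measurable trow"
 unfolding trow_def
 using measurable_component_singleton[of i UNIV "\<lambda>_. circ"] by (simp add: measurable_cong_sets[OF refl sets_circ])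

lemma tmat_component_measurable [measurable]: "(\<lambda>u. u i) \<in> measurable tmat trow"
 unfolding tmat_def using measurable_component_singleton[of i UNIV "\<lambda>_. trow"] by simp

lemma tmat_rdot_measurable [measurable]: "(\<lambda>u. rdot (u i) q) \<in> borel_measurable tmat"
 by (rule measurable_compose[OF tmat_component_measurable rdot_measurable])

lemma integral_prod_trow:
 fixes f :: "'m::finite => real => real"
 assumes "!!i. f i \<in> borel_measurable borel" "!!i y. 0 \<le> f i y \<and> f i y \<le> 1"
 shows "(\<integral>x. (\<Prod>i\<in>UNIV. f i (x i)) \<partial>trow) = (\<Prod>i\<in>UNIV. integral\<^sup>L circ (f i))"
proof -
 interpret product_prob_space "\<lambda>_::'m. circ" UNIV by (intro product_prob_spaceI prob_space_circ)
 show ?thesis unfolding trow_def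
  by (rule product_integral_prod) (use assms in \<open>auto intro: integrable_circ\<close>)
qed

lemma integral_prod_tmat:
 fixes g :: "'m::finite => ('n::finite => real) => real"
 assumes "!!i. g i \<in> borel_measurable trow" "!!i w. 0 \<le> g i w \<and> g i w \<le> 1"
 shows "(\<integral>u. (\<Prod>i\<in>UNIV. g i (u i)) \<partial>tmat) = (\<Prod>i\<in>UNIV. integral\<^sup>L trow (g i))"
proof -
 interpret product_prob_space "\<lambda>_::'m. (trow :: ('n => real) measure)" UNIV by (intro product_prob_spaceI prob_space_trow)
 show ?thesis unfolding tmat_def
  by (rule product_integral_prod) (use assms in \<open>auto intro!: bounded_integrable[OF prob_space_trow, where B = 1]\<close>)
qed

lemma circle_fun_measurable_circ: "circle_fun f ==> f \<in> borel_measurable circ"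
 by (simp add: circle_fun_def measurable_cong_sets[OF sets_circ refl])

definition torus_prod :: "('m::finite => real => real) => int ^ 'n::finite => ('m => 'n => real) => ('m => real) => real" where
 "torus_prod f q u x = (\<Prod>i\<in>UNIV. f i (rdot (u i) q + x i))"

lemma torus_prod_bounds:
 assumes "!!i. circle_fun (f i)" shows "0 \<le> torus_prod f q u x" "torus_prod f q u x \<le> 1"
 unfolding torus_prod_def using assms by (auto simp: circle_fun_def intro!: prod_nonneg prod_le_1)

lemma torus_prod_measurable:
 assumes "!!i. circle_fun (f i)"
 shows "(\<lambda>(u, x). torus_prod f q u x) \<in> borel_measurable (tmat \<Otimes>\<^sub>M trow)"
proof -
 have [measurable]: "f i \<in> borel_measurable borel" for i using assms by (rule circle_fun_measurable)
 have [measurable]: "(\<lambda>p. snd p i) \<in> borel_measurable (tmat \<Otimes>\<^sub>M trow)" for i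
  by (rule measurable_compose[OF measurable_snd trow_component_measurable])
 have [measurable]: "(\<lambda>p. rdot (fst p i) q) \<in> borel_measurable (tmat \<Otimes>\<^sub>M trow)" for i
  by (rule measurable_compose[OF measurable_fst tmat_rdot_measurable])
 show ?thesis unfolding torus_prod_def case_prod_beta by measurable
qed

lemma torus_prod_measurable_x:
 assumes "!!i. circle_fun (f i)"
 shows "torus_prod f q u \<in> borel_measurable trow"
proof -
 have [measurable]: "f i \<in> borel_measurable borel" for i using assms by (rule circle_fun_measurable)
 show ?thesis unfolding torus_prod_def by measurable
qed

lemma integral_torus_prod:
 assumes f: "!!i. circle_fun (f i)"
 shows "(\<integral>x. torus_prod f q u x \<partial>trow) = (\<Prod>i\<in>UNIV. integral\<^sup>L circ (f i))"
proof -
 have "(\<integral>x. torus_prod f q u x \<partial>trow) = (\<Prod>i\<in>UNIV. \<integral>y. f i (rdot (u i) q + y) \<partial>circ)"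
  unfolding torus_prod_def
  by (rule integral_prod_trow) (use circle_fun_shift[OF f] in \<open>auto simp: circle_fun_def\<close>)
 then show ?thesis by (simp add: integral_circ_shift[OF f])
qed

lemma row_integral_unit:
 assumes f: "circle_fun f1" "circle_fun f2" "circle_fun f3"
 shows "(\<lambda>w. \<integral>y. f1 (rdot w q1 + y) * f2 (rdot w q2 + y) * f3 (rdot w q3 + y) \<partial>circ) \<in> borel_measurable trow"
  and "0 \<le> (\<integral>y. f1 (rdot w q1 + y) * f2 (rdot w q2 + y) * f3 (rdot w q3 + y) \<partial>circ) \<and>
    (\<integral>y. f1 (rdot w q1 + y) * f2 (rdot w q2 + y) * f3 (rdot w q3 + y) \<partial>circ) \<le> 1"
proof -
 note [measurable] = f[THEN circle_fun_measurable]
 show "(\<lambda>w. \<integral>y. f1 (rdot w q1 + y) * f2 (rdot w q2 + y) * f3 (rdot w q3 + y) \<partial>circ) \<in> borel_measurable trow"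
  by measurable
 have "circle_fun (\<lambda>y. f1 (rdot w q1 + y) * f2 (rdot w q2 + y) * f3 (rdot w q3 + y))"
  by (intro circle_fun_mult circle_fun_shift f)
 then show "0 \<le> (\<integral>y. f1 (rdot w q1 + y) * f2 (rdot w q2 + y) * f3 (rdot w q3 + y) \<partial>circ) \<and>
    (\<integral>y. f1 (rdot w q1 + y) * f2 (rdot w q2 + y) * f3 (rdot w q3 + y) \<partial>circ) \<le> 1"
  by (intro integral_in_unit_interval[OF prob_space_circ] circle_fun_measurable_circ) (auto simp: circle_fun_def)
qed

lemma integral_torus_prod3_x:
 assumes f: "!!i. circle_fun (f1 i)" "!!i. circle_fun (f2 i)" "!!i. circle_fun (f3 i)"
 shows "(\<integral>x. torus_prod f1 q1 u x * torus_prod f2 q2 u x * torus_prod f3 q3 u x \<partial>trow)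
  = (\<Prod>i\<in>UNIV. \<integral>y. f1 i (rdot (u i) q1 + y) * f2 i (rdot (u i) q2 + y) * f3 i (rdot (u i) q3 + y) \<partial>circ)"
proof -
 have cf: "circle_fun (\<lambda>y. f1 i (rdot (u i) q1 + y) * f2 i (rdot (u i) q2 + y) * f3 i (rdot (u i) q3 + y))" for i
  by (intro circle_fun_mult circle_fun_shift f)
 show ?thesis
  unfolding torus_prod_def prod.distrib[symmetric]
  by (rule integral_prod_trow)
   (rule circle_fun_measurable[OF cf], rule conjI, rule circle_fun_nonneg[OF cf], rule circle_fun_le_1[OF cf])
qed

lemma integral_torus_prod3:
 assumes f: "!!i. circle_fun (f1 i)" "!!i. circle_fun (f2 i)" "!!i. circle_fun (f3 i)"
 shows "(\<integral>u. (\<integral>x. torus_prod f1 q1 u x * torus_prod f2 q2 u x * torus_prod f3 q3 u x \<partial>trow) \<partial>tmat)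
  = (\<Prod>i\<in>UNIV. \<integral>w. (\<integral>y. f1 i (rdot w q1 + y) * f2 i (rdot w q2 + y) * f3 i (rdot w q3 + y) \<partial>circ) \<partial>trow)"
 unfolding integral_torus_prod3_x[OF f]
 by (rule integral_prod_tmat) (rule row_integral_unit[OF assms])+

lemma circle_fun_1: "circle_fun (\<lambda>_. 1)"
 by (simp add: circle_fun_def)

lemma torus_prod_1: "torus_prod (\<lambda>_ _. 1) q u x = 1"
 by (simp add: torus_prod_def)

lemma integral_torus_prod_pair:
 assumes f: "!!i. circle_fun (f i)" and h: "!!i. circle_fun (h i)" and q: "q \<noteq> q'"
 shows "(\<integral>u. (\<integral>x. torus_prod f q u x * torus_prod h q' u x \<partial>trow) \<partial>tmat)
  = (\<Prod>i\<in>UNIV. integral\<^sup>L circ (f i)) * (\<Prod>i\<in>UNIV. integral\<^sup>L circ (h i))"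
 using integral_torus_prod3[of f h "\<lambda>_ _. 1" q q' q, OF f h circle_fun_1]
 by (simp add: torus_prod_1 row_pair[OF f h q] prod.distrib)

text \<open>The bound is uniform in the phases because the phases come from the base point, which is
  integrated afterwards.\<close>
definition two_point_bound :: "real => real => int ^ 'n::finite => int ^ 'n => real => bool" where
 "two_point_bound b b' r r' B \<longleftrightarrow>
  (\<forall>s s'. (\<integral>w. near_int b (s + rdot w r) * near_int b' (s' + rdot w r') \<partial>trow) \<le> B)"

lemma integral_triple_le:
 assumes b: "!!i. 0 \<le> b1 i" "!!i. b1 i \<le> 1/2"
  and B: "!!i. two_point_bound (b2 i) (b3 i) (q2 - q1) (q3 - q1) (B i)"
 shows "(\<integral>u. (\<integral>x. torus_prod (\<lambda>i. near_int (b1 i)) q1 u x * torus_prod (\<lambda>i. near_int (b2 i)) q2 u x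
   * torus_prod (\<lambda>i. near_int (b3 i)) q3 u x \<partial>trow) \<partial>tmat) \<le> (\<Prod>i\<in>UNIV. 2 * b1 i) * (\<Prod>i\<in>UNIV. B i)"
 unfolding integral_torus_prod3[OF circle_fun_near_int circle_fun_near_int circle_fun_near_int] prod.distrib[symmetric]
proof (intro prod_mono conjI)
 fix i
 show "0 \<le> (\<integral>w. (\<integral>y. near_int (b1 i) (rdot w q1 + y) * near_int (b2 i) (rdot w q2 + y) * near_int (b3 i) (rdot w q3 + y) \<partial>circ) \<partial>trow)"
  by (intro integral_nonneg_AE AE_I2) (auto simp: near_int_def intro!: integral_nonneg_AE AE_I2)
 have "(\<integral>w. near_int (b2 i) (y + rdot w (q2 - q1)) * near_int (b3 i) (y + rdot w (q3 - q1)) \<partial>trow) \<le> B i" for y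
  using B by (auto simp: two_point_bound_def)
 from row_triple_le(1)[OF circle_fun_near_int[of "b1 i"] circle_fun_near_int circle_fun_near_int this]
 show "(\<integral>w. (\<integral>y. near_int (b1 i) (rdot w q1 + y) * near_int (b2 i) (rdot w q2 + y) * near_int (b3 i) (rdot w q3 + y) \<partial>circ) \<partial>trow)
  \<le> 2 * b1 i * B i"
  using integral_near_int[of "b1 i"] b by simp
qed

lemma integral_quadruple_le:
 assumes b: "!!i. 0 \<le> b1 i" "!!i. b1 i \<le> 1/2" "!!i. 0 \<le> b3 i" "!!i. b3 i \<le> 1/2"
  and B: "!!i. two_point_bound (b2 i) (b4 i) (q2 - q1) (q4 - q3) (B i)"
 shows "(\<integral>u. (\<integral>x. torus_prod (\<lambda>i. near_int (b1 i)) q1 u x * torus_prod (\<lambda>i. near_int (b2 i)) q2 u x \<partial>trow)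
   * (\<integral>x. torus_prod (\<lambda>i. near_int (b3 i)) q3 u x * torus_prod (\<lambda>i. near_int (b4 i)) q4 u x \<partial>trow) \<partial>tmat)
  \<le> (\<Prod>i\<in>UNIV. 2 * b1 i) * (\<Prod>i\<in>UNIV. 2 * b3 i) * (\<Prod>i\<in>UNIV. B i)"
proof -
 let ?J = "\<lambda>b b' q q' w. \<integral>y. near_int b (rdot w q + y) * near_int b' (rdot w q' + y) \<partial>circ"
 have J: "?J b b' q q' \<in> borel_measurable trow" "0 \<le> ?J b b' q q' w \<and> ?J b b' q q' w \<le> 1" for b b' q q' w
  using row_integral_unit[where ?f1.0 = "near_int b" and ?f2.0 = "near_int b'" and ?f3.0 = "\<lambda>_. 1" and ?q1.0 = q and ?q2.0 = q' and ?q3.0 = q, OF circle_fun_near_int circle_fun_near_int circle_fun_1] by auto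
 note [measurable] = J(1)
 have x: "(\<integral>x. torus_prod (\<lambda>i. near_int (b i)) q u x * torus_prod (\<lambda>i. near_int (b' i)) q' u x \<partial>trow)
  = (\<Prod>i\<in>UNIV. ?J (b i) (b' i) q q' (u i))" for b b' :: "'a => real" and q q' u
  using integral_torus_prod3_x[of "\<lambda>i. near_int (b i)" "\<lambda>i. near_int (b' i)" "\<lambda>_ _. 1" q u q' q, OF circle_fun_near_int circle_fun_near_int circle_fun_1]
  by (simp add: torus_prod_1)
 have "(\<integral>u. (\<Prod>i\<in>UNIV. ?J (b1 i) (b2 i) q1 q2 (u i)) * (\<Prod>i\<in>UNIV. ?J (b3 i) (b4 i) q3 q4 (u i)) \<partial>tmat)
  = (\<Prod>i\<in>UNIV. \<integral>w. ?J (b1 i) (b2 i) q1 q2 w * ?J (b3 i) (b4 i) q3 q4 w \<partial>trow)"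
  unfolding prod.distrib[symmetric]
  by (rule integral_prod_tmat) (measurable, intro conjI mult_nonneg_nonneg mult_le_one conjunct1[OF J(2)] conjunct2[OF J(2)])
 also have "... \<le> (\<Prod>i\<in>UNIV. 2 * b1 i * (2 * b3 i) * B i)"
 proof (intro prod_mono conjI)
  fix i
  show "0 \<le> (\<integral>w. ?J (b1 i) (b2 i) q1 q2 w * ?J (b3 i) (b4 i) q3 q4 w \<partial>trow)"
   by (intro integral_nonneg_AE AE_I2 mult_nonneg_nonneg conjunct1[OF J(2)])
  have "(\<integral>w. near_int (b2 i) (y + rdot w (q2 - q1)) * near_int (b4 i) (y' + rdot w (q4 - q3)) \<partial>trow) \<le> B i" for y y'
   using B by (auto simp: two_point_bound_def)
  from row_quadruple_le[OF circle_fun_near_int[of "b1 i"] circle_fun_near_int circle_fun_near_int[of "b3 i"] circle_fun_near_int this]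
  show "(\<integral>w. ?J (b1 i) (b2 i) q1 q2 w * ?J (b3 i) (b4 i) q3 q4 w \<partial>trow) \<le> 2 * b1 i * (2 * b3 i) * B i"
   using integral_near_int[of "b1 i"] integral_near_int[of "b3 i"] b by simp
 qed
 finally show ?thesis unfolding x by (simp only: prod.distrib)
qed

lemma prob_space_tP: "prob_space (tmat \<Otimes>\<^sub>M trow)"
proof -
 interpret u: prob_space tmat by (rule prob_space_tmat)
 interpret x: prob_space trow by (rule prob_space_trow)
 interpret pair_prob_space tmat trow ..
 show ?thesis by unfold_locales
qed

lemma integral_tP:
 fixes F :: "('m::finite => 'n::finite => real) => ('m => real) => 'c::{banach, second_countable_topology}"
 assumes "(\<lambda>(u, x). F u x) \<in> borel_measurable (tmat \<Otimes>\<^sub>M trow)" "!!u x. norm (F u x) \<le> B"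
 shows "(\<integral>p. F (fst p) (snd p) \<partial>(tmat \<Otimes>\<^sub>M trow)) = (\<integral>u. (\<integral>x. F u x \<partial>trow) \<partial>tmat)"
 using bounded_Fubini(2)[OF prob_space_tmat prob_space_trow assms] by simp

lemma (in prob_space) expectation_abs_le_sqrt:
 fixes Z :: "'a => real"
 assumes [measurable]: "Z \<in> borel_measurable M" and B: "!!x. \<bar>Z x\<bar> \<le> B"
 shows "expectation (\<lambda>x. \<bar>Z x\<bar>) \<le> sqrt (expectation (\<lambda>x. (Z x)\<^sup>2))"
proof -
 have i: "integrable M (\<lambda>x. \<bar>Z x\<bar>)" by (rule integrable_const_bound[where B = B]) (use B in auto)
 have i2: "integrable M (\<lambda>x. (\<bar>Z x\<bar>)\<^sup>2)"
 proof (rule integrable_const_bound[where B = "B\<^sup>2"])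
  have "\<bar>Z x\<bar>\<^sup>2 \<le> B\<^sup>2" for x by (rule power_mono[OF B]) simp
  then show "AE x in M. norm ((\<bar>Z x\<bar>)\<^sup>2) \<le> B\<^sup>2" by simp
 qed measurable
 have "0 \<le> variance (\<lambda>x. \<bar>Z x\<bar>)" by simp
 then have "(expectation (\<lambda>x. \<bar>Z x\<bar>))\<^sup>2 \<le> expectation (\<lambda>x. (Z x)\<^sup>2)"
  using variance_eq[OF i i2] by simp
 then show ?thesis by (rule real_le_rsqrt)
qed

text \<open>For distinct frequencies the affine forms are independent and uniform, hence the summands are
  uncorrelated.\<close>
lemma torus_variance_le:
 fixes f :: "int ^ 'n::finite => 'm::finite => real => real"
 assumes S: "finite S" and f: "!!q i. circle_fun (f q i)"
 defines "p \<equiv> \<lambda>q. \<Prod>i\<in>UNIV. integral\<^sup>L circ (f q i)"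
 shows "(\<integral>z. (\<Sum>q\<in>S. torus_prod (f q) q (fst z) (snd z) - p q)\<^sup>2 \<partial>(tmat \<Otimes>\<^sub>M trow)) \<le> (\<Sum>q\<in>S. p q)"
  and "(\<integral>z. \<bar>\<Sum>q\<in>S. torus_prod (f q) q (fst z) (snd z) - p q\<bar> \<partial>(tmat \<Otimes>\<^sub>M trow)) \<le> sqrt (\<Sum>q\<in>S. p q)"
proof -
 interpret P: prob_space "tmat \<Otimes>\<^sub>M trow :: (('m => 'n => real) \<times> ('m => real)) measure" by (rule prob_space_tP)
 let ?P = "tmat \<Otimes>\<^sub>M trow :: (('m => 'n => real) \<times> ('m => real)) measure"
 let ?Z = "\<lambda>q z. torus_prod (f q) q (fst z) (snd z)"
 have [measurable]: "?Z q \<in> borel_measurable ?P" for q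
  using torus_prod_measurable[OF f] by (simp add: case_prod_beta')
 have tb: "0 \<le> torus_prod (f q) q u x" "torus_prod (f q) q u x \<le> 1" for q u x by (rule torus_prod_bounds, rule f)+
 have Z01: "0 \<le> ?Z q z" "?Z q z \<le> 1" for q z by (rule tb)+
 have p0: "0 \<le> p q" for q unfolding p_def by (intro prod_nonneg circle_fun_integral_nonneg f ballI)
 have EZ: "integral\<^sup>L ?P (?Z q) = p q" for q
  using integral_tP[of "torus_prod (f q) q" 1] torus_prod_measurable[OF f] Z01
  by (simp add: integral_torus_prod[OF f] p_def prob_space.prob_space[OF prob_space_tmat] tb)
 have iZ: "integrable ?P (?Z q)" for q
  by (rule P.integrable_const_bound[where B = 1]) (use Z01 in auto)
 have iZZ: "integrable ?P (\<lambda>z. ?Z q z * ?Z q' z)" for q q'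
  by (rule P.integrable_const_bound[where B = 1]) (use Z01 in \<open>auto simp: abs_mult intro!: AE_I2 mult_le_one\<close>)
 have EZZ: "(\<integral>z. ?Z q z * ?Z q' z \<partial>?P) = p q * p q'" if "q \<noteq> q'" for q q'
 proof -
  have "(\<lambda>(u, x). torus_prod (f q) q u x * torus_prod (f q') q' u x) \<in> borel_measurable ?P"
   using torus_prod_measurable[OF f] by (simp add: case_prod_beta')
  from integral_tP[OF this, of 1] show ?thesis
   using integral_torus_prod_pair[of "f q" "f q'" q q', OF f f that]
   by (simp add: p_def abs_mult mult_le_one tb)
 qed
 have cov: "(\<integral>z. (?Z q z - p q) * (?Z q' z - p q') \<partial>?P) \<le> (if q' = q then p q else 0)" for q q'
 proof -
  have "(\<integral>z. (?Z q z - p q) * (?Z q' z - p q') \<partial>?P) = (\<integral>z. ?Z q z * ?Z q' z - p q' * ?Z q z - p q * ?Z q' z + p q * p q' \<partial>?P)"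
   by (rule Bochner_Integration.integral_cong) (auto simp: algebra_simps)
  also have "... = (\<integral>z. ?Z q z * ?Z q' z \<partial>?P) - p q * p q'"
   using iZ iZZ P.prob_space by (simp add: EZ)
  also have "... \<le> (if q' = q then p q else 0)"
  proof (cases "q' = q")
   case True
   have "(\<integral>z. ?Z q z * ?Z q z \<partial>?P) \<le> (\<integral>z. ?Z q z \<partial>?P)"
    by (intro integral_mono iZ iZZ mult_left_le) (use Z01 in auto)
   then show ?thesis using True p0[of q] by (simp add: EZ) (meson mult_nonneg_nonneg order.trans diff_le_eq le_add_same_cancel1)
  qed (use EZZ in auto)
  finally show ?thesis .
 qed
 have "(\<integral>z. (\<Sum>q\<in>S. ?Z q z - p q)\<^sup>2 \<partial>?P) = (\<Sum>q\<in>S. \<Sum>q'\<in>S. \<integral>z. (?Z q z - p q) * (?Z q' z - p q') \<partial>?P)"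
 proof -
  have i: "integrable ?P (\<lambda>z. (?Z q z - p q) * (?Z q' z - p q'))" for q q'
   using iZ iZZ by (auto simp: algebra_simps)
  show ?thesis unfolding power2_eq_square sum_product
   by (subst Bochner_Integration.integral_sum, intro Bochner_Integration.integrable_sum i)
    (intro sum.cong refl Bochner_Integration.integral_sum i)
 qed
 also have "... \<le> (\<Sum>q\<in>S. \<Sum>q'\<in>S. if q' = q then p q else 0)" by (intro sum_mono cov)
 also have "... = (\<Sum>q\<in>S. p q)" using S by (simp add: sum.delta)
 finally show 1: "(\<integral>z. (\<Sum>q\<in>S. ?Z q z - p q)\<^sup>2 \<partial>?P) \<le> (\<Sum>q\<in>S. p q)" .
 have "(\<integral>z. \<bar>\<Sum>q\<in>S. ?Z q z - p q\<bar> \<partial>?P) \<le> sqrt (\<integral>z. (\<Sum>q\<in>S. ?Z q z - p q)\<^sup>2 \<partial>?P)"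
 proof (rule P.expectation_abs_le_sqrt)
  show "\<bar>\<Sum>q\<in>S. ?Z q z - p q\<bar> \<le> (\<Sum>q\<in>S. 1 + p q)" for z
   by (rule order.trans[OF sum_abs], intro sum_mono)
    (use Z01 p0 in \<open>smt (verit)\<close>)
 qed measurable
 also have "... \<le> sqrt (\<Sum>q\<in>S. p q)" using 1 by simp
 finally show "(\<integral>z. \<bar>\<Sum>q\<in>S. ?Z q z - p q\<bar> \<partial>?P) \<le> sqrt (\<Sum>q\<in>S. p q)" .
qed

lemma emeasure_circ_shift:
 assumes A[measurable]: "A \<in> sets borel"
 shows "emeasure circ {y. frac (y + s) \<in> A} = emeasure circ A"
proof -
 have cf: "circle_fun (\<lambda>y. indicator A (frac y))" unfolding circle_fun_def
  by (auto simp: frac_1_eq)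
 have f2: "measure circ {y. frac (y + s) \<in> A} = (\<integral>y. indicator A (frac (s + y)) \<partial>circ)" for s
 proof -
  have "{y. frac (y + s) \<in> A} \<in> sets circ" by (simp, measurable)
  moreover have "(\<lambda>y. indicator A (frac (s + y)) :: real) = indicator {y. frac (y + s) \<in> A}"
   by (auto simp: indicator_def add.commute)
  ultimately show ?thesis by simp
 qed
 have "emeasure circ A = emeasure circ {y. frac (y + 0) \<in> A}"
  using A by (simp add: emeasure_circ, intro arg_cong[where f = "emeasure lborel"]) (auto simp: frac_eq)
 moreover have "measure circ {y. frac (y + s) \<in> A} = measure circ {y. frac (y + 0) \<in> A}"
  unfolding f2 using integral_circ_shift[OF cf, of s] integral_circ_shift[OF cf, of 0] by simp
 ultimately show ?thesis by (simp add: circ.emeasure_eq_measure)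
qed

lemma distr_trow_shift:
 "distr trow trow (\<lambda>x i. frac (x i + s i)) = (trow :: ('m::finite => real) measure)"
proof -
 interpret product_prob_space "\<lambda>_::'m. circ" UNIV by (intro product_prob_spaceI prob_space_circ)
 have m[measurable]: "(\<lambda>x i. frac (x i + s i)) \<in> measurable trow (trow :: ('m => real) measure)"
 proof -
  have "(\<lambda>x. frac (x i + s i)) \<in> measurable trow circ" for i
   by (simp add: measurable_cong_sets[OF refl sets_circ])
  then show ?thesis by (subst (2) trow_def, intro measurable_PiM_single') (auto simp: PiE_UNIV_domain)
 qed
 have "distr trow trow (\<lambda>x i. frac (x i + s i)) = PiM UNIV (\<lambda>_::'m. circ)"
 proof (rule PiM_eqI)
  fix A :: "'m => real set" assume "!!i. i \<in> UNIV ==> A i \<in> sets circ"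
  then have A[measurable]: "!!i. A i \<in> sets borel" by simp
  have "emeasure (distr trow trow (\<lambda>x i. frac (x i + s i))) (Pi\<^sub>E UNIV A)
   = emeasure trow ((\<lambda>x i. frac (x i + s i)) -` (Pi\<^sub>E UNIV A) \<inter> space trow)"
   by (rule emeasure_distr[OF m]) (simp add: trow_def sets_PiM_I_finite)
  also have "(\<lambda>x i. frac (x i + s i)) -` (Pi\<^sub>E UNIV A) \<inter> space trow = Pi\<^sub>E UNIV (\<lambda>i. {y. frac (y + s i) \<in> A i})"
   by (auto simp: trow_def space_PiM PiE_UNIV_domain)
  also have "emeasure trow (Pi\<^sub>E UNIV (\<lambda>i. {y. frac (y + s i) \<in> A i})) = (\<Prod>i\<in>UNIV. emeasure circ {y. frac (y + s i) \<in> A i})"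
   unfolding trow_def by (rule emeasure_PiM) auto
  finally show "emeasure (distr trow trow (\<lambda>x i. frac (x i + s i))) (Pi\<^sub>E UNIV A) = (\<Prod>i\<in>UNIV. emeasure circ (A i))"
   by (simp add: emeasure_circ_shift A)
 qed (simp_all add: trow_def)
 then show ?thesis by (simp add: trow_def)
qed

lemma integral_trow_shift:
 fixes F :: "('m::finite => real) => 'c::{banach, second_countable_topology}"
 assumes [measurable]: "F \<in> borel_measurable trow" and per: "!!x (k :: 'm => int). F (\<lambda>i. x i + of_int (k i)) = F x"
 shows "(\<integral>x. F (\<lambda>i. x i + s i) \<partial>trow) = integral\<^sup>L trow F"
proof -
 have m: "(\<lambda>x i. frac (x i + s i)) \<in> measurable trow (trow :: ('m => real) measure)"
 proof -
   have "(\<lambda>x. frac (x i + s i)) \<in> measurable trow circ" for i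
   by (simp add: measurable_cong_sets[OF refl sets_circ])
  then show ?thesis by (subst (2) trow_def, intro measurable_PiM_single') (auto simp: PiE_UNIV_domain)
 qed
 have "integral\<^sup>L trow F = integral\<^sup>L (distr trow trow (\<lambda>x i. frac (x i + s i))) F"
  by (simp only: distr_trow_shift)
 also have "... = (\<integral>x. F (\<lambda>i. frac (x i + s i)) \<partial>trow)"
  by (rule integral_distr[OF m]) simp
 also have "... = (\<integral>x. F (\<lambda>i. x i + s i) \<partial>trow)"
 proof (rule Bochner_Integration.integral_cong[OF refl])
  show "F (\<lambda>i. frac (x i + s i)) = F (\<lambda>i. x i + s i)" for x
   using per[of "\<lambda>i. frac (x i + s i)" "\<lambda>i. \<lfloor>x i + s i\<rfloor>"] by (simp add: frac_def)
 qed
 finally show ?thesis by simp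
qed

section \<open>A decoupling principle\<close>

lemma norm_cis_diff_le: "norm (cis a - cis b) \<le> \<bar>a - b\<bar>"
proof -
 have "cis a - cis b = cis b * (cis (a - b) - 1)" by (simp add: algebra_simps cis_mult)
 then have "norm (cis a - cis b) = norm (cis (a - b) - 1)" by (simp add: norm_mult)
 also have "... \<le> \<bar>a - b\<bar>" using iexp_approx1[of "a - b" 0] by (simp add: cis_conv_exp)
 finally show ?thesis .
qed

lemma norm_mult_diff_le:
 fixes a b c d :: complex
 assumes "norm a \<le> 1" "norm d \<le> 1"
 shows "norm (a * b - c * d) \<le> norm (b - d) + norm (a - c)"
proof -
 have "norm (a * b - c * d) = norm (a * (b - d) + (a - c) * d)" by (simp add: algebra_simps)
 also have "... \<le> norm a * norm (b - d) + norm (a - c) * norm d"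
  by (rule order.trans[OF norm_triangle_ineq]) (simp add: norm_mult)
 also have "... \<le> 1 * norm (b - d) + norm (a - c) * 1"
  by (rule add_mono[OF mult_right_mono[OF assms(1)] mult_left_mono[OF assms(2)]]) auto
 finally show ?thesis by simp
qed

lemma cis_measurable [measurable]: "cis \<in> borel_measurable borel"
 by (intro borel_measurable_continuous_onI continuous_intros)

definition cell :: "nat => int => real => real" where
 "cell D k y = (if \<lfloor>real D * y\<rfloor> mod int D = k then 1 else 0)"

lemma circle_fun_cell: "circle_fun (cell D k)"
 unfolding circle_fun_def
proof (intro conjI allI)
 have "(\<lambda>y. \<lfloor>real D * y\<rfloor>) \<in> measurable borel (count_space UNIV)"
  by (rule measurable_compose[OF _ measurable_real_floor]) measurable
 then have "{y \<in> space borel. \<lfloor>real D * y\<rfloor> mod int D = k} \<in> sets borel"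
  by measurable
 moreover have "cell D k = indicator {y. \<lfloor>real D * y\<rfloor> mod int D = k}" by (auto simp: cell_def)
 ultimately show "cell D k \<in> borel_measurable borel" by simp
 have "\<lfloor>real D * (x + 1)\<rfloor> = \<lfloor>real D * x\<rfloor> + int D" for x
  using floor_add_int[of "real D * x" "int D"] by (simp add: distrib_left)
 then show "cell D k (x + 1) = cell D k x" for x by (simp add: cell_def)
qed (auto simp: cell_def)

lemma integral_cell:
 assumes "D > 0" "0 \<le> k" "k < int D"
 shows "integral\<^sup>L circ (cell D k) = 1 / real D"
proof -
 have "indicator {0..<1} y * cell D k y = indicator {of_int k / real D..<(of_int k + 1) / real D} y" for y
 proof (cases "0 \<le> y \<and> y < 1")
  case True
  then have "0 \<le> real D * y" "real D * y < real D" using assms by auto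
  then have "0 \<le> \<lfloor>real D * y\<rfloor>" "\<lfloor>real D * y\<rfloor> < int D" by (auto simp: floor_less_iff)
  then have "cell D k y = (if \<lfloor>real D * y\<rfloor> = k then 1 else 0)" by (simp add: cell_def)
  also have "\<lfloor>real D * y\<rfloor> = k \<longleftrightarrow> of_int k \<le> real D * y \<and> real D * y < of_int k + 1" by (rule floor_eq_iff)
  also have "... \<longleftrightarrow> y \<in> {of_int k / real D..<(of_int k + 1) / real D}" using assms by (auto simp: field_simps)
  finally show ?thesis using True by (simp add: indicator_def)
 next
  case False
  have "0 \<le> of_int k / real D" "(of_int k + 1) / real D \<le> 1"
  proof -
   show "0 \<le> of_int k / real D" using assms by simp
   have "of_int k + 1 \<le> real D" using assms by linarith
   then show "(of_int k + 1) / real D \<le> 1" using assms by (simp add: field_simps)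
  qed
  then have "y \<notin> {of_int k / real D..<(of_int k + 1) / real D}" using False by (smt (verit) atLeastLessThan_iff)
  then have "indicator {of_int k / real D..<(of_int k + 1) / real D} y = (0 :: real)" by (rule indicator_simps(2))
  moreover have "indicator {0..<1} y = (0 :: real)" using False by (auto simp: indicator_def)
  ultimately show ?thesis by (simp only: mult_zero_left)
 qed
 then have "integral\<^sup>L circ (cell D k) = (\<integral>y. indicator {of_int k / real D..<(of_int k + 1) / real D} y \<partial>lborel)"
  by (subst integral_circ[OF circle_fun_measurable[OF circle_fun_cell]]) simp
 also have "... = (of_int k + 1) / real D - of_int k / real D"
  using assms by (simp add: divide_right_mono)
 finally show ?thesis by (simp add: add_divide_distrib)
qed

text \<open>The points \<open>u q + x\<close> with \<open>q \<in> S\<close> are pairwise independent and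
  uniform. Expand a function that is constant on cells in the cell indicators; with \<open>M\<close> cells,
  the average of one indicator over \<open>S\<close> deviates from its mean \<open>1/M\<close> by at most
  \<open>sqrt (1 / (M card S))\<close> in mean, and there are \<open>M\<close> of them.\<close>
lemma cell_average:
 fixes D :: "'m::finite => nat" and S :: "(int ^ 'n::finite) set"
  and G :: "('m => 'n => real) => ('m => int) => complex"
 assumes D: "!!i. D i > 0" and S: "finite S" "S \<noteq> {}"
  and G: "!!u k. norm (G u k) \<le> 1" and Gm: "!!k. (\<lambda>u. G u k) \<in> borel_measurable tmat"
 defines "\<kappa> \<equiv> \<lambda>x i. \<lfloor>real (D i) * x i\<rfloor> mod int (D i)"
 defines "A \<equiv> \<lambda>u x. (\<Sum>q\<in>S. G u (\<kappa> (\<lambda>i. rdot (u i) q + x i))) / of_nat (card S)"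
 shows "(\<lambda>(u, x). norm (A u x - (\<integral>y. G u (\<kappa> y) \<partial>trow))) \<in> borel_measurable (tmat \<Otimes>\<^sub>M trow)"
  and "(\<integral>z. norm (A (fst z) (snd z) - (\<integral>y. G (fst z) (\<kappa> y) \<partial>trow)) \<partial>(tmat \<Otimes>\<^sub>M trow))
   \<le> sqrt ((\<Prod>i\<in>UNIV. real (D i)) / real (card S))"
  and "(\<lambda>(u, x). G u (\<kappa> x)) \<in> borel_measurable (tmat \<Otimes>\<^sub>M trow)"
  and "(\<lambda>(u, x). A u x) \<in> borel_measurable (tmat \<Otimes>\<^sub>M trow)"
proof -
 let ?P = "tmat \<Otimes>\<^sub>M trow :: (('m => 'n => real) \<times> ('m => real)) measure"
 interpret P: prob_space ?P by (rule prob_space_tP)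
 define K where "K = (\<Pi>\<^sub>E i\<in>UNIV. {0..<int (D i)})"
 define M where "M = (\<Prod>i\<in>UNIV. real (D i))"
 have M0: "M > 0" unfolding M_def using D by (intro prod_pos) auto
 have finK: "finite K" unfolding K_def by (intro finite_PiE) auto
 have cardK: "real (card K) = M" unfolding K_def M_def by (subst card_PiE) auto
 let ?c = "\<lambda>k q z. torus_prod (\<lambda>i. cell (D i) (k i)) q (fst z) (snd z)"
 have cm[measurable]: "?c k q \<in> borel_measurable ?P" for k q
 proof -
  have "(\<lambda>(u, x). torus_prod (\<lambda>i. cell (D i) (k i)) q u x) \<in> borel_measurable ?P"
   by (rule torus_prod_measurable) (rule circle_fun_cell)
  then show ?thesis by (simp add: case_prod_beta')
 qed
 have c01: "0 \<le> ?c k q z" "?c k q z \<le> 1" for k q z by (rule torus_prod_bounds, rule circle_fun_cell)+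
 have Gm'[measurable]: "(\<lambda>z. G (fst z) k) \<in> borel_measurable ?P" for k
  by (rule measurable_compose[OF measurable_fst Gm])
 have expand: "G u (\<kappa> y) = (\<Sum>k\<in>K. G u k * of_real (\<Prod>i\<in>UNIV. cell (D i) (k i) (y i)))" for u y
 proof -
  have "\<kappa> y \<in> K" unfolding K_def \<kappa>_def using D by auto
  have "(\<Prod>i\<in>UNIV. cell (D i) (k i) (y i)) = (if k = \<kappa> y then 1 else 0)" for k
  proof (cases "k = \<kappa> y")
   case False
   then obtain i where "k i \<noteq> \<kappa> y i" by auto
   then have "cell (D i) (k i) (y i) = 0" by (auto simp: cell_def \<kappa>_def)
   then show ?thesis using False by (auto intro: prod_zero)
  qed (simp add: cell_def \<kappa>_def)
  then have "(\<Sum>k\<in>K. G u k * of_real (\<Prod>i\<in>UNIV. cell (D i) (k i) (y i))) = (\<Sum>k\<in>K. if k = \<kappa> y then G u k else 0)"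
   by (intro sum.cong) auto
  also have "... = G u (\<kappa> y)" using finK \<open>\<kappa> y \<in> K\<close> by (simp add: sum.delta')
  finally show ?thesis by simp
 qed
 have p: "(\<Prod>i\<in>UNIV. integral\<^sup>L circ (cell (D i) (k i))) = 1 / M" if "k \<in> K" for k
 proof -
  have "integral\<^sup>L circ (cell (D i) (k i)) = 1 / real (D i)" for i
   using that D by (intro integral_cell) (auto simp: K_def PiE_iff)
  then show ?thesis by (simp add: M_def prod_dividef)
 qed
 have mean: "(\<integral>y. G u (\<kappa> y) \<partial>trow) = (\<Sum>k\<in>K. G u k * of_real (1 / M))" for u
 proof -
  have i: "integrable trow (\<lambda>y. \<Prod>i\<in>UNIV. cell (D i) (k i) (y i))" for k
  proof (rule bounded_integrable[OF prob_space_trow, where B = 1])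
   have "torus_prod (\<lambda>i. cell (D i) (k i)) (0 :: int ^ 'n) (\<lambda>_ _. 0) \<in> borel_measurable trow"
    by (rule torus_prod_measurable_x) (rule circle_fun_cell)
   then show "(\<lambda>y. \<Prod>i\<in>UNIV. cell (D i) (k i) (y i)) \<in> borel_measurable trow"
    by (simp add: torus_prod_def[abs_def] rdot_def)
   show "norm (\<Prod>i\<in>UNIV. cell (D i) (k i) (y i)) \<le> 1" for y
    by (simp add: abs_prod) (intro prod_le_1, auto simp: cell_def)
  qed
  have "(\<integral>y. G u (\<kappa> y) \<partial>trow) = (\<Sum>k\<in>K. \<integral>y. G u k * of_real (\<Prod>i\<in>UNIV. cell (D i) (k i) (y i)) \<partial>trow)"
   unfolding expand by (intro Bochner_Integration.integral_sum integrable_mult_right integrable_of_real i)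
  also have "... = (\<Sum>k\<in>K. G u k * of_real (\<integral>y. (\<Prod>i\<in>UNIV. cell (D i) (k i) (y i)) \<partial>trow))"
   by (simp only: Bochner_Integration.integral_mult_right_zero integral_complex_of_real)
  also have "... = (\<Sum>k\<in>K. G u k * of_real (1 / M))"
  proof (rule sum.cong[OF refl])
   fix k assume "k \<in> K"
   have "(\<integral>y. (\<Prod>i\<in>UNIV. cell (D i) (k i) (y i)) \<partial>trow) = (\<Prod>i\<in>UNIV. integral\<^sup>L circ (cell (D i) (k i)))"
    by (rule integral_prod_trow) (rule circle_fun_measurable[OF circle_fun_cell], auto simp: cell_def)
   then show "G u k * of_real (\<integral>y. (\<Prod>i\<in>UNIV. cell (D i) (k i) (y i)) \<partial>trow) = G u k * of_real (1 / M)"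
    using p[OF \<open>k \<in> K\<close>] by simp
  qed
  finally show ?thesis .
 qed
 have N: "real (card S) > 0" using S by (simp add: card_gt_0_iff)
 have A: "A (fst z) (snd z) = (\<Sum>k\<in>K. G (fst z) k * of_real ((\<Sum>q\<in>S. ?c k q z) / real (card S)))" for z
 proof -
  have "(\<Sum>q\<in>S. G (fst z) (\<kappa> (\<lambda>i. rdot (fst z i) q + snd z i))) = (\<Sum>k\<in>K. \<Sum>q\<in>S. G (fst z) k * of_real (?c k q z))"
   unfolding expand torus_prod_def by (rule sum.swap)
  then show ?thesis unfolding A_def by (simp add: sum_divide_distrib sum_distrib_left)
 qed
 have diff: "A (fst z) (snd z) - (\<integral>y. G (fst z) (\<kappa> y) \<partial>trow)
  = (\<Sum>k\<in>K. G (fst z) k * of_real ((\<Sum>q\<in>S. ?c k q z - 1 / M) / real (card S)))" for z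
 proof -
  have e: "(\<Sum>q\<in>S. ?c k q z - 1 / M) / real (card S) = (\<Sum>q\<in>S. ?c k q z) / real (card S) - 1 / M" for k
   using N by (simp add: sum_subtractf diff_divide_distrib)
  show ?thesis unfolding A mean sum_subtractf[symmetric]
   by (intro sum.cong refl) (simp only: e of_real_diff right_diff_distrib)
 qed
 show "(\<lambda>(u, x). A u x) \<in> borel_measurable (tmat \<Otimes>\<^sub>M trow)"
  unfolding case_prod_beta A by measurable
 have dm: "(\<lambda>z. norm (A (fst z) (snd z) - (\<integral>y. G (fst z) (\<kappa> y) \<partial>trow))) \<in> borel_measurable ?P"
  unfolding diff by measurable
 then show "(\<lambda>(u, x). norm (A u x - (\<integral>y. G u (\<kappa> y) \<partial>trow))) \<in> borel_measurable (tmat \<Otimes>\<^sub>M trow)"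
  by (simp add: case_prod_beta')
 show "(\<lambda>(u, x). G u (\<kappa> x)) \<in> borel_measurable (tmat \<Otimes>\<^sub>M trow)"
 proof -
  have "(\<lambda>z. G (fst z) (\<kappa> (snd z))) = (\<lambda>z. \<Sum>k\<in>K. G (fst z) k * of_real (?c k 0 z))"
   unfolding expand torus_prod_def by (simp add: rdot_def)
  then show ?thesis by (simp add: case_prod_beta')
 qed
 have bd: "norm (A (fst z) (snd z) - (\<integral>y. G (fst z) (\<kappa> y) \<partial>trow)) \<le> (\<Sum>k\<in>K. \<bar>\<Sum>q\<in>S. ?c k q z - 1 / M\<bar> / real (card S))" for z
  unfolding diff
 proof (rule sum_norm_le)
  fix k
  have "norm (G (fst z) k * of_real ((\<Sum>q\<in>S. ?c k q z - 1 / M) / real (card S)))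
   = norm (G (fst z) k) * (\<bar>\<Sum>q\<in>S. ?c k q z - 1 / M\<bar> / real (card S))"
   by (simp only: norm_mult norm_of_real abs_divide abs_of_nat)
  also have "... \<le> 1 * (\<bar>\<Sum>q\<in>S. ?c k q z - 1 / M\<bar> / real (card S))"
   by (intro mult_right_mono G) simp
  finally show "norm (G (fst z) k * of_real ((\<Sum>q\<in>S. ?c k q z - 1 / M) / real (card S)))
   \<le> \<bar>\<Sum>q\<in>S. ?c k q z - 1 / M\<bar> / real (card S)" by simp
 qed
 have cn: "norm (?c k q z) \<le> 1" for k q z using c01[of k q z] by (simp add: abs_of_nonneg)
 have ik: "integrable ?P (\<lambda>z. \<bar>\<Sum>q\<in>S. ?c k q z - 1 / M\<bar>)" for k
  by (intro integrable_abs Bochner_Integration.integrable_sum Bochner_Integration.integrable_diff P.integrable_const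
    P.integrable_const_bound[where B = 1] AE_I2 cn cm)
 have "(\<integral>z. norm (A (fst z) (snd z) - (\<integral>y. G (fst z) (\<kappa> y) \<partial>trow)) \<partial>?P)
  \<le> (\<integral>z. (\<Sum>k\<in>K. \<bar>\<Sum>q\<in>S. ?c k q z - 1 / M\<bar> / real (card S)) \<partial>?P)"
 proof (rule integral_mono')
  show "integrable ?P (\<lambda>z. \<Sum>k\<in>K. \<bar>\<Sum>q\<in>S. ?c k q z - 1 / M\<bar> / real (card S))"
   by (intro Bochner_Integration.integrable_sum integrable_divide ik)
 qed (rule bd, intro sum_nonneg divide_nonneg_nonneg, auto)
 also have "... = (\<Sum>k\<in>K. (\<integral>z. \<bar>\<Sum>q\<in>S. ?c k q z - 1 / M\<bar> \<partial>?P) / real (card S))"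
  by (subst Bochner_Integration.integral_sum) (auto intro!: integrable_divide ik)
 also have "... \<le> (\<Sum>k\<in>K. sqrt (real (card S) / M) / real (card S))"
 proof (intro sum_mono divide_right_mono)
  fix k assume "k \<in> K"
  show "(\<integral>z. \<bar>\<Sum>q\<in>S. ?c k q z - 1 / M\<bar> \<partial>?P) \<le> sqrt (real (card S) / M)"
   using torus_variance_le(2)[OF S(1), of "\<lambda>_ i. cell (D i) (k i)", OF circle_fun_cell] p[OF \<open>k \<in> K\<close>] by simp
 qed simp
 also have "... = M * sqrt (real (card S) / M) / real (card S)" by (simp add: cardK)
 also have "... = sqrt (M / real (card S))"
  using M0 N by (simp add: real_sqrt_divide field_simps)
 finally show "(\<integral>z. norm (A (fst z) (snd z) - (\<integral>y. G (fst z) (\<kappa> y) \<partial>trow)) \<partial>(tmat \<Otimes>\<^sub>M trow))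
   \<le> sqrt ((\<Prod>i\<in>UNIV. real (D i)) / real (card S))" by (simp add: M_def)
qed

definition periodic :: "(('m => real) => 'c) => bool" where
 "periodic F \<longleftrightarrow> (\<forall>x (k :: 'm => int). F (\<lambda>i. x i + of_int (k i)) = F x)"

text \<open>Here \<open>f\<close> is almost invariant under the translations \<open>x \<mapsto> x + u
  q\<close>, \<open>q \<in> S\<close>, and \<open>\<Phi>\<close> is almost constant on the cells of a grid.
  Averaging the integral of the product over these translations leaves \<open>f\<close> in place and, by
  \<open>cell_average\<close>, turns \<open>\<Phi>\<close> into its mean.\<close>
lemma decoupling:
 fixes \<Phi> f :: "('m::finite => 'n::finite => real) => ('m => real) => complex"
  and D :: "'m => nat" and S :: "(int ^ 'n) set"
 assumes D: "!!i. D i > 0" and S: "finite S" "S \<noteq> {}"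
  and \<Phi>: "!!u x. norm (\<Phi> u x) \<le> 1" "(\<lambda>(u, x). \<Phi> u x) \<in> borel_measurable (tmat \<Otimes>\<^sub>M trow)" "!!u. periodic (\<Phi> u)"
   "!!x. (\<lambda>u. \<Phi> u x) \<in> borel_measurable tmat" "!!u. \<Phi> u \<in> borel_measurable trow"
  and f: "!!u x. norm (f u x) \<le> 1" "(\<lambda>(u, x). f u x) \<in> borel_measurable (tmat \<Otimes>\<^sub>M trow)" "!!u. periodic (f u)"
   "!!u. f u \<in> borel_measurable trow"
  and \<eta>: "!!q u. q \<in> S ==> (\<integral>x. norm (f u (\<lambda>i. x i + rdot (u i) q) - f u x) \<partial>trow) \<le> \<eta>"
  and \<epsilon>: "!!u. (\<integral>x. norm (\<Phi> u x - \<Phi> u (\<lambda>i. of_int \<lfloor>real (D i) * x i\<rfloor> / real (D i))) \<partial>trow) \<le> \<epsilon>"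
 shows "(\<integral>u. norm ((\<integral>x. \<Phi> u x * f u x \<partial>trow) - (\<integral>x. \<Phi> u x \<partial>trow) * (\<integral>x. f u x \<partial>trow)) \<partial>tmat)
  \<le> \<eta> + 2 * \<epsilon> + sqrt ((\<Prod>i\<in>UNIV. real (D i)) / real (card S))"
proof -
 interpret u: prob_space "tmat :: ('m => 'n => real) measure" by (rule prob_space_tmat)
 interpret x: prob_space "trow :: ('m => real) measure" by (rule prob_space_trow)
 note [measurable] = \<Phi>(2,4,5) f(2,4)
 let ?N = "real (card S)"
 have N: "?N > 0" using S by (simp add: card_gt_0_iff)
 define \<kappa> where "\<kappa> = (\<lambda>(x :: 'm => real) i. \<lfloor>real (D i) * x i\<rfloor> mod int (D i))"
 define G where "G = (\<lambda>u k. \<Phi> u (\<lambda>i. of_int (k i) / real (D i)))"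
 have GA: "G u (\<kappa> x) = \<Phi> u (\<lambda>i. of_int \<lfloor>real (D i) * x i\<rfloor> / real (D i))" for u x
 proof -
  have "(\<lambda>i. of_int \<lfloor>real (D i) * x i\<rfloor> / real (D i)) = (\<lambda>i. of_int (\<kappa> x i) / real (D i) + of_int (\<lfloor>real (D i) * x i\<rfloor> div int (D i)))"
  proof
   fix i
   have "of_int \<lfloor>real (D i) * x i\<rfloor> = (of_int (\<lfloor>real (D i) * x i\<rfloor> div int (D i)) * real (D i) + of_int (\<kappa> x i) :: real)"
    unfolding \<kappa>_def by (metis div_mult_mod_eq of_int_add of_int_mult of_int_of_nat_eq)
   then show "of_int \<lfloor>real (D i) * x i\<rfloor> / real (D i) = of_int (\<kappa> x i) / real (D i) + of_int (\<lfloor>real (D i) * x i\<rfloor> div int (D i))"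
    using D[of i] by (simp add: field_simps)
  qed
  then show ?thesis unfolding G_def
   by (simp only: \<Phi>(3)[of u, unfolded periodic_def, rule_format,
     of "\<lambda>i. of_int (\<kappa> x i) / real (D i)" "\<lambda>i. \<lfloor>real (D i) * x i\<rfloor> div int (D i)"])
 qed
 define A where "A = (\<lambda>u x. (\<Sum>q\<in>S. G u (\<kappa> (\<lambda>i. rdot (u i) q + x i))) / of_nat (card S))"
 have G1: "norm (G u k) \<le> 1" for u k by (simp add: G_def \<Phi>)
 have Gm: "(\<lambda>u. G u k) \<in> borel_measurable tmat" for k unfolding G_def by (rule \<Phi>(4))
 have CA: "(\<lambda>(u, x). norm (A u x - (\<integral>y. G u (\<kappa> y) \<partial>trow))) \<in> borel_measurable (tmat \<Otimes>\<^sub>M trow)"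
  "(\<integral>z. norm (A (fst z) (snd z) - (\<integral>y. G (fst z) (\<kappa> y) \<partial>trow)) \<partial>(tmat \<Otimes>\<^sub>M trow))
   \<le> sqrt ((\<Prod>i\<in>UNIV. real (D i)) / real (card S))"
  "(\<lambda>(u, x). G u (\<kappa> x)) \<in> borel_measurable (tmat \<Otimes>\<^sub>M trow)"
  "(\<lambda>(u, x). A u x) \<in> borel_measurable (tmat \<Otimes>\<^sub>M trow)"
  unfolding A_def \<kappa>_def by (rule cell_average[OF D S G1 Gm])+
 have [measurable]: "(\<lambda>(u, x). G u (\<kappa> x)) \<in> borel_measurable (tmat \<Otimes>\<^sub>M trow)" by (rule CA(3))
 have [measurable]: "(\<lambda>(u, x). A u x) \<in> borel_measurable (tmat \<Otimes>\<^sub>M trow)" by (rule CA(4))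
 have Gx[measurable]: "(\<lambda>x. G u (\<kappa> x)) \<in> borel_measurable trow" for u
  using measurable_Pair2[OF CA(3), of u] by (simp add: tmat_def trow_def space_PiM)
 have Ax[measurable]: "(\<lambda>x. A u x) \<in> borel_measurable trow" for u
  using measurable_Pair2[OF CA(4), of u] by (simp add: tmat_def trow_def space_PiM)
 have per\<kappa>: "periodic (\<lambda>x. G u (\<kappa> x))" for u
 proof -
  have "\<kappa> (\<lambda>i. x i + of_int (k i)) = \<kappa> x" for x and k :: "'m => int"
  proof
   fix i
   have "\<lfloor>real (D i) * (x i + of_int (k i))\<rfloor> = \<lfloor>real (D i) * x i\<rfloor> + int (D i) * k i"
    using floor_add_int[of "real (D i) * x i" "int (D i) * k i"] by (simp add: distrib_left)
   then show "\<kappa> (\<lambda>i. x i + of_int (k i)) i = \<kappa> x i" by (simp add: \<kappa>_def)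
  qed
  then show ?thesis by (simp add: periodic_def)
 qed
 have ib: "integrable trow g" if "g \<in> borel_measurable trow" "!!x. norm (g x) \<le> 1" for g :: "('m => real) => complex"
  by (rule bounded_integrable[OF prob_space_trow that])
 have A1: "norm (A u x) \<le> 1" for u x
 proof -
  have "norm (\<Sum>q\<in>S. G u (\<kappa> (\<lambda>i. rdot (u i) q + x i))) \<le> (\<Sum>q\<in>S. 1)" by (intro sum_norm_le G1)
  then show ?thesis using N by (simp add: A_def norm_divide)
 qed
 have E1: "norm (\<integral>x. g x \<partial>trow) \<le> 1" if "g \<in> borel_measurable trow" "!!x. norm (g x) \<le> 1" for g :: "('m => real) => complex"
  by (rule integral_norm_le_const[OF prob_space_trow that])
 have key: "norm ((\<integral>x. \<Phi> u x * f u x \<partial>trow) - (\<integral>x. \<Phi> u x \<partial>trow) * (\<integral>x. f u x \<partial>trow))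
   \<le> \<eta> + 2 * \<epsilon> + (\<integral>x. norm (A u x - (\<integral>y. G u (\<kappa> y) \<partial>trow)) \<partial>trow)" for u
 proof -
  let ?E = "\<lambda>g :: ('m => real) => complex. (\<integral>x. g x \<partial>trow)"
  let ?s = "\<lambda>q x i. x i + rdot (u i) q"
  have sm[measurable]: "(\<lambda>x. g (?s q x)) \<in> borel_measurable trow" if [measurable]: "g \<in> borel_measurable trow" for g :: "('m => real) => complex" and q
  proof -
   have "?s q \<in> measurable trow trow"
    by (subst (2) trow_def, intro measurable_PiM_single')
     (auto simp: PiE_UNIV_domain measurable_cong_sets[OF refl sets_circ])
   then show ?thesis by (rule measurable_compose) fact
  qed
  have step1: "norm (?E (\<lambda>x. \<Phi> u x * f u x) - ?E (\<lambda>x. G u (\<kappa> (?s q x)) * f u x)) \<le> \<eta> + \<epsilon>" if q: "q \<in> S" for q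
  proof -
   have m: "(\<lambda>x. \<Phi> u x * f u x) \<in> borel_measurable trow" by measurable
   have p: "periodic (\<lambda>x. \<Phi> u x * f u x)" using \<Phi>(3)[of u] f(3)[of u] by (simp add: periodic_def)
   have e: "?E (\<lambda>x. \<Phi> u x * f u x) = ?E (\<lambda>x. \<Phi> u (?s q x) * f u (?s q x))"
    using integral_trow_shift[OF m, of "\<lambda>i. rdot (u i) q"] p by (simp add: periodic_def)
   have i1: "integrable trow (\<lambda>x. \<Phi> u (?s q x) * f u (?s q x))" "integrable trow (\<lambda>x. G u (\<kappa> (?s q x)) * f u x)"
    by (intro ib; use \<Phi>(1) f(1) G1 in \<open>auto simp: norm_mult intro!: mult_le_one\<close>; measurable)+
   have d1: "integrable trow (\<lambda>x. norm (f u (?s q x) - f u x))"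
    by (intro integrable_norm Bochner_Integration.integrable_diff ib) (use f(1) in auto)
   have d2: "integrable trow (\<lambda>x. norm (\<Phi> u (?s q x) - G u (\<kappa> (?s q x))))"
    by (intro integrable_norm Bochner_Integration.integrable_diff ib) (use \<Phi>(1) G1 in auto)
   have "norm (?E (\<lambda>x. \<Phi> u x * f u x) - ?E (\<lambda>x. G u (\<kappa> (?s q x)) * f u x))
    = norm (\<integral>x. \<Phi> u (?s q x) * f u (?s q x) - G u (\<kappa> (?s q x)) * f u x \<partial>trow)"
    unfolding e by (subst Bochner_Integration.integral_diff[OF i1]) simp
   also have "... \<le> (\<integral>x. norm (\<Phi> u (?s q x) * f u (?s q x) - G u (\<kappa> (?s q x)) * f u x) \<partial>trow)"
    by (rule integral_norm_bound)
   also have "... \<le> (\<integral>x. norm (f u (?s q x) - f u x) + norm (\<Phi> u (?s q x) - G u (\<kappa> (?s q x))) \<partial>trow)"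
   proof (rule integral_mono')
    show "integrable trow (\<lambda>x. norm (f u (?s q x) - f u x) + norm (\<Phi> u (?s q x) - G u (\<kappa> (?s q x))))"
     by (intro Bochner_Integration.integrable_add d1 d2)
    fix x
    show "norm (\<Phi> u (?s q x) * f u (?s q x) - G u (\<kappa> (?s q x)) * f u x)
     \<le> norm (f u (?s q x) - f u x) + norm (\<Phi> u (?s q x) - G u (\<kappa> (?s q x)))"
     by (rule norm_mult_diff_le[OF \<Phi>(1) f(1)])
   qed simp
   also have "... = (\<integral>x. norm (f u (?s q x) - f u x) \<partial>trow) + (\<integral>x. norm (\<Phi> u (?s q x) - G u (\<kappa> (?s q x))) \<partial>trow)"
    by (rule Bochner_Integration.integral_add[OF d1 d2])
   also have "(\<integral>x. norm (\<Phi> u (?s q x) - G u (\<kappa> (?s q x))) \<partial>trow) = (\<integral>x. norm (\<Phi> u x - G u (\<kappa> x)) \<partial>trow)"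
   proof -
    have "periodic (\<lambda>x. norm (\<Phi> u x - G u (\<kappa> x)))" using \<Phi>(3)[of u] per\<kappa>[of u] by (simp add: periodic_def)
    then show ?thesis
     using integral_trow_shift[of "\<lambda>x. norm (\<Phi> u x - G u (\<kappa> x))" "\<lambda>i. rdot (u i) q"] by (simp add: periodic_def)
   qed
   also have "... \<le> \<epsilon>" using \<epsilon>[of u] by (simp add: GA)
   finally show ?thesis using \<eta>[OF q, of u] by simp
  qed
  have intA: "?E (\<lambda>x. A u x * f u x) = (\<Sum>q\<in>S. ?E (\<lambda>x. G u (\<kappa> (?s q x)) * f u x)) / of_nat (card S)"
  proof -
   have "integrable trow (\<lambda>x. G u (\<kappa> (?s q x)) * f u x)" for q
    by (intro ib; use f(1) G1 in \<open>auto simp: norm_mult intro!: mult_le_one\<close>; measurable)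
   moreover have "A u x * f u x = (\<Sum>q\<in>S. G u (\<kappa> (?s q x)) * f u x) / of_nat (card S)" for x
    by (simp add: A_def sum_distrib_right add.commute)
   ultimately show ?thesis by (simp add: Bochner_Integration.integral_sum)
  qed
  have step2: "norm (?E (\<lambda>x. \<Phi> u x * f u x) - ?E (\<lambda>x. A u x * f u x)) \<le> \<eta> + \<epsilon>"
  proof -
   have "?E (\<lambda>x. \<Phi> u x * f u x) - ?E (\<lambda>x. A u x * f u x)
    = (\<Sum>q\<in>S. ?E (\<lambda>x. \<Phi> u x * f u x) - ?E (\<lambda>x. G u (\<kappa> (?s q x)) * f u x)) / of_nat (card S)"
    unfolding intA using N by (simp add: sum_subtractf diff_divide_distrib)
   also have "norm ... \<le> (\<Sum>q\<in>S. \<eta> + \<epsilon>) / ?N"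
    unfolding norm_divide norm_of_nat by (intro divide_right_mono sum_norm_le step1) auto
   finally show ?thesis using N by simp
  qed
  let ?g = "?E (\<lambda>y. G u (\<kappa> y))"
  have step3: "norm (?E (\<lambda>x. A u x * f u x) - ?g * ?E (f u)) \<le> (\<integral>x. norm (A u x - ?g) \<partial>trow)"
  proof -
   have i: "integrable trow (\<lambda>x. A u x * f u x)" "integrable trow (\<lambda>x. ?g * f u x)"
    by (intro ib; use f(1) A1 E1[OF Gx G1] in \<open>auto simp: norm_mult intro!: mult_le_one\<close>; measurable)+
   have "?E (\<lambda>x. A u x * f u x) - ?g * ?E (f u) = (\<integral>x. A u x * f u x - ?g * f u x \<partial>trow)"
    by (subst Bochner_Integration.integral_diff[OF i]) simp
   also have "norm ... \<le> (\<integral>x. norm (A u x * f u x - ?g * f u x) \<partial>trow)" by (rule integral_norm_bound)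
   also have "... \<le> (\<integral>x. norm (A u x - ?g) \<partial>trow)"
   proof (rule integral_mono')
    show "integrable trow (\<lambda>x. norm (A u x - ?g))"
     by (intro integrable_norm Bochner_Integration.integrable_diff ib) (use A1 E1[OF Gx G1] in auto)
    fix x
    have "norm (A u x * f u x - ?g * f u x) = norm (A u x - ?g) * norm (f u x)"
     by (simp add: norm_mult[symmetric] left_diff_distrib)
    also have "... \<le> norm (A u x - ?g) * 1" by (intro mult_left_mono f(1)) auto
    finally show "norm (A u x * f u x - ?g * f u x) \<le> norm (A u x - ?g)" by simp
   qed simp
   finally show ?thesis .
  qed
  have step4: "norm (?g * ?E (f u) - ?E (\<Phi> u) * ?E (f u)) \<le> \<epsilon>"
  proof -
   have "norm (?g * ?E (f u) - ?E (\<Phi> u) * ?E (f u)) = norm (?E (\<Phi> u) - ?g) * norm (?E (f u))"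
    by (simp only: norm_mult left_diff_distrib[symmetric] norm_minus_commute[of ?g])
   also have "... \<le> norm (?E (\<Phi> u) - ?g) * 1"
    by (intro mult_left_mono E1 f) auto
   also have "?E (\<Phi> u) - ?g = (\<integral>x. \<Phi> u x - G u (\<kappa> x) \<partial>trow)"
    by (subst Bochner_Integration.integral_diff) (auto intro!: ib simp: \<Phi> G1)
   also have "norm ... \<le> (\<integral>x. norm (\<Phi> u x - G u (\<kappa> x)) \<partial>trow)" by (rule integral_norm_bound)
   also have "... \<le> \<epsilon>" using \<epsilon>[of u] by (simp add: GA)
   finally show ?thesis by simp
  qed
  let ?a = "?E (\<lambda>x. \<Phi> u x * f u x)" and ?b = "?E (\<lambda>x. A u x * f u x)" and ?c = "?g * ?E (f u)" and ?d = "?E (\<Phi> u) * ?E (f u)"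
  have "norm (?a - ?d) \<le> norm (?a - ?b) + norm (?b - ?c) + norm (?c - ?d)"
   using norm_triangle_ineq[of "?a - ?b" "?b - ?c"] norm_triangle_ineq[of "?a - ?c" "?c - ?d"] by simp
  then show ?thesis using step2 step3 step4 by linarith
 qed
 let ?h = "\<lambda>u x. norm (A u x - (\<integral>y. G u (\<kappa> y) \<partial>trow))"
 have h2: "?h u x \<le> 2" for u x
  using norm_triangle_ineq4[of "A u x" "\<integral>y. G u (\<kappa> y) \<partial>trow"] A1[of u x] E1[OF Gx G1, of u] by linarith
 have hm: "(\<lambda>(u, x). ?h u x) \<in> borel_measurable (tmat \<Otimes>\<^sub>M trow)" by (rule CA(1))
 have Hm[measurable]: "(\<lambda>u. \<integral>x. ?h u x \<partial>trow) \<in> borel_measurable tmat"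
  by (rule x.borel_measurable_lebesgue_integral[OF hm])
 have hx: "?h u \<in> borel_measurable trow" for u by measurable
 have Hi: "integrable tmat (\<lambda>u. \<integral>x. ?h u x \<partial>trow)"
  by (rule bounded_integrable[OF prob_space_tmat Hm, where B = 2])
   (use integral_norm_le_const[OF prob_space_trow hx, of _ 2] h2 in auto)
 have "(\<integral>u. norm ((\<integral>x. \<Phi> u x * f u x \<partial>trow) - (\<integral>x. \<Phi> u x \<partial>trow) * (\<integral>x. f u x \<partial>trow)) \<partial>tmat)
  \<le> (\<integral>u. \<eta> + 2 * \<epsilon> + (\<integral>x. ?h u x \<partial>trow) \<partial>tmat)"
 proof (rule integral_mono')
  show "integrable tmat (\<lambda>u. \<eta> + 2 * \<epsilon> + (\<integral>x. ?h u x \<partial>trow))"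
   by (intro Bochner_Integration.integrable_add u.integrable_const Hi)
 qed (rule key, rule order.trans[OF norm_ge_zero key])
 also have "... = \<eta> + 2 * \<epsilon> + (\<integral>u. (\<integral>x. ?h u x \<partial>trow) \<partial>tmat)"
  using Hi u.prob_space by (subst Bochner_Integration.integral_add) auto
 also have "(\<integral>u. (\<integral>x. ?h u x \<partial>trow) \<partial>tmat) = (\<integral>z. ?h (fst z) (snd z) \<partial>(tmat \<Otimes>\<^sub>M trow))"
  by (rule integral_tP[symmetric, OF hm, of 2]) (use h2 in simp)
 finally show ?thesis using CA(2) by linarith
qed

section \<open>Hits of boxes\<close>

text \<open>For radii at most \<open>1/2\<close> this is the number of integer vectors that solve the
  inequalities with frequency \<open>p\<close>.\<close>
definition box_hit :: "('m::finite => real) => int ^ 'n::finite => ('m => 'n => real) => ('m => real) => real" where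
 "box_hit c = torus_prod (\<lambda>i. near_int (c i))"

lemma box_hit_nonneg: "0 \<le> box_hit c p u x"
 and box_hit_le_1: "box_hit c p u x \<le> 1"
 unfolding box_hit_def by (rule torus_prod_bounds, rule circle_fun_near_int)+

lemma box_hit_measurable: "(\<lambda>(u, x). box_hit c p u x) \<in> borel_measurable (tmat \<Otimes>\<^sub>M trow)"
 unfolding box_hit_def by (rule torus_prod_measurable) (rule circle_fun_near_int)

lemma box_hit_measurable_P [measurable]: "(\<lambda>z. box_hit c p (fst z) (snd z)) \<in> borel_measurable (tmat \<Otimes>\<^sub>M trow)"
 using box_hit_measurable by (simp add: case_prod_beta')

lemma box_hit_measurable_x [measurable]: "box_hit c p u \<in> borel_measurable trow"
 unfolding box_hit_def by (rule torus_prod_measurable_x) (rule circle_fun_near_int)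

lemma box_hit_measurable_u [measurable]: "(\<lambda>u. box_hit c p u x) \<in> borel_measurable tmat"
proof -
 have [measurable]: "near_int b \<in> borel_measurable borel" for b
  by (rule circle_fun_measurable[OF circle_fun_near_int])
 show ?thesis unfolding box_hit_def torus_prod_def by measurable
qed

lemma box_hit_integrable_x: "integrable trow (box_hit c p u)"
 by (rule bounded_integrable[OF prob_space_trow box_hit_measurable_x, where B = 1])
  (simp add: abs_of_nonneg box_hit_nonneg box_hit_le_1)

lemma box_hit_mono: "(!!i. c i \<le> c' i) ==> box_hit c p u x \<le> box_hit c' p u x"
 unfolding box_hit_def torus_prod_def
 by (intro prod_mono conjI near_int_mono) (auto simp: near_int_def)

lemma box_hit_mono_near:
 assumes "!!i. \<bar>x i - x' i\<bar> \<le> d i" shows "box_hit c p u x \<le> box_hit (\<lambda>i. c i + d i) p u x'"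
 unfolding box_hit_def torus_prod_def
proof (intro prod_mono conjI near_int_le_near_int_near)
 show "\<bar>(rdot (u i) p + x i) - (rdot (u i) p + x' i)\<bar> \<le> d i" for i using assms[of i] by simp
qed (auto simp: near_int_def)

lemma integral_box_hit:
 assumes "!!i. 0 \<le> c i" "!!i. c i \<le> 1/2"
 shows "(\<integral>x. box_hit c p u x \<partial>trow) = (\<Prod>i\<in>UNIV. 2 * c i)"
 unfolding box_hit_def
 by (subst integral_torus_prod, rule circle_fun_near_int) (intro prod.cong refl integral_near_int assms)

lemma integral_box_hit_le:
 assumes "!!i. 0 \<le> c i" shows "(\<integral>x. box_hit c p u x \<partial>trow) \<le> (\<Prod>i\<in>UNIV. 2 * c i)"
 unfolding box_hit_def
 by (subst integral_torus_prod, rule circle_fun_near_int)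
  (intro prod_mono conjI integral_near_int_le circle_fun_integral_nonneg circle_fun_near_int assms)

lemma box_hit_translate: "box_hit c p u (\<lambda>i. x i + rdot (u i) q) = box_hit c (p + q) u x"
 by (simp add: box_hit_def torus_prod_def rdot_add ac_simps)

lemma periodic_box_hit: "periodic (box_hit c p u)"
 unfolding periodic_def box_hit_def torus_prod_def
proof (intro allI prod.cong refl)
 show "near_int (c i) (rdot (u i) p + (x i + of_int (k i))) = near_int (c i) (rdot (u i) p + x i)" for x and k :: "'a => int" and i
  using circle_fun_add_int[OF circle_fun_near_int, of "c i" "rdot (u i) p + x i" "k i"] by (simp add: ac_simps)
qed

lemma integral_box_hit_nested:
 assumes "!!i. 0 \<le> c i" "!!i. c i \<le> c' i" "!!i. c' i \<le> 1/2"
 shows "(\<integral>x. \<bar>box_hit c' p u x - box_hit c p u x\<bar> \<partial>trow) = (\<Prod>i\<in>UNIV. 2 * c' i) - (\<Prod>i\<in>UNIV. 2 * c i)"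
proof -
 have "(\<integral>x. \<bar>box_hit c' p u x - box_hit c p u x\<bar> \<partial>trow) = (\<integral>x. box_hit c' p u x - box_hit c p u x \<partial>trow)"
  using box_hit_mono[of c c' p u] assms by (simp add: abs_of_nonneg)
 also have "... = (\<integral>x. box_hit c' p u x \<partial>trow) - (\<integral>x. box_hit c p u x \<partial>trow)"
  by (rule Bochner_Integration.integral_diff[OF box_hit_integrable_x box_hit_integrable_x])
 also have "(\<integral>x. box_hit c' p u x \<partial>trow) = (\<Prod>i\<in>UNIV. 2 * c' i)"
  using order.trans[OF assms(1,2)] assms(3) by (rule integral_box_hit)
 also have "(\<integral>x. box_hit c p u x \<partial>trow) = (\<Prod>i\<in>UNIV. 2 * c i)"
  using assms(1) order.trans[OF assms(2,3)] by (rule integral_box_hit)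
 finally show ?thesis .
qed

lemma box_hit_compose_measurable:
 assumes [measurable]: "!!i. (\<lambda>x. g x i) \<in> borel_measurable trow"
 shows "(\<lambda>x. box_hit c p u (g x)) \<in> borel_measurable trow"
proof -
 have "g \<in> measurable trow trow"
  by (subst (2) trow_def, intro measurable_PiM_single')
   (auto simp: PiE_UNIV_domain measurable_cong_sets[OF refl sets_circ])
 then show ?thesis by (rule measurable_compose[OF _ box_hit_measurable_x])
qed

text \<open>Rounding moves each coordinate by at most the proportion \<open>\<tau>\<close> of the radius, so a
  hit can only change between the boxes with radii scaled by \<open>1 - \<tau>\<close> and \<open>1 +
  \<tau>\<close>.\<close>
lemma integral_box_hit_coarse:
 fixes D :: "'m::finite => nat" and p :: "int ^ 'n::finite"
 assumes D: "!!i. D i > 0" and \<tau>: "0 \<le> \<tau>" "\<tau> \<le> 1" "!!i. 1 / real (D i) \<le> \<tau> * c i"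
  and c: "!!i. 0 \<le> c i" "!!i. c i \<le> 1/2"
 shows "(\<integral>x. \<bar>box_hit c p u x - box_hit c p u (\<lambda>i. of_int \<lfloor>real (D i) * x i\<rfloor> / real (D i))\<bar> \<partial>trow)
  \<le> (\<Prod>i\<in>UNIV. 2 * c i) * ((1 + \<tau>) ^ CARD('m) - (1 - \<tau>) ^ CARD('m))"
proof -
 let ?d = "\<lambda>i. 1 / real (D i)"
 let ?x = "\<lambda>x i. of_int \<lfloor>real (D i) * x i\<rfloor> / real (D i)"
 have near: "\<bar>x i - ?x x i\<bar> \<le> ?d i" for x i
 proof -
  have "\<bar>real (D i) * x i - of_int \<lfloor>real (D i) * x i\<rfloor>\<bar> \<le> 1" by linarith
  then have "\<bar>real (D i) * x i - of_int \<lfloor>real (D i) * x i\<rfloor>\<bar> / real (D i) \<le> 1 / real (D i)" by (rule divide_right_mono) simp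
  moreover have "x i - ?x x i = (real (D i) * x i - of_int \<lfloor>real (D i) * x i\<rfloor>) / real (D i)"
   using D[of i] by (simp add: field_simps)
  ultimately show ?thesis using D[of i] by (simp add: abs_divide)
 qed
 have dc: "?d i \<le> c i" for i
  using \<tau>(3)[of i] mult_right_mono[OF \<tau>(2) c(1)[of i]] by simp
 let ?u = "\<lambda>i. c i + ?d i" and ?l = "\<lambda>i. c i - ?d i"
 have b1: "\<bar>box_hit c p u x - box_hit c p u (?x x)\<bar> \<le> box_hit ?u p u x - box_hit ?l p u x" for x
 proof -
  have "box_hit c p u (?x x) \<le> box_hit ?u p u x"
   by (rule box_hit_mono_near) (use near in \<open>simp add: abs_minus_commute\<close>)
  moreover have "box_hit ?l p u x \<le> box_hit (\<lambda>i. ?l i + ?d i) p u (?x x)"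
   by (rule box_hit_mono_near) (use near in simp)
  moreover have "box_hit c p u x \<le> box_hit ?u p u x" "box_hit ?l p u x \<le> box_hit c p u x"
   by (rule box_hit_mono, simp)+
  ultimately show ?thesis by simp
 qed
 have "(\<integral>x. \<bar>box_hit c p u x - box_hit c p u (?x x)\<bar> \<partial>trow) \<le> (\<integral>x. box_hit ?u p u x - box_hit ?l p u x \<partial>trow)"
  by (rule integral_mono'[OF Bochner_Integration.integrable_diff[OF box_hit_integrable_x box_hit_integrable_x] b1])
   (rule order.trans[OF abs_ge_zero b1])
 also have "... = (\<integral>x. box_hit ?u p u x \<partial>trow) - (\<integral>x. box_hit ?l p u x \<partial>trow)"
  by (rule Bochner_Integration.integral_diff[OF box_hit_integrable_x box_hit_integrable_x])
 also have "(\<integral>x. box_hit ?u p u x \<partial>trow) - (\<integral>x. box_hit ?l p u x \<partial>trow)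
   \<le> (\<Prod>i\<in>UNIV. 2 * c i * (1 + \<tau>)) - (\<Prod>i\<in>UNIV. 2 * c i * (1 - \<tau>))"
 proof (rule diff_mono)
  have "(\<integral>x. box_hit ?u p u x \<partial>trow) \<le> (\<Prod>i\<in>UNIV. 2 * ?u i)"
   by (rule integral_box_hit_le) (use c in simp)
  also have "... \<le> (\<Prod>i\<in>UNIV. 2 * c i * (1 + \<tau>))"
  proof (intro prod_mono conjI)
   fix i
   show "2 * ?u i \<le> 2 * c i * (1 + \<tau>)" using mult_left_mono[OF \<tau>(3)[of i], of 2] by (simp add: algebra_simps)
  qed (use c in auto)
  finally show "(\<integral>x. box_hit ?u p u x \<partial>trow) \<le> (\<Prod>i\<in>UNIV. 2 * c i * (1 + \<tau>))" .
  have "(\<Prod>i\<in>UNIV. 2 * c i * (1 - \<tau>)) \<le> (\<Prod>i\<in>UNIV. 2 * ?l i)"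
  proof (intro prod_mono conjI)
   fix i
   show "2 * c i * (1 - \<tau>) \<le> 2 * ?l i" using mult_left_mono[OF \<tau>(3)[of i], of 2] by (simp add: algebra_simps)
  qed (use c \<tau> in auto)
  also have "... = (\<integral>x. box_hit ?l p u x \<partial>trow)"
  proof (rule integral_box_hit[symmetric])
   fix i
   show "0 \<le> ?l i" using dc[of i] by simp
   have "0 \<le> ?d i" by simp
   then show "?l i \<le> 1 / 2" using c(2)[of i] by linarith
  qed
  finally show "(\<Prod>i\<in>UNIV. 2 * c i * (1 - \<tau>)) \<le> (\<integral>x. box_hit ?l p u x \<partial>trow)" .
 qed
 finally show ?thesis
 proof -
  have pe: "(\<Prod>i\<in>UNIV. 2 * c i * t) = (\<Prod>i\<in>UNIV. 2 * c i) * t ^ CARD('m)" for t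
   by (subst prod.distrib) simp
  assume "(\<integral>x. \<bar>box_hit c p u x - box_hit c p u (?x x)\<bar> \<partial>trow)
   \<le> (\<Prod>i\<in>UNIV. 2 * c i * (1 + \<tau>)) - (\<Prod>i\<in>UNIV. 2 * c i * (1 - \<tau>))"
  then show ?thesis unfolding pe by (simp only: right_diff_distrib)
 qed
qed

text \<open>The integrand of the characteristic function of the number of hits in \<open>Q\<close>, centred at
  \<open>a\<close>.\<close>
definition phase :: "(int ^ 'n::finite => 'm::finite => real) => (int ^ 'n) set => real => real
  => ('m => 'n => real) => ('m => real) => complex" where
 "phase b Q s a u x = cis (s * ((\<Sum>q\<in>Q. box_hit (b q) q u x) - a))"

lemma phase_facts:
 shows "norm (phase b Q s a u x) \<le> 1" "(\<lambda>(u, x). phase b Q s a u x) \<in> borel_measurable (tmat \<Otimes>\<^sub>M trow)"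
  "periodic (phase b Q s a u)" "(\<lambda>u. phase b Q s a u x) \<in> borel_measurable tmat" "phase b Q s a u \<in> borel_measurable trow"
proof -
 show "norm (phase b Q s a u x) \<le> 1" by (simp add: phase_def)
 show "(\<lambda>(u, x). phase b Q s a u x) \<in> borel_measurable (tmat \<Otimes>\<^sub>M trow)"
  unfolding phase_def case_prod_beta by measurable
 show "periodic (phase b Q s a u)"
 proof -
  have "box_hit (b q) q u (\<lambda>i. x i + of_int (k i)) = box_hit (b q) q u x" for q x k
   using periodic_box_hit[of "b q" q u] unfolding periodic_def by blast
  then show ?thesis unfolding phase_def periodic_def by simp
 qed
 show "(\<lambda>u. phase b Q s a u x) \<in> borel_measurable tmat" unfolding phase_def by measurable
 show "phase b Q s a u \<in> borel_measurable trow" unfolding phase_def by measurable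
qed

lemma phase_diff_le:
 "norm (phase b Q s a u x - phase b Q s a u y) \<le> \<bar>s\<bar> * (\<Sum>q\<in>Q. \<bar>box_hit (b q) q u x - box_hit (b q) q u y\<bar>)"
proof -
 have "norm (phase b Q s a u x - phase b Q s a u y) \<le> \<bar>s * ((\<Sum>q\<in>Q. box_hit (b q) q u x) - a) - s * ((\<Sum>q\<in>Q. box_hit (b q) q u y) - a)\<bar>"
  unfolding phase_def by (rule norm_cis_diff_le)
 also have "... = \<bar>s\<bar> * \<bar>\<Sum>q\<in>Q. box_hit (b q) q u x - box_hit (b q) q u y\<bar>"
  by (simp add: abs_mult[symmetric] sum_subtractf algebra_simps)
 also have "... \<le> \<bar>s\<bar> * (\<Sum>q\<in>Q. \<bar>box_hit (b q) q u x - box_hit (b q) q u y\<bar>)"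
  by (intro mult_left_mono sum_abs) simp
 finally show ?thesis .
qed

lemma phase_coarse_le:
 fixes b :: "int ^ 'n::finite => 'm::finite => real"
 assumes Q: "finite Q" and D: "!!i. D i > 0" and \<tau>: "0 \<le> \<tau>" "\<tau> \<le> 1" "!!q i. q \<in> Q ==> 1 / real (D i) \<le> \<tau> * b q i"
  and b: "!!q i. q \<in> Q ==> 0 \<le> b q i" "!!q i. q \<in> Q ==> b q i \<le> 1/2"
 shows "(\<integral>x. norm (phase b Q s a u x - phase b Q s a u (\<lambda>i. of_int \<lfloor>real (D i) * x i\<rfloor> / real (D i))) \<partial>trow)
  \<le> \<bar>s\<bar> * ((\<Sum>q\<in>Q. \<Prod>i\<in>UNIV. 2 * b q i) * ((1 + \<tau>) ^ CARD('m) - (1 - \<tau>) ^ CARD('m)))"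
proof -
 let ?x = "\<lambda>x i. of_int \<lfloor>real (D i) * x i\<rfloor> / real (D i)"
 have [measurable]: "(\<lambda>x. box_hit c q u (?x x)) \<in> borel_measurable trow" for c q
 proof (rule box_hit_compose_measurable)
  fix i
  have "(\<lambda>x. \<lfloor>real (D i) * x i\<rfloor>) \<in> measurable trow (count_space UNIV)"
   by (rule measurable_compose[OF _ measurable_real_floor]) measurable
  then have "(\<lambda>x. real_of_int \<lfloor>real (D i) * x i\<rfloor>) \<in> borel_measurable trow"
   by (rule measurable_compose) simp
  then show "(\<lambda>x. ?x x i) \<in> borel_measurable trow" by measurable
 qed
 have i: "integrable trow (\<lambda>x. \<bar>box_hit c q u x - box_hit c q u (?x x)\<bar>)" for c q
 proof (rule bounded_integrable[OF prob_space_trow, where B = 1])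
  show "norm \<bar>box_hit c q u x - box_hit c q u (?x x)\<bar> \<le> 1" for x
   using box_hit_nonneg[of c q u x] box_hit_le_1[of c q u x] box_hit_nonneg[of c q u "?x x"] box_hit_le_1[of c q u "?x x"]
   unfolding real_norm_def by linarith
 qed measurable
 have "(\<integral>x. norm (phase b Q s a u x - phase b Q s a u (?x x)) \<partial>trow)
  \<le> (\<integral>x. \<bar>s\<bar> * (\<Sum>q\<in>Q. \<bar>box_hit (b q) q u x - box_hit (b q) q u (?x x)\<bar>) \<partial>trow)"
  by (rule integral_mono'[OF _ phase_diff_le])
   (auto intro!: integrable_mult_right Bochner_Integration.integrable_sum i mult_nonneg_nonneg sum_nonneg)
 also have "... = \<bar>s\<bar> * (\<Sum>q\<in>Q. \<integral>x. \<bar>box_hit (b q) q u x - box_hit (b q) q u (?x x)\<bar> \<partial>trow)"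
  by (simp only: Bochner_Integration.integral_mult_right_zero Bochner_Integration.integral_sum[OF i])
 also have "... \<le> \<bar>s\<bar> * (\<Sum>q\<in>Q. (\<Prod>i\<in>UNIV. 2 * b q i) * ((1 + \<tau>) ^ CARD('m) - (1 - \<tau>) ^ CARD('m)))"
  by (intro mult_left_mono sum_mono integral_box_hit_coarse D \<tau> b) auto
 finally show ?thesis by (simp add: sum_distrib_right)
qed

text \<open>Extension by zero makes the frequencies that enter or leave \<open>Q\<close> under a translation
  part of one sum.\<close>
definition restricted_volume :: "(int ^ 'n => 'm::finite => real) => (int ^ 'n) set => int ^ 'n => real" where
 "restricted_volume b Q p = (if p \<in> Q then \<Prod>i\<in>UNIV. 2 * b p i else 0)"

text \<open>Translation by \<open>u r\<close> renames the frequency \<open>q\<close> as \<open>q + r\<close>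
  but keeps its radii. For equal frequencies the boxes are nested, so the mean distance of two hits is the
  difference of their volumes.\<close>
lemma phase_translate_le:
 fixes b :: "int ^ 'n::finite => 'm::finite => real" and u :: "'m => 'n => real"
 assumes Q: "finite Q" and b: "!!q i. q \<in> Q ==> 0 \<le> b q i" "!!q i. q \<in> Q ==> b q i \<le> 1/2"
  and nest: "!!q q'. q \<in> Q ==> q' \<in> Q ==> (\<forall>i. b q i \<le> b q' i) \<or> (\<forall>i. b q' i \<le> b q i)"
 shows "(\<integral>x. norm (phase b Q s a u (\<lambda>i. x i + rdot (u i) r) - phase b Q s a u x) \<partial>trow)
  \<le> \<bar>s\<bar> * (\<Sum>p\<in>Q \<union> (\<lambda>q. q + r) ` Q. \<bar>restricted_volume b Q (p - r) - restricted_volume b Q p\<bar>)"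
proof -
 let ?R = "(\<lambda>q. q + r) ` Q" and ?x = "\<lambda>x i. x i + rdot (u i) r"
 define h where "h q p x = (if q \<in> Q then box_hit (b q) p u x else 0)" for q p x
 have hi: "integrable trow (h q p)" for q p
 proof -
  have "h q p = (if q \<in> Q then box_hit (b q) p u else (\<lambda>_. 0))" by (auto simp: h_def fun_eq_iff)
  then show ?thesis by (simp add: box_hit_integrable_x)
 qed
 have hi': "integrable trow (\<lambda>x. \<bar>h (p - r) p x - h p p x\<bar>)" for p
  by (intro integrable_abs Bochner_Integration.integrable_diff hi)
 have fin: "finite (Q \<union> ?R)" using Q by simp
 have e: "(\<Sum>q\<in>Q. box_hit (b q) q u (?x x)) - (\<Sum>q\<in>Q. box_hit (b q) q u x) = (\<Sum>p\<in>Q \<union> ?R. h (p - r) p x - h p p x)" for x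
 proof -
  have "(\<Sum>q\<in>Q. box_hit (b q) q u (?x x)) = (\<Sum>q\<in>Q. h q (q + r) x)"
   by (intro sum.cong) (auto simp: h_def box_hit_translate)
  also have "... = (\<Sum>p\<in>?R. h (p - r) p x)" by (subst sum.reindex) (auto simp: inj_on_def)
  also have "... = (\<Sum>p\<in>Q \<union> ?R. h (p - r) p x)"
  proof (rule sum.mono_neutral_left[OF fin])
   show "\<forall>p\<in>Q \<union> ?R - ?R. h (p - r) p x = 0"
   proof
    fix p assume "p \<in> Q \<union> ?R - ?R"
    then have "p - r \<notin> Q" by (metis DiffD2 diff_add_cancel image_eqI)
    then show "h (p - r) p x = 0" by (simp add: h_def)
   qed
  qed simp
  finally have 1: "(\<Sum>q\<in>Q. box_hit (b q) q u (?x x)) = (\<Sum>p\<in>Q \<union> ?R. h (p - r) p x)" .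
  have "(\<Sum>q\<in>Q. box_hit (b q) q u x) = (\<Sum>p\<in>Q \<union> ?R. h p p x)"
   by (rule sum.mono_neutral_cong_left[OF fin]) (auto simp: h_def)
  with 1 show ?thesis by (simp add: sum_subtractf)
 qed
 have hp: "(\<integral>x. \<bar>h q p x - h q' p x\<bar> \<partial>trow) \<le> \<bar>restricted_volume b Q q - restricted_volume b Q q'\<bar>" for q q' p
 proof -
  have v0: "0 \<le> (\<Prod>i\<in>UNIV. 2 * b q i)" if "q \<in> Q" for q using b(1)[OF that] by (intro prod_nonneg) auto
  have I: "(\<integral>x. box_hit (b q) p u x \<partial>trow) = (\<Prod>i\<in>UNIV. 2 * b q i)" if "q \<in> Q" for q
   by (rule integral_box_hit) (use b that in auto)
  have A: "(\<integral>x. \<bar>box_hit (b q') p u x - box_hit (b q) p u x\<bar> \<partial>trow) \<le> \<bar>(\<Prod>i\<in>UNIV. 2 * b q' i) - (\<Prod>i\<in>UNIV. 2 * b q i)\<bar>"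
   if "q \<in> Q" "q' \<in> Q" "\<forall>i. b q i \<le> b q' i" for q q'
   by (subst integral_box_hit_nested) (use b that in auto)
  consider "q \<in> Q" "q' \<in> Q" | "q \<in> Q" "q' \<notin> Q" | "q \<notin> Q" "q' \<in> Q" | "q \<notin> Q" "q' \<notin> Q" by blast
  then show ?thesis
  proof cases
   case 1
   then show ?thesis using nest[OF 1] A[OF 1] A[OF 1(2) 1(1)]
    by (auto simp: h_def restricted_volume_def abs_minus_commute)
  next
   case 2
   then show ?thesis using I[of q] v0[of q] by (simp add: h_def restricted_volume_def abs_of_nonneg box_hit_nonneg)
  next
   case 3
   then show ?thesis using I[of q'] v0[of q'] by (simp add: h_def restricted_volume_def abs_of_nonneg box_hit_nonneg)
  next
   case 4
   then show ?thesis by (simp add: h_def restricted_volume_def)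
  qed
 qed
 have pw: "norm (phase b Q s a u (?x x) - phase b Q s a u x) \<le> \<bar>s\<bar> * (\<Sum>p\<in>Q \<union> ?R. \<bar>h (p - r) p x - h p p x\<bar>)" for x
 proof -
  have "norm (phase b Q s a u (?x x) - phase b Q s a u x)
   \<le> \<bar>s * ((\<Sum>q\<in>Q. box_hit (b q) q u (?x x)) - a) - s * ((\<Sum>q\<in>Q. box_hit (b q) q u x) - a)\<bar>"
   unfolding phase_def by (rule norm_cis_diff_le)
  also have "... = \<bar>s\<bar> * \<bar>(\<Sum>q\<in>Q. box_hit (b q) q u (?x x)) - (\<Sum>q\<in>Q. box_hit (b q) q u x)\<bar>"
   by (simp add: abs_mult[symmetric] algebra_simps)
  also have "... \<le> \<bar>s\<bar> * (\<Sum>p\<in>Q \<union> ?R. \<bar>h (p - r) p x - h p p x\<bar>)"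
   unfolding e by (intro mult_left_mono sum_abs) simp
  finally show ?thesis .
 qed
 have "(\<integral>x. norm (phase b Q s a u (?x x) - phase b Q s a u x) \<partial>trow)
  \<le> (\<integral>x. \<bar>s\<bar> * (\<Sum>p\<in>Q \<union> ?R. \<bar>h (p - r) p x - h p p x\<bar>) \<partial>trow)"
  by (rule integral_mono'[OF _ pw])
   (auto intro!: integrable_mult_right Bochner_Integration.integrable_sum hi' mult_nonneg_nonneg sum_nonneg)
 also have "... = \<bar>s\<bar> * (\<Sum>p\<in>Q \<union> ?R. \<integral>x. \<bar>h (p - r) p x - h p p x\<bar> \<partial>trow)"
  by (simp only: Bochner_Integration.integral_mult_right_zero Bochner_Integration.integral_sum[OF hi'])
 also have "... \<le> \<bar>s\<bar> * (\<Sum>p\<in>Q \<union> ?R. \<bar>restricted_volume b Q (p - r) - restricted_volume b Q p\<bar>)"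
  by (intro mult_left_mono sum_mono hp) simp
 finally show ?thesis .
qed

definition int_cube :: "nat => (int ^ 'n::finite) set" where
 "int_cube P = {q. \<forall>j. 0 \<le> q $ j \<and> q $ j < int P}"

lemma card_int_cube: "finite (int_cube P :: (int ^ 'n::finite) set)" "card (int_cube P :: (int ^ 'n) set) = P ^ CARD('n)"
proof -
 have e: "(int_cube P :: (int ^ 'n) set) = vec_lambda ` (\<Pi>\<^sub>E j\<in>UNIV. {0..<int P})"
 proof (intro equalityI subsetI)
  fix q :: "int ^ 'n" assume "q \<in> int_cube P"
  then have "vec_nth q \<in> (\<Pi>\<^sub>E j\<in>UNIV. {0..<int P})" by (auto simp: int_cube_def PiE_UNIV_domain)
  then show "q \<in> vec_lambda ` (\<Pi>\<^sub>E j\<in>UNIV. {0..<int P})" by (metis image_eqI vec_nth_inverse)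
 qed (auto simp: int_cube_def)
 have inj: "inj_on vec_lambda (\<Pi>\<^sub>E j\<in>(UNIV :: 'n set). {0..<int P})"
  by (auto intro!: inj_onI simp: vec_lambda_inject)
 show "finite (int_cube P :: (int ^ 'n) set)" unfolding e by (intro finite_imageI finite_PiE) auto
 show "card (int_cube P :: (int ^ 'n) set) = P ^ CARD('n)"
  unfolding e card_image[OF inj] by (subst card_PiE) auto
qed

text \<open>The block \<open>Q\<close> supplies the function that is coarse in \<open>x\<close>, and
  \<open>Q'\<close> the one that is almost invariant under translations from a cube of integer
  vectors.\<close>
lemma phase_decoupling:
 fixes b :: "int ^ 'n::finite => 'm::finite => real" and D :: "'m => nat"
 assumes Q: "finite Q" "finite Q'"
  and b: "!!q i. q \<in> Q \<union> Q' ==> 0 \<le> b q i" "!!q i. q \<in> Q \<union> Q' ==> b q i \<le> 1/2"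
  and nest: "!!q q'. q \<in> Q' ==> q' \<in> Q' ==> (\<forall>i. b q i \<le> b q' i) \<or> (\<forall>i. b q' i \<le> b q i)"
  and D: "!!i. D i > 0" and \<tau>: "0 \<le> \<tau>" "\<tau> \<le> 1" "!!q i. q \<in> Q ==> 1 / real (D i) \<le> \<tau> * b q i"
  and P: "P > 0"
  and H: "!!r. r \<in> int_cube P ==>
   (\<Sum>p\<in>Q' \<union> (\<lambda>q. q + r) ` Q'. \<bar>restricted_volume b Q' (p - r) - restricted_volume b Q' p\<bar>) \<le> H"
 shows "(\<integral>u. norm ((\<integral>x. phase b Q s a u x * phase b Q' s a' u x \<partial>trow)
    - (\<integral>x. phase b Q s a u x \<partial>trow) * (\<integral>x. phase b Q' s a' u x \<partial>trow)) \<partial>tmat)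
  \<le> \<bar>s\<bar> * H + 2 * (\<bar>s\<bar> * ((\<Sum>q\<in>Q. \<Prod>i\<in>UNIV. 2 * b q i) * ((1 + \<tau>) ^ CARD('m) - (1 - \<tau>) ^ CARD('m))))
   + sqrt ((\<Prod>i\<in>UNIV. real (D i)) / real P ^ CARD('n))"
proof -
 have ne: "int_cube P \<noteq> ({} :: (int ^ 'n) set)"
  using P card_int_cube(2)[where 'n='n, of P] by (metis card.empty less_irrefl zero_less_power)
 have "(\<integral>u. norm ((\<integral>x. phase b Q s a u x * phase b Q' s a' u x \<partial>trow)
    - (\<integral>x. phase b Q s a u x \<partial>trow) * (\<integral>x. phase b Q' s a' u x \<partial>trow)) \<partial>tmat)
  \<le> \<bar>s\<bar> * H + 2 * (\<bar>s\<bar> * ((\<Sum>q\<in>Q. \<Prod>i\<in>UNIV. 2 * b q i) * ((1 + \<tau>) ^ CARD('m) - (1 - \<tau>) ^ CARD('m))))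
   + sqrt ((\<Prod>i\<in>UNIV. real (D i)) / real (card (int_cube P :: (int ^ 'n) set)))"
 proof (rule decoupling[OF D card_int_cube(1) ne phase_facts phase_facts(1,2,3,5)])
  fix r :: "int ^ 'n" and u :: "'m => 'n => real" assume r: "r \<in> int_cube P"
  have "(\<integral>x. norm (phase b Q' s a' u (\<lambda>i. x i + rdot (u i) r) - phase b Q' s a' u x) \<partial>trow)
   \<le> \<bar>s\<bar> * (\<Sum>p\<in>Q' \<union> (\<lambda>q. q + r) ` Q'. \<bar>restricted_volume b Q' (p - r) - restricted_volume b Q' p\<bar>)"
   by (rule phase_translate_le[OF Q(2) _ _ nest]) (use b in auto)
  also have "... \<le> \<bar>s\<bar> * H" by (intro mult_left_mono H r) simp
  finally show "(\<integral>x. norm (phase b Q' s a' u (\<lambda>i. x i + rdot (u i) r) - phase b Q' s a' u x) \<partial>trow) \<le> \<bar>s\<bar> * H" .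
 next
  show "(\<integral>x. norm (phase b Q s a u x - phase b Q s a u (\<lambda>i. of_int \<lfloor>real (D i) * x i\<rfloor> / real (D i))) \<partial>trow)
   \<le> \<bar>s\<bar> * ((\<Sum>q\<in>Q. \<Prod>i\<in>UNIV. 2 * b q i) * ((1 + \<tau>) ^ CARD('m) - (1 - \<tau>) ^ CARD('m)))" for u
   by (rule phase_coarse_le[OF Q(1) D \<tau>]) (use b in auto)
 qed
 then show ?thesis by (simp add: card_int_cube)
qed

section \<open>Lattice points in norm balls\<close>

lemma power_diff_le:
 fixes x y :: real
 assumes "0 \<le> y" "y \<le> x" shows "x ^ n - y ^ n \<le> real n * (x - y) * x ^ (n - 1)"
proof (cases n)
 case (Suc k)
 have "x ^ n - y ^ n = (x - y) * (\<Sum>i<n. y ^ (n - Suc i) * x ^ i)" by (rule power_diff_sumr2)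
 also have "... \<le> (x - y) * (\<Sum>i<n. x ^ (n - 1))"
 proof (intro mult_left_mono sum_mono)
  fix i assume "i \<in> {..<n}"
  then have "x ^ (n - 1) = x ^ (n - Suc i) * x ^ i" by (simp add: power_add[symmetric])
  then show "y ^ (n - Suc i) * x ^ i \<le> x ^ (n - 1)" using assms by (auto intro!: mult_right_mono power_mono)
 qed (use assms in auto)
 finally show ?thesis by (simp add: ac_simps)
qed simp

locale norm_setting =
 fixes N :: "real ^ 'n => real"
 assumes is_norm: "is_norm N"
begin

lemma N_nonneg: "0 \<le> N x" and N_zero: "N x = 0 \<longleftrightarrow> x = 0" and N_scale: "N (c *\<^sub>R x) = \<bar>c\<bar> * N x"
 and N_triangle: "N (x + y) \<le> N x + N y"
 using is_norm by (auto simp: is_norm_def)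

lemma N_minus: "N (- x) = N x"
 using N_scale[of "-1" x] by simp

definition nn :: "int ^ 'n => real" where "nn q = N (of_int_vec q)"

lemma of_int_vec_add: "of_int_vec (p + q) = of_int_vec p + (of_int_vec q :: real ^ 'n)"
 by (simp add: vec_eq_iff)

lemma nn_nonneg: "0 \<le> nn q" by (simp add: nn_def N_nonneg)

lemma nn_add: "nn (p + q) \<le> nn p + nn q"
 unfolding nn_def of_int_vec_add by (rule N_triangle)

lemma nn_minus: "nn (- q) = nn q"
proof -
 have "of_int_vec (- q) = - (of_int_vec q :: real ^ 'n)" by (simp add: vec_eq_iff)
 then show ?thesis by (simp add: nn_def N_minus)
qed

lemma nn_diff: "nn (p - q) \<le> nn p + nn q"
 using nn_add[of p "- q"] by (simp add: nn_minus)

lemma nn_diff_abs: "\<bar>nn (p - q) - nn p\<bar> \<le> nn q"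
 using nn_diff[of p q] nn_add[of "p - q" q] by simp

lemma nn_scale: "nn (\<chi> j. c * q $ j) = \<bar>of_int c\<bar> * nn q"
proof -
 have "of_int_vec (\<chi> j. c * q $ j) = of_int c *\<^sub>R (of_int_vec q :: real ^ 'n)" by (simp add: vec_eq_iff)
 then show ?thesis by (simp add: nn_def N_scale)
qed

lemma nn_pos: "q \<noteq> 0 ==> 0 < nn q"
 using N_nonneg[of "of_int_vec q"] N_zero[of "of_int_vec q"] by (auto simp: nn_def vec_eq_iff less_le)

lemma finite_nn_le: "finite {q. nn q \<le> R}"
proof -
 obtain c where c: "c > 0" "!!z. c * norm z \<le> N z"
  using is_norm_lower_bound[OF is_norm] by blast
 have "{q. nn q \<le> R} \<subseteq> {q :: int ^ 'n. \<forall>j. \<bar>q $ j\<bar> \<le> \<lceil>R / c\<rceil>}"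
 proof (intro subsetI CollectI allI)
  fix q :: "int ^ 'n" and j assume q: "q \<in> {q. nn q \<le> R}"
  have "c * \<bar>real_of_int (q $ j)\<bar> \<le> c * norm (of_int_vec q)"
   using component_le_norm_cart[of "of_int_vec q" j] c(1) by (intro mult_left_mono) auto
  also have "... \<le> R" using c(2)[of "of_int_vec q"] q by (simp add: nn_def)
  finally have "\<bar>real_of_int (q $ j)\<bar> \<le> R / c" using c(1) by (simp add: field_simps)
  then show "\<bar>q $ j\<bar> \<le> \<lceil>R / c\<rceil>" by linarith
 qed
 then show ?thesis using finite_int_vec_bounded by (rule finite_subset)
qed

lemma nn_lower: obtains c where "c > 0" "!!q. q \<noteq> 0 ==> c \<le> nn q"
proof -
 obtain c where c: "c > 0" "!!z. c * norm z \<le> N z"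
  using is_norm_lower_bound[OF is_norm] by blast
 have "c \<le> nn q" if "q \<noteq> 0" for q
 proof -
  have "\<exists>j. q $ j \<noteq> 0" using that by (metis vec_eq_iff zero_index)
  then obtain j where j: "q $ j \<noteq> 0" by blast
  have "1 \<le> \<bar>real_of_int (q $ j)\<bar>" using j by linarith
  also have "... \<le> norm (of_int_vec q)" using component_le_norm_cart[of "of_int_vec q" j] by simp
  finally have "c * 1 \<le> c * norm (of_int_vec q)" using c(1) by (intro mult_left_mono) auto
  then show ?thesis using c(2)[of "of_int_vec q"] by (simp add: nn_def)
 qed
 then show ?thesis using that c(1) by blast
qed

text \<open>A bound for the norm on the cube \<open>[-1, 1]^n\<close>.\<close>
definition \<kappa> :: real where "\<kappa> = 1 + (\<Sum>j\<in>UNIV. N (axis j 1))"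

lemma \<kappa>_ge_1: "1 \<le> \<kappa>" by (simp add: \<kappa>_def sum_nonneg N_nonneg)

lemma N_le_sum: "N z \<le> (\<Sum>j\<in>UNIV. \<bar>z $ j\<bar> * N (axis j 1))"
proof -
 have fin: "N (\<Sum>j\<in>B. (z $ j) *\<^sub>R axis j 1) \<le> (\<Sum>j\<in>B. \<bar>z $ j\<bar> * N (axis j 1))" if "finite B" for B
  using that
 proof induction
  case empty then show ?case using N_zero[of 0] by simp
 next
  case (insert j B)
  then show ?case using N_triangle[of "(z $ j) *\<^sub>R axis j 1" "\<Sum>j\<in>B. (z $ j) *\<^sub>R axis j 1"] by (simp add: N_scale)
 qed
 have "(\<Sum>j\<in>UNIV. (z $ j) *\<^sub>R axis j 1) = z"
  by (simp add: vec_eq_iff axis_def if_distrib cong: if_cong)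
 then show ?thesis using fin[of UNIV] by simp
qed

lemma N_le_\<kappa>: assumes "!!j. \<bar>z $ j\<bar> \<le> 1" shows "N z \<le> \<kappa>"
proof -
 have "N z \<le> (\<Sum>j\<in>UNIV. 1 * N (axis j 1))"
  by (rule order.trans[OF N_le_sum]) (intro sum_mono mult_right_mono assms N_nonneg)
 then show ?thesis by (simp add: \<kappa>_def)
qed

lemma nn_int_cube: assumes "q \<in> int_cube P" shows "nn q \<le> \<kappa> * real P"
proof -
 have "nn q \<le> (\<Sum>j\<in>UNIV. \<bar>of_int (q $ j)\<bar> * N (axis j 1))" using N_le_sum[of "of_int_vec q"] by (simp add: nn_def)
 also have "... \<le> (\<Sum>j\<in>UNIV. real P * N (axis j 1))"
 proof (intro sum_mono mult_right_mono N_nonneg)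
  fix j
  have "0 \<le> q $ j" "q $ j < int P" using assms by (auto simp: int_cube_def)
  then show "\<bar>real_of_int (q $ j)\<bar> \<le> real P" by linarith
 qed
 also have "... = real P * (\<Sum>j\<in>UNIV. N (axis j 1))" by (simp add: sum_distrib_left)
 also have "... \<le> real P * \<kappa>" by (intro mult_left_mono) (simp_all add: \<kappa>_def)
 also have "... = \<kappa> * real P" by (rule mult.commute)
 finally show ?thesis .
qed

lemma continuous_N: "continuous_on UNIV N"
proof (rule convex_on_continuous)
 show "convex_on UNIV N"
 proof (rule convex_onI)
  fix t :: real and x y assume "0 < t" "t < 1"
  then show "N ((1 - t) *\<^sub>R x + t *\<^sub>R y) \<le> (1 - t) * N x + t * N y"
   using N_triangle[of "(1 - t) *\<^sub>R x" "t *\<^sub>R y"] by (simp add: N_scale)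
 qed simp
qed simp

definition vol :: real where "vol = vol_unit_ball N"

lemma ball_borel: "{z. N z \<le> R} \<in> sets borel"
proof -
 have "closed {z. N z \<le> R}"
  using continuous_N by (intro closed_Collect_le) auto
 then show ?thesis by simp
qed

lemma ball_finite: "emeasure lborel {z. N z \<le> R} < \<infinity>"
proof -
 obtain c where c: "c > 0" "!!z. c * norm z \<le> N z"
  using is_norm_lower_bound[OF is_norm] by blast
 have "norm z \<le> R / c" if "N z \<le> R" for z using c(2)[of z] that c(1) by (simp add: field_simps)
 then have "bounded {z. N z \<le> R}" by (auto simp: bounded_iff)
 then show ?thesis by (rule emeasure_bounded_finite)
qed

lemma measure_ball: assumes "0 \<le> R" shows "measure lborel {z. N z \<le> R} = vol * R ^ CARD('n)"
proof (cases "R = 0")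
 case True
 have "N z \<le> 0 \<longleftrightarrow> z = 0" for z using N_nonneg[of z] N_zero[of z] by (smt (verit))
 then have "{z. N z \<le> 0} = {0}" by auto
 then show ?thesis using True by simp
next
 case False
 with assms have R: "R > 0" by simp
 have "{z. N z \<le> R} = (\<lambda>x. R *\<^sub>R x + 0) ` {z. N z \<le> 1}"
 proof (intro equalityI subsetI)
  fix z assume z: "z \<in> {z. N z \<le> R}"
  have "z = R *\<^sub>R ((1 / R) *\<^sub>R z) + 0" using R by simp
  moreover have "N ((1 / R) *\<^sub>R z) \<le> 1" using z R by (simp add: N_scale)
  ultimately show "z \<in> (\<lambda>x. R *\<^sub>R x + 0) ` {z. N z \<le> 1}" by blast
 next
  fix z assume "z \<in> (\<lambda>x. R *\<^sub>R x + 0) ` {z. N z \<le> 1}"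
  then obtain y where "z = R *\<^sub>R y" "N y \<le> 1" by auto
  then show "z \<in> {z. N z \<le> R}" using R mult_left_mono[of "N y" 1 R] by (simp add: N_scale)
 qed
 then have "measure lebesgue {z. N z \<le> R} = R ^ CARD('n) * measure lebesgue {z. N z \<le> 1}"
  using measure_lebesgue_affine[of R 0 "{z. N z \<le> 1}"] R by simp
 then show ?thesis by (simp add: ball_borel vol_def vol_unit_ball_def)
qed

lemma vol_pos: "vol > 0"
proof -
 have "box (\<chi> j. - (1/\<kappa>)) (\<chi> j. 1/\<kappa>) \<subseteq> {z. N z \<le> 1}"
 proof
  fix z :: "real ^ 'n" assume z: "z \<in> box (\<chi> j. - (1/\<kappa>)) (\<chi> j. 1/\<kappa>)"
  have k: "\<kappa> > 0" using \<kappa>_ge_1 by simp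
  have "N (\<kappa> *\<^sub>R z) \<le> \<kappa>"
  proof (rule N_le_\<kappa>)
   fix j
   have "- (1/\<kappa>) < z $ j" "z $ j < 1/\<kappa>" using z by (auto simp: mem_box_cart)
   then show "\<bar>(\<kappa> *\<^sub>R z) $ j\<bar> \<le> 1" using k by (auto simp: abs_le_iff field_simps)
  qed
  then show "z \<in> {z. N z \<le> 1}" using k by (simp add: N_scale)
 qed
 then have "measure lborel (box (\<chi> j. - (1/\<kappa>)) (\<chi> j. 1/\<kappa>) :: (real ^ 'n) set) \<le> measure lborel {z. N z \<le> 1}"
  using ball_finite[of 1] ball_borel[of 1] by (intro measure_mono_fmeasurable) (auto simp: fmeasurable_def)
 moreover have "0 < measure lborel (box (\<chi> j. - (1/\<kappa>)) (\<chi> j. 1/\<kappa>) :: (real ^ 'n) set)"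
  using \<kappa>_ge_1 by (subst measure_lborel_box_eq) (auto simp: Basis_vec_def inner_axis intro!: prod_pos)
 ultimately show ?thesis by (simp add: vol_def vol_unit_ball_def)
qed

definition count :: "real => real" where "count R = real (card {q. nn q < R})"

lemma finite_nn_less: "finite {q. nn q < R}"
 by (rule finite_subset[OF _ finite_nn_le[of R]]) auto

abbreviation ucube :: "int ^ 'n => (real ^ 'n) set" where
 "ucube q \<equiv> cbox (of_int_vec q) (of_int_vec q + 1)"

lemma measure_cube: "measure lborel (ucube q) = 1" "measure lborel (box (of_int_vec q) (of_int_vec q + (1 :: real ^ 'n))) = 1"
proof -
 have 1: "(of_int_vec q + 1 - of_int_vec q) \<bullet> b = 1" if "b \<in> Basis" for b :: "real ^ 'n"
  using that by (auto simp: Basis_vec_def inner_axis)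
 have 2: "of_int_vec q \<bullet> b \<le> (of_int_vec q + 1) \<bullet> b" if "b \<in> Basis" for b :: "real ^ 'n"
  using 1[OF that] by (simp add: inner_add_left)
 show "measure lborel (ucube q) = 1" "measure lborel (box (of_int_vec q) (of_int_vec q + (1 :: real ^ 'n))) = 1"
  using 1 2 by (simp_all only: measure_lborel_cbox_eq measure_lborel_box_eq) (simp_all)
qed

text \<open>The unit cubes attached to the lattice points of a ball lie in a slightly larger ball.\<close>
lemma count_upper: assumes "0 \<le> R" shows "count R \<le> vol * (R + \<kappa>) ^ CARD('n)"
proof -
 let ?S = "{q. nn q < R}" and ?B = "\<lambda>q. box (of_int_vec q) (of_int_vec q + (1 :: real ^ 'n))"
 have disj: "disjoint_family_on ?B ?S" unfolding disjoint_family_on_def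
 proof (intro ballI impI, rule ccontr)
  fix p q assume "p \<noteq> q" "?B p \<inter> ?B q \<noteq> {}"
  then obtain z where z: "z \<in> ?B p" "z \<in> ?B q" by blast
  have "p $ j = q $ j" for j
  proof -
   have "of_int (p $ j) < z $ j" "z $ j < of_int (p $ j) + 1" "of_int (q $ j) < z $ j" "z $ j < of_int (q $ j) + 1"
    using z by (auto simp: mem_box_cart)
   then show ?thesis by linarith
  qed
  then show False using \<open>p \<noteq> q\<close> by (simp add: vec_eq_iff)
 qed
 have "measure lborel (\<Union>q\<in>?S. ?B q) = (\<Sum>q\<in>?S. measure lborel (?B q))"
  by (rule measure_finite_Union[OF finite_nn_less _ disj]) (use emeasure_lborel_box_finite in \<open>auto simp: less_top[symmetric]\<close>)
 then have "count R = measure lborel (\<Union>q\<in>?S. ?B q)" by (simp only: measure_cube) (simp add: count_def)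
 also have "... \<le> measure lborel {z. N z \<le> R + \<kappa>}"
 proof (rule measure_mono_fmeasurable)
  show "(\<Union>q\<in>?S. ?B q) \<subseteq> {z. N z \<le> R + \<kappa>}"
  proof (intro subsetI, elim UN_E)
   fix z q assume q: "q \<in> ?S" and z: "z \<in> ?B q"
   have "N (z - of_int_vec q) \<le> \<kappa>"
   proof (rule N_le_\<kappa>)
    fix j
    have "of_int (q $ j) < z $ j" "z $ j < of_int (q $ j) + 1" using z by (auto simp: mem_box_cart)
    then show "\<bar>(z - of_int_vec q) $ j\<bar> \<le> 1" by (simp add: abs_le_iff)
   qed
   moreover have "N z \<le> N (of_int_vec q) + N (z - of_int_vec q)" using N_triangle[of "of_int_vec q" "z - of_int_vec q"] by simp
   ultimately show "z \<in> {z. N z \<le> R + \<kappa>}" using q by (simp add: nn_def)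
  qed
  show "{z. N z \<le> R + \<kappa>} \<in> fmeasurable lborel" using ball_finite ball_borel by (auto simp: fmeasurable_def)
 qed (auto intro!: sets.finite_UN finite_nn_less)
 also have "... = vol * (R + \<kappa>) ^ CARD('n)" using assms \<kappa>_ge_1 by (intro measure_ball) simp
 finally show ?thesis .
qed

text \<open>Conversely, the unit cubes attached to the lattice points of a ball cover a slightly smaller
  ball.\<close>
lemma count_lower: assumes "2 * \<kappa> \<le> R" shows "vol * (R - 2 * \<kappa>) ^ CARD('n) \<le> count R"
proof -
 let ?S = "{q. nn q < R}"
 have "vol * (R - 2 * \<kappa>) ^ CARD('n) = measure lborel {z. N z \<le> R - 2 * \<kappa>}" using assms by (intro measure_ball[symmetric]) simp
 also have "... \<le> measure lborel (\<Union>q\<in>?S. ucube q)"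
 proof (rule measure_mono_fmeasurable)
  show "{z. N z \<le> R - 2 * \<kappa>} \<subseteq> (\<Union>q\<in>?S. ucube q)"
  proof
   fix z assume z: "z \<in> {z. N z \<le> R - 2 * \<kappa>}"
   define q where "q = (\<chi> j. \<lfloor>z $ j\<rfloor>)"
   have "N (of_int_vec q - z) \<le> \<kappa>"
   proof (rule N_le_\<kappa>)
    fix j show "\<bar>(of_int_vec q - z) $ j\<bar> \<le> 1" by (simp add: q_def) linarith
   qed
   then have "nn q \<le> R - 2 * \<kappa> + \<kappa>" using N_triangle[of z "of_int_vec q - z"] z by (simp add: nn_def)
   then have "q \<in> ?S" using \<kappa>_ge_1 by simp
   moreover have "z \<in> ucube q" by (simp add: mem_box_cart q_def)
   ultimately show "z \<in> (\<Union>q\<in>?S. ucube q)" by blast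
  qed
  show "(\<Union>q\<in>?S. ucube q) \<in> fmeasurable lborel"
   by (intro fmeasurable.finite_UN finite_nn_less fmeasurableI emeasure_lborel_cbox_finite) simp
 qed (use ball_borel in auto)
 also have "... \<le> (\<Sum>q\<in>?S. measure lborel (ucube q))"
  by (rule measure_UNION_le[OF finite_nn_less]) auto
 also have "... = count R" by (simp only: measure_cube) (simp add: count_def)
 finally show ?thesis .
qed

lemma count_asymp: obtains C where "C > 0" "!!R. 1 \<le> R ==> \<bar>count R - vol * R ^ CARD('n)\<bar> \<le> C * R ^ (CARD('n) - 1)"
proof -
 let ?n = "CARD('n)"
 have n: "?n \<ge> 1" by (simp add: Suc_leI)
 define C where "C = vol * real ?n * (2 * \<kappa>) * (1 + \<kappa>) ^ (?n - 1) + vol * 2 * \<kappa>"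
 have k: "\<kappa> \<ge> 1" by (rule \<kappa>_ge_1)
 have C: "C > 0" unfolding C_def using vol_pos k by (intro add_nonneg_pos) auto
 have "\<bar>count R - vol * R ^ ?n\<bar> \<le> C * R ^ (?n - 1)" if R: "1 \<le> R" for R
 proof -
  have C1: "vol * real ?n * (2 * \<kappa>) * (1 + \<kappa>) ^ (?n - 1) * R ^ (?n - 1) \<le> C * R ^ (?n - 1)"
   unfolding C_def using R vol_pos k by (intro mult_right_mono) auto
  have C2: "vol * 2 * \<kappa> * R ^ (?n - 1) \<le> C * R ^ (?n - 1)"
   unfolding C_def using R vol_pos k by (intro mult_right_mono) auto
  have "count R \<le> vol * (R + \<kappa>) ^ ?n" using R by (intro count_upper) simp
  moreover have "(R + \<kappa>) ^ ?n - R ^ ?n \<le> real ?n * \<kappa> * ((1 + \<kappa>) ^ (?n - 1) * R ^ (?n - 1))"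
  proof -
   have "(R + \<kappa>) ^ ?n - R ^ ?n \<le> real ?n * (R + \<kappa> - R) * (R + \<kappa>) ^ (?n - 1)"
    using R k by (intro power_diff_le) auto
   also have "(R + \<kappa>) ^ (?n - 1) \<le> ((1 + \<kappa>) * R) ^ (?n - 1)"
    using R k by (intro power_mono) (auto simp: algebra_simps mult_le_cancel_left1)
   finally show ?thesis using R k by (simp add: power_mult_distrib mult_left_mono)
  qed
  then have "vol * ((R + \<kappa>) ^ ?n - R ^ ?n) \<le> vol * (real ?n * \<kappa> * ((1 + \<kappa>) ^ (?n - 1) * R ^ (?n - 1)))"
   using vol_pos by (intro mult_left_mono) auto
  moreover have "vol * (real ?n * \<kappa> * ((1 + \<kappa>) ^ (?n - 1) * R ^ (?n - 1))) \<le> vol * real ?n * (2 * \<kappa>) * (1 + \<kappa>) ^ (?n - 1) * R ^ (?n - 1)"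
   using vol_pos k R by (simp add: mult_left_mono)
  moreover have "vol * ((R + \<kappa>) ^ ?n - R ^ ?n) = vol * (R + \<kappa>) ^ ?n - vol * R ^ ?n" by (rule right_diff_distrib)
  ultimately have up: "count R - vol * R ^ ?n \<le> C * R ^ (?n - 1)" using C1 by linarith
  have lo: "vol * R ^ ?n - count R \<le> C * R ^ (?n - 1)"
  proof (cases "2 * \<kappa> \<le> R")
   case True
   have "R ^ ?n - (R - 2 * \<kappa>) ^ ?n \<le> real ?n * (R - (R - 2 * \<kappa>)) * R ^ (?n - 1)"
    using True k by (intro power_diff_le) auto
   then have "vol * (R ^ ?n - (R - 2 * \<kappa>) ^ ?n) \<le> vol * (real ?n * (2 * \<kappa>) * R ^ (?n - 1))"
    using vol_pos by (intro mult_left_mono) auto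
   also have "... = vol * real ?n * (2 * \<kappa>) * 1 * R ^ (?n - 1)" by simp
   also have "... \<le> vol * real ?n * (2 * \<kappa>) * (1 + \<kappa>) ^ (?n - 1) * R ^ (?n - 1)"
    using vol_pos k R by (intro mult_right_mono mult_left_mono) auto
   finally show ?thesis using count_lower[OF True] C1 by (simp add: right_diff_distrib)
  next
   case False
   have "R ^ ?n = R * R ^ (?n - 1)" using n by (metis Suc_diff_1 power_Suc zero_less_card_finite)
   also have "... \<le> 2 * \<kappa> * R ^ (?n - 1)" using False R by (intro mult_right_mono) auto
   finally have "vol * R ^ ?n \<le> vol * (2 * \<kappa> * R ^ (?n - 1))" using vol_pos by (intro mult_left_mono) auto
   moreover have "0 \<le> count R" by (simp add: count_def)
   ultimately show ?thesis using C2 by (simp add: mult.assoc)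
  qed
  show ?thesis using up lo by (simp add: abs_le_iff)
 qed
 then show ?thesis using that C by blast
qed

definition shell :: "real => real => (int ^ 'n) set" where "shell a b = {q. a \<le> nn q \<and> nn q < b}"

lemma finite_shell: "finite (shell a b)"
 by (rule finite_subset[OF _ finite_nn_le[of b]]) (auto simp: shell_def)

lemma card_shell: "a \<le> b ==> real (card (shell a b)) = count b - count a"
proof -
 assume "a \<le> b"
 then have e: "{q. nn q < b} = {q. nn q < a} \<union> shell a b" by (auto simp: shell_def)
 have "card {q. nn q < b} = card {q. nn q < a} + card (shell a b)"
  unfolding e by (rule card_Un_disjoint[OF finite_nn_less finite_shell]) (auto simp: shell_def)
 then show ?thesis by (simp add: count_def)
qed

lemma card_thin_shell: obtains C where "C > 0"
 "!!a \<rho>. 1 \<le> \<rho> ==> \<rho> \<le> a ==> real (card (shell a (a + \<rho>))) \<le> C * \<rho> * a ^ (CARD('n) - 1)"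
proof -
 let ?n = "CARD('n)"
 obtain C where C: "C > 0" "!!R. 1 \<le> R ==> \<bar>count R - vol * R ^ ?n\<bar> \<le> C * R ^ (?n - 1)" using count_asymp by blast
 define C' where "C' = (vol * real ?n + 2 * C) * 2 ^ (?n - 1)"
 have C': "C' > 0" unfolding C'_def using vol_pos C by (intro mult_pos_pos add_nonneg_pos) auto
 have "real (card (shell a (a + \<rho>))) \<le> C' * \<rho> * a ^ (?n - 1)" if \<rho>: "1 \<le> \<rho>" "\<rho> \<le> a" for a \<rho>
 proof -
  have pw: "(a + \<rho>) ^ (?n - 1) \<le> 2 ^ (?n - 1) * a ^ (?n - 1)"
  proof -
   have "(a + \<rho>) ^ (?n - 1) \<le> (2 * a) ^ (?n - 1)" using \<rho> by (intro power_mono) auto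
   then show ?thesis by (simp add: power_mult_distrib)
  qed
  have pw': "a ^ (?n - 1) \<le> (a + \<rho>) ^ (?n - 1)" using \<rho> by (intro power_mono) auto
  have "real (card (shell a (a + \<rho>))) = count (a + \<rho>) - count a" using \<rho> by (intro card_shell) simp
  also have "... \<le> vol * ((a + \<rho>) ^ ?n - a ^ ?n) + C * (a + \<rho>) ^ (?n - 1) + C * a ^ (?n - 1)"
   using C(2)[of "a + \<rho>"] C(2)[of a] \<rho> by (simp add: abs_le_iff right_diff_distrib)
  also have "... \<le> vol * (real ?n * \<rho> * (a + \<rho>) ^ (?n - 1)) + C * (a + \<rho>) ^ (?n - 1) + C * (a + \<rho>) ^ (?n - 1)"
   using power_diff_le[of a "a + \<rho>" ?n] \<rho> vol_pos C pw' by (intro add_mono mult_left_mono) auto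
  also have "... = (vol * real ?n * \<rho> + 2 * C * 1) * (a + \<rho>) ^ (?n - 1)" by (simp add: algebra_simps)
  also have "... \<le> (vol * real ?n * \<rho> + 2 * C * \<rho>) * (2 ^ (?n - 1) * a ^ (?n - 1))"
   using \<rho> C vol_pos pw by (intro mult_mono add_mono mult_left_mono) auto
  also have "... = C' * \<rho> * a ^ (?n - 1)" by (simp add: C'_def algebra_simps)
  finally show ?thesis .
 qed
 then show ?thesis using that C' by blast
qed

text \<open>The source of \<open>log T\<close>: lattice points of norm \<open>r\<close> have density \<open>n
  vol r^(n - 1) dr\<close>, and the weight \<open>r^(-n)\<close> leaves \<open>n vol dr / r\<close>.\<close>
lemma sum_shell_asymp: obtains C where "C > 0"
 "!!a b. 1 \<le> a ==> a \<le> b ==> \<bar>(\<Sum>q\<in>shell a b. 1 / nn q ^ CARD('n)) - real CARD('n) * vol * ln (b / a)\<bar> \<le> C"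
proof -
 let ?n = "CARD('n)"
 have n: "?n \<ge> 1" by (simp add: Suc_leI)
 obtain C where C: "C > 0" "!!R. 1 \<le> R ==> \<bar>count R - vol * R ^ ?n\<bar> \<le> C * R ^ (?n - 1)" using count_asymp by blast
 define C' where "C' = (vol + 2 * C) + (2 * C * real ?n + vol)"
 have C': "C' > 0" unfolding C'_def using vol_pos C by (intro add_pos_pos) auto
 have "\<bar>(\<Sum>q\<in>shell a b. 1 / nn q ^ ?n) - real ?n * vol * ln (b / a)\<bar> \<le> C'" if a: "1 \<le> a" and ab: "a \<le> b" for a b
 proof -
  let ?S = "shell a b"
  have b: "1 \<le> b" using a ab by simp
  have FTC: "((\<lambda>\<rho>. real ?n / \<rho> ^ (?n + 1)) has_integral (1 / c ^ ?n - 1 / b ^ ?n)) {c..b}" if c: "1 \<le> c" "c \<le> b" for c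
  proof -
   have "((\<lambda>\<rho>. real ?n / \<rho> ^ (?n + 1)) has_integral ((- 1 / b ^ ?n) - (- 1 / c ^ ?n))) {c..b}"
   proof (rule fundamental_theorem_of_calculus[OF c(2)])
    fix \<rho> assume r: "\<rho> \<in> {c..b}"
    then have r0: "\<rho> \<noteq> 0" using c by auto
    obtain k where k: "?n = Suc k" using n by (metis Suc_le_D One_nat_def)
    have "((\<lambda>\<rho>. - inverse (\<rho> ^ Suc k)) has_real_derivative
      - (- (inverse (\<rho> ^ Suc k) * (real (Suc k) * \<rho> ^ (Suc k - Suc 0)) * inverse (\<rho> ^ Suc k)))) (at \<rho> within {c..b})"
     by (intro DERIV_minus DERIV_inverse' DERIV_pow) (use r0 in simp)
    moreover have "- (- (inverse (\<rho> ^ Suc k) * (real (Suc k) * \<rho> ^ (Suc k - Suc 0)) * inverse (\<rho> ^ Suc k)))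
      = real (Suc k) / \<rho> ^ (Suc k + 1)"
     using r0 by (simp add: field_simps)
    moreover have "(\<lambda>\<rho>. - inverse (\<rho> ^ Suc k)) = (\<lambda>\<rho> :: real. - 1 / \<rho> ^ Suc k)"
     by (simp add: inverse_eq_divide)
    ultimately have "((\<lambda>\<rho>. - 1 / \<rho> ^ ?n) has_real_derivative (real ?n / \<rho> ^ (?n + 1))) (at \<rho> within {c..b})"
     unfolding k by (simp only:)
    then show "((\<lambda>\<rho>. - 1 / \<rho> ^ ?n) has_vector_derivative (real ?n / \<rho> ^ (?n + 1))) (at \<rho> within {c..b})"
     by (simp add: has_real_derivative_iff_has_vector_derivative)
   qed
   then show ?thesis by simp
  qed
  define g where "g \<rho> = (\<Sum>q\<in>?S. if \<rho> \<in> {nn q..b} then real ?n / \<rho> ^ (?n + 1) else 0)" for \<rho>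
  have I: "(g has_integral (\<Sum>q\<in>?S. 1 / nn q ^ ?n - 1 / b ^ ?n)) {a..b}"
   unfolding g_def
  proof (rule has_integral_sum[OF finite_shell])
   fix q assume q: "q \<in> ?S"
   then have sub: "{nn q..b} \<subseteq> {a..b}" by (auto simp: shell_def)
   show "((\<lambda>\<rho>. if \<rho> \<in> {nn q..b} then real ?n / \<rho> ^ (?n + 1) else 0) has_integral 1 / nn q ^ ?n - 1 / b ^ ?n) {a..b}"
    unfolding has_integral_restrict[OF sub] by (rule FTC) (use q a in \<open>auto simp: shell_def\<close>)
  qed
  have gb: "g \<rho> = real ?n / \<rho> ^ (?n + 1) * real (card {q\<in>?S. nn q \<le> \<rho>})" if "\<rho> \<in> {a..b}" for \<rho>
  proof -
   have "g \<rho> = (\<Sum>q\<in>{q\<in>?S. nn q \<le> \<rho>}. real ?n / \<rho> ^ (?n + 1))"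
    unfolding g_def using that by (subst sum.inter_filter[OF finite_shell]) (auto intro!: sum.cong)
   then show ?thesis by simp
  qed
  have cardb: "vol * (\<rho> ^ ?n - a ^ ?n) - 2 * C * \<rho> ^ (?n - 1) \<le> real (card {q\<in>?S. nn q \<le> \<rho>})"
   "real (card {q\<in>?S. nn q < \<rho>}) \<le> vol * (\<rho> ^ ?n - a ^ ?n) + 2 * C * \<rho> ^ (?n - 1)" if \<rho>: "\<rho> \<in> {a..b}" for \<rho>
  proof -
   have e: "{q\<in>?S. nn q < \<rho>} = shell a \<rho>" using \<rho> by (auto simp: shell_def)
   have c: "real (card (shell a \<rho>)) = count \<rho> - count a" using \<rho> by (intro card_shell) auto
   have "C * a ^ (?n - 1) \<le> C * \<rho> ^ (?n - 1)" using \<rho> a C by (intro mult_left_mono power_mono) auto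
   then have "\<bar>count \<rho> - count a - vol * (\<rho> ^ ?n - a ^ ?n)\<bar> \<le> 2 * C * \<rho> ^ (?n - 1)"
    using C(2)[of \<rho>] C(2)[of a] \<rho> a by (simp add: abs_le_iff right_diff_distrib)
   moreover have "card (shell a \<rho>) \<le> card {q\<in>?S. nn q \<le> \<rho>}"
    using \<rho> unfolding e[symmetric] by (intro card_mono finite_subset[OF _ finite_shell[of a b]]) auto
   ultimately show "vol * (\<rho> ^ ?n - a ^ ?n) - 2 * C * \<rho> ^ (?n - 1) \<le> real (card {q\<in>?S. nn q \<le> \<rho>})"
    "real (card {q\<in>?S. nn q < \<rho>}) \<le> vol * (\<rho> ^ ?n - a ^ ?n) + 2 * C * \<rho> ^ (?n - 1)"
    unfolding e using c by (auto simp: abs_le_iff)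
  qed
  have FTC1: "((\<lambda>\<rho>. 1 / \<rho>) has_integral ln (b / a)) {a..b}"
  proof -
   have "((\<lambda>\<rho>. 1 / \<rho>) has_integral (ln b - ln a)) {a..b}"
   proof (rule fundamental_theorem_of_calculus[OF ab])
    fix \<rho> assume "\<rho> \<in> {a..b}"
    then have "\<rho> > 0" using a by auto
    then have "(ln has_real_derivative 1 / \<rho>) (at \<rho> within {a..b})"
     by (auto intro!: derivative_eq_intros simp: divide_inverse)
    then show "(ln has_vector_derivative 1 / \<rho>) (at \<rho> within {a..b})"
     by (simp add: has_real_derivative_iff_has_vector_derivative)
   qed
   then show ?thesis using a b by (simp add: ln_div)
  qed
  have FTC2: "((\<lambda>\<rho>. 1 / \<rho>\<^sup>2) has_integral (1 / a - 1 / b)) {a..b}"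
  proof -
   have "((\<lambda>\<rho>. 1 / \<rho>\<^sup>2) has_integral ((- 1 / b) - (- 1 / a))) {a..b}"
   proof (rule fundamental_theorem_of_calculus[OF ab])
    fix \<rho> assume "\<rho> \<in> {a..b}"
    then have "\<rho> \<noteq> 0" using a by auto
    then have "((\<lambda>\<rho>. - 1 / \<rho>) has_real_derivative 1 / \<rho>\<^sup>2) (at \<rho> within {a..b})"
     by (auto intro!: derivative_eq_intros simp: power2_eq_square)
    then show "((\<lambda>\<rho>. - 1 / \<rho>) has_vector_derivative 1 / \<rho>\<^sup>2) (at \<rho> within {a..b})"
     by (simp add: has_real_derivative_iff_has_vector_derivative)
   qed
   then show ?thesis by simp
  qed
  define U where "U \<epsilon> \<rho> = real ?n * vol * (1 / \<rho>) - vol * a ^ ?n * (real ?n / \<rho> ^ (?n + 1)) + \<epsilon> * (2 * C * real ?n) * (1 / \<rho>\<^sup>2)" for \<epsilon> \<rho> :: real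
  have IU: "(U \<epsilon> has_integral (real ?n * vol * ln (b / a) - vol * a ^ ?n * (1 / a ^ ?n - 1 / b ^ ?n) + \<epsilon> * (2 * C * real ?n) * (1 / a - 1 / b))) {a..b}" for \<epsilon>
   unfolding U_def
   by (intro has_integral_add has_integral_diff has_integral_mult_right FTC1 FTC2 FTC a ab)
  have Ueq: "U \<epsilon> \<rho> = real ?n / \<rho> ^ (?n + 1) * (vol * (\<rho> ^ ?n - a ^ ?n) + \<epsilon> * (2 * C * \<rho> ^ (?n - 1)))" if "\<rho> \<in> {a..b}" for \<epsilon> \<rho>
  proof -
   have r: "\<rho> \<noteq> 0" using that a by auto
   obtain k where k: "?n = Suc k" using n by (metis Suc_le_D One_nat_def)
   show ?thesis unfolding U_def k using r by (simp add: field_simps power2_eq_square)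
  qed
  let ?main = "real ?n * vol * ln (b / a)"
  let ?sum = "\<Sum>q\<in>?S. 1 / nn q ^ ?n - 1 / b ^ ?n"
  have t0: "0 \<le> vol * a ^ ?n * (1 / a ^ ?n - 1 / b ^ ?n)" "vol * a ^ ?n * (1 / a ^ ?n - 1 / b ^ ?n) \<le> vol"
  proof -
   have q: "a ^ ?n / b ^ ?n \<le> 1" using a ab by (auto intro!: divide_le_eq_1[THEN iffD2] power_mono)
   have e: "vol * a ^ ?n * (1 / a ^ ?n - 1 / b ^ ?n) = vol * (1 - a ^ ?n / b ^ ?n)" using a by (simp add: field_simps)
   have "0 \<le> a ^ ?n / b ^ ?n" using a b by simp
   then show "0 \<le> vol * a ^ ?n * (1 / a ^ ?n - 1 / b ^ ?n)" "vol * a ^ ?n * (1 / a ^ ?n - 1 / b ^ ?n) \<le> vol"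
    unfolding e using q vol_pos by (auto simp: mult_le_cancel_left1)
  qed
  have t1: "0 \<le> 2 * C * real ?n * (1 / a - 1 / b)" "2 * C * real ?n * (1 / a - 1 / b) \<le> 2 * C * real ?n"
  proof -
   have "1 / b \<le> 1 / a" using a ab by (intro divide_left_mono) auto
   moreover have "1 / a \<le> 1" "0 \<le> 1 / b" using a b by auto
   then have "1 / a - 1 / b \<le> 1" by linarith
   ultimately show "0 \<le> 2 * C * real ?n * (1 / a - 1 / b)" "2 * C * real ?n * (1 / a - 1 / b) \<le> 2 * C * real ?n"
    using C by (auto intro!: mult_nonneg_nonneg simp: mult_le_cancel_left1)
  qed
  have lower: "?main - vol - 2 * C * real ?n \<le> ?sum"
  proof -
   have "?main - vol * a ^ ?n * (1 / a ^ ?n - 1 / b ^ ?n) + (- 1) * (2 * C * real ?n) * (1 / a - 1 / b) \<le> ?sum"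
   proof (rule has_integral_le[OF IU I])
    fix \<rho> assume r: "\<rho> \<in> {a..b}"
    then have "0 \<le> real ?n / \<rho> ^ (?n + 1)" using a by auto
    then show "U (- 1) \<rho> \<le> g \<rho>" unfolding Ueq[OF r] gb[OF r]
     using cardb(1)[OF r] by (intro mult_left_mono) auto
   qed
   then show ?thesis using t0 t1 by linarith
  qed
  have upper: "?sum \<le> ?main + 2 * C * real ?n"
  proof -
   define g' where "g' \<rho> = (\<Sum>q\<in>?S. if \<rho> \<in> {nn q<..b} then real ?n / \<rho> ^ (?n + 1) else 0)" for \<rho>
   have I': "(g' has_integral ?sum) {a..b}"
   proof (rule has_integral_spike_finite[OF _ _ I, where S = "nn ` ?S"])
    fix \<rho> assume "\<rho> \<in> {a..b} - nn ` ?S"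
    then show "g' \<rho> = g \<rho>" unfolding g'_def g_def by (intro sum.cong refl) (auto simp: less_le)
   qed (simp add: finite_shell)
   have gb': "g' \<rho> = real ?n / \<rho> ^ (?n + 1) * real (card {q\<in>?S. nn q < \<rho>})" if "\<rho> \<in> {a..b}" for \<rho>
   proof -
    have "g' \<rho> = (\<Sum>q\<in>{q\<in>?S. nn q < \<rho>}. real ?n / \<rho> ^ (?n + 1))"
     unfolding g'_def using that by (subst sum.inter_filter[OF finite_shell]) (auto intro!: sum.cong)
    then show ?thesis by simp
   qed
   have "?sum \<le> ?main - vol * a ^ ?n * (1 / a ^ ?n - 1 / b ^ ?n) + 1 * (2 * C * real ?n) * (1 / a - 1 / b)"
   proof (rule has_integral_le[OF I' IU])
    fix \<rho> assume r: "\<rho> \<in> {a..b}"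
    then have "0 \<le> real ?n / \<rho> ^ (?n + 1)" using a by auto
    then show "g' \<rho> \<le> U 1 \<rho>" unfolding Ueq[OF r] gb'[OF r]
     using cardb(2)[OF r] by (intro mult_left_mono) auto
   qed
   then show ?thesis using t0 t1 by linarith
  qed
  have S: "(\<Sum>q\<in>?S. 1 / nn q ^ ?n) = ?sum + real (card ?S) / b ^ ?n" by (simp add: sum_subtractf)
  have S0: "0 \<le> real (card ?S) / b ^ ?n" using b by simp
  have S1: "real (card ?S) / b ^ ?n \<le> vol + 2 * C"
  proof -
   have "{q\<in>?S. nn q < b} = ?S" by (auto simp: shell_def)
   then have "real (card ?S) \<le> vol * (b ^ ?n - a ^ ?n) + 2 * C * b ^ (?n - 1)" using cardb(2)[of b] ab by simp
   also have "... \<le> vol * b ^ ?n + 2 * C * b ^ ?n"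
    using vol_pos C a b by (intro add_mono mult_left_mono power_increasing) auto
   finally show ?thesis using b by (simp add: field_simps)
  qed
  show ?thesis unfolding S C'_def using lower upper S0 S1 vol_pos C(1) by (auto simp: abs_le_iff)
 qed
 then show ?thesis using that C' by blast
qed

end

section \<open>Decoupling of separated blocks\<close>

locale clt_setting = norm_setting N for N :: "real ^ 'n => real" +
 fixes \<theta> \<omega> :: "real ^ 'm"
 assumes card_m: "CARD('m) \<ge> 2"
  and \<theta>_pos: "!!i. \<theta> $ i > 0"
  and \<omega>_pos: "!!i. \<omega> $ i > 0"
  and \<omega>_sum: "(\<Sum>i\<in>UNIV. \<omega> $ i) = real CARD('n)"
begin

definition b :: "int ^ 'n => 'm => real" where "b q i = \<theta> $ i * nn q powr (- (\<omega> $ i))"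

definition A :: real where "A = 2 ^ CARD('m) * (\<Prod>i\<in>UNIV. \<theta> $ i)"

text \<open>The volume of the box for the frequency \<open>q\<close>, which is the probability of a hit as
  soon as the radii are at most \<open>1/2\<close>.\<close>
definition v :: "int ^ 'n => real" where "v q = (\<Prod>i\<in>UNIV. 2 * b q i)"

lemma A_pos: "A > 0" unfolding A_def using \<theta>_pos by (intro mult_pos_pos prod_pos) auto

lemma b_nonneg: "0 \<le> b q i" unfolding b_def using \<theta>_pos[of i] by simp

lemma v_nonneg: "0 \<le> v q" unfolding v_def by (intro prod_nonneg) (simp add: b_nonneg)

lemma prod_powr_\<omega>: assumes "t > 0" shows "(\<Prod>i\<in>UNIV. t powr (\<omega> $ i)) = t ^ CARD('n)"
 using assms by (simp add: powr_sum[symmetric] \<omega>_sum powr_realpow)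

lemma v_eq: assumes "nn q > 0" shows "v q = A / nn q ^ CARD('n)"
proof -
 have "v q = (\<Prod>i\<in>UNIV. (2 * \<theta> $ i) / nn q powr (\<omega> $ i))"
  unfolding v_def b_def by (simp add: powr_minus divide_inverse mult.assoc)
 also have "... = (\<Prod>i\<in>UNIV. 2 * \<theta> $ i) / nn q ^ CARD('n)" by (simp add: prod_dividef prod_powr_\<omega>[OF assms])
 finally show ?thesis by (simp add: A_def prod.distrib)
qed

lemma b_antimono: assumes "0 < nn q" "nn q \<le> nn q'" shows "b q' i \<le> b q i"
 unfolding b_def using assms \<theta>_pos[of i] \<omega>_pos[of i]
 by (intro mult_left_mono powr_mono2') auto

text \<open>A size from which on all radii are at most \<open>1/2\<close>.\<close>
definition T0 :: real where "T0 = 1 + (\<Sum>i\<in>UNIV. (2 * \<theta> $ i) powr (1 / \<omega> $ i))"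

lemma T0_ge_1: "1 \<le> T0" unfolding T0_def by (simp add: sum_nonneg)

lemma b_le_half: assumes "T0 \<le> nn q" shows "b q i \<le> 1/2"
proof -
 have "(2 * \<theta> $ i) powr (1 / \<omega> $ i) \<le> (\<Sum>i\<in>UNIV. (2 * \<theta> $ i) powr (1 / \<omega> $ i))" by (rule member_le_sum) auto
 then have t: "(2 * \<theta> $ i) powr (1 / \<omega> $ i) \<le> nn q" using assms by (simp add: T0_def)
 have "2 * \<theta> $ i = ((2 * \<theta> $ i) powr (1 / \<omega> $ i)) powr (\<omega> $ i)" using \<theta>_pos[of i] \<omega>_pos[of i] by (simp add: powr_powr)
 also have "... \<le> nn q powr (\<omega> $ i)" using t \<omega>_pos[of i] by (intro powr_mono2) auto
 finally have "2 * \<theta> $ i \<le> nn q powr (\<omega> $ i)" .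
 moreover have "0 < nn q powr (\<omega> $ i)" using assms T0_ge_1 by simp
 ultimately show ?thesis by (simp add: b_def powr_minus field_simps)
qed

lemma sum_v_shell: obtains C where "C > 0"
 "!!\<alpha> \<gamma>. 1 \<le> \<alpha> ==> \<alpha> \<le> \<gamma> ==> \<bar>(\<Sum>q\<in>shell \<alpha> \<gamma>. v q) - A * real CARD('n) * vol * ln (\<gamma> / \<alpha>)\<bar> \<le> C"
proof -
 obtain C where C: "C > 0"
  "!!a b. 1 \<le> a ==> a \<le> b ==> \<bar>(\<Sum>q\<in>shell a b. 1 / nn q ^ CARD('n)) - real CARD('n) * vol * ln (b / a)\<bar> \<le> C"
  using sum_shell_asymp by blast
 have "\<bar>(\<Sum>q\<in>shell \<alpha> \<gamma>. v q) - A * real CARD('n) * vol * ln (\<gamma> / \<alpha>)\<bar> \<le> A * C" if "1 \<le> \<alpha>" "\<alpha> \<le> \<gamma>" for \<alpha> \<gamma>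
 proof -
  have "(\<Sum>q\<in>shell \<alpha> \<gamma>. v q) = (\<Sum>q\<in>shell \<alpha> \<gamma>. A * (1 / nn q ^ CARD('n)))"
   by (intro sum.cong refl, subst v_eq) (use that in \<open>auto simp: shell_def\<close>)
  then have "(\<Sum>q\<in>shell \<alpha> \<gamma>. v q) - A * real CARD('n) * vol * ln (\<gamma> / \<alpha>)
   = A * ((\<Sum>q\<in>shell \<alpha> \<gamma>. 1 / nn q ^ CARD('n)) - real CARD('n) * vol * ln (\<gamma> / \<alpha>))"
   by (simp add: sum_distrib_left right_diff_distrib mult.assoc)
  then have "\<bar>(\<Sum>q\<in>shell \<alpha> \<gamma>. v q) - A * real CARD('n) * vol * ln (\<gamma> / \<alpha>)\<bar>
   = A * \<bar>(\<Sum>q\<in>shell \<alpha> \<gamma>. 1 / nn q ^ CARD('n)) - real CARD('n) * vol * ln (\<gamma> / \<alpha>)\<bar>"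
   using A_pos by (simp add: abs_mult)
  then show ?thesis using C(2)[OF that] A_pos by (simp add: mult_left_mono)
 qed
 then show ?thesis using that[of "A * C"] A_pos C(1) by simp
qed

lemma sum_v_shell_le: obtains C where "C > 0"
 "!!\<alpha> \<gamma>. 1 \<le> \<alpha> ==> \<alpha> \<le> \<gamma> ==> (\<Sum>q\<in>shell \<alpha> \<gamma>. v q) \<le> C * (1 + ln (\<gamma> / \<alpha>))"
proof -
 obtain C where C: "C > 0"
  "!!\<alpha> \<gamma>. 1 \<le> \<alpha> ==> \<alpha> \<le> \<gamma> ==> \<bar>(\<Sum>q\<in>shell \<alpha> \<gamma>. v q) - A * real CARD('n) * vol * ln (\<gamma> / \<alpha>)\<bar> \<le> C"
  using sum_v_shell by blast
 let ?K = "A * real CARD('n) * vol"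
 have K: "?K > 0" using A_pos vol_pos by simp
 have "(\<Sum>q\<in>shell \<alpha> \<gamma>. v q) \<le> (C + ?K) * (1 + ln (\<gamma> / \<alpha>))" if "1 \<le> \<alpha>" "\<alpha> \<le> \<gamma>" for \<alpha> \<gamma>
 proof -
  have l: "0 \<le> ln (\<gamma> / \<alpha>)" using that by simp
  have "(\<Sum>q\<in>shell \<alpha> \<gamma>. v q) \<le> C + ?K * ln (\<gamma> / \<alpha>)" using C(2)[OF that] by linarith
  also have "... \<le> (C + ?K) * (1 + ln (\<gamma> / \<alpha>))" using C(1) K l by (simp add: algebra_simps)
  finally show ?thesis .
 qed
 then show ?thesis using that[of "C + ?K"] C(1) K by simp
qed

text \<open>The volume is proportional to the power \<open>-n\<close> of the norm, hence varies slowly under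
  translations that are short compared with \<open>p\<close>.\<close>
lemma v_diff_le:
 assumes \<alpha>: "1 \<le> \<alpha>" "0 \<le> \<rho>" "\<rho> \<le> \<alpha> / 2" and r: "nn r \<le> \<rho>" and p: "\<alpha> \<le> nn p" "\<alpha> \<le> nn (p - r)"
 shows "\<bar>v (p - r) - v p\<bar> \<le> real CARD('n) * 4 ^ CARD('n) * (\<rho> / \<alpha>) * v p"
proof -
 let ?n = "CARD('n)" and ?a = "nn p" and ?c = "nn (p - r)"
 have n: "?n \<ge> 1" by (simp add: Suc_leI)
 have d: "\<bar>?c - ?a\<bar> \<le> \<rho>" using nn_diff_abs[of p r] r by linarith
 have a: "?a > 0" "?c > 0" using p \<alpha> by auto
 have c2: "?a / 2 \<le> ?c" "?c \<le> 2 * ?a" using d \<alpha> p by linarith+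
 have "\<bar>?a ^ ?n - ?c ^ ?n\<bar> \<le> real ?n * \<rho> * (2 * ?a) ^ (?n - 1)"
 proof (cases "?c \<le> ?a")
  case True
  have "?a ^ ?n - ?c ^ ?n \<le> real ?n * (?a - ?c) * ?a ^ (?n - 1)" using True a by (intro power_diff_le) auto
  also have "... \<le> real ?n * \<rho> * (2 * ?a) ^ (?n - 1)"
   using d a \<alpha> True by (intro mult_mono power_mono mult_left_mono) auto
  finally show ?thesis using True a by (simp add: power_mono)
 next
  case False
  have "?c ^ ?n - ?a ^ ?n \<le> real ?n * (?c - ?a) * ?c ^ (?n - 1)" using False a by (intro power_diff_le) auto
  also have "... \<le> real ?n * \<rho> * (2 * ?a) ^ (?n - 1)"
   using d a \<alpha> False c2 by (intro mult_mono power_mono mult_left_mono) auto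
  finally show ?thesis using False a by (simp add: power_mono abs_minus_commute)
 qed
 then have "\<bar>?a ^ ?n - ?c ^ ?n\<bar> / ?c ^ ?n \<le> real ?n * \<rho> * (2 * ?a) ^ (?n - 1) / (?a / 2) ^ ?n"
  using a c2 \<alpha> by (intro frac_le power_mono) auto
 also have "... = real ?n * \<rho> * (2 ^ (?n - 1) * 2 ^ ?n) / ?a"
 proof -
  obtain k where k: "?n = Suc k" using n by (metis Suc_le_D One_nat_def)
  show ?thesis unfolding k using a by (simp add: field_simps power_mult_distrib)
 qed
 also have "... \<le> real ?n * \<rho> * 4 ^ ?n / \<alpha>"
 proof (intro frac_le mult_left_mono)
  have "(2::real) ^ (?n - 1) * 2 ^ ?n \<le> 2 ^ ?n * 2 ^ ?n" by (intro mult_right_mono power_increasing) auto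
  also have "... = 4 ^ ?n" by (simp add: power_mult_distrib[symmetric])
  finally show "(2::real) ^ (?n - 1) * 2 ^ ?n \<le> 4 ^ ?n" .
 qed (use \<alpha> p in auto)
 finally have e: "\<bar>?a ^ ?n - ?c ^ ?n\<bar> / ?c ^ ?n \<le> real ?n * 4 ^ ?n * (\<rho> / \<alpha>)" by (simp add: ac_simps)
 have "v (p - r) - v p = v p * ((?a ^ ?n - ?c ^ ?n) / ?c ^ ?n)"
  using a by (simp add: v_eq field_simps)
 then have "\<bar>v (p - r) - v p\<bar> = v p * (\<bar>?a ^ ?n - ?c ^ ?n\<bar> / ?c ^ ?n)"
  using v_nonneg[of p] a by (simp add: abs_mult abs_divide)
 also have "... \<le> v p * (real ?n * 4 ^ ?n * (\<rho> / \<alpha>))" using e v_nonneg[of p] by (rule mult_left_mono)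
 finally show ?thesis by (simp add: ac_simps)
qed

text \<open>Frequencies that stay in the shell contribute the slow variation of \<open>v\<close>; those that
  enter or leave it lie in thin shells at its two boundaries.\<close>
lemma translation_sum_le: obtains C where "C > 0"
 "!!\<alpha> \<gamma> \<rho> r. 1 \<le> \<rho> ==> \<rho> \<le> \<alpha> / 2 ==> \<alpha> \<le> \<gamma> ==> nn r \<le> \<rho> ==>
  (\<Sum>p\<in>shell \<alpha> \<gamma> \<union> (\<lambda>q. q + r) ` shell \<alpha> \<gamma>.
   \<bar>restricted_volume b (shell \<alpha> \<gamma>) (p - r) - restricted_volume b (shell \<alpha> \<gamma>) p\<bar>) \<le> C * (\<rho> / \<alpha>) * (1 + ln (\<gamma> / \<alpha>))"
proof -
 let ?n = "CARD('n)"
 have n: "?n \<ge> 1" by (simp add: Suc_leI)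
 obtain C1 where C1: "C1 > 0" "!!a \<rho>. 1 \<le> \<rho> ==> \<rho> \<le> a ==> real (card (shell a (a + \<rho>))) \<le> C1 * \<rho> * a ^ (?n - 1)"
  using card_thin_shell by blast
 obtain C2 where C2: "C2 > 0" "!!\<alpha> \<gamma>. 1 \<le> \<alpha> ==> \<alpha> \<le> \<gamma> ==> (\<Sum>q\<in>shell \<alpha> \<gamma>. v q) \<le> C2 * (1 + ln (\<gamma> / \<alpha>))"
  using sum_v_shell_le by blast
 define C where "C = real ?n * 4 ^ ?n * C2 + 6 * (A * C1)"
 have C: "C > 0" unfolding C_def using C2 A_pos C1 n by (intro add_pos_pos mult_pos_pos) auto
 have "(\<Sum>p\<in>shell \<alpha> \<gamma> \<union> (\<lambda>q. q + r) ` shell \<alpha> \<gamma>.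
   \<bar>restricted_volume b (shell \<alpha> \<gamma>) (p - r) - restricted_volume b (shell \<alpha> \<gamma>) p\<bar>) \<le> C * (\<rho> / \<alpha>) * (1 + ln (\<gamma> / \<alpha>))"
  if \<rho>: "1 \<le> \<rho>" "\<rho> \<le> \<alpha> / 2" and \<alpha>\<gamma>: "\<alpha> \<le> \<gamma>" and r: "nn r \<le> \<rho>" for \<alpha> \<gamma> \<rho> r
 proof -
  let ?Q = "shell \<alpha> \<gamma>" and ?U = "shell \<alpha> \<gamma> \<union> (\<lambda>q. q + r) ` shell \<alpha> \<gamma>"
  have \<alpha>: "\<alpha> \<ge> 2" using \<rho> by simp
  define E1 where "E1 = shell \<alpha> (\<alpha> + \<rho>)"
  define E2 where "E2 = shell (\<gamma> - \<rho>) \<gamma>"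
  define E where "E = E1 \<union> E2"
  have finE: "finite E" "finite E1" "finite E2" unfolding E_def E1_def E2_def by (simp_all add: finite_shell)
  have finU: "finite ?U" by (simp add: finite_shell)
  have rv: "restricted_volume b ?Q p = (if p \<in> ?Q then v p else 0)" for p by (simp add: restricted_volume_def v_def)
  have dn: "\<bar>nn (p - r) - nn p\<bar> \<le> \<rho>" for p using nn_diff_abs[of p r] r by linarith
  have edge1: "p \<in> E" if "p \<in> ?Q" "p - r \<notin> ?Q" for p
   using that dn[of p] unfolding E_def E1_def E2_def shell_def by auto
  have edge2: "p - r \<in> E" if "p \<notin> ?Q" "p - r \<in> ?Q" for p
   using that dn[of p] unfolding E_def E1_def E2_def shell_def by auto
  have regroup: "K * w * (C2 * X) + 3 * (B * w) + 3 * (B * w) = K * C2 * (w * X) + 6 * B * (w * 1)" for K w X B :: real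
   by (simp add: algebra_simps)
  have pw: "\<bar>restricted_volume b ?Q (p - r) - restricted_volume b ?Q p\<bar> \<le>
    (if p \<in> ?Q then real ?n * 4 ^ ?n * (\<rho> / \<alpha>) * v p else 0) + (if p \<in> E then v p else 0) + (if p - r \<in> E then v (p - r) else 0)" for p
  proof -
   have nonneg: "0 \<le> real ?n * 4 ^ ?n * (\<rho> / \<alpha>) * v p" using \<rho> \<alpha> v_nonneg[of p] by simp
   have main: "\<bar>v (p - r) - v p\<bar> \<le> real ?n * 4 ^ ?n * (\<rho> / \<alpha>) * v p" if "p \<in> ?Q" "p - r \<in> ?Q"
    by (rule v_diff_le[OF _ _ \<rho>(2) r]) (use that \<alpha> \<rho> in \<open>auto simp: shell_def\<close>)
   show ?thesis
    unfolding rv using main edge1[of p] edge2[of p] nonneg v_nonneg[of p] v_nonneg[of "p - r"]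
    by (cases "p \<in> ?Q"; cases "p - r \<in> ?Q") auto
  qed
  have E1: "(\<Sum>p\<in>E1. v p) \<le> A * C1 * (\<rho> / \<alpha>)"
  proof -
   have "(\<Sum>p\<in>E1. v p) \<le> (\<Sum>p\<in>E1. A / \<alpha> ^ ?n)"
   proof (rule sum_mono)
    fix p assume "p \<in> E1"
    then have "\<alpha> \<le> nn p" by (simp add: E1_def shell_def)
    then show "v p \<le> A / \<alpha> ^ ?n" using \<alpha> A_pos by (subst v_eq) (auto intro!: divide_left_mono power_mono)
   qed
   also have "... = real (card E1) * (A / \<alpha> ^ ?n)" by simp
   also have "... \<le> (C1 * \<rho> * \<alpha> ^ (?n - 1)) * (A / \<alpha> ^ ?n)"
    unfolding E1_def using \<rho> \<alpha> A_pos by (intro mult_right_mono C1(2)) auto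
   also have "... = A * C1 * (\<rho> / \<alpha>)"
   proof -
    obtain k where k: "?n = Suc k" using n by (metis Suc_le_D One_nat_def)
    show ?thesis unfolding k using \<alpha> by (simp add: field_simps)
   qed
   finally show ?thesis .
  qed
  have E2: "(\<Sum>p\<in>E2. v p) \<le> 2 * (A * C1 * (\<rho> / \<alpha>))"
  proof -
   let ?g = "\<gamma> - \<rho>"
   have g: "?g \<ge> \<alpha> / 2" "?g \<ge> \<rho>" "?g > 0" using \<rho> \<alpha>\<gamma> \<alpha> by linarith+
   have "(\<Sum>p\<in>E2. v p) \<le> (\<Sum>p\<in>E2. A / ?g ^ ?n)"
   proof (rule sum_mono)
    fix p assume "p \<in> E2"
    then have "?g \<le> nn p" by (simp add: E2_def shell_def)
    then show "v p \<le> A / ?g ^ ?n" using g A_pos by (subst v_eq) (auto intro!: divide_left_mono power_mono)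
   qed
   also have "... = real (card E2) * (A / ?g ^ ?n)" by simp
   also have "... \<le> (C1 * \<rho> * ?g ^ (?n - 1)) * (A / ?g ^ ?n)"
    unfolding E2_def using C1(2)[OF \<rho>(1) g(2)] g A_pos by (intro mult_right_mono) auto
   also have "... = A * C1 * (\<rho> / ?g)"
   proof -
    obtain k where k: "?n = Suc k" using n by (metis Suc_le_D One_nat_def)
    show ?thesis unfolding k using g by (simp add: field_simps)
   qed
   also have "... \<le> A * C1 * (\<rho> / (\<alpha> / 2))"
    using g \<rho> \<alpha> A_pos C1 by (intro mult_left_mono divide_left_mono) auto
   finally show ?thesis by (simp add: ac_simps)
  qed
  have "(\<Sum>p\<in>E. v p) \<le> (\<Sum>p\<in>E1. v p) + (\<Sum>p\<in>E2. v p)"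
   unfolding E_def using finE v_nonneg by (simp add: sum_Un sum_nonneg)
  also have "... \<le> A * C1 * (\<rho> / \<alpha>) + 2 * (A * C1 * (\<rho> / \<alpha>))" by (rule add_mono[OF E1 E2])
  also have "... = 3 * (A * C1 * (\<rho> / \<alpha>))" by simp
  finally have E3: "(\<Sum>p\<in>E. v p) \<le> 3 * (A * C1 * (\<rho> / \<alpha>))" .
  have "(\<Sum>p\<in>?U. \<bar>restricted_volume b ?Q (p - r) - restricted_volume b ?Q p\<bar>)
   \<le> (\<Sum>p\<in>?U. (if p \<in> ?Q then real ?n * 4 ^ ?n * (\<rho> / \<alpha>) * v p else 0) + (if p \<in> E then v p else 0) + (if p - r \<in> E then v (p - r) else 0))"
   by (rule sum_mono) (rule pw)
  also have "... = (\<Sum>p\<in>?U. if p \<in> ?Q then real ?n * 4 ^ ?n * (\<rho> / \<alpha>) * v p else 0)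
   + (\<Sum>p\<in>?U. if p \<in> E then v p else 0) + (\<Sum>p\<in>?U. if p - r \<in> E then v (p - r) else 0)"
   by (simp add: sum.distrib)
  also have "(\<Sum>p\<in>?U. if p \<in> ?Q then real ?n * 4 ^ ?n * (\<rho> / \<alpha>) * v p else 0) = (\<Sum>p\<in>?Q. real ?n * 4 ^ ?n * (\<rho> / \<alpha>) * v p)"
   by (rule sum.mono_neutral_cong_right[OF finU]) auto
  also have "... = real ?n * 4 ^ ?n * (\<rho> / \<alpha>) * (\<Sum>p\<in>?Q. v p)" by (simp add: sum_distrib_left)
  also have "... \<le> real ?n * 4 ^ ?n * (\<rho> / \<alpha>) * (C2 * (1 + ln (\<gamma> / \<alpha>)))"
   using \<rho> \<alpha> \<alpha>\<gamma> by (intro mult_left_mono C2(2)) auto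
  also have "(\<Sum>p\<in>?U. if p \<in> E then v p else 0) \<le> (\<Sum>p\<in>E. v p)"
  proof -
   have "(\<Sum>p\<in>?U. if p \<in> E then v p else 0) = (\<Sum>p\<in>?U \<inter> E. v p)" using finU by (simp add: sum.inter_restrict)
   also have "... \<le> (\<Sum>p\<in>E. v p)" using finE v_nonneg by (intro sum_mono2) auto
   finally show ?thesis .
  qed
  also note E3
  also have "(\<Sum>p\<in>?U. if p - r \<in> E then v (p - r) else 0) \<le> (\<Sum>p\<in>E. v p)"
  proof -
   have "(\<Sum>p\<in>?U. if p - r \<in> E then v (p - r) else 0) = (\<Sum>p\<in>(\<lambda>p. p - r) ` ?U. if p \<in> E then v p else 0)"
    by (subst sum.reindex) (auto simp: inj_on_def)
   also have "... = (\<Sum>p\<in>((\<lambda>p. p - r) ` ?U) \<inter> E. v p)" using finU by (intro sum.inter_restrict[symmetric]) simp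
   also have "... \<le> (\<Sum>p\<in>E. v p)" using finE v_nonneg by (intro sum_mono2) auto
   finally show ?thesis .
  qed
  also note E3
  finally have "(\<Sum>p\<in>?U. \<bar>restricted_volume b ?Q (p - r) - restricted_volume b ?Q p\<bar>)
   \<le> real ?n * 4 ^ ?n * (\<rho> / \<alpha>) * (C2 * (1 + ln (\<gamma> / \<alpha>))) + 3 * (A * C1 * (\<rho> / \<alpha>)) + 3 * (A * C1 * (\<rho> / \<alpha>))" by simp
  also have "... = real ?n * 4 ^ ?n * C2 * ((\<rho> / \<alpha>) * (1 + ln (\<gamma> / \<alpha>))) + 6 * (A * C1) * ((\<rho> / \<alpha>) * 1)" by (rule regroup)
  also have "... \<le> real ?n * 4 ^ ?n * C2 * ((\<rho> / \<alpha>) * (1 + ln (\<gamma> / \<alpha>))) + 6 * (A * C1) * ((\<rho> / \<alpha>) * (1 + ln (\<gamma> / \<alpha>)))"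
   using A_pos C1 \<rho> \<alpha> \<alpha>\<gamma> by (intro add_left_mono mult_left_mono) auto
  also have "... = C * (\<rho> / \<alpha>) * (1 + ln (\<gamma> / \<alpha>))" unfolding C_def by (simp only: distrib_right mult.assoc)
  finally show ?thesis .
 qed
 then show ?thesis using that C by blast
qed

text \<open>The gap \<open>exp g\<close> leaves room for a grid that is fine compared with the radii of the
  first block together with translations that are more numerous than the cells of the grid and yet short
  compared with the second block.\<close>
lemma block_decoupling: obtains C c g0 where "C > 0" "c > 0" "g0 > 0"
 "!!\<beta> \<gamma> g s a a' Q. T0 \<le> \<beta> ==> g0 \<le> g ==> \<beta> * exp g \<le> \<gamma> ==> Q \<subseteq> shell T0 \<beta> ==>
  (\<integral>u. norm ((\<integral>x. phase b Q s a u x * phase b (shell (\<beta> * exp g) \<gamma>) s a' u x \<partial>trow)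
    - (\<integral>x. phase b Q s a u x \<partial>trow) * (\<integral>x. phase b (shell (\<beta> * exp g) \<gamma>) s a' u x \<partial>trow)) \<partial>tmat)
  \<le> C * (1 + \<bar>s\<bar>) * (1 + ln \<gamma>) * exp (- c * g)"
proof -
 let ?n = "CARD('n)" and ?m = "CARD('m)"
 have n: "?n \<ge> 1" by (simp add: Suc_leI)
 obtain C1 where C1: "C1 > 0"
  "!!\<alpha> \<gamma> \<rho> r. 1 \<le> \<rho> ==> \<rho> \<le> \<alpha> / 2 ==> \<alpha> \<le> \<gamma> ==> nn r \<le> \<rho> ==>
  (\<Sum>p\<in>shell \<alpha> \<gamma> \<union> (\<lambda>q. q + r) ` shell \<alpha> \<gamma>.
   \<bar>restricted_volume b (shell \<alpha> \<gamma>) (p - r) - restricted_volume b (shell \<alpha> \<gamma>) p\<bar>) \<le> C1 * (\<rho> / \<alpha>) * (1 + ln (\<gamma> / \<alpha>))"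
  using translation_sum_le by blast
 obtain C2 where C2: "C2 > 0" "!!\<alpha> \<gamma>. 1 \<le> \<alpha> ==> \<alpha> \<le> \<gamma> ==> (\<Sum>q\<in>shell \<alpha> \<gamma>. v q) \<le> C2 * (1 + ln (\<gamma> / \<alpha>))"
  using sum_v_shell_le by blast
 define c where "c = 1 / (4 * real ?m)"
 have m0: "real ?m \<ge> 2" using card_m by simp
 have c: "c > 0" "c \<le> 1/8" unfolding c_def using m0 by (auto simp: field_simps)
 define E where "E = (\<Prod>i\<in>UNIV. 1 + 1 / \<theta> $ i)"
 have E0: "E > 0" unfolding E_def using \<theta>_pos by (intro prod_pos ballI add_pos_pos) auto
 \<comment> \<open>For such gaps the translations are at most half as long as the frequencies of the second
   block.\<close>
 define g0 where "g0 = 2 * ln (4 * \<kappa>)"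
 have k: "\<kappa> \<ge> 1" by (rule \<kappa>_ge_1)
 have g0: "g0 > 0" unfolding g0_def using k by simp
 define C where "C = C1 * (2 * \<kappa>) + 2 * (C2 * (real ?m * 2 ^ ?m)) + sqrt E"
 have C: "C > 0" unfolding C_def using C1 C2 k E0 m0 by (intro add_pos_pos mult_pos_pos) auto
 have "(\<integral>u. norm ((\<integral>x. phase b Q s a u x * phase b (shell (\<beta> * exp g) \<gamma>) s a' u x \<partial>trow)
    - (\<integral>x. phase b Q s a u x \<partial>trow) * (\<integral>x. phase b (shell (\<beta> * exp g) \<gamma>) s a' u x \<partial>trow)) \<partial>tmat)
  \<le> C * (1 + \<bar>s\<bar>) * (1 + ln \<gamma>) * exp (- c * g)"
  if \<beta>: "T0 \<le> \<beta>" and g: "g0 \<le> g" and \<gamma>: "\<beta> * exp g \<le> \<gamma>" and Q: "Q \<subseteq> shell T0 \<beta>" for \<beta> \<gamma> g s a a' Q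
 proof -
  have gp: "g > 0" using g g0 by simp
  have b1: "\<beta> \<ge> 1" using \<beta> T0_ge_1 by simp
  let ?\<alpha> = "\<beta> * exp g" and ?Q' = "shell (\<beta> * exp g) \<gamma>"
  have \<alpha>: "?\<alpha> \<ge> \<beta>" using b1 gp by simp
  have \<gamma>1: "\<gamma> \<ge> 1" using \<alpha> \<gamma> b1 by linarith
  have L: "ln (\<gamma> / ?\<alpha>) \<le> ln \<gamma>"
  proof -
   have a1: "1 \<le> ?\<alpha>" using \<alpha> b1 by linarith
   then have "0 \<le> ln ?\<alpha>" by (rule ln_ge_zero)
   moreover have "ln (\<gamma> / ?\<alpha>) = ln \<gamma> - ln ?\<alpha>" using a1 \<gamma>1 by (subst ln_div) auto
   ultimately show ?thesis by linarith
  qed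
  have "\<beta> \<le> \<gamma>" using \<gamma> \<alpha> by linarith
  then have L\<beta>: "ln \<beta> \<le> ln \<gamma>" "0 \<le> ln \<beta>" using b1 by auto
  \<comment> \<open>On the logarithmic scale, the side of the cube of translations is midway between the two
    blocks.\<close>
  define P where "P = nat \<lceil>\<beta> * exp (g / 2)\<rceil>"
  have be: "\<beta> * exp (g / 2) \<ge> 1" using b1 gp mult_mono[of 1 \<beta> 1 "exp (g/2)"] by simp
  have P: "P > 0" "real P \<ge> \<beta> * exp (g / 2)" "real P \<le> 2 * (\<beta> * exp (g / 2))"
   unfolding P_def using be by (linarith, linarith, linarith)
  \<comment> \<open>The grid is finer than the radii of the first block by the factor \<open>\<tau>\<close>.
    Up to a constant it has \<open>\<beta>^n exp (m c g) = \<beta>^n exp (g / 4)\<close> cells, while there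
    are at least \<open>\<beta>^n exp (g / 2)\<close> translations.\<close>
  define \<tau> where "\<tau> = exp (- c * g)"
  have \<tau>: "0 < \<tau>" "\<tau> \<le> 1" unfolding \<tau>_def using c gp by auto
  define D where "D i = nat \<lceil>\<beta> powr (\<omega> $ i) / (\<tau> * \<theta> $ i)\<rceil>" for i
  have X: "\<beta> powr (\<omega> $ i) / (\<tau> * \<theta> $ i) > 0" for i using b1 \<tau> \<theta>_pos[of i] by simp
  have D: "D i > 0" "real (D i) \<ge> \<beta> powr (\<omega> $ i) / (\<tau> * \<theta> $ i)" "real (D i) \<le> 1 + \<beta> powr (\<omega> $ i) / (\<tau> * \<theta> $ i)" for i
   unfolding D_def using X[of i] by (linarith, linarith, linarith)
  have half: "4 * \<kappa> \<le> exp (g / 2)"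
  proof -
   have "ln (4 * \<kappa>) \<le> g / 2" using g unfolding g0_def by simp
   then have "exp (ln (4 * \<kappa>)) \<le> exp (g / 2)" by simp
   then show ?thesis using k by simp
  qed
  have eg: "exp g = exp (g / 2) * exp (g / 2)" by (simp add: exp_add[symmetric])
  define \<rho> where "\<rho> = \<kappa> * real P"
  have \<rho>: "1 \<le> \<rho>" "\<rho> \<le> ?\<alpha> / 2" "\<rho> / ?\<alpha> \<le> 2 * \<kappa> * exp (- g / 2)"
  proof -
   have "1 * 1 \<le> \<kappa> * real P" using k P be by (intro mult_mono) auto
   then show "1 \<le> \<rho>" by (simp add: \<rho>_def)
   have up: "\<rho> \<le> 2 * \<kappa> * (\<beta> * exp (g / 2))" unfolding \<rho>_def using P(3) k mult_left_mono[of "real P" "2 * (\<beta> * exp (g / 2))" \<kappa>] by simp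
   also have "... \<le> exp (g / 2) / 2 * (\<beta> * exp (g / 2))" using half b1 by (intro mult_right_mono) auto
   also have "... = ?\<alpha> / 2" unfolding eg by simp
   finally show "\<rho> \<le> ?\<alpha> / 2" .
   have "\<rho> / ?\<alpha> \<le> 2 * \<kappa> * (\<beta> * exp (g / 2)) / ?\<alpha>" using up b1 by (intro divide_right_mono) auto
   also have "... = 2 * \<kappa> * exp (- g / 2)" unfolding eg using b1 by (simp add: field_simps exp_minus)
   finally show "\<rho> / ?\<alpha> \<le> 2 * \<kappa> * exp (- g / 2)" .
  qed
  have exps: "exp (- g / 2) \<le> \<tau>" "exp (- g / 8) \<le> \<tau>" unfolding \<tau>_def using c gp by auto
  let ?H = "C1 * (2 * \<kappa> * \<tau>) * (1 + ln \<gamma>)"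
  have H: "(\<Sum>p\<in>?Q' \<union> (\<lambda>q. q + r) ` ?Q'. \<bar>restricted_volume b ?Q' (p - r) - restricted_volume b ?Q' p\<bar>) \<le> ?H"
   if "r \<in> int_cube P" for r
  proof -
   have "nn r \<le> \<rho>" unfolding \<rho>_def by (rule nn_int_cube[OF that])
   from C1(2)[OF \<rho>(1,2) \<gamma> this]
   have "(\<Sum>p\<in>?Q' \<union> (\<lambda>q. q + r) ` ?Q'. \<bar>restricted_volume b ?Q' (p - r) - restricted_volume b ?Q' p\<bar>) \<le> C1 * (\<rho> / ?\<alpha>) * (1 + ln (\<gamma> / ?\<alpha>))" .
   also have "... \<le> ?H"
   proof (intro mult_mono mult_left_mono)
    have "2 * \<kappa> * exp (- g / 2) \<le> 2 * \<kappa> * \<tau>" using exps(1) k by (intro mult_left_mono) auto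
    then show "\<rho> / ?\<alpha> \<le> 2 * \<kappa> * \<tau>" using \<rho>(3) by linarith
    have "1 \<le> \<gamma> / ?\<alpha>" using \<gamma> \<alpha> b1 by simp
    then have "0 \<le> ln (\<gamma> / ?\<alpha>)" by (rule ln_ge_zero)
    then show "0 \<le> 1 + ln (\<gamma> / ?\<alpha>)" by simp
   qed (use C1(1) L k \<tau> \<rho>(1) b1 in auto)
   finally show ?thesis .
  qed
  have Qnn: "T0 \<le> nn q \<and> nn q < \<beta>" if "q \<in> Q" for q using that Q by (auto simp: shell_def)
  have finQ: "finite Q" using Q finite_shell by (rule finite_subset)
  have Q'nn: "T0 \<le> nn q" if "q \<in> ?Q'" for q using that \<alpha> \<beta> by (auto simp: shell_def)
  have bh: "b q i \<le> 1/2" if "q \<in> Q \<union> ?Q'" for q i using that Qnn Q'nn by (intro b_le_half) auto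
  have D\<tau>: "1 / real (D i) \<le> \<tau> * b q i" if "q \<in> Q" for q i
  proof -
   have "1 / real (D i) \<le> 1 / (\<beta> powr (\<omega> $ i) / (\<tau> * \<theta> $ i))" using D(1)[of i] D(2)[of i] X[of i] by (intro divide_left_mono mult_pos_pos) auto
   also have "... = \<tau> * (\<theta> $ i * \<beta> powr (- (\<omega> $ i)))" by (simp add: powr_minus field_simps)
   also have "... \<le> \<tau> * b q i" unfolding b_def
    using Qnn[OF that] T0_ge_1 \<tau> \<theta>_pos[of i] \<omega>_pos[of i] by (intro mult_left_mono powr_mono2') auto
   finally show ?thesis .
  qed
  have nest: "(\<forall>i. b q i \<le> b q' i) \<or> (\<forall>i. b q' i \<le> b q i)" if "q \<in> ?Q'" "q' \<in> ?Q'" for q q'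
  proof -
   have "nn q > 0" "nn q' > 0" using Q'nn[OF that(1)] Q'nn[OF that(2)] T0_ge_1 by auto
   then show ?thesis using b_antimono[of q q'] b_antimono[of q' q] by (meson linear)
  qed
  have main: "(\<integral>u. norm ((\<integral>x. phase b Q s a u x * phase b ?Q' s a' u x \<partial>trow)
    - (\<integral>x. phase b Q s a u x \<partial>trow) * (\<integral>x. phase b ?Q' s a' u x \<partial>trow)) \<partial>tmat)
   \<le> \<bar>s\<bar> * ?H + 2 * (\<bar>s\<bar> * ((\<Sum>q\<in>Q. \<Prod>i\<in>UNIV. 2 * b q i) * ((1 + \<tau>) ^ ?m - (1 - \<tau>) ^ ?m)))
    + sqrt ((\<Prod>i\<in>UNIV. real (D i)) / real P ^ ?n)"
   by (rule phase_decoupling[OF finQ finite_shell b_nonneg bh nest D(1) _ \<tau>(2) D\<tau> P(1) H]) (use \<tau> in auto)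
  have t1: "\<bar>s\<bar> * ?H \<le> (C1 * (2 * \<kappa>)) * ((1 + \<bar>s\<bar>) * (1 + ln \<gamma>) * \<tau>)"
  proof -
   have "\<bar>s\<bar> * ?H = (C1 * (2 * \<kappa>)) * (\<bar>s\<bar> * (1 + ln \<gamma>) * \<tau>)" by (simp add: ac_simps)
   also have "... \<le> (C1 * (2 * \<kappa>)) * ((1 + \<bar>s\<bar>) * (1 + ln \<gamma>) * \<tau>)"
    using C1 k \<tau> L\<beta> by (intro mult_left_mono mult_right_mono) auto
   finally show ?thesis .
  qed
  have t2: "2 * (\<bar>s\<bar> * ((\<Sum>q\<in>Q. \<Prod>i\<in>UNIV. 2 * b q i) * ((1 + \<tau>) ^ ?m - (1 - \<tau>) ^ ?m)))
   \<le> (2 * (C2 * (real ?m * 2 ^ ?m))) * ((1 + \<bar>s\<bar>) * (1 + ln \<gamma>) * \<tau>)"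
  proof -
   have "(\<Sum>q\<in>Q. \<Prod>i\<in>UNIV. 2 * b q i) \<le> (\<Sum>q\<in>shell T0 \<beta>. v q)"
    unfolding v_def[symmetric] by (rule sum_mono2[OF finite_shell Q]) (rule v_nonneg)
   also have "... \<le> C2 * (1 + ln (\<beta> / T0))" by (rule C2(2)[OF T0_ge_1 \<beta>])
   also have "... \<le> C2 * (1 + ln \<gamma>)"
   proof -
    have "ln (\<beta> / T0) \<le> ln \<beta>" using b1 T0_ge_1 by (subst ln_div) auto
    then show ?thesis using L\<beta> C2 by (intro mult_left_mono) auto
   qed
   finally have s1: "(\<Sum>q\<in>Q. \<Prod>i\<in>UNIV. 2 * b q i) \<le> C2 * (1 + ln \<gamma>)" .
   have "(1 + \<tau>) ^ ?m - (1 - \<tau>) ^ ?m \<le> real ?m * ((1 + \<tau>) - (1 - \<tau>)) * (1 + \<tau>) ^ (?m - 1)"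
    using \<tau> by (intro power_diff_le) auto
   also have "... \<le> real ?m * (2 * \<tau>) * 2 ^ (?m - 1)" using \<tau> by (intro mult_mono power_mono) auto
   also have "... = real ?m * 2 ^ ?m * \<tau>"
   proof -
    have "(2::real) ^ ?m = 2 * 2 ^ (?m - 1)" using card_m by (metis Suc_diff_1 power_Suc zero_less_card_finite)
    then show ?thesis by simp
   qed
   finally have s2: "(1 + \<tau>) ^ ?m - (1 - \<tau>) ^ ?m \<le> real ?m * 2 ^ ?m * \<tau>" .
   have s3: "0 \<le> (1 + \<tau>) ^ ?m - (1 - \<tau>) ^ ?m" using \<tau> by (simp add: power_mono)
   have "2 * (\<bar>s\<bar> * ((\<Sum>q\<in>Q. \<Prod>i\<in>UNIV. 2 * b q i) * ((1 + \<tau>) ^ ?m - (1 - \<tau>) ^ ?m)))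
    \<le> 2 * ((1 + \<bar>s\<bar>) * ((C2 * (1 + ln \<gamma>)) * (real ?m * 2 ^ ?m * \<tau>)))"
    by (rule mult_left_mono, rule mult_mono, simp, rule mult_mono[OF s1 s2])
     (use C2 L\<beta> s3 b_nonneg in \<open>auto intro!: mult_nonneg_nonneg sum_nonneg prod_nonneg\<close>)
   then show ?thesis by (simp add: ac_simps)
  qed
  have t3: "sqrt ((\<Prod>i\<in>UNIV. real (D i)) / real P ^ ?n) \<le> sqrt E * ((1 + \<bar>s\<bar>) * (1 + ln \<gamma>) * \<tau>)"
  proof -
   have "(\<Prod>i\<in>UNIV. real (D i)) \<le> (\<Prod>i\<in>UNIV. (1 + 1 / \<theta> $ i) * (\<beta> powr (\<omega> $ i) * (1 / \<tau>)))"
   proof (intro prod_mono conjI)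
    fix i
    have "1 * 1 \<le> \<beta> powr (\<omega> $ i) * (1 / \<tau>)" using b1 \<omega>_pos[of i] \<tau> by (intro mult_mono) (auto simp: ge_one_powr_ge_zero)
    moreover have "\<beta> powr (\<omega> $ i) / (\<tau> * \<theta> $ i) = (1 / \<theta> $ i) * (\<beta> powr (\<omega> $ i) * (1 / \<tau>))" by simp
    ultimately have "real (D i) \<le> \<beta> powr (\<omega> $ i) * (1 / \<tau>) + (1 / \<theta> $ i) * (\<beta> powr (\<omega> $ i) * (1 / \<tau>))"
     using D(3)[of i] by linarith
    then show "real (D i) \<le> (1 + 1 / \<theta> $ i) * (\<beta> powr (\<omega> $ i) * (1 / \<tau>))"
     by (simp only: distrib_right mult_1_left)
   qed simp
   also have "... = E * (\<beta> ^ ?n * (1 / \<tau>) ^ ?m)"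
    using b1 unfolding E_def by (simp only: prod.distrib prod_powr_\<omega> prod_constant)
   also have "(1 / \<tau>) ^ ?m = exp (g / 4)"
   proof -
    have "(1 / \<tau>) ^ ?m = exp (real ?m * (c * g))" unfolding \<tau>_def by (simp add: exp_minus exp_of_nat_mult inverse_eq_divide)
    also have "real ?m * (c * g) = g / 4" unfolding c_def using m0 by simp
    finally show ?thesis .
   qed
   finally have up: "(\<Prod>i\<in>UNIV. real (D i)) \<le> E * (\<beta> ^ ?n * exp (g / 4))" .
   have lo: "\<beta> ^ ?n * exp (g / 2) \<le> real P ^ ?n"
   proof -
    have "exp (g / 2) \<le> exp (g / 2) ^ ?n" using n gp self_le_power[of "exp (g/2)" ?n] by simp
    then have "\<beta> ^ ?n * exp (g / 2) \<le> \<beta> ^ ?n * exp (g / 2) ^ ?n" using b1 by (intro mult_left_mono) auto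
    also have "... = (\<beta> * exp (g / 2)) ^ ?n" by (simp add: power_mult_distrib)
    also have "... \<le> real P ^ ?n" using P(2) be by (intro power_mono) auto
    finally show ?thesis .
   qed
   have "(\<Prod>i\<in>UNIV. real (D i)) / real P ^ ?n \<le> E * (\<beta> ^ ?n * exp (g / 4)) / (\<beta> ^ ?n * exp (g / 2))"
    using up lo b1 E0 by (intro frac_le) auto
   also have "... = E * (exp (- g / 8))\<^sup>2"
   proof -
    have "exp (g / 2) = exp (g / 4) * exp (g / 4)" "(exp (- g / 8))\<^sup>2 * exp (g / 4) = 1"
     by (simp_all add: exp_add[symmetric] power2_eq_square)
    then show ?thesis using b1 by (simp add: field_simps)
   qed
   finally have "sqrt ((\<Prod>i\<in>UNIV. real (D i)) / real P ^ ?n) \<le> sqrt (E * (exp (- g / 8))\<^sup>2)" by (rule real_sqrt_le_mono)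
   also have "... = sqrt E * exp (- g / 8)" by (simp add: real_sqrt_mult)
   also have "... \<le> sqrt E * \<tau>" using exps E0 by (intro mult_left_mono) auto
   also have "... \<le> sqrt E * ((1 + \<bar>s\<bar>) * (1 + ln \<gamma>) * \<tau>)"
   proof (intro mult_left_mono)
    have "1 * 1 \<le> (1 + \<bar>s\<bar>) * (1 + ln \<gamma>)" using L\<beta> by (intro mult_mono) auto
    then show "\<tau> \<le> (1 + \<bar>s\<bar>) * (1 + ln \<gamma>) * \<tau>" using \<tau> by simp
   qed (use E0 in auto)
   finally show ?thesis .
  qed
  have "C * (1 + \<bar>s\<bar>) * (1 + ln \<gamma>) * exp (- c * g) = C * ((1 + \<bar>s\<bar>) * (1 + ln \<gamma>) * \<tau>)" by (simp add: \<tau>_def)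
  also have "... = (C1 * (2 * \<kappa>)) * ((1 + \<bar>s\<bar>) * (1 + ln \<gamma>) * \<tau>) + (2 * (C2 * (real ?m * 2 ^ ?m))) * ((1 + \<bar>s\<bar>) * (1 + ln \<gamma>) * \<tau>)
    + sqrt E * ((1 + \<bar>s\<bar>) * (1 + ln \<gamma>) * \<tau>)" unfolding C_def by (simp only: distrib_right)
  finally show ?thesis using main t1 t2 t3 by linarith
 qed
 then show ?thesis by (rule that[OF C c(1) g0])
qed

end

section \<open>Correlations of frequencies\<close>

definition int_scale :: "int => int ^ 'n => int ^ 'n" where "int_scale c r = (\<chi> j. c * r $ j)"

definition common_direction :: "int ^ 'n => int ^ 'n => (int ^ 'n) \<times> int \<times> int => bool" where
 "common_direction r r' = (\<lambda>(r0, c, c'). r = int_scale c r0 \<and> r' = int_scale c' r0 \<and> r0 \<noteq> 0 \<and> c \<noteq> 0 \<and> c' \<noteq> 0 \<and> coprime c c')"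

text \<open>The multipliers are two corresponding coordinates, divided by their greatest common
  divisor.\<close>
lemma common_direction_exists:
 fixes r r' :: "int ^ 'n"
 assumes r: "r \<noteq> 0" "r' \<noteq> 0" and par: "!!a b. r $ a * r' $ b = r $ b * r' $ a"
 shows "\<exists>t. common_direction r r' t"
proof -
 have "\<exists>a. r $ a \<noteq> 0" using r(1) by (metis vec_eq_iff zero_index)
 then obtain a where a: "r $ a \<noteq> 0" by blast
 have a': "r' $ a \<noteq> 0"
 proof
  assume 0: "r' $ a = 0"
  have "r' $ b = 0" for b using par[of a b] a 0 by simp
  then show False using r(2) by (metis vec_eq_iff zero_index)
 qed
 define e where "e = gcd (r $ a) (r' $ a)"
 define c where "c = r $ a div e"
 define c' where "c' = r' $ a div e"
 have e: "e \<noteq> 0" "r $ a = c * e" "r' $ a = c' * e" using a by (auto simp: e_def c_def c'_def)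
 have cop: "coprime c c'" unfolding c_def c'_def e_def by (rule div_gcd_coprime) (use a in simp)
 have c: "c \<noteq> 0" "c' \<noteq> 0" using a a' e by auto
 have cross: "c * r' $ b = c' * r $ b" for b
 proof -
  have "e * (c * r' $ b) = e * (c' * r $ b)" using par[of a b] unfolding e(2,3) by (simp add: ac_simps)
  then show ?thesis using e(1) by simp
 qed
 have dv: "c dvd r $ b" for b
 proof -
  have "c dvd c' * r $ b" using cross[of b] by (metis dvd_triv_left)
  then show ?thesis using cop coprime_dvd_mult_right_iff by blast
 qed
 define r0 where "r0 = (\<chi> j. r $ j div c)"
 have 1: "r = int_scale c r0" using dv by (simp add: r0_def vec_eq_iff int_scale_def)
 have 2: "r' = int_scale c' r0"
 proof -
  have "c * r' $ j = c * (c' * (r $ j div c))" for j using cross[of j] dv[of j] by (simp add: mult.left_commute)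
  then show ?thesis using c(1) by (simp add: vec_eq_iff r0_def int_scale_def)
 qed
 have "r0 \<noteq> 0" using 1 r(1) by (auto simp: vec_eq_iff int_scale_def)
 then show ?thesis using 1 2 c cop by (intro exI[of _ "(r0, c, c')"]) (simp add: common_direction_def)
qed

lemma (in prob_space) expectation_product_shifted:
 fixes Y Z :: "'a => real"
 assumes "integrable M Y" "integrable M Z" "integrable M (\<lambda>x. Y x * Z x)"
 shows "expectation (\<lambda>x. (Y x - y) * (Z x - z)) = expectation (\<lambda>x. Y x * Z x) - z * expectation Y - y * expectation Z + y * z"
proof -
 have "expectation (\<lambda>x. (Y x - y) * (Z x - z)) = expectation (\<lambda>x. Y x * Z x - z * Y x - y * Z x + y * z)"
  by (rule Bochner_Integration.integral_cong) (auto simp: algebra_simps)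
 also have "... = expectation (\<lambda>x. Y x * Z x) - z * expectation Y - y * expectation Z + y * z"
  using assms prob_space by simp
 finally show ?thesis .
qed

lemma (in prob_space) integrable_product_shifted:
 fixes Y Z :: "'a => real"
 assumes "integrable M Y" "integrable M Z" "integrable M (\<lambda>x. Y x * Z x)"
 shows "integrable M (\<lambda>x. (Y x - y) * (Z x - z))"
proof -
 have "integrable M (\<lambda>x. Y x * Z x - z * Y x - y * Z x + y * z)" using assms by simp
 moreover have "(\<lambda>x. (Y x - y) * (Z x - z)) = (\<lambda>x. Y x * Z x - z * Y x - y * Z x + y * z)" by (auto simp: algebra_simps)
 ultimately show ?thesis by simp
qed

lemma prod_excess_le:
 fixes w :: "'m::finite => real"
 assumes w: "!!i. 0 \<le> w i" "!!i. w i \<le> 1" and d: "0 \<le> d" "d \<le> 1"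
  and \<epsilon>: "!!i. (\<Prod>j\<in>UNIV - {i}. w j) \<le> \<epsilon>" "0 \<le> \<epsilon>"
 shows "(\<Prod>i\<in>UNIV. (w i)\<^sup>2 + w i * d) \<le> (\<Prod>i\<in>UNIV. (w i)\<^sup>2) + 2 ^ CARD('m) * (\<Prod>i\<in>UNIV. w i) * (d\<^sup>2 + d * \<epsilon>)"
proof -
 let ?W = "\<Prod>i\<in>UNIV. w i"
 have W: "0 \<le> ?W" using w by (intro prod_nonneg) auto
 have term_le: "(\<Prod>i\<in>X. d) * (\<Prod>i\<in>UNIV - X. w i) \<le> (if X = {} then ?W else 0) + (d\<^sup>2 + d * \<epsilon>)" for X :: "'m set"
 proof -
  have e0: "0 \<le> d\<^sup>2 + d * \<epsilon>" using d \<epsilon>(2) by simp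
  have P: "0 \<le> (\<Prod>i\<in>UNIV - X. w i)" "(\<Prod>i\<in>UNIV - X. w i) \<le> 1" using w by (auto intro!: prod_nonneg prod_le_1)
  consider "X = {}" | i where "X = {i}" | "card X \<ge> 2"
   by (metis One_nat_def Suc_1 card_0_eq card_1_singletonE finite_code le_less_linear less_2_cases_iff less_Suc_eq)
  then show ?thesis
  proof cases
   case 1 then show ?thesis using e0 by simp
  next
   case 2
   then have "(\<Prod>i\<in>X. d) * (\<Prod>i\<in>UNIV - X. w i) \<le> d * \<epsilon>" using \<epsilon>(1) d by (simp add: mult_left_mono)
   then show ?thesis using 2 by (simp add: add_increasing)
  next
   case 3
   then have "d ^ card X \<le> d\<^sup>2" using d by (intro power_decreasing) auto
   then have "(\<Prod>i\<in>X. d) * (\<Prod>i\<in>UNIV - X. w i) \<le> d\<^sup>2 * 1" using P d by (intro mult_mono) auto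
   moreover have "0 \<le> d * \<epsilon>" using d \<epsilon>(2) by simp
   ultimately show ?thesis using W by auto
  qed
 qed
 have "(\<Prod>i\<in>UNIV. d + w i) = (\<Sum>X\<in>Pow UNIV. (\<Prod>i\<in>X. d) * (\<Prod>i\<in>UNIV - X. w i))"
  by (rule prod_add) simp
 also have "... \<le> (\<Sum>X\<in>(Pow UNIV :: 'm set set). (if X = {} then ?W else 0) + (d\<^sup>2 + d * \<epsilon>))" by (rule sum_mono) (rule term_le)
 also have "... = ?W + 2 ^ CARD('m) * (d\<^sup>2 + d * \<epsilon>)" by (simp add: sum.distrib card_Pow)
 finally have "(\<Prod>i\<in>UNIV. d + w i) \<le> ?W + 2 ^ CARD('m) * (d\<^sup>2 + d * \<epsilon>)" .
 then have "?W * (\<Prod>i\<in>UNIV. d + w i) \<le> ?W * (?W + 2 ^ CARD('m) * (d\<^sup>2 + d * \<epsilon>))" using W by (rule mult_left_mono)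
 moreover have "?W * (\<Prod>i\<in>UNIV. d + w i) = (\<Prod>i\<in>UNIV. (w i)\<^sup>2 + w i * d)"
  unfolding prod.distrib[symmetric] by (intro prod.cong refl) (simp add: power2_eq_square algebra_simps)
 moreover have "?W * ?W = (\<Prod>i\<in>UNIV. (w i)\<^sup>2)"
  unfolding prod.distrib[symmetric] by (simp add: power2_eq_square)
 ultimately show ?thesis by (simp add: distrib_left ac_simps)
qed

lemma (in norm_setting) nn_int_scale: "nn (int_scale c q) = \<bar>of_int c\<bar> * nn q"
 unfolding int_scale_def by (rule nn_scale)

context clt_setting
begin

text \<open>Positive because there are at least two rows with positive weights.\<close>
definition ka :: real where "ka = min 1 (Min (range (\<lambda>i. \<Sum>j\<in>UNIV - {i}. \<omega> $ j)))"

lemma ka: "0 < ka" "ka \<le> 1" "ka \<le> (\<Sum>j\<in>UNIV - {i}. \<omega> $ j)"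
proof -
 have "0 < (\<Sum>j\<in>UNIV - {i}. \<omega> $ j)" for i
 proof (rule sum_pos)
  show "UNIV - {i} \<noteq> ({} :: 'm set)"
  proof
   assume "UNIV - {i} = ({} :: 'm set)"
   then have "(UNIV :: 'm set) \<subseteq> {i}" by blast
   then have "CARD('m) \<le> 1" using card_mono[of "{i}" UNIV] by simp
   then show False using card_m by simp
  qed
 qed (simp_all add: \<omega>_pos)
 then show "0 < ka" unfolding ka_def by simp
 show "ka \<le> 1" by (simp add: ka_def)
 show "ka \<le> (\<Sum>j\<in>UNIV - {i}. \<omega> $ j)" unfolding ka_def by (rule min.coboundedI2) (auto intro: Min_le)
qed

text \<open>A measure of the dependence of the products with \<open>r\<close> and \<open>r'\<close>: it
  vanishes unless they are parallel and decays with their coprime multipliers. These are unique up to sign,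
  which is why an arbitrary choice is harmless.\<close>
definition corr :: "int ^ 'n => int ^ 'n => real" where
 "corr r r' = (if \<exists>t. common_direction r r' t
  then (case SOME t. common_direction r r' t of (r0, c, c') => \<bar>of_int (c * c')\<bar> powr (- (1 + ka) / 2)) else 0)"

lemma corr_nonneg: "0 \<le> corr r r'"
 by (simp add: corr_def split: prod.split)

text \<open>If \<open>r\<close> and \<open>r'\<close> are parallel, row \<open>i\<close> contributes its
  product of volumes plus the error term for coprime dilations. In the expanded product over the rows, a term
  with a single error factor keeps the full volumes of all other rows. These decay like a power of \<open>nn q
  * nn q'\<close> with exponent at least \<open>ka\<close>, up to a constant factor, and \<open>|c c'|\<close>
  is at most a constant times this product of norms; hence the gain of \<open>ka / 2\<close> over the exponent
  \<open>1/2\<close> in \<open>corr\<close>.\<close>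
lemma two_point_excess: obtains C where "C > 0"
 "!!q q' r r'. T0 \<le> nn q ==> T0 \<le> nn q' ==> r \<noteq> 0 ==> r' \<noteq> 0 ==> nn r \<le> 2 * nn q ==> nn r' \<le> 2 * nn q' ==>
  \<exists>B. (\<forall>i. two_point_bound (b q i) (b q' i) r r' (B i)) \<and> (\<forall>i. 0 \<le> B i) \<and>
   (\<Prod>i\<in>UNIV. B i) \<le> v q * v q' + C * (sqrt (v q) * sqrt (v q') * corr r r')"
proof -
 obtain c0 where c0: "c0 > 0" "!!q. q \<noteq> 0 ==> c0 \<le> nn q" using nn_lower by blast
 define K where "K = (\<Sum>i\<in>UNIV. \<Prod>j\<in>UNIV - {i}. 2 * \<theta> $ j)"
 have K: "0 \<le> K" unfolding K_def using \<theta>_pos by (intro sum_nonneg prod_nonneg) (auto intro: less_imp_le)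
 define C where "C = 2 ^ CARD('m) * (1 + K * (c0\<^sup>2 / 4) powr (- ka / 2))"
 have C: "C > 0" unfolding C_def using K by (intro mult_pos_pos add_pos_nonneg) auto
 have "\<exists>B. (\<forall>i. two_point_bound (b q i) (b q' i) r r' (B i)) \<and> (\<forall>i. 0 \<le> B i) \<and>
   (\<Prod>i\<in>UNIV. B i) \<le> v q * v q' + C * (sqrt (v q) * sqrt (v q') * corr r r')"
  if q: "T0 \<le> nn q" "T0 \<le> nn q'" and r: "r \<noteq> 0" "r' \<noteq> 0" and rq: "nn r \<le> 2 * nn q" "nn r' \<le> 2 * nn q'" for q q' r r'
 proof -
  have bh: "b q i \<le> 1/2" "b q' i \<le> 1/2" for i by (rule b_le_half[OF q(1)], rule b_le_half[OF q(2)])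
  have bint: "integral\<^sup>L circ (near_int (b q i)) = 2 * b q i" "integral\<^sup>L circ (near_int (b q' i)) = 2 * b q' i" for i
   using bh b_nonneg by (auto intro: integral_near_int)
  define z where "z i = 4 * b q i * b q' i" for i
  have z0: "0 \<le> z i" for i by (simp add: z_def b_nonneg)
  have zprod: "(\<Prod>i\<in>UNIV. z i) = v q * v q'" unfolding z_def v_def prod.distrib[symmetric] by (intro prod.cong) auto
  show ?thesis
  proof (cases "\<exists>t. common_direction r r' t")
   case False
   then obtain a a' where np: "r $ a * r' $ a' \<noteq> r $ a' * r' $ a" using common_direction_exists[OF r] by blast
   have "two_point_bound (b q i) (b q' i) r r' (z i)" for i
    unfolding two_point_bound_def
   proof (intro allI)
    fix s s'
    have sh: "integral\<^sup>L circ (\<lambda>y. near_int c (s + y)) = integral\<^sup>L circ (near_int c)" for c s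
     by (rule integral_circ_shift[OF circle_fun_near_int])
    have "(\<integral>w. near_int (b q i) (s + rdot w r) * near_int (b q' i) (s' + rdot w r') \<partial>trow)
     = integral\<^sup>L circ (near_int (b q i)) * integral\<^sup>L circ (near_int (b q' i))"
     by (rule integral_row_dot2_nonparallel[OF circle_fun_near_int circle_fun_near_int np])
    then show "(\<integral>w. near_int (b q i) (s + rdot w r) * near_int (b q' i) (s' + rdot w r') \<partial>trow) \<le> z i"
     by (simp add: bint z_def)
   qed
   then show ?thesis using z0 zprod False by (intro exI[of _ z]) (simp add: corr_def)
  next
   case True
   define t where "t = (SOME t. common_direction r r' t)"
   have t: "common_direction r r' t" unfolding t_def using True by (rule someI_ex)
   obtain r0 c c' where tt: "t = (r0, c, c')" by (cases t)
   have cd: "r = int_scale c r0" "r' = int_scale c' r0" "r0 \<noteq> 0" "c \<noteq> 0" "c' \<noteq> 0" "coprime c c'"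
    using t unfolding tt common_direction_def by auto
   define D where "D = \<bar>real_of_int (c * c')\<bar>"
   have "1 \<le> \<bar>c * c'\<bar>" using cd(4,5) by (metis abs_of_nonneg abs_zero int_one_le_iff_zero_less mult_eq_0_iff zero_less_abs_iff)
   then have D1: "1 \<le> D" unfolding D_def by linarith
   have corr: "corr r r' = D powr (- (1 + ka) / 2)" using True tt by (simp add: corr_def t_def[symmetric] D_def)
   define w where "w i = sqrt (z i)" for i
   define d where "d = 1 / sqrt D"
   have d: "0 \<le> d" "d \<le> 1" using D1 by (auto simp: d_def)
   have w: "0 \<le> w i" "w i \<le> 1" "(w i)\<^sup>2 = z i" for i
   proof -
    show "0 \<le> w i" "(w i)\<^sup>2 = z i" using z0 by (auto simp: w_def)
    have "z i \<le> 4 * (1/2) * (1/2)" unfolding z_def using bh b_nonneg by (intro mult_mono) auto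
    then show "w i \<le> 1" by (simp add: w_def)
   qed
   define X where "X = nn q * nn q'"
   have q1: "1 \<le> nn q" "1 \<le> nn q'" using q T0_ge_1 by auto
   then have X1: "1 \<le> X" unfolding X_def using mult_mono[of 1 "nn q" 1 "nn q'"] by simp
   define \<epsilon> where "\<epsilon> = K * X powr (- ka / 2)"
   have \<epsilon>0: "0 \<le> \<epsilon>" using K by (simp add: \<epsilon>_def)
   have weq: "w i = 2 * \<theta> $ i * X powr (- (\<omega> $ i) / 2)" for i
   proof -
    have "z i = (2 * \<theta> $ i)\<^sup>2 * X powr (- (\<omega> $ i))"
     unfolding z_def b_def X_def using q1 by (simp add: powr_mult power2_eq_square)
    moreover have "X powr (- (\<omega> $ i)) = (X powr (- (\<omega> $ i) / 2))\<^sup>2"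
     using X1 by (simp add: power2_eq_square powr_add[symmetric])
    ultimately show ?thesis unfolding w_def using \<theta>_pos[of i] by (simp add: real_sqrt_mult)
   qed
   have \<epsilon>: "(\<Prod>j\<in>UNIV - {i}. w j) \<le> \<epsilon>" for i
   proof -
    have "(\<Prod>j\<in>UNIV - {i}. w j) = (\<Prod>j\<in>UNIV - {i}. 2 * \<theta> $ j) * (\<Prod>j\<in>UNIV - {i}. X powr (- (\<omega> $ j) / 2))"
     unfolding weq by (rule prod.distrib)
    also have "(\<Prod>j\<in>UNIV - {i}. X powr (- (\<omega> $ j) / 2)) = X powr (\<Sum>j\<in>UNIV - {i}. - (\<omega> $ j) / 2)"
     using X1 by (simp add: powr_sum)
    also have "(\<Sum>j\<in>UNIV - {i}. - (\<omega> $ j) / 2) = - (\<Sum>j\<in>UNIV - {i}. \<omega> $ j) / 2"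
     by (simp add: sum_divide_distrib[symmetric] sum_negf)
    also have "(\<Prod>j\<in>UNIV - {i}. 2 * \<theta> $ j) * X powr (- (\<Sum>j\<in>UNIV - {i}. \<omega> $ j) / 2) \<le> K * X powr (- ka / 2)"
    proof (rule mult_mono)
     show "(\<Prod>j\<in>UNIV - {i}. 2 * \<theta> $ j) \<le> K" unfolding K_def
      by (rule member_le_sum) (use \<theta>_pos in \<open>auto intro!: prod_nonneg intro: less_imp_le\<close>)
     show "X powr (- (\<Sum>j\<in>UNIV - {i}. \<omega> $ j) / 2) \<le> X powr (- ka / 2)"
      using ka(3)[of i] X1 by (intro powr_mono) auto
    qed (use K in auto)
    finally show ?thesis by (simp add: \<epsilon>_def)
   qed
   define B where "B i = (w i)\<^sup>2 + w i * d" for i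
   have B0: "0 \<le> B i" for i unfolding B_def using w(1) d(1) by (intro add_nonneg_nonneg mult_nonneg_nonneg) auto
   have tp: "two_point_bound (b q i) (b q' i) r r' (B i)" for i
    unfolding two_point_bound_def
   proof (intro allI)
    fix s s'
    have "(\<integral>w. near_int (b q i) (s + rdot w r) * near_int (b q' i) (s' + rdot w r') \<partial>trow)
     \<le> 4 * b q i * b q' i + sqrt (4 * b q i * b q' i / \<bar>of_int (c * c')\<bar>)"
     unfolding cd(1,2) int_scale_def by (rule integral_row_near_int2_parallel[OF cd(3-6) b_nonneg b_nonneg])
    also have "... = B i" unfolding B_def w(3) z_def[symmetric] D_def[symmetric] by (simp add: w_def d_def real_sqrt_divide)
    finally show "(\<integral>w. near_int (b q i) (s + rdot w r) * near_int (b q' i) (s' + rdot w r') \<partial>trow) \<le> B i" .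
   qed
   have Wp: "(\<Prod>i\<in>UNIV. w i) = sqrt (v q) * sqrt (v q')"
   proof -
    have "(\<Prod>i\<in>S. sqrt (z i)) = sqrt (\<Prod>i\<in>S. z i)" if "finite S" for S
     using that by induction (auto simp: real_sqrt_mult)
    then show ?thesis unfolding w_def real_sqrt_mult[symmetric] zprod[symmetric] by simp
   qed
   have "(\<Prod>i\<in>UNIV. B i) \<le> (\<Prod>i\<in>UNIV. (w i)\<^sup>2) + 2 ^ CARD('m) * (\<Prod>i\<in>UNIV. w i) * (d\<^sup>2 + d * \<epsilon>)"
    unfolding B_def by (rule prod_excess_le[OF w(1,2) d \<epsilon> \<epsilon>0])
   also have "(\<Prod>i\<in>UNIV. (w i)\<^sup>2) = v q * v q'" by (simp add: w(3) zprod)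
   finally have up: "(\<Prod>i\<in>UNIV. B i) \<le> v q * v q' + 2 ^ CARD('m) * (sqrt (v q) * sqrt (v q')) * (d\<^sup>2 + d * \<epsilon>)" by (simp only: Wp)
   have de: "d\<^sup>2 + d * \<epsilon> \<le> (1 + K * (c0\<^sup>2 / 4) powr (- ka / 2)) * D powr (- (1 + ka) / 2)"
   proof -
    have "d\<^sup>2 = D powr (- 1)" using D1 by (simp add: d_def power_divide powr_minus_divide)
    also have "... \<le> D powr (- (1 + ka) / 2)" using D1 ka(2) by (intro powr_mono) auto
    finally have 1: "d\<^sup>2 \<le> D powr (- (1 + ka) / 2)" .
    have dd: "d = D powr (- 1 / 2)" using D1 by (simp add: d_def powr_minus_divide powr_half_sqrt)
    have "c0\<^sup>2 / 4 * D \<le> X"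
    proof -
     have "\<bar>of_int c\<bar> * c0 \<le> 2 * nn q" using rq(1) c0(2)[OF cd(3)] mult_left_mono[of c0 "nn r0" "\<bar>of_int c\<bar>"]
      unfolding cd(1) nn_int_scale by linarith
     moreover have "\<bar>of_int c'\<bar> * c0 \<le> 2 * nn q'" using rq(2) c0(2)[OF cd(3)] mult_left_mono[of c0 "nn r0" "\<bar>of_int c'\<bar>"]
      unfolding cd(2) nn_int_scale by linarith
     ultimately have "(\<bar>of_int c\<bar> * c0) * (\<bar>of_int c'\<bar> * c0) \<le> (2 * nn q) * (2 * nn q')"
      by (rule mult_mono) (use c0(1) nn_nonneg in auto)
     then show ?thesis by (simp add: D_def X_def abs_mult power2_eq_square ac_simps)
    qed
    then have "X powr (- ka / 2) \<le> (c0\<^sup>2 / 4 * D) powr (- ka / 2)"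
     using ka(1) c0(1) D1 by (intro powr_mono2') auto
    also have "... = (c0\<^sup>2 / 4) powr (- ka / 2) * D powr (- ka / 2)" by (subst powr_mult) (use D1 in auto)
    finally have "d * \<epsilon> \<le> d * (K * ((c0\<^sup>2 / 4) powr (- ka / 2) * D powr (- ka / 2)))"
     unfolding \<epsilon>_def using d K by (intro mult_left_mono) auto
    also have "d * (K * ((c0\<^sup>2 / 4) powr (- ka / 2) * D powr (- ka / 2)))
     = K * (c0\<^sup>2 / 4) powr (- ka / 2) * (D powr (- 1 / 2) * D powr (- ka / 2))" unfolding dd by (simp only: ac_simps)
    also have "D powr (- 1 / 2) * D powr (- ka / 2) = D powr (- (1 + ka) / 2)"
     unfolding powr_add[symmetric] by (simp add: field_simps)
    finally show ?thesis using 1 by (simp only: distrib_right mult_1_left)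
   qed
   have s0: "0 \<le> sqrt (v q) * sqrt (v q')" using v_nonneg by simp
   have "2 ^ CARD('m) * (sqrt (v q) * sqrt (v q')) * (d\<^sup>2 + d * \<epsilon>)
    \<le> 2 ^ CARD('m) * (sqrt (v q) * sqrt (v q')) * ((1 + K * (c0\<^sup>2 / 4) powr (- ka / 2)) * D powr (- (1 + ka) / 2))"
    using de s0 by (intro mult_left_mono) auto
   also have "... = C * (sqrt (v q) * sqrt (v q') * corr r r')" unfolding C_def corr by (simp only: ac_simps)
   finally show ?thesis using up tp B0 by (intro exI[of _ B]) auto
  qed
 qed
 then show ?thesis by (rule that[OF C])
qed

abbreviation X :: "int ^ 'n => ('m => 'n => real) => ('m => real) => real" where
 "X q \<equiv> box_hit (b q) q"

lemma X_bound: "norm (X q u x) \<le> 1" "\<bar>X q u x\<bar> \<le> 1"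
 using box_hit_nonneg[of "b q" q u x] box_hit_le_1[of "b q" q u x] by auto

lemma integral_X: "T0 \<le> nn q ==> (\<integral>x. X q u x \<partial>trow) = v q"
 unfolding v_def by (rule integral_box_hit) (rule b_nonneg, rule b_le_half)

lemma X_idem: "X q u x * X q u x = X q u x"
proof -
 have "box_hit c p u x = 0 \<or> box_hit c p u x = 1" for c :: "'m => real" and p :: "int ^ 'n"
 proof (cases "\<exists>i. near_int (c i) (rdot (u i) p + x i) = 0")
  case True then show ?thesis unfolding box_hit_def torus_prod_def by (auto intro: prod_zero)
 next
  case False
  then have "near_int (c i) (rdot (u i) p + x i) = 1" for i by (auto simp: near_int_def split: if_splits)
  then show ?thesis by (simp add: box_hit_def torus_prod_def)
 qed
 then show ?thesis by (metis mult_cancel_left2 mult_zero_left)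
qed

text \<open>Ordering pairs by norm bounds the difference of the two frequencies by twice the norm of the
  second one.\<close>
definition upper_pairs :: "(int ^ 'n) set => int ^ 'n => (int ^ 'n) set" where
 "upper_pairs Q q1 = {q \<in> Q. q \<noteq> q1 \<and> nn q1 \<le> nn q}"

definition corr_sum :: "(int ^ 'n) set => (int ^ 'n) set => int ^ 'n => int ^ 'n => real" where
 "corr_sum Q Q' q1 q3 = (\<Sum>q2\<in>upper_pairs Q q1. \<Sum>q4\<in>upper_pairs Q' q3. sqrt (v q2) * sqrt (v q4) * corr (q2 - q1) (q4 - q3))"

lemma upper_pairs_facts:
 assumes "q2 \<in> upper_pairs Q q1"
 shows "q2 \<in> Q" "q2 - q1 \<noteq> 0" "nn (q2 - q1) \<le> 2 * nn q2" "nn q1 \<le> nn q2" "q2 \<noteq> q1"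
 using assms nn_diff[of q2 q1] by (auto simp: upper_pairs_def)

abbreviation PP :: "(('m => 'n => real) \<times> ('m => real)) measure" where "PP \<equiv> tmat \<Otimes>\<^sub>M trow"

lemma expectation_X: assumes "T0 \<le> nn q" shows "(\<integral>z. X q (fst z) (snd z) \<partial>PP) = v q"
proof -
 have "(\<integral>z. X q (fst z) (snd z) \<partial>PP) = (\<integral>u. (\<integral>x. X q u x \<partial>trow) \<partial>tmat)"
  by (rule integral_tP[OF box_hit_measurable, where B = 1]) (rule X_bound)
 then show ?thesis by (simp add: integral_X[OF assms] prob_space.prob_space[OF prob_space_tmat])
qed

lemma expectation_X_X:
 assumes "T0 \<le> nn q" "T0 \<le> nn q'" "q \<noteq> q'"
 shows "(\<integral>u. (\<integral>x. X q u x * X q' u x \<partial>trow) \<partial>tmat) = v q * v q'"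
  and "(\<integral>z. X q (fst z) (snd z) * X q' (fst z) (snd z) \<partial>PP) = v q * v q'"
proof -
 have i: "integral\<^sup>L circ (near_int (b q i)) = 2 * b q i" if "T0 \<le> nn q" for q i
  using b_le_half[OF that] b_nonneg by (intro integral_near_int)
 show 1: "(\<integral>u. (\<integral>x. X q u x * X q' u x \<partial>trow) \<partial>tmat) = v q * v q'"
  unfolding box_hit_def
  by (subst integral_torus_prod_pair[OF circle_fun_near_int circle_fun_near_int assms(3)]) (simp add: i assms v_def)
 have "(\<integral>z. X q (fst z) (snd z) * X q' (fst z) (snd z) \<partial>PP) = (\<integral>u. (\<integral>x. X q u x * X q' u x \<partial>trow) \<partial>tmat)"
 proof (rule integral_tP[where B = 1])
  show "(\<lambda>(u, x). X q u x * X q' u x) \<in> borel_measurable PP" unfolding case_prod_beta by measurable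
  show "norm (X q u x * X q' u x) \<le> 1" for u x
   using X_bound(2)[of q u x] X_bound(2)[of q' u x] by (simp add: abs_mult mult_le_one)
 qed
 then show "(\<integral>z. X q (fst z) (snd z) * X q' (fst z) (snd z) \<partial>PP) = v q * v q'" using 1 by simp
qed

lemma cube_sum_le:
 fixes x :: "int ^ 'n => real"
 assumes Q: "finite Q" and x0: "!!q. 0 \<le> x q" and id: "!!q. x q * x q = x q"
 shows "(\<Sum>q\<in>Q. x q) ^ 3 \<le> 3 * (\<Sum>q1\<in>Q. x q1 + 2 * (\<Sum>q2\<in>upper_pairs Q q1. x q1 * x q2)
   + (\<Sum>q2\<in>upper_pairs Q q1. \<Sum>q3\<in>upper_pairs Q q1. x q1 * x q2 * x q3))"
proof -
 define F where "F p q r = (if nn p \<le> nn q \<and> nn p \<le> nn r then x p * x q * x r else 0)" for p q r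
 have s2: "(\<Sum>q\<in>Q. x q) * (\<Sum>r\<in>Q. x r) = (\<Sum>q\<in>Q. \<Sum>r\<in>Q. x q * x r)" by (rule sum_product)
 have "(\<Sum>q\<in>Q. x q) ^ 3 = (\<Sum>p\<in>Q. x p) * (\<Sum>q\<in>Q. \<Sum>r\<in>Q. x q * x r)"
  unfolding s2[symmetric] by (simp add: power3_eq_cube mult.assoc)
 also have "... = (\<Sum>p\<in>Q. \<Sum>q\<in>Q. x p * (\<Sum>r\<in>Q. x q * x r))" by (rule sum_product)
 also have "... = (\<Sum>p\<in>Q. \<Sum>q\<in>Q. \<Sum>r\<in>Q. x p * x q * x r)" by (simp add: sum_distrib_left mult.assoc)
 also have "... \<le> (\<Sum>p\<in>Q. \<Sum>q\<in>Q. \<Sum>r\<in>Q. F p q r + F q p r + F r p q)"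
 proof (intro sum_mono)
  fix p q r
  have n: "0 \<le> x p * x q * x r" using x0 by simp
  have "nn p \<le> nn q \<and> nn p \<le> nn r \<or> nn q \<le> nn p \<and> nn q \<le> nn r \<or> nn r \<le> nn p \<and> nn r \<le> nn q" by linarith
  then show "x p * x q * x r \<le> F p q r + F q p r + F r p q"
   using n unfolding F_def by (auto simp: ac_simps)
 qed
 also have "... = (\<Sum>p\<in>Q. \<Sum>q\<in>Q. \<Sum>r\<in>Q. F p q r) + (\<Sum>p\<in>Q. \<Sum>q\<in>Q. \<Sum>r\<in>Q. F q p r) + (\<Sum>p\<in>Q. \<Sum>q\<in>Q. \<Sum>r\<in>Q. F r p q)"
  by (simp add: sum.distrib)
 also have "(\<Sum>p\<in>Q. \<Sum>q\<in>Q. \<Sum>r\<in>Q. F q p r) = (\<Sum>p\<in>Q. \<Sum>q\<in>Q. \<Sum>r\<in>Q. F p q r)" by (rule sum.swap)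
 also have "(\<Sum>p\<in>Q. \<Sum>q\<in>Q. \<Sum>r\<in>Q. F r p q) = (\<Sum>p\<in>Q. \<Sum>r\<in>Q. \<Sum>q\<in>Q. F r p q)" by (rule sum.cong[OF refl sum.swap])
 also have "... = (\<Sum>p\<in>Q. \<Sum>q\<in>Q. \<Sum>r\<in>Q. F p q r)" by (rule sum.swap)
 finally have 1: "(\<Sum>q\<in>Q. x q) ^ 3 \<le> 3 * (\<Sum>p\<in>Q. \<Sum>q\<in>Q. \<Sum>r\<in>Q. F p q r)" by simp
 have "(\<Sum>q\<in>Q. \<Sum>r\<in>Q. F p q r) = x p + 2 * (\<Sum>q2\<in>upper_pairs Q p. x p * x q2)
   + (\<Sum>q2\<in>upper_pairs Q p. \<Sum>q3\<in>upper_pairs Q p. x p * x q2 * x q3)" if p: "p \<in> Q" for p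
 proof -
  let ?S = "{q\<in>Q. nn p \<le> nn q}" and ?U = "upper_pairs Q p"
  have S: "?S = insert p ?U" "p \<notin> ?U" "finite ?U" using p Q by (auto simp: upper_pairs_def)
  have "(\<Sum>q\<in>Q. \<Sum>r\<in>Q. F p q r) = (\<Sum>q\<in>?S. \<Sum>r\<in>?S. x p * x q * x r)"
   using Q unfolding F_def by (simp add: sum.inter_filter if_distrib cong: if_cong) (intro sum.cong, auto)
  also have "... = x p * (x p + (\<Sum>q\<in>?U. x q)) * (x p + (\<Sum>q\<in>?U. x q))"
   unfolding S(1) using S(2,3) by (simp add: sum_distrib_left[symmetric] sum_distrib_right[symmetric] mult.assoc)
  also have "... = x p + 2 * (x p * (\<Sum>q\<in>?U. x q)) + x p * (\<Sum>q\<in>?U. x q) * (\<Sum>q\<in>?U. x q)"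
  proof -
   have "y * (y + s) * (y + s) = y + 2 * (y * s) + y * s * s" if "y * y = y" for y s :: real
   proof -
    have "y * (y + s) * (y + s) = (y * y) * y + 2 * ((y * y) * s) + y * s * s" by (simp add: algebra_simps)
    then show ?thesis using that by simp
   qed
   then show ?thesis using id by blast
  qed
  also have "x p * (\<Sum>q\<in>?U. x q) = (\<Sum>q\<in>?U. x p * x q)" by (rule sum_distrib_left)
  also have "(\<Sum>q\<in>?U. x p * x q) * (\<Sum>q\<in>?U. x q) = (\<Sum>q2\<in>?U. \<Sum>q3\<in>?U. x p * x q2 * x q3)" by (rule sum_product)
  finally show ?thesis .
 qed
 then show ?thesis using 1 by simp
qed

text \<open>The cube of a sum of indicators is expanded into triples ordered by norm. Removing the smallest
  frequency by translation leaves two differences, to which the two-point estimate applies.\<close>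
lemma third_moment_le: obtains C where "C > 0"
 "!!Q \<Xi>. finite Q ==> (!!q. q \<in> Q ==> T0 \<le> nn q) ==> (!!q1. q1 \<in> Q ==> corr_sum Q Q q1 q1 \<le> \<Xi>) ==>
  (\<integral>z. (\<Sum>q\<in>Q. X q (fst z) (snd z)) ^ 3 \<partial>PP)
   \<le> 3 * ((\<Sum>q\<in>Q. v q) + 2 * (\<Sum>q\<in>Q. v q)\<^sup>2 + (\<Sum>q\<in>Q. v q) ^ 3 + C * (\<Sum>q\<in>Q. v q) * \<Xi>)"
proof -
 obtain C where C: "C > 0" "!!q q' r r'. T0 \<le> nn q ==> T0 \<le> nn q' ==> r \<noteq> 0 ==> r' \<noteq> 0 ==> nn r \<le> 2 * nn q ==> nn r' \<le> 2 * nn q' ==>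
  \<exists>B. (\<forall>i. two_point_bound (b q i) (b q' i) r r' (B i)) \<and> (\<forall>i. 0 \<le> B i) \<and>
   (\<Prod>i\<in>UNIV. B i) \<le> v q * v q' + C * (sqrt (v q) * sqrt (v q') * corr r r')" using two_point_excess by blast
 have "(\<integral>z. (\<Sum>q\<in>Q. X q (fst z) (snd z)) ^ 3 \<partial>PP)
   \<le> 3 * ((\<Sum>q\<in>Q. v q) + 2 * (\<Sum>q\<in>Q. v q)\<^sup>2 + (\<Sum>q\<in>Q. v q) ^ 3 + C * (\<Sum>q\<in>Q. v q) * \<Xi>)"
  if Q: "finite Q" and T: "!!q. q \<in> Q ==> T0 \<le> nn q" and \<Xi>: "!!q1. q1 \<in> Q ==> corr_sum Q Q q1 q1 \<le> \<Xi>" for Q \<Xi>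
 proof -
  interpret P: prob_space PP by (rule prob_space_tP)
  let ?X = "\<lambda>q z. X q (fst z) (snd z)" and ?U = "upper_pairs Q"
  let ?\<mu> = "\<Sum>q\<in>Q. v q"
  have \<mu>0: "0 \<le> ?\<mu>" by (intro sum_nonneg v_nonneg)
  have finU: "finite (?U q)" for q using Q by (simp add: upper_pairs_def)
  have subU: "?U q \<subseteq> Q" for q by (auto simp: upper_pairs_def)
  have Xz: "\<bar>?X q z\<bar> \<le> 1" for q z by (rule X_bound)
  have i1: "integrable PP (?X q)" for q by (rule P.integrable_const_bound[where B = 1]) (use Xz in auto)
  have i2: "integrable PP (\<lambda>z. ?X q z * ?X q' z)" for q q'
   by (rule P.integrable_const_bound[where B = 1]) (use Xz in \<open>auto simp: abs_mult mult_le_one\<close>)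
  have i3: "integrable PP (\<lambda>z. ?X q z * ?X q' z * ?X q'' z)" for q q' q''
   by (rule P.integrable_const_bound[where B = 1]) (use Xz in \<open>auto simp: abs_mult intro!: mult_le_one\<close>)
  have E3: "(\<integral>z. ?X q1 z * ?X q2 z * ?X q3 z \<partial>PP) \<le> v q1 * (v q2 * v q3 + C * (sqrt (v q2) * sqrt (v q3) * corr (q2 - q1) (q3 - q1)))"
   if q1: "q1 \<in> Q" and q2: "q2 \<in> ?U q1" and q3: "q3 \<in> ?U q1" for q1 q2 q3
  proof -
   note f2 = upper_pairs_facts[OF q2] and f3 = upper_pairs_facts[OF q3]
   obtain B where B: "!!i. two_point_bound (b q2 i) (b q3 i) (q2 - q1) (q3 - q1) (B i)"
    "(\<Prod>i\<in>UNIV. B i) \<le> v q2 * v q3 + C * (sqrt (v q2) * sqrt (v q3) * corr (q2 - q1) (q3 - q1))"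
    using C(2)[OF T[OF f2(1)] T[OF f3(1)] f2(2) f3(2) f2(3) f3(3)] by blast
   have "(\<integral>z. ?X q1 z * ?X q2 z * ?X q3 z \<partial>PP) = (\<integral>u. (\<integral>x. X q1 u x * X q2 u x * X q3 u x \<partial>trow) \<partial>tmat)"
   proof (rule integral_tP[where B = 1])
    show "(\<lambda>(u, x). X q1 u x * X q2 u x * X q3 u x) \<in> borel_measurable PP" unfolding case_prod_beta by measurable
    show "norm (X q1 u x * X q2 u x * X q3 u x) \<le> 1" for u x
     using X_bound(2)[of q1 u x] X_bound(2)[of q2 u x] X_bound(2)[of q3 u x] by (auto simp: abs_mult intro!: mult_le_one)
   qed
   also have "... \<le> (\<Prod>i\<in>UNIV. 2 * b q1 i) * (\<Prod>i\<in>UNIV. B i)"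
    unfolding box_hit_def by (rule integral_triple_le[OF b_nonneg b_le_half[OF T[OF q1]] B(1)])
   also have "... \<le> v q1 * (v q2 * v q3 + C * (sqrt (v q2) * sqrt (v q3) * corr (q2 - q1) (q3 - q1)))"
    unfolding v_def[of q1, symmetric] by (rule mult_left_mono[OF B(2) v_nonneg])
   finally show ?thesis .
  qed
  have E2: "(\<integral>z. ?X q1 z * ?X q2 z \<partial>PP) = v q1 * v q2" if "q1 \<in> Q" "q2 \<in> ?U q1" for q1 q2
   using upper_pairs_facts[OF that(2)] T that(1) by (intro expectation_X_X) auto
  have le: "(\<integral>z. (\<Sum>q\<in>Q. ?X q z) ^ 3 \<partial>PP) \<le> (\<integral>z. 3 * (\<Sum>q1\<in>Q. ?X q1 z + 2 * (\<Sum>q2\<in>?U q1. ?X q1 z * ?X q2 z)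
   + (\<Sum>q2\<in>?U q1. \<Sum>q3\<in>?U q1. ?X q1 z * ?X q2 z * ?X q3 z)) \<partial>PP)" (is "_ \<le> integral\<^sup>L PP ?R")
  proof (rule integral_mono')
   show "integrable PP ?R"
    by (intro integrable_mult_right Bochner_Integration.integrable_sum Bochner_Integration.integrable_add i1 i2 i3)
   show p: "(\<Sum>q\<in>Q. ?X q z) ^ 3 \<le> ?R z" for z
    by (rule cube_sum_le[OF Q box_hit_nonneg X_idem])
   show "0 \<le> ?R z" for z
    by (rule order.trans[OF _ p]) (intro zero_le_power sum_nonneg box_hit_nonneg)
  qed
  also have "integral\<^sup>L PP ?R = 3 * (\<Sum>q1\<in>Q. (\<integral>z. ?X q1 z \<partial>PP) + 2 * (\<Sum>q2\<in>?U q1. \<integral>z. ?X q1 z * ?X q2 z \<partial>PP)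
   + (\<Sum>q2\<in>?U q1. \<Sum>q3\<in>?U q1. \<integral>z. ?X q1 z * ?X q2 z * ?X q3 z \<partial>PP))"
   by (simp add: Bochner_Integration.integral_sum Bochner_Integration.integral_add Bochner_Integration.integrable_sum
     Bochner_Integration.integrable_add i1 i2 i3)
  also have "... \<le> 3 * (\<Sum>q1\<in>Q. v q1 + 2 * (v q1 * ?\<mu>) + v q1 * (?\<mu>\<^sup>2 + C * \<Xi>))"
  proof (intro mult_left_mono sum_mono add_mono)
   fix q1 assume q1: "q1 \<in> Q"
   show "(\<integral>z. ?X q1 z \<partial>PP) \<le> v q1" using expectation_X[OF T[OF q1]] by simp
   have sU: "(\<Sum>q2\<in>?U q1. v q2) \<le> ?\<mu>" by (rule sum_mono2[OF Q subU v_nonneg])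
   have "(\<Sum>q2\<in>?U q1. \<integral>z. ?X q1 z * ?X q2 z \<partial>PP) = v q1 * (\<Sum>q2\<in>?U q1. v q2)"
    using E2[OF q1] by (simp add: sum_distrib_left)
   also have "... \<le> v q1 * ?\<mu>" by (intro mult_left_mono sU v_nonneg)
   finally show "(\<Sum>q2\<in>?U q1. \<integral>z. ?X q1 z * ?X q2 z \<partial>PP) \<le> v q1 * ?\<mu>" .
   have "(\<Sum>q2\<in>?U q1. \<Sum>q3\<in>?U q1. \<integral>z. ?X q1 z * ?X q2 z * ?X q3 z \<partial>PP)
    \<le> (\<Sum>q2\<in>?U q1. \<Sum>q3\<in>?U q1. v q1 * (v q2 * v q3 + C * (sqrt (v q2) * sqrt (v q3) * corr (q2 - q1) (q3 - q1))))"
    by (intro sum_mono E3 q1)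
   also have "... = v q1 * ((\<Sum>q2\<in>?U q1. v q2) * (\<Sum>q3\<in>?U q1. v q3) + C * corr_sum Q Q q1 q1)"
    unfolding sum_product corr_sum_def by (simp add: sum_distrib_left sum.distrib distrib_left)
   also have "... \<le> v q1 * (?\<mu>\<^sup>2 + C * \<Xi>)"
    unfolding power2_eq_square
    by (intro mult_left_mono add_mono mult_mono sU \<Xi> q1 v_nonneg \<mu>0 sum_nonneg less_imp_le[OF C(1)])
   finally show "(\<Sum>q2\<in>?U q1. \<Sum>q3\<in>?U q1. \<integral>z. ?X q1 z * ?X q2 z * ?X q3 z \<partial>PP) \<le> v q1 * (?\<mu>\<^sup>2 + C * \<Xi>)" .
  qed auto
  also have "(\<Sum>q1\<in>Q. v q1 + 2 * (v q1 * ?\<mu>) + v q1 * (?\<mu>\<^sup>2 + C * \<Xi>)) = ?\<mu> + 2 * (?\<mu> * ?\<mu>) + ?\<mu> * (?\<mu>\<^sup>2 + C * \<Xi>)"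
   by (simp only: sum.distrib sum_distrib_left[symmetric] sum_distrib_right[symmetric])
  also have "3 * (?\<mu> + 2 * (?\<mu> * ?\<mu>) + ?\<mu> * (?\<mu>\<^sup>2 + C * \<Xi>)) = 3 * (?\<mu> + 2 * ?\<mu>\<^sup>2 + ?\<mu> ^ 3 + C * ?\<mu> * \<Xi>)"
   by (simp add: algebra_simps power2_eq_square power3_eq_cube)
  finally show ?thesis .
 qed
 then show ?thesis by (rule that[OF C(1)])
qed

definition pair_prob :: "int ^ 'n => int ^ 'n => ('m => 'n => real) => real" where
 "pair_prob q q' u = (\<integral>x. X q u x * X q' u x \<partial>trow)"

text \<open>The part of the variance given \<open>u\<close> of the number of hits in \<open>Q\<close> that
  depends on \<open>u\<close>; for frequencies beyond \<open>T0\<close> it has mean zero by pairwise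
  independence.\<close>
definition cov_sum :: "(int ^ 'n) set => ('m => 'n => real) => real" where
 "cov_sum Q u = (\<Sum>q\<in>Q. \<Sum>q'\<in>Q - {q}. pair_prob q q' u - v q * v q')"

lemma pair_prob_measurable [measurable]: "pair_prob q q' \<in> borel_measurable tmat"
proof -
 interpret x: prob_space "trow :: ('m => real) measure" by (rule prob_space_trow)
 have "(\<lambda>(u, x). X q u x * X q' u x) \<in> borel_measurable PP" unfolding case_prod_beta by measurable
 from x.borel_measurable_lebesgue_integral[OF this] show ?thesis by (simp add: pair_prob_def[abs_def])
qed

lemma pair_prob_bounds: "0 \<le> pair_prob q q' u" "pair_prob q q' u \<le> 1"
proof -
 have "0 \<le> pair_prob q q' u \<and> pair_prob q q' u \<le> 1" unfolding pair_prob_def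
  by (rule integral_in_unit_interval[OF prob_space_trow])
   (auto intro: mult_nonneg_nonneg mult_le_one box_hit_nonneg box_hit_le_1)
 then show "0 \<le> pair_prob q q' u" "pair_prob q q' u \<le> 1" by auto
qed

lemma pair_prob_sym: "pair_prob q q' u = pair_prob q' q u" by (simp add: pair_prob_def mult.commute)

lemma cov_sum_measurable [measurable]: "cov_sum Q \<in> borel_measurable tmat"
 unfolding cov_sum_def by measurable

lemma cov_sum_bounded: "\<exists>B. \<forall>u. \<bar>cov_sum Q u\<bar> \<le> B"
proof (intro exI allI)
 fix u
 show "\<bar>cov_sum Q u\<bar> \<le> (\<Sum>q\<in>Q. \<Sum>q'\<in>Q - {q}. 1 + v q * v q')" unfolding cov_sum_def
 proof (rule order.trans[OF sum_abs], intro sum_mono, rule order.trans[OF sum_abs], intro sum_mono)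
  fix q q'
  show "\<bar>pair_prob q q' u - v q * v q'\<bar> \<le> 1 + v q * v q'"
   using pair_prob_bounds[of q q' u] mult_nonneg_nonneg[OF v_nonneg[of q] v_nonneg[of q']] by linarith
 qed
qed

lemma conditional_variance_eq:
 assumes Q: "finite Q" and T: "!!q. q \<in> Q ==> T0 \<le> nn q"
 shows "(\<integral>x. ((\<Sum>q\<in>Q. X q u x) - (\<Sum>q\<in>Q. v q))\<^sup>2 \<partial>trow) = (\<Sum>q\<in>Q. v q - (v q)\<^sup>2) + cov_sum Q u"
proof -
 interpret x: prob_space "trow :: ('m => real) measure" by (rule prob_space_trow)
 have i2: "integrable trow (\<lambda>x. X q u x * X q' u x)" for q q'
  by (rule bounded_integrable[OF prob_space_trow, where B = 1])
   (auto simp: abs_mult intro!: mult_le_one X_bound)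
 note i1 = box_hit_integrable_x
 have cov: "(\<integral>x. (X q u x - v q) * (X q' u x - v q') \<partial>trow) = pair_prob q q' u - v q * v q'" if "q \<in> Q" "q' \<in> Q" for q q'
 proof -
  show ?thesis using x.expectation_product_shifted[of "X q u" "X q' u" "v q" "v q'", OF i1 i1 i2]
   by (simp add: pair_prob_def integral_X T that)
 qed
 have ic: "integrable trow (\<lambda>x. (X q u x - v q) * (X q' u x - v q'))" for q q'
  by (rule x.integrable_product_shifted[of "X q u" "X q' u", OF i1 i1 i2])
 have "(\<integral>x. ((\<Sum>q\<in>Q. X q u x) - (\<Sum>q\<in>Q. v q))\<^sup>2 \<partial>trow) = (\<integral>x. (\<Sum>q\<in>Q. \<Sum>q'\<in>Q. (X q u x - v q) * (X q' u x - v q')) \<partial>trow)"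
  unfolding sum_subtractf[symmetric] power2_eq_square sum_product ..
 also have "... = (\<Sum>q\<in>Q. \<Sum>q'\<in>Q. \<integral>x. (X q u x - v q) * (X q' u x - v q') \<partial>trow)"
  by (simp add: Bochner_Integration.integral_sum ic Bochner_Integration.integrable_sum)
 also have "... = (\<Sum>q\<in>Q. \<Sum>q'\<in>Q. pair_prob q q' u - v q * v q')" by (intro sum.cong refl cov)
 also have "... = (\<Sum>q\<in>Q. (pair_prob q q u - v q * v q) + (\<Sum>q'\<in>Q - {q}. pair_prob q q' u - v q * v q'))"
  by (intro sum.cong refl sum.remove Q)
 also have "... = (\<Sum>q\<in>Q. v q - (v q)\<^sup>2) + cov_sum Q u"
  unfolding cov_sum_def sum.distrib
  by (intro arg_cong2[where f = "(+)"] sum.cong refl) (simp_all add: pair_prob_def X_idem integral_X T power2_eq_square)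
 finally show ?thesis .
qed

text \<open>A pair with distinct norms occurs in both orders in a double sum but only once among the ordered
  pairs.\<close>
definition pair_weight :: "int ^ 'n => int ^ 'n => real" where
 "pair_weight q q' = (if nn q < nn q' then 2 else 1)"

lemma cov_sum_ordered:
 assumes Q: "finite Q"
 shows "cov_sum Q u = (\<Sum>q\<in>Q. \<Sum>q'\<in>upper_pairs Q q. pair_weight q q' * (pair_prob q q' u - v q * v q'))"
proof -
 define t where "t q q' = (if q = q' then 0 else pair_prob q q' u - v q * v q')" for q q'
 have sym: "t q q' = t q' q" for q q' by (simp add: t_def pair_prob_sym mult.commute)
 have "cov_sum Q u = (\<Sum>q\<in>Q. \<Sum>q'\<in>Q. t q q')" unfolding cov_sum_def
  by (intro sum.cong refl sum.mono_neutral_cong_left) (use Q in \<open>auto simp: t_def\<close>)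
 also have "... = (\<Sum>q\<in>Q. \<Sum>q'\<in>Q. (if nn q < nn q' then t q q' else 0) + (if nn q = nn q' then t q q' else 0) + (if nn q' < nn q then t q q' else 0))"
  by (intro sum.cong refl) auto
 also have "... = (\<Sum>q\<in>Q. \<Sum>q'\<in>Q. if nn q < nn q' then t q q' else 0) + (\<Sum>q\<in>Q. \<Sum>q'\<in>Q. if nn q = nn q' then t q q' else 0)
   + (\<Sum>q\<in>Q. \<Sum>q'\<in>Q. if nn q' < nn q then t q q' else 0)" by (simp add: sum.distrib)
 also have "(\<Sum>q\<in>Q. \<Sum>q'\<in>Q. if nn q' < nn q then t q q' else 0) = (\<Sum>q\<in>Q. \<Sum>q'\<in>Q. if nn q < nn q' then t q q' else 0)"
  by (rule trans[OF sum.swap], intro sum.cong refl, metis sym)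
 also have "(\<Sum>q\<in>Q. \<Sum>q'\<in>Q. if nn q < nn q' then t q q' else 0) + (\<Sum>q\<in>Q. \<Sum>q'\<in>Q. if nn q = nn q' then t q q' else 0)
   + (\<Sum>q\<in>Q. \<Sum>q'\<in>Q. if nn q < nn q' then t q q' else 0)
  = (\<Sum>q\<in>Q. \<Sum>q'\<in>Q. (if nn q < nn q' then t q q' else 0) + (if nn q = nn q' then t q q' else 0) + (if nn q < nn q' then t q q' else 0))"
  by (simp only: sum.distrib)
 also have "... = (\<Sum>q\<in>Q. \<Sum>q'\<in>upper_pairs Q q. pair_weight q q' * (pair_prob q q' u - v q * v q'))"
  by (intro sum.cong refl sum.mono_neutral_cong_right) (use Q in \<open>auto simp: upper_pairs_def t_def pair_weight_def\<close>)
 finally show ?thesis .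
qed

text \<open>The covariance of a pair given \<open>u\<close> has mean zero as a function of \<open>u\<close>,
  so the expected product of two of them is the excess of a four-point probability over the product of
  volumes. Translating both pairs by their smaller frequency turns it into a two-point estimate for the
  differences.\<close>
lemma cov_sum_product_le: obtains C where "C > 0"
 "!!Q Q' \<Xi>. finite Q ==> finite Q' ==> (!!q. q \<in> Q \<union> Q' ==> T0 \<le> nn q) ==>
  (!!q1 q3. q1 \<in> Q ==> q3 \<in> Q' ==> corr_sum Q Q' q1 q3 \<le> \<Xi>) ==>
  (\<integral>u. cov_sum Q u * cov_sum Q' u \<partial>tmat) \<le> C * (\<Sum>q\<in>Q. v q) * (\<Sum>q\<in>Q'. v q) * \<Xi>"
proof -
 obtain C where C: "C > 0" "!!q q' r r'. T0 \<le> nn q ==> T0 \<le> nn q' ==> r \<noteq> 0 ==> r' \<noteq> 0 ==> nn r \<le> 2 * nn q ==> nn r' \<le> 2 * nn q' ==>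
  \<exists>B. (\<forall>i. two_point_bound (b q i) (b q' i) r r' (B i)) \<and> (\<forall>i. 0 \<le> B i) \<and>
   (\<Prod>i\<in>UNIV. B i) \<le> v q * v q' + C * (sqrt (v q) * sqrt (v q') * corr r r')" using two_point_excess by blast
 have "(\<integral>u. cov_sum Q u * cov_sum Q' u \<partial>tmat) \<le> (4 * C) * (\<Sum>q\<in>Q. v q) * (\<Sum>q\<in>Q'. v q) * \<Xi>"
  if Q: "finite Q" "finite Q'" and T: "!!q. q \<in> Q \<union> Q' ==> T0 \<le> nn q"
   and \<Xi>: "!!q1 q3. q1 \<in> Q ==> q3 \<in> Q' ==> corr_sum Q Q' q1 q3 \<le> \<Xi>" for Q Q' \<Xi>
 proof -
  interpret u: prob_space "tmat :: ('m => 'n => real) measure" by (rule prob_space_tmat)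
  let ?c = "\<lambda>q q' u. pair_prob q q' u - v q * v q'"
  have ib: "integrable tmat (pair_prob q q')" for q q'
   by (rule u.integrable_const_bound[where B = 1]) (use pair_prob_bounds in \<open>auto simp: abs_le_iff intro: order.trans[of _ 0]\<close>)
  have ibb: "integrable tmat (\<lambda>u. pair_prob q1 q2 u * pair_prob q3 q4 u)" for q1 q2 q3 q4
   by (rule u.integrable_const_bound[where B = 1])
    (use pair_prob_bounds in \<open>auto simp: abs_mult abs_of_nonneg intro!: mult_le_one\<close>)
  have E1: "(\<integral>u. pair_prob q q' u \<partial>tmat) = v q * v q'" if "T0 \<le> nn q" "T0 \<le> nn q'" "q \<noteq> q'" for q q'
   unfolding pair_prob_def by (rule expectation_X_X(1)[OF that])
  have E4: "(\<integral>u. ?c q1 q2 u * ?c q3 q4 u \<partial>tmat) \<le> C * (v q1 * v q3 * (sqrt (v q2) * sqrt (v q4) * corr (q2 - q1) (q4 - q3)))"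
   if q: "q1 \<in> Q" "q2 \<in> upper_pairs Q q1" "q3 \<in> Q'" "q4 \<in> upper_pairs Q' q3" for q1 q2 q3 q4
  proof -
   note f2 = upper_pairs_facts[OF q(2)] and f4 = upper_pairs_facts[OF q(4)]
   have t: "T0 \<le> nn q1" "T0 \<le> nn q2" "T0 \<le> nn q3" "T0 \<le> nn q4" using T q f2(1) f4(1) by auto
   obtain B where B: "!!i. two_point_bound (b q2 i) (b q4 i) (q2 - q1) (q4 - q3) (B i)"
    "(\<Prod>i\<in>UNIV. B i) \<le> v q2 * v q4 + C * (sqrt (v q2) * sqrt (v q4) * corr (q2 - q1) (q4 - q3))"
    using C(2)[OF t(2) t(4) f2(2) f4(2) f2(3) f4(3)] by blast
   have "(\<integral>u. pair_prob q1 q2 u * pair_prob q3 q4 u \<partial>tmat) \<le> (\<Prod>i\<in>UNIV. 2 * b q1 i) * (\<Prod>i\<in>UNIV. 2 * b q3 i) * (\<Prod>i\<in>UNIV. B i)"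
    unfolding pair_prob_def box_hit_def
    by (rule integral_quadruple_le[OF b_nonneg b_le_half[OF t(1)] b_nonneg b_le_half[OF t(3)] B(1)])
   also have "... \<le> v q1 * v q3 * (v q2 * v q4 + C * (sqrt (v q2) * sqrt (v q4) * corr (q2 - q1) (q4 - q3)))"
    unfolding v_def[of q1, symmetric] v_def[of q3, symmetric]
    by (rule mult_left_mono[OF B(2)]) (simp add: v_nonneg)
   finally have 1: "(\<integral>u. pair_prob q1 q2 u * pair_prob q3 q4 u \<partial>tmat)
    \<le> v q1 * v q3 * (v q2 * v q4 + C * (sqrt (v q2) * sqrt (v q4) * corr (q2 - q1) (q4 - q3)))" .
   have "(\<integral>u. ?c q1 q2 u * ?c q3 q4 u \<partial>tmat) = (\<integral>u. pair_prob q1 q2 u * pair_prob q3 q4 u \<partial>tmat) - v q1 * v q2 * (v q3 * v q4)"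
    using u.expectation_product_shifted[of "pair_prob q1 q2" "pair_prob q3 q4" "v q1 * v q2" "v q3 * v q4", OF ib ib ibb]
     E1[OF t(1,2) f2(5)[symmetric]] E1[OF t(3,4) f4(5)[symmetric]] by simp
   then show ?thesis using 1 by (simp add: algebra_simps)
  qed
  have icc: "integrable tmat (\<lambda>u. ?c q1 q2 u * ?c q3 q4 u)" for q1 q2 q3 q4
   by (rule u.integrable_product_shifted[of "pair_prob q1 q2" "pair_prob q3 q4", OF ib ib ibb])
  let ?a = pair_weight
  have a: "0 \<le> ?a q q'" "?a q q' \<le> 2" for q q' by (auto simp: pair_weight_def)
  have "(\<integral>u. cov_sum Q u * cov_sum Q' u \<partial>tmat)
   = (\<integral>u. (\<Sum>q1\<in>Q. \<Sum>q3\<in>Q'. \<Sum>q2\<in>upper_pairs Q q1. \<Sum>q4\<in>upper_pairs Q' q3. (?a q1 q2 * ?a q3 q4) * (?c q1 q2 u * ?c q3 q4 u)) \<partial>tmat)"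
   unfolding cov_sum_ordered[OF Q(1)] cov_sum_ordered[OF Q(2)] sum_product
   by (intro Bochner_Integration.integral_cong refl sum.cong) (simp add: ac_simps)
  also have "... = (\<Sum>q1\<in>Q. \<Sum>q3\<in>Q'. \<Sum>q2\<in>upper_pairs Q q1. \<Sum>q4\<in>upper_pairs Q' q3. (?a q1 q2 * ?a q3 q4) * (\<integral>u. ?c q1 q2 u * ?c q3 q4 u \<partial>tmat))"
   by (simp add: Bochner_Integration.integral_sum Bochner_Integration.integrable_sum icc)
  also have "... \<le> (\<Sum>q1\<in>Q. \<Sum>q3\<in>Q'. \<Sum>q2\<in>upper_pairs Q q1. \<Sum>q4\<in>upper_pairs Q' q3.
    4 * (C * (v q1 * v q3 * (sqrt (v q2) * sqrt (v q4) * corr (q2 - q1) (q4 - q3)))))"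
  proof (intro sum_mono)
   fix q1 q3 q2 q4 assume q: "q1 \<in> Q" "q3 \<in> Q'" "q2 \<in> upper_pairs Q q1" "q4 \<in> upper_pairs Q' q3"
   let ?R = "C * (v q1 * v q3 * (sqrt (v q2) * sqrt (v q4) * corr (q2 - q1) (q4 - q3)))"
   have R: "0 \<le> ?R" using C(1) v_nonneg corr_nonneg by simp
   have aa: "?a q1 q2 * ?a q3 q4 \<le> 2 * 2" by (intro mult_mono a) auto
   have "(?a q1 q2 * ?a q3 q4) * (\<integral>u. ?c q1 q2 u * ?c q3 q4 u \<partial>tmat) \<le> (?a q1 q2 * ?a q3 q4) * ?R"
    by (intro mult_left_mono E4 q) (simp add: a)
   also have "... \<le> 4 * ?R" using aa R by (intro mult_right_mono) auto
   finally show "(?a q1 q2 * ?a q3 q4) * (\<integral>u. ?c q1 q2 u * ?c q3 q4 u \<partial>tmat) \<le> 4 * ?R" .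
  qed
  also have "... = (\<Sum>q1\<in>Q. \<Sum>q3\<in>Q'. (4 * C) * (v q1 * v q3 * corr_sum Q Q' q1 q3))"
   by (intro sum.cong refl) (simp add: corr_sum_def sum_distrib_left mult.assoc)
  also have "... \<le> (\<Sum>q1\<in>Q. \<Sum>q3\<in>Q'. (4 * C) * (v q1 * v q3 * \<Xi>))"
   by (intro sum_mono mult_left_mono \<Xi> mult_nonneg_nonneg v_nonneg) (use C in auto)
  also have "... = (4 * C) * (\<Sum>q\<in>Q. v q) * (\<Sum>q\<in>Q'. v q) * \<Xi>"
   by (simp add: sum_product sum_distrib_left sum_distrib_right ac_simps)
  finally show ?thesis .
 qed
 moreover have "0 < 4 * C" using C(1) by simp
 ultimately show ?thesis using that by blast
qed

end

section \<open>Total correlation of the blocks\<close>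

lemma geometric_sum_le:
 fixes a :: real
 assumes "0 \<le> a" "a \<le> 1/2"
 shows "(\<Sum>i<k. a ^ (j + i)) \<le> 2 * a ^ j"
proof -
 have "(\<Sum>i<k. a ^ (j + i)) \<le> 2 * a ^ j - 2 * a ^ (j + k)"
 proof (induction k)
  case (Suc k)
  have "a ^ (j + Suc k) \<le> (1/2) * a ^ (j + k)" using mult_right_mono[OF assms(2), of "a ^ (j + k)"] assms(1) by simp
  then show ?case using Suc by simp
 qed simp
 moreover have "0 \<le> 2 * a ^ (j + k)" using assms by simp
 ultimately show ?thesis by linarith
qed

lemma geometric_sum_subset_le:
 fixes a :: real
 assumes a: "0 \<le> a" "a \<le> 1/2" and J: "finite J" "!!j. j \<in> J ==> j0 \<le> j"
 shows "(\<Sum>j\<in>J. a ^ j) \<le> 2 * a ^ j0"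
proof -
 define k where "k = Suc (Max (insert 0 J))"
 have "J \<subseteq> (\<lambda>i. j0 + i) ` {..<k}"
 proof
  fix j assume j: "j \<in> J"
  have "j \<le> Max (insert 0 J)" using J(1) j by (intro Max_ge) auto
  then have "j - j0 < k" by (simp add: k_def)
  moreover have "j = j0 + (j - j0)" using J(2)[OF j] by simp
  ultimately show "j \<in> (\<lambda>i. j0 + i) ` {..<k}" by blast
 qed
 then have "(\<Sum>j\<in>J. a ^ j) \<le> (\<Sum>j\<in>(\<lambda>i. j0 + i) ` {..<k}. a ^ j)" using a by (intro sum_mono2) auto
 also have "... = (\<Sum>i<k. a ^ (j0 + i))" by (subst sum.reindex) (auto simp: inj_on_def)
 also have "... \<le> 2 * a ^ j0" by (rule geometric_sum_le[OF a])
 finally show ?thesis .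
qed

lemma sum_int_powr_le: assumes "p > 1" obtains Z :: real where "Z > 0"
 "!!K :: int. (\<Sum>c\<in>{-K..K} - {0}. \<bar>of_int c\<bar> powr (- p)) \<le> Z"
proof -
 have sm: "summable (\<lambda>k. real k powr (- p))" using assms by (simp add: summable_real_powr_iff)
 define S where "S = (\<Sum>k. real k powr (- p))"
 have S0: "0 \<le> S" unfolding S_def by (intro suminf_nonneg sm) simp
 have "(\<Sum>c\<in>{-K..K} - {0}. \<bar>of_int c\<bar> powr (- p)) \<le> 2 * S + 1" for K :: int
 proof -
  have half: "(\<Sum>c\<in>{1..K}. \<bar>of_int c\<bar> powr (- p)) \<le> S"
  proof -
   have "(\<Sum>c\<in>{1..K}. \<bar>of_int c\<bar> powr (- p)) = (\<Sum>k\<in>nat ` {1..K}. real k powr (- p))"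
    by (subst sum.reindex) (auto simp: inj_on_def intro!: sum.cong)
   also have "... \<le> S" unfolding S_def by (intro sum_le_suminf sm) auto
   finally show ?thesis .
  qed
  have e: "{-K..K} - {0} = {1..K} \<union> uminus ` {1..K}"
  proof (intro equalityI subsetI)
   fix c assume c: "c \<in> {-K..K} - {0}"
   show "c \<in> {1..K} \<union> uminus ` {1..K}"
   proof (cases "c > 0")
    case False
    then have "c = - (- c)" "- c \<in> {1..K}" using c by auto
    then show ?thesis by blast
   qed (use c in auto)
  qed auto
  have "(\<Sum>c\<in>{-K..K} - {0}. \<bar>of_int c\<bar> powr (- p)) = (\<Sum>c\<in>{1..K}. \<bar>of_int c\<bar> powr (- p)) + (\<Sum>c\<in>uminus ` {1..K}. \<bar>of_int c\<bar> powr (- p))"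
   unfolding e by (rule sum.union_disjoint) auto
  also have "(\<Sum>c\<in>uminus ` {1..K}. \<bar>real_of_int c\<bar> powr (- p)) = (\<Sum>c\<in>{1..K}. \<bar>of_int c\<bar> powr (- p))"
   by (subst sum.reindex) (auto simp: inj_on_def)
  finally show ?thesis using half by simp
 qed
 then show ?thesis using that[of "2 * S + 1"] S0 by (simp add: add_nonneg_pos)
qed

context clt_setting
begin

text \<open>The frequencies of logarithmic size between \<open>j L + g\<close> and \<open>(j + 1) L\<close>:
  block \<open>j\<close> without its initial gap.\<close>
definition blk :: "real => real => nat => (int ^ 'n) set" where
 "blk L g j = shell (exp (real j * L) * exp g) (exp (real (Suc j) * L))"

text \<open>An envelope, up to the factor \<open>sqrt A\<close>, of \<open>sqrt (v q2)\<close> in terms of the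
  difference \<open>r\<close> of two frequencies of block \<open>j\<close>, the larger of which is
  \<open>q2\<close>.\<close>
definition wt :: "real => nat => int ^ 'n => real" where
 "wt L j r = (if nn r \<le> 2 * exp (real (Suc j) * L) then max (exp (real j * L)) (nn r / 2) powr (- (real CARD('n) / 2)) else 0)"

lemma wt_nonneg: "0 \<le> wt L j r" by (simp add: wt_def)

text \<open>At most one block has the scale of \<open>r\<close> itself; over the later blocks the weights
  decay geometrically.\<close>
lemma wt_sum_le:
 assumes L: "2 \<le> L" and r: "r \<noteq> 0" and J: "finite J"
 shows "(\<Sum>j\<in>J. wt L j r) \<le> 3 * (nn r / 2) powr (- (real CARD('n) / 2))"
proof -
 let ?h = "real CARD('n) / 2"
 have n: "real CARD('n) \<ge> 1" using zero_less_card_finite[where 'a='n] by linarith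
 define x where "x = nn r / 2"
 have x: "x > 0" using nn_pos[OF r] by (simp add: x_def)
 define a where "a = exp (- L * ?h)"
 have a: "0 \<le> a" "a \<le> 1/2"
 proof -
  have "1 \<le> L * ?h" using L n mult_mono[of 2 L "1/2" ?h] by simp
  then have "a \<le> exp (- 1)" by (simp add: a_def)
  also have "... \<le> 1/2"
  proof -
   have "(2::real) \<le> exp 1" using exp_ge_add_one_self[of 1] by simp
   then show ?thesis by (simp add: exp_minus field_simps)
  qed
  finally show "a \<le> 1/2" .
 qed (simp add: a_def)
 have apow: "exp (real j * L) powr (- ?h) = a ^ j" for j
  by (simp add: a_def exp_powr_real exp_of_nat_mult[symmetric] ac_simps)
 let ?P1 = "\<lambda>j. x \<le> exp (real j * L)" and ?P2 = "\<lambda>j. exp (real j * L) < x \<and> x \<le> exp (real (Suc j) * L)"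
 have "(\<Sum>j\<in>J. wt L j r) \<le> (\<Sum>j\<in>J. (if ?P1 j then a ^ j else 0) + (if ?P2 j then x powr (- ?h) else 0))"
 proof (rule sum_mono)
  fix j
  have "max (exp (real j * L)) x = (if x \<le> exp (real j * L) then exp (real j * L) else x)" by simp
  then show "wt L j r \<le> (if ?P1 j then a ^ j else 0) + (if ?P2 j then x powr (- ?h) else 0)"
   unfolding wt_def x_def[symmetric] using apow[of j] a(1) by (auto simp: x_def)
 qed
 also have "... = (\<Sum>j\<in>{j\<in>J. ?P1 j}. a ^ j) + (\<Sum>j\<in>{j\<in>J. ?P2 j}. x powr (- ?h))"
  unfolding sum.distrib by (simp only: sum.inter_filter[OF J])
 also have "(\<Sum>j\<in>{j\<in>J. ?P1 j}. a ^ j) \<le> 2 * x powr (- ?h)"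
 proof (cases "{j\<in>J. ?P1 j} = {}")
  case False
  define j0 where "j0 = Min {j\<in>J. ?P1 j}"
  have fin: "finite {j\<in>J. ?P1 j}" using J by simp
  have "j0 \<in> {j\<in>J. ?P1 j}" unfolding j0_def using fin False by (rule Min_in)
  then have j0: "x \<le> exp (real j0 * L)" by simp
  have "(\<Sum>j\<in>{j\<in>J. ?P1 j}. a ^ j) \<le> 2 * a ^ j0"
   by (rule geometric_sum_subset_le[OF a fin]) (use fin in \<open>simp add: j0_def\<close>)
  also have "a ^ j0 \<le> x powr (- ?h)" unfolding apow[symmetric] using j0 x by (intro powr_mono2') auto
  finally show ?thesis by simp
 next
  case True
  show ?thesis unfolding True by simp
 qed
 also have "(\<Sum>j\<in>{j\<in>J. ?P2 j}. x powr (- ?h)) \<le> x powr (- ?h)"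
 proof -
  have "j = j'" if "?P2 j" "?P2 j'" for j j'
  proof (rule ccontr)
   have no: False if "?P2 i" "?P2 i'" "i < i'" for i i'
   proof -
    have "real (Suc i) * L \<le> real i' * L" using that(3) L by (intro mult_right_mono) auto
    then have "exp (real (Suc i) * L) \<le> exp (real i' * L)" by simp
    then show False using that by linarith
   qed
   assume "j \<noteq> j'"
   then show False using no[of j j'] no[of j' j] that by (meson linorder_neqE_nat)
  qed
  then have "\<forall>i\<in>{j\<in>J. ?P2 j}. \<forall>i'\<in>{j\<in>J. ?P2 j}. i = i'" by blast
  moreover have "finite {j\<in>J. ?P2 j}" using J by simp
  ultimately have "card {j\<in>J. ?P2 j} \<le> Suc 0" by (simp only: card_le_Suc0_iff_eq)
  then show ?thesis using mult_right_mono[of "real (card {j\<in>J. ?P2 j})" 1 "x powr (- ?h)"] by simp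
 qed
 finally show ?thesis by (simp add: x_def)
qed

definition ball0 :: "real => (int ^ 'n) set" where "ball0 M = {r. r \<noteq> 0 \<and> nn r \<le> M}"

lemma finite_ball0: "finite (ball0 M)"
 by (rule finite_subset[OF _ finite_nn_le[of M]]) (auto simp: ball0_def)

text \<open>A bound, uniform in the smaller frequencies, for the correlation sums of two blocks: all
  differences of norm at most \<open>M\<close> are allowed.\<close>
definition Xi :: "real => real => nat => nat => real" where
 "Xi L M j j' = (\<Sum>r\<in>ball0 M. \<Sum>r'\<in>ball0 M. wt L j r * wt L j' r' * corr r r')"

lemma Xi_nonneg: "0 \<le> Xi L M j j'"
 unfolding Xi_def by (intro sum_nonneg mult_nonneg_nonneg wt_nonneg corr_nonneg)

lemma sqrt_v_le_wt:
 assumes g: "0 \<le> g" and q: "q2 \<in> upper_pairs (blk L g j) q1"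
 shows "sqrt (v q2) \<le> sqrt A * wt L j (q2 - q1)"
  and "nn (q2 - q1) \<le> 2 * exp (real (Suc j) * L)"
proof -
 note f = upper_pairs_facts[OF q]
 have b1: "exp (real j * L) * exp g \<le> nn q2" "nn q2 < exp (real (Suc j) * L)" using f(1) by (auto simp: blk_def shell_def)
 have "exp (real j * L) * 1 \<le> exp (real j * L) * exp g" using g by (intro mult_left_mono) auto
 then have lo: "exp (real j * L) \<le> nn q2" using b1 by linarith
 then have pos: "nn q2 > 0" by (smt (verit) exp_gt_zero)
 show r: "nn (q2 - q1) \<le> 2 * exp (real (Suc j) * L)" using f(3) b1 by linarith
 have "sqrt (v q2) = sqrt A * nn q2 powr (- (real CARD('n) / 2))"
 proof -
  have "nn q2 ^ CARD('n) = (nn q2 powr (real CARD('n) / 2))\<^sup>2"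
   using pos by (simp add: power2_eq_square powr_add[symmetric] powr_realpow)
  then have "sqrt (nn q2 ^ CARD('n)) = nn q2 powr (real CARD('n) / 2)" by simp
  then show ?thesis using pos by (simp add: v_eq real_sqrt_divide powr_minus_divide)
 qed
 also have "... \<le> sqrt A * wt L j (q2 - q1)"
 proof (rule mult_left_mono)
  have "0 < max (exp (real j * L)) (nn (q2 - q1) / 2)" by (simp add: less_max_iff_disj)
  then show "nn q2 powr (- (real CARD('n) / 2)) \<le> wt L j (q2 - q1)"
   unfolding wt_def using r lo f(3) by (auto intro!: powr_mono2')
 qed (use A_pos in simp)
 finally show "sqrt (v q2) \<le> sqrt A * wt L j (q2 - q1)" .
qed

lemma corr_sum_le_Xi:
 assumes g: "0 \<le> g" and M: "2 * exp (real (Suc j) * L) \<le> M" "2 * exp (real (Suc j') * L) \<le> M"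
 shows "corr_sum (blk L g j) (blk L g j') q1 q3 \<le> A * Xi L M j j'"
proof -
 let ?U = "upper_pairs (blk L g j) q1" and ?U' = "upper_pairs (blk L g j') q3"
 let ?f = "\<lambda>r r'. wt L j r * wt L j' r' * corr r r'"
 have f0: "0 \<le> ?f r r'" for r r' by (intro mult_nonneg_nonneg wt_nonneg corr_nonneg)
 have "corr_sum (blk L g j) (blk L g j') q1 q3 \<le> (\<Sum>q2\<in>?U. \<Sum>q4\<in>?U'. A * ?f (q2 - q1) (q4 - q3))"
  unfolding corr_sum_def
 proof (intro sum_mono)
  fix q2 q4 assume q: "q2 \<in> ?U" "q4 \<in> ?U'"
  have "sqrt (v q2) * sqrt (v q4) * corr (q2 - q1) (q4 - q3)
   \<le> (sqrt A * wt L j (q2 - q1)) * (sqrt A * wt L j' (q4 - q3)) * corr (q2 - q1) (q4 - q3)"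
   by (intro mult_mono sqrt_v_le_wt(1)[OF g] q corr_nonneg mult_nonneg_nonneg real_sqrt_ge_zero v_nonneg wt_nonneg order.refl less_imp_le[OF A_pos])
  also have "... = (sqrt A * sqrt A) * ?f (q2 - q1) (q4 - q3)" by (simp only: ac_simps)
  also have "sqrt A * sqrt A = A" using A_pos by simp
  finally show "sqrt (v q2) * sqrt (v q4) * corr (q2 - q1) (q4 - q3) \<le> A * ?f (q2 - q1) (q4 - q3)" .
 qed
 also have "... = A * (\<Sum>q2\<in>?U. \<Sum>q4\<in>?U'. ?f (q2 - q1) (q4 - q3))" by (simp only: sum_distrib_left)
 also have "(\<Sum>q2\<in>?U. \<Sum>q4\<in>?U'. ?f (q2 - q1) (q4 - q3)) = (\<Sum>r\<in>(\<lambda>q. q - q1) ` ?U. \<Sum>r'\<in>(\<lambda>q. q - q3) ` ?U'. ?f r r')"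
  by (subst (1 2) sum.reindex) (auto simp: inj_on_def)
 also have "... \<le> (\<Sum>r\<in>ball0 M. \<Sum>r'\<in>(\<lambda>q. q - q3) ` ?U'. ?f r r')"
 proof (rule sum_mono2[OF finite_ball0])
  show "(\<lambda>q. q - q1) ` ?U \<subseteq> ball0 M"
   using sqrt_v_le_wt(2)[OF g] upper_pairs_facts(2) M(1) unfolding ball0_def by (fastforce intro: order.trans)
 qed (intro sum_nonneg f0)
 also have "... \<le> (\<Sum>r\<in>ball0 M. \<Sum>r'\<in>ball0 M. ?f r r')"
 proof (intro sum_mono sum_mono2[OF finite_ball0] f0)
  show "(\<lambda>q. q - q3) ` ?U' \<subseteq> ball0 M"
   using sqrt_v_le_wt(2)[OF g] upper_pairs_facts(2) M(2) unfolding ball0_def by (fastforce intro: order.trans)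
 qed
 finally show ?thesis using A_pos by (simp add: Xi_def mult_left_mono)
qed

lemma sum_ball0: obtains C where "C > 0" "!!M. 1 \<le> M ==> (\<Sum>r\<in>ball0 M. 1 / nn r ^ CARD('n)) \<le> C * (1 + ln M)"
proof -
 obtain C where C: "C > 0"
  "!!a b. 1 \<le> a ==> a \<le> b ==> \<bar>(\<Sum>q\<in>shell a b. 1 / nn q ^ CARD('n)) - real CARD('n) * vol * ln (b / a)\<bar> \<le> C"
  using sum_shell_asymp by blast
 define S0 where "S0 = (\<Sum>r\<in>ball0 1. 1 / nn r ^ CARD('n))"
 have S0: "0 \<le> S0" unfolding S0_def by (intro sum_nonneg) (simp add: nn_nonneg)
 let ?K = "real CARD('n) * vol"
 have K: "?K > 0" using vol_pos by simp
 have "(\<Sum>r\<in>ball0 M. 1 / nn r ^ CARD('n)) \<le> (S0 + C + 2 * ?K) * (1 + ln M)" if M: "1 \<le> M" for M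
 proof -
  have sub: "ball0 M \<subseteq> ball0 1 \<union> shell 1 (2 * M)" using M by (auto simp: ball0_def shell_def)
  have "(\<Sum>r\<in>ball0 M. 1 / nn r ^ CARD('n)) \<le> (\<Sum>r\<in>ball0 1 \<union> shell 1 (2 * M). 1 / nn r ^ CARD('n))"
   by (rule sum_mono2[OF _ sub]) (auto simp: finite_ball0 finite_shell nn_nonneg)
  also have "... \<le> (\<Sum>r\<in>ball0 1. 1 / nn r ^ CARD('n)) + (\<Sum>r\<in>shell 1 (2 * M). 1 / nn r ^ CARD('n))"
   by (simp add: sum_Un finite_ball0 finite_shell sum_nonneg nn_nonneg)
  also have "... \<le> S0 + (C + ?K * ln (2 * M))" using C(2)[of 1 "2 * M"] M unfolding S0_def by simp
  also have "... \<le> S0 + (C + ?K * (2 + ln M))"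
  proof -
   have "ln (2 * M) = ln 2 + ln M" using M by (simp add: ln_mult)
   moreover have "ln 2 \<le> (2::real)" using ln_le_minus_one[of 2] by simp
   ultimately show ?thesis using K by (intro add_left_mono mult_left_mono) auto
  qed
  also have "... \<le> (S0 + C + 2 * ?K) * (1 + ln M)"
  proof -
   have l: "0 \<le> ln M" using M by simp
   show ?thesis using mult_nonneg_nonneg[OF S0 l] mult_nonneg_nonneg[OF less_imp_le[OF C(1)] l] mult_nonneg_nonneg[OF less_imp_le[OF K] l]
    by (simp add: algebra_simps)
  qed
  finally show ?thesis .
 qed
 moreover have "S0 + C + 2 * ?K > 0" using S0 C(1) K by linarith
 ultimately show ?thesis using that by blast
qed

text \<open>A correlated pair is determined by its common vector \<open>r0\<close> and two multipliers. The
  sums over the multipliers converge, and the sum over \<open>r0\<close> grows logarithmically.\<close>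
lemma corr_total_le: obtains C where "C > 0"
 "!!M. 1 \<le> M ==> (\<Sum>r\<in>ball0 M. \<Sum>r'\<in>ball0 M. nn r powr (- (real CARD('n) / 2)) * nn r' powr (- (real CARD('n) / 2)) * corr r r') \<le> C * (1 + ln M)"
proof -
 let ?n = "real CARD('n)"
 have n: "?n \<ge> 1" using zero_less_card_finite[where 'a='n] by linarith
 obtain c0 where c0: "c0 > 0" "!!q. q \<noteq> 0 ==> c0 \<le> nn q" using nn_lower by blast
 \<comment> \<open>The exponent of each multiplier: \<open>n / 2\<close> comes from the norms and \<open>(1 +
   ka) / 2\<close> from \<open>corr\<close>.\<close>
 define p where "p = (?n + 1 + ka) / 2"
 have "1 + 0 < ?n + ka" using n ka(1) by (rule add_le_less_mono)
 then have p: "p > 1" unfolding p_def by simp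
 obtain Z where Z: "Z > 0" "!!K :: int. (\<Sum>c\<in>{-K..K} - {0}. \<bar>of_int c\<bar> powr (- p)) \<le> Z" using sum_int_powr_le[OF p] by blast
 obtain C1 where C1: "C1 > 0" "!!M. 1 \<le> M ==> (\<Sum>r\<in>ball0 M. 1 / nn r ^ CARD('n)) \<le> C1 * (1 + ln M)" using sum_ball0 by blast
 have "(\<Sum>r\<in>ball0 M. \<Sum>r'\<in>ball0 M. nn r powr (- (?n / 2)) * nn r' powr (- (?n / 2)) * corr r r') \<le> (Z * Z * C1) * (1 + ln M)"
  if M: "1 \<le> M" for M
 proof -
  define D where "D = {(r, r'). r \<in> ball0 M \<and> r' \<in> ball0 M \<and> (\<exists>t. common_direction r r' t)}"
  define T where "T = (\<lambda>(r :: int ^ 'n, r' :: int ^ 'n). SOME t. common_direction r r' t)"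
  define F where "F = (\<lambda>(r0 :: int ^ 'n, c :: int, c' :: int). (1 / nn r0 ^ CARD('n)) * (\<bar>of_int c\<bar> powr (- p) * \<bar>of_int c'\<bar> powr (- p)))"
  define K where "K = \<lceil>M / c0\<rceil>"
  define I where "I = ball0 M \<times> (({-K..K} - {0}) \<times> ({-K..K} - {0}))"
  have Tcd: "common_direction r r' (T (r, r'))" if "(r, r') \<in> D" for r r'
   unfolding T_def case_prod_conv by (rule someI_ex) (use that in \<open>auto simp: D_def\<close>)
  have inj: "inj_on T D"
  proof (rule inj_onI)
   fix x y assume x: "x \<in> D" and y: "y \<in> D" and e: "T x = T y"
   obtain r r' where xx: "x = (r, r')" by (cases x)
   obtain s s' where yy: "y = (s, s')" by (cases y)
   obtain r0 c c' where t: "T x = (r0, c, c')" by (cases "T x")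
   have "common_direction r r' (r0, c, c')" "common_direction s s' (r0, c, c')"
    using Tcd[of r r'] Tcd[of s s'] x y e t xx yy by auto
   then show "x = y" unfolding xx yy common_direction_def by simp
  qed
  have TI: "T ` D \<subseteq> I"
  proof
   fix t assume "t \<in> T ` D"
   then obtain r r' where rr: "(r, r') \<in> D" "t = T (r, r')" by auto
   obtain r0 c c' where t: "t = (r0, c, c')" by (cases t)
   have cd: "r = int_scale c r0" "r' = int_scale c' r0" "r0 \<noteq> 0" "c \<noteq> 0" "c' \<noteq> 0"
    using Tcd[OF rr(1)] unfolding rr(2)[symmetric] t common_direction_def by auto
   have rM: "nn r \<le> M" "nn r' \<le> M" using rr(1) by (auto simp: D_def ball0_def)
   have bound: "c \<in> {-K..K} - {0} \<and> nn r0 \<le> M" if "nn (int_scale c r0) \<le> M" "c \<noteq> 0" for c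
   proof -
    have le: "\<bar>of_int c\<bar> * nn r0 \<le> M" using that(1) by (simp add: nn_int_scale)
    have "\<bar>of_int c\<bar> * c0 \<le> \<bar>of_int c\<bar> * nn r0" by (intro mult_left_mono c0(2) cd(3)) simp
    then have "\<bar>real_of_int c\<bar> \<le> M / c0" using le c0(1) by (simp add: field_simps)
    then have "\<bar>c\<bar> \<le> K" unfolding K_def by linarith
    moreover have "1 * nn r0 \<le> \<bar>of_int c\<bar> * nn r0" using that(2) by (intro mult_right_mono nn_nonneg) linarith
    ultimately show ?thesis using that(2) le by (auto simp: abs_le_iff)
   qed
   show "t \<in> I" unfolding t I_def ball0_def
    using bound[of c] bound[of c'] rM cd by auto
  qed
  have finI: "finite I" unfolding I_def by (simp add: finite_ball0)
  have F0: "0 \<le> F t" for t unfolding F_def by (cases t) (simp add: nn_nonneg)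
  have val: "nn r powr (- (?n / 2)) * nn r' powr (- (?n / 2)) * corr r r' = F (T (r, r'))" if "(r, r') \<in> D" for r r'
  proof -
   obtain r0 c c' where t: "T (r, r') = (r0, c, c')" by (cases "T (r, r')")
   have cd: "r = int_scale c r0" "r' = int_scale c' r0" "r0 \<noteq> 0" "c \<noteq> 0" "c' \<noteq> 0"
    using Tcd[OF that] unfolding t common_direction_def by auto
   have co: "corr r r' = \<bar>of_int (c * c')\<bar> powr (- (1 + ka) / 2)"
    using that t unfolding corr_def D_def T_def by auto
   have pos: "nn r0 > 0" using nn_pos[OF cd(3)] .
   have e: "nn (int_scale d r0) powr (- (?n / 2)) = \<bar>of_int d\<bar> powr (- (?n / 2)) * nn r0 powr (- (?n / 2))" for d
    unfolding nn_int_scale by (subst powr_mult) (use pos in auto)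
   have e2: "\<bar>of_int (c * c')\<bar> powr (- (1 + ka) / 2) = \<bar>of_int c\<bar> powr (- (1 + ka) / 2) * \<bar>of_int c'\<bar> powr (- (1 + ka) / 2)"
    unfolding of_int_mult abs_mult by (subst powr_mult) auto
   have e3: "\<bar>of_int d\<bar> powr (- (?n / 2)) * \<bar>of_int d\<bar> powr (- (1 + ka) / 2) = \<bar>of_int d\<bar> powr (- p)" for d :: int
   proof -
    have "- (?n / 2) + - (1 + ka) / 2 = - p" unfolding p_def by (simp add: field_simps)
    then show ?thesis unfolding powr_add[symmetric] by (simp only:)
   qed
   have e4: "nn r0 powr (- (?n / 2)) * nn r0 powr (- (?n / 2)) = 1 / nn r0 ^ CARD('n)"
    unfolding powr_add[symmetric] using pos by (simp add: powr_minus_divide powr_realpow)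
   have "nn r powr (- (?n / 2)) * nn r' powr (- (?n / 2)) * corr r r'
    = (nn r0 powr (- (?n / 2)) * nn r0 powr (- (?n / 2))) * ((\<bar>of_int c\<bar> powr (- (?n / 2)) * \<bar>of_int c\<bar> powr (- (1 + ka) / 2))
     * (\<bar>of_int c'\<bar> powr (- (?n / 2)) * \<bar>of_int c'\<bar> powr (- (1 + ka) / 2)))"
    unfolding co e2 unfolding cd(1,2) e by (simp only: ac_simps)
   then show ?thesis unfolding e3 e4 t F_def by simp
  qed
  have "(\<Sum>r\<in>ball0 M. \<Sum>r'\<in>ball0 M. nn r powr (- (?n / 2)) * nn r' powr (- (?n / 2)) * corr r r')
   = (\<Sum>(r, r')\<in>ball0 M \<times> ball0 M. nn r powr (- (?n / 2)) * nn r' powr (- (?n / 2)) * corr r r')"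
   by (rule sum.cartesian_product)
  also have "... = (\<Sum>(r, r')\<in>D. nn r powr (- (?n / 2)) * nn r' powr (- (?n / 2)) * corr r r')"
  proof (rule sum.mono_neutral_right)
   show "finite (ball0 M \<times> ball0 M)" by (simp add: finite_ball0)
   show "D \<subseteq> ball0 M \<times> ball0 M" by (auto simp: D_def)
   have "corr r r' = 0" if "r \<in> ball0 M" "r' \<in> ball0 M" "(r, r') \<notin> D" for r r'
   proof -
    have "\<not> (\<exists>t. common_direction r r' t)" using that unfolding D_def by blast
    then show ?thesis unfolding corr_def by (simp only: if_False)
   qed
   then show "\<forall>x\<in>ball0 M \<times> ball0 M - D. (case x of (r, r') => nn r powr (- (?n / 2)) * nn r' powr (- (?n / 2)) * corr r r') = 0"
    by auto
  qed
  also have "... = (\<Sum>x\<in>D. F (T x))" by (rule sum.cong) (auto simp: val)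
  also have "... = (\<Sum>t\<in>T ` D. F t)" using inj by (simp add: sum.reindex)
  also have "... \<le> (\<Sum>t\<in>I. F t)" by (rule sum_mono2[OF finI TI F0])
  also have "... = (\<Sum>r0\<in>ball0 M. 1 / nn r0 ^ CARD('n)) * ((\<Sum>c\<in>{-K..K} - {0}. \<bar>of_int c\<bar> powr (- p)) * (\<Sum>c'\<in>{-K..K} - {0}. \<bar>of_int c'\<bar> powr (- p)))"
  proof -
   have e: "F (r0, c, c') = (1 / nn r0 ^ CARD('n)) * (\<bar>of_int c\<bar> powr (- p) * \<bar>of_int c'\<bar> powr (- p))" for r0 c c'
    by (simp add: F_def)
   have "(\<Sum>t\<in>I. F t) = (\<Sum>r0\<in>ball0 M. \<Sum>y\<in>({-K..K} - {0}) \<times> ({-K..K} - {0}). F (r0, y))"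
    unfolding I_def by (simp add: sum.cartesian_product)
   also have "... = (\<Sum>r0\<in>ball0 M. \<Sum>c\<in>{-K..K} - {0}. \<Sum>c'\<in>{-K..K} - {0}. F (r0, c, c'))"
    by (intro sum.cong refl) (simp add: sum.cartesian_product)
   also have "... = (\<Sum>r0\<in>ball0 M. (1 / nn r0 ^ CARD('n)) * ((\<Sum>c\<in>{-K..K} - {0}. \<bar>of_int c\<bar> powr (- p)) * (\<Sum>c'\<in>{-K..K} - {0}. \<bar>of_int c'\<bar> powr (- p))))"
    unfolding e sum_product by (simp only: sum_distrib_left)
   finally show ?thesis by (simp only: sum_distrib_right)
  qed
  also have "... \<le> (C1 * (1 + ln M)) * (Z * Z)"
   using Z C1 M by (intro mult_mono C1(2) Z(2) mult_nonneg_nonneg sum_nonneg) (auto intro: order.trans[OF _ C1(2)] simp: nn_nonneg)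
  finally show ?thesis by (simp only: ac_simps)
 qed
 moreover have "Z * Z * C1 > 0" using Z C1 by simp
 ultimately show ?thesis using that by blast
qed

lemma Xi_total_le: obtains C where "C > 0"
 "!!L M J. 2 \<le> L ==> 1 \<le> M ==> finite J ==> (\<Sum>j\<in>J. \<Sum>j'\<in>J. Xi L M j j') \<le> C * (1 + ln M)"
proof -
 let ?h = "real CARD('n) / 2"
 obtain C where C: "C > 0" "!!M. 1 \<le> M ==> (\<Sum>r\<in>ball0 M. \<Sum>r'\<in>ball0 M. nn r powr (- ?h) * nn r' powr (- ?h) * corr r r') \<le> C * (1 + ln M)"
  using corr_total_le by blast
 define c where "c = 9 * (2 powr ?h * 2 powr ?h)"
 have c: "c > 0" by (simp add: c_def)
 have "(\<Sum>j\<in>J. \<Sum>j'\<in>J. Xi L M j j') \<le> (c * C) * (1 + ln M)" if L: "2 \<le> L" and M: "1 \<le> M" and J: "finite J" for L M J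
 proof -
  have "(\<Sum>j\<in>J. \<Sum>j'\<in>J. Xi L M j j') = (\<Sum>j\<in>J. \<Sum>r\<in>ball0 M. \<Sum>j'\<in>J. \<Sum>r'\<in>ball0 M. wt L j r * wt L j' r' * corr r r')"
   unfolding Xi_def by (intro sum.cong refl sum.swap)
  also have "... = (\<Sum>r\<in>ball0 M. \<Sum>j\<in>J. \<Sum>j'\<in>J. \<Sum>r'\<in>ball0 M. wt L j r * wt L j' r' * corr r r')" by (rule sum.swap)
  also have "... = (\<Sum>r\<in>ball0 M. \<Sum>j\<in>J. \<Sum>r'\<in>ball0 M. \<Sum>j'\<in>J. wt L j r * wt L j' r' * corr r r')"
   by (intro sum.cong refl sum.swap)
  also have "... = (\<Sum>r\<in>ball0 M. \<Sum>r'\<in>ball0 M. \<Sum>j\<in>J. \<Sum>j'\<in>J. wt L j r * wt L j' r' * corr r r')"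
   by (intro sum.cong refl sum.swap)
  also have "... = (\<Sum>r\<in>ball0 M. \<Sum>r'\<in>ball0 M. (\<Sum>j\<in>J. wt L j r) * (\<Sum>j'\<in>J. wt L j' r') * corr r r')"
  proof (intro sum.cong refl)
   fix r r'
   have "(\<Sum>j\<in>J. wt L j r) * (\<Sum>j'\<in>J. wt L j' r') = (\<Sum>j\<in>J. \<Sum>j'\<in>J. wt L j r * wt L j' r')" by (rule sum_product)
   then show "(\<Sum>j\<in>J. \<Sum>j'\<in>J. wt L j r * wt L j' r' * corr r r') = (\<Sum>j\<in>J. wt L j r) * (\<Sum>j'\<in>J. wt L j' r') * corr r r'"
    by (simp only: sum_distrib_right)
  qed
  also have "... \<le> (\<Sum>r\<in>ball0 M. \<Sum>r'\<in>ball0 M. c * (nn r powr (- ?h) * nn r' powr (- ?h) * corr r r'))"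
  proof (intro sum_mono)
   fix r r' assume r: "r \<in> ball0 M" "r' \<in> ball0 M"
   have w: "(\<Sum>j\<in>J. wt L j r) \<le> 3 * (2 powr ?h * nn r powr (- ?h))" if "r \<in> ball0 M" for r
   proof -
    have r: "r \<noteq> 0" using that by (simp add: ball0_def)
    have "(nn r / 2) powr (- ?h) = 2 powr ?h * nn r powr (- ?h)"
    proof -
     have "(nn r / 2) powr (- ?h) = nn r powr (- ?h) / 2 powr (- ?h)" by (subst powr_divide) (use nn_nonneg in auto)
     also have "... = 2 powr ?h * nn r powr (- ?h)" by (simp add: powr_minus_divide[of 2])
     finally show ?thesis .
    qed
    then show ?thesis using wt_sum_le[OF L r J] by simp
   qed
   have "(\<Sum>j\<in>J. wt L j r) * (\<Sum>j'\<in>J. wt L j' r') * corr r r'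
    \<le> (3 * (2 powr ?h * nn r powr (- ?h))) * (3 * (2 powr ?h * nn r' powr (- ?h))) * corr r r'"
    by (intro mult_right_mono mult_mono w r corr_nonneg sum_nonneg wt_nonneg) auto
   also have "... = c * (nn r powr (- ?h) * nn r' powr (- ?h) * corr r r')" unfolding c_def by simp
   finally show "(\<Sum>j\<in>J. wt L j r) * (\<Sum>j'\<in>J. wt L j' r') * corr r r' \<le> c * (nn r powr (- ?h) * nn r' powr (- ?h) * corr r r')" .
  qed
  also have "... = c * (\<Sum>r\<in>ball0 M. \<Sum>r'\<in>ball0 M. nn r powr (- ?h) * nn r' powr (- ?h) * corr r r')" by (simp only: sum_distrib_left)
  also have "... \<le> c * (C * (1 + ln M))" using c by (intro mult_left_mono C(2) M) auto
  finally show ?thesis by (simp only: mult.assoc)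
 qed
 moreover have "c * C > 0" using c C(1) by simp
 ultimately show ?thesis using that by blast
qed

end

section \<open>Factorization of the characteristic function\<close>

lemma phase_union:
 assumes "finite Q" "finite Q'" "Q \<inter> Q' = {}"
 shows "phase b (Q \<union> Q') s (a + a') u x = phase b Q s a u x * phase b Q' s a' u x"
proof -
 have "(\<Sum>q\<in>Q \<union> Q'. box_hit (b q) q u x) = (\<Sum>q\<in>Q. box_hit (b q) q u x) + (\<Sum>q\<in>Q'. box_hit (b q) q u x)"
  by (rule sum.union_disjoint[OF assms])
 then show ?thesis by (simp add: phase_def cis_mult algebra_simps)
qed

lemma phase_integral_facts:
 shows "(\<lambda>u. \<integral>x. phase b Q s a u x \<partial>trow) \<in> borel_measurable tmat" "norm (\<integral>x. phase b Q s a u x \<partial>trow) \<le> 1"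
proof -
 interpret x: prob_space "trow :: ('m::finite => real) measure" by (rule prob_space_trow)
 show "(\<lambda>u. \<integral>x. phase b Q s a u x \<partial>trow) \<in> borel_measurable tmat"
  by (rule x.borel_measurable_lebesgue_integral[OF phase_facts(2)])
 show "norm (\<integral>x. phase b Q s a u x \<partial>trow) \<le> 1"
  by (rule integral_norm_le_const[OF prob_space_trow]) (auto simp: phase_facts)
qed

lemma norm_exp_diff_le:
 fixes x y :: real assumes "0 \<le> x" "0 \<le> y"
 shows "\<bar>exp (- x) - exp (- y)\<bar> \<le> \<bar>x - y\<bar>"
proof -
 have key: "exp (- x) - exp (- y) \<le> y - x \<and> 0 \<le> exp (- x) - exp (- y)" if "x \<le> y" "0 \<le> x" for x y :: real
 proof -
  have "exp (- x) - exp (- y) = exp (- x) * (1 - exp (x - y))" by (simp add: right_diff_distrib exp_add[symmetric])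
  also have "... \<le> 1 * (y - x)"
  proof (rule mult_mono)
   show "1 - exp (x - y) \<le> y - x" using exp_ge_add_one_self[of "x - y"] by linarith
  qed (use that in auto)
  finally show ?thesis using that by simp
 qed
 show ?thesis using key[of x y] key[of y x] assms by linarith
qed

lemma exp_quadratic_bound:
 fixes y :: real assumes "0 \<le> y"
 shows "\<bar>exp (- y) - (1 - y)\<bar> \<le> y\<^sup>2 / 2"
proof -
 have 1: "1 - y \<le> exp (- y)" using exp_ge_add_one_self[of "- y"] by simp
 have "exp (- y) \<le> 1 - y + y\<^sup>2 / 2"
 proof -
  define h where "h y = 1 - y + y\<^sup>2 / 2 - exp (- y)" for y :: real
  have "h 0 \<le> h y"
  proof (rule DERIV_nonneg_imp_nondecreasing[OF assms])
   fix x :: real assume "0 \<le> x" "x \<le> y"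
   have "(h has_real_derivative (- 1 + x + exp (- x))) (at x)"
    unfolding h_def by (auto intro!: derivative_eq_intros)
   moreover have "0 \<le> - 1 + x + exp (- x)" using exp_ge_add_one_self[of "- x"] by simp
   ultimately show "\<exists>y. (h has_real_derivative y) (at x) \<and> 0 \<le> y" by blast
  qed
  then show ?thesis by (simp add: h_def)
 qed
 then show ?thesis using 1 by simp
qed

lemma cis_cubic_bound: "norm (cis y - (1 + \<i> * of_real y - of_real (y\<^sup>2 / 2))) \<le> \<bar>y\<bar> ^ 3 / 6"
proof -
 have "(\<Sum>k\<le>2. (\<i> * complex_of_real y) ^ k / fact k) = 1 + \<i> * of_real y - of_real (y\<^sup>2 / 2)"
 proof -
  have "(\<i> * complex_of_real y) ^ 2 = - of_real (y\<^sup>2)" unfolding power_mult_distrib by simp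
  then show ?thesis by (simp add: numeral_2_eq_2)
 qed
 then show ?thesis using iexp_approx1[of y 2] by (simp add: cis_conv_exp numeral_3_eq_3 fact_numeral eval_nat_numeral)
qed

text \<open>Taylor expansion of second order of the characteristic function, compared with that of the
  Gaussian of the same variance.\<close>
lemma (in prob_space) char_gaussian_approx:
 fixes W :: "'a => real"
 assumes W[measurable]: "W \<in> borel_measurable M" and B: "!!x. \<bar>W x\<bar> \<le> B" and E0: "expectation W = 0"
 defines "V \<equiv> expectation (\<lambda>x. (W x)\<^sup>2)"
 shows "norm (expectation (\<lambda>x. cis (s * W x)) - of_real (exp (- (s\<^sup>2 * V / 2))))
  \<le> \<bar>s\<bar> ^ 3 * expectation (\<lambda>x. \<bar>W x\<bar> ^ 3) + s ^ 4 * V\<^sup>2"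
proof -
 have B0: "0 \<le> B" using B[of undefined] by linarith
 have pw: "\<bar>W x\<bar> ^ k \<le> B ^ k" for x k by (rule power_mono[OF B]) simp
 have iW: "integrable M W" by (rule integrable_const_bound[where B = B]) (use B in auto)
 have i3: "integrable M (\<lambda>x. \<bar>W x\<bar> ^ 3)" by (rule integrable_const_bound[where B = "B ^ 3"]) (use pw[of _ 3] in auto)
 have i2: "integrable M (\<lambda>x. (W x)\<^sup>2)" by (rule integrable_const_bound[where B = "B ^ 2"]) (use pw[of _ 2] in auto)
 have ic: "integrable M (\<lambda>x. cis (s * W x))" by (rule integrable_const_bound[where B = 1]) auto
 have V0: "0 \<le> V" unfolding V_def by simp
 let ?P = "\<lambda>x. 1 + \<i> * of_real (s * W x) - of_real ((s * W x)\<^sup>2 / 2) :: complex"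
 have i1': "integrable M (\<lambda>x. \<i> * of_real (s * W x) :: complex)" using iW by simp
 have i2': "integrable M (\<lambda>x. of_real ((s * W x)\<^sup>2 / 2) :: complex)"
 proof (rule integrable_of_real)
  show "integrable M (\<lambda>x. (s * W x)\<^sup>2 / 2)" using i2 by (simp add: power_mult_distrib)
 qed
 have i0: "integrable M (\<lambda>x. 1 + \<i> * of_real (s * W x) :: complex)" using i1' by (intro Bochner_Integration.integrable_add) auto
 have iP: "integrable M ?P" by (rule Bochner_Integration.integrable_diff[OF i0 i2'])
 have e1: "expectation (\<lambda>x. \<i> * of_real (s * W x) :: complex) = 0"
 proof -
  have "expectation (\<lambda>x. of_real (s * W x) :: complex) = of_real (expectation (\<lambda>x. s * W x))" by (rule integral_complex_of_real)
  also have "... = 0" using E0 by simp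
  finally show ?thesis by (simp only: Bochner_Integration.integral_mult_right_zero mult_zero_right)
 qed
 have e2: "expectation (\<lambda>x. of_real ((s * W x)\<^sup>2 / 2) :: complex) = of_real (s\<^sup>2 * V / 2)"
 proof -
  have "expectation (\<lambda>x. of_real ((s * W x)\<^sup>2 / 2) :: complex) = of_real (expectation (\<lambda>x. (s * W x)\<^sup>2 / 2))" by (rule integral_complex_of_real)
  then show ?thesis by (simp add: V_def power_mult_distrib)
 qed
 have eP: "expectation ?P = of_real (1 - s\<^sup>2 * V / 2)"
 proof -
  have "expectation ?P = expectation (\<lambda>x. 1 + \<i> * of_real (s * W x) :: complex) - of_real (s\<^sup>2 * V / 2)"
   using Bochner_Integration.integral_diff[OF i0 i2'] e2 by simp
  also have "expectation (\<lambda>x. 1 + \<i> * of_real (s * W x) :: complex) = 1"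
   using Bochner_Integration.integral_add[OF integrable_const[of 1] i1'] e1 prob_space by simp
  finally show ?thesis by simp
 qed
 have "norm (expectation (\<lambda>x. cis (s * W x)) - of_real (1 - s\<^sup>2 * V / 2)) = norm (expectation (\<lambda>x. cis (s * W x) - ?P x))"
  unfolding eP[symmetric] by (simp only: Bochner_Integration.integral_diff[OF ic iP])
 also have "... \<le> expectation (\<lambda>x. norm (cis (s * W x) - ?P x))" by (rule integral_norm_bound)
 also have "... \<le> expectation (\<lambda>x. \<bar>s\<bar> ^ 3 * \<bar>W x\<bar> ^ 3)"
 proof (rule integral_mono)
  show "integrable M (\<lambda>x. norm (cis (s * W x) - ?P x))" by (intro integrable_norm Bochner_Integration.integrable_diff ic iP)
  show "integrable M (\<lambda>x. \<bar>s\<bar> ^ 3 * \<bar>W x\<bar> ^ 3)" using i3 by simp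
  fix x
  have "norm (cis (s * W x) - ?P x) \<le> \<bar>s * W x\<bar> ^ 3 / 6" by (rule cis_cubic_bound)
  also have "... \<le> \<bar>s * W x\<bar> ^ 3" by simp
  finally show "norm (cis (s * W x) - ?P x) \<le> \<bar>s\<bar> ^ 3 * \<bar>W x\<bar> ^ 3" by (simp only: abs_mult power_mult_distrib)
 qed
 also have "... = \<bar>s\<bar> ^ 3 * expectation (\<lambda>x. \<bar>W x\<bar> ^ 3)" by simp
 finally have 1: "norm (expectation (\<lambda>x. cis (s * W x)) - of_real (1 - s\<^sup>2 * V / 2)) \<le> \<bar>s\<bar> ^ 3 * expectation (\<lambda>x. \<bar>W x\<bar> ^ 3)" .
 have "norm (of_real (1 - s\<^sup>2 * V / 2) - of_real (exp (- (s\<^sup>2 * V / 2))) :: complex) = \<bar>(1 - s\<^sup>2 * V / 2) - exp (- (s\<^sup>2 * V / 2))\<bar>"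
  unfolding of_real_diff[symmetric] norm_of_real ..
 also have "... \<le> (s\<^sup>2 * V / 2)\<^sup>2 / 2" using exp_quadratic_bound[of "s\<^sup>2 * V / 2"] V0 by (simp add: abs_minus_commute)
 also have "... \<le> s ^ 4 * V\<^sup>2"
 proof -
  have "(s\<^sup>2 * V / 2)\<^sup>2 / 2 = (s ^ 4 * V\<^sup>2) / 8" by (simp add: power_mult_distrib power_divide power_mult[symmetric])
  moreover have "0 \<le> s ^ 4 * V\<^sup>2" by simp
  ultimately show ?thesis by linarith
 qed
 finally have 2: "norm (of_real (1 - s\<^sup>2 * V / 2) - of_real (exp (- (s\<^sup>2 * V / 2))) :: complex) \<le> s ^ 4 * V\<^sup>2" .
 show ?thesis using norm_triangle_ineq[of "expectation (\<lambda>x. cis (s * W x)) - of_real (1 - s\<^sup>2 * V / 2)" "of_real (1 - s\<^sup>2 * V / 2) - of_real (exp (- (s\<^sup>2 * V / 2)))"] 1 2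
  by simp
qed

context clt_setting begin

definition mu :: "real => real => nat => real" where "mu L g j = (\<Sum>q\<in>blk L g j. v q)"

definition blocks :: "real => real => nat => (int ^ 'n) set" where "blocks L g R = (\<Union>j\<in>{1..<R}. blk L g j)"

abbreviation \<sigma>2 :: real where "\<sigma>2 \<equiv> A * real CARD('n) * vol"

lemma finite_blk: "finite (blk L g j)" unfolding blk_def by (rule finite_shell)

lemma finite_blocks: "finite (blocks L g R)" unfolding blocks_def by (intro finite_UN_I finite_blk) auto

lemma mu_nonneg: "0 \<le> mu L g j" unfolding mu_def by (intro sum_nonneg v_nonneg)

lemma blk_bounds:
 assumes "0 \<le> g" "q \<in> blk L g j" shows "exp (real j * L) \<le> nn q" "nn q < exp (real (Suc j) * L)"
proof -
 have "exp (real j * L) * 1 \<le> exp (real j * L) * exp g" using assms(1) by (intro mult_left_mono) auto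
 moreover have q: "exp (real j * L) * exp g \<le> nn q" using assms(2) by (simp add: blk_def shell_def)
 ultimately show "exp (real j * L) \<le> nn q" by linarith
 show "nn q < exp (real (Suc j) * L)" using assms(2) by (simp add: blk_def shell_def)
qed

lemma blk_ge_T0:
 assumes L: "0 \<le> L" "T0 \<le> exp L" and g: "0 \<le> g" and j: "1 \<le> j" and q: "q \<in> blk L g j"
 shows "T0 \<le> nn q" "exp L \<le> nn q"
proof -
 have "1 * L \<le> real j * L" using j L(1) by (intro mult_right_mono) auto
 then have "exp L \<le> exp (real j * L)" by simp
 then show "exp L \<le> nn q" using blk_bounds(1)[OF g q] by linarith
 then show "T0 \<le> nn q" using L(2) by linarith
qed

lemma blk_disjoint:
 assumes L: "0 \<le> L" and g: "0 \<le> g" and j: "j \<noteq> j'"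
 shows "blk L g j \<inter> blk L g j' = {}"
proof -
 have no: False if q: "q \<in> blk L g j" "q \<in> blk L g j'" and l: "j < j'" for q j j'
 proof -
  have "real (Suc j) * L \<le> real j' * L" using l L by (intro mult_right_mono) auto
  then have "exp (real (Suc j) * L) \<le> exp (real j' * L)" by simp
  then show False using blk_bounds[OF g q(1)] blk_bounds[OF g q(2)] by linarith
 qed
 show ?thesis using no[of _ j j'] no[of _ j' j] j by (auto simp: linorder_neq_iff)
qed

lemma blocks_subset:
 assumes L: "0 \<le> L" "T0 \<le> exp L" and g: "0 \<le> g"
 shows "blocks L g R \<subseteq> shell T0 (exp (real R * L))"
proof
 fix q assume "q \<in> blocks L g R"
 then obtain j where j: "1 \<le> j" "j < R" "q \<in> blk L g j" unfolding blocks_def by auto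
 have "real (Suc j) * L \<le> real R * L" using j(2) L(1) by (intro mult_right_mono) auto
 then have "exp (real (Suc j) * L) \<le> exp (real R * L)" by simp
 then have "nn q < exp (real R * L)" using blk_bounds(2)[OF g j(3)] by linarith
 then show "q \<in> shell T0 (exp (real R * L))"
  using blk_ge_T0(1)[OF L g j(1,3)] by (simp add: shell_def)
qed

lemma sum_blocks:
 assumes L: "0 \<le> L" and g: "0 \<le> g"
 shows "(\<Sum>q\<in>blocks L g R. h q) = (\<Sum>j\<in>{1..<R}. \<Sum>q\<in>blk L g j. h q)"
 unfolding blocks_def by (rule sum.UNION_disjoint) (use finite_blk blk_disjoint[OF L g] in auto)

text \<open>The blocks are split off one at a time, the last one first; the gap in front of it gives the
  decoupling.\<close>
lemma phase_blocks_factorize: obtains C c g0 where "C > 0" "c > 0" "g0 > 0"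
 "!!L g R s. T0 \<le> exp L ==> g0 \<le> g ==> g \<le> L ==>
  (\<integral>u. norm ((\<integral>x. phase b (blocks L g R) s (\<Sum>j\<in>{1..<R}. mu L g j) u x \<partial>trow)
    - (\<Prod>j\<in>{1..<R}. \<integral>x. phase b (blk L g j) s (mu L g j) u x \<partial>trow)) \<partial>tmat)
  \<le> real R * (C * (1 + \<bar>s\<bar>) * (1 + real R * L) * exp (- c * g))"
proof -
 obtain C c g0 where C: "C > 0" "c > 0" "g0 > 0"
 "!!\<beta> \<gamma> g s a a' Q. T0 \<le> \<beta> ==> g0 \<le> g ==> \<beta> * exp g \<le> \<gamma> ==> Q \<subseteq> shell T0 \<beta> ==>
  (\<integral>u. norm ((\<integral>x. phase b Q s a u x * phase b (shell (\<beta> * exp g) \<gamma>) s a' u x \<partial>trow)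
    - (\<integral>x. phase b Q s a u x \<partial>trow) * (\<integral>x. phase b (shell (\<beta> * exp g) \<gamma>) s a' u x \<partial>trow)) \<partial>tmat)
  \<le> C * (1 + \<bar>s\<bar>) * (1 + ln \<gamma>) * exp (- c * g)" using block_decoupling by blast
 interpret u: prob_space "tmat :: ('m => 'n => real) measure" by (rule prob_space_tmat)
 have "(\<integral>u. norm ((\<integral>x. phase b (blocks L g R) s (\<Sum>j\<in>{1..<R}. mu L g j) u x \<partial>trow)
    - (\<Prod>j\<in>{1..<R}. \<integral>x. phase b (blk L g j) s (mu L g j) u x \<partial>trow)) \<partial>tmat)
  \<le> real R * (C * (1 + \<bar>s\<bar>) * (1 + real R * L) * exp (- c * g))"
  if L: "T0 \<le> exp L" and g: "g0 \<le> g" "g \<le> L" for L g R s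
 proof -
  have gp: "0 < g" "0 \<le> g" and L0: "0 \<le> L" using C(3) g by auto
  let ?F = "\<lambda>k u. \<integral>x. phase b (blocks L g k) s (\<Sum>j\<in>{1..<k}. mu L g j) u x \<partial>trow"
  let ?p = "\<lambda>j u. \<integral>x. phase b (blk L g j) s (mu L g j) u x \<partial>trow"
  let ?E = "C * (1 + \<bar>s\<bar>) * (1 + real R * L) * exp (- c * g)"
  have E0: "0 \<le> ?E" using C L0 by (intro mult_nonneg_nonneg add_nonneg_nonneg) auto
  note fm[measurable] = phase_integral_facts(1)
  have pn: "norm (\<Prod>j\<in>J. ?p j u) \<le> 1" for J u
   unfolding prod_norm[symmetric] by (rule prod_le_1) (auto intro: phase_integral_facts(2))
  have "(\<integral>u. norm (?F k u - (\<Prod>j\<in>{1..<k}. ?p j u)) \<partial>tmat) \<le> real k * ?E" if "k \<le> R" for k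
   using that
  proof (induction k)
   case 0
   interpret x: prob_space "trow :: ('m => real) measure" by (rule prob_space_trow)
   have "phase b (blocks L g 0) s 0 u x = 1" for u x by (simp add: blocks_def phase_def)
   then show ?case using x.prob_space by simp
  next
   case (Suc k)
   show ?case
   proof (cases "k = 0")
    case True
    interpret x: prob_space "trow :: ('m => real) measure" by (rule prob_space_trow)
    have "phase b (blocks L g 1) s 0 u x = 1" for u x by (simp add: blocks_def phase_def)
    then show ?thesis using x.prob_space E0 unfolding True by simp
   next
    case False
    have blkk: "blk L g k = shell (exp (real k * L) * exp g) (exp (real (Suc k) * L))" by (simp add: blk_def)
    have sk: "{1..<Suc k} = insert k {1..<k}" using False by auto
    have un: "blocks L g (Suc k) = blocks L g k \<union> blk L g k" unfolding blocks_def sk by auto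
    have dj: "blocks L g k \<inter> blk L g k = {}"
    proof -
     have "q \<notin> blk L g j" if "q \<in> blk L g k" "j < k" for q j using blk_disjoint[OF L0 gp(2), of j k] that by auto
     then show ?thesis unfolding blocks_def by auto
    qed
    have Fk: "?F (Suc k) u = (\<integral>x. phase b (blocks L g k) s (\<Sum>j\<in>{1..<k}. mu L g j) u x * phase b (blk L g k) s (mu L g k) u x \<partial>trow)" for u
    proof -
     have sm: "(\<Sum>j\<in>{1..<Suc k}. mu L g j) = (\<Sum>j\<in>{1..<k}. mu L g j) + mu L g k" unfolding sk by simp
     show ?thesis unfolding un sm phase_union[OF finite_blocks finite_blk dj] ..
    qed
    have T0k: "T0 \<le> exp (real k * L)"
    proof -
     have "1 * L \<le> real k * L" using False L0 by (intro mult_right_mono) auto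
     then have "exp L \<le> exp (real k * L)" by simp
     then show ?thesis using L by linarith
    qed
    have le: "exp (real k * L) * exp g \<le> exp (real (Suc k) * L)"
     unfolding exp_add[symmetric] using g(2) by (simp add: algebra_simps)
    have "(\<integral>u. norm (?F (Suc k) u - ?F k u * ?p k u) \<partial>tmat) \<le> C * (1 + \<bar>s\<bar>) * (1 + ln (exp (real (Suc k) * L))) * exp (- c * g)"
     unfolding Fk blkk by (rule C(4)[OF T0k g(1) le blocks_subset[OF L0 L gp(2)]])
    also have "... \<le> ?E"
    proof -
     have "real (Suc k) * L \<le> real R * L" using Suc.prems L0 by (intro mult_right_mono) auto
     then show ?thesis using C L0 by (intro mult_right_mono mult_left_mono) auto
    qed
    finally have 1: "(\<integral>u. norm (?F (Suc k) u - ?F k u * ?p k u) \<partial>tmat) \<le> ?E" .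
    have ib: "integrable tmat (\<lambda>u. norm (f u))" if "f \<in> borel_measurable tmat" "!!u. norm (f u) \<le> 2" for f :: "('m => 'n => real) => complex"
     by (rule u.integrable_const_bound[where B = 2]) (use that in auto)
    have n2: "norm (a - b) \<le> 2" if "norm a \<le> 1" "norm b \<le> 1" for a b :: complex
     using norm_triangle_ineq4[of a b] that by linarith
    have nm: "norm (a * b) \<le> 1" if "norm a \<le> 1" "norm b \<le> 1" for a b :: complex
     using that by (simp add: norm_mult mult_le_one)
    have tri: "norm (f' - p * c) \<le> norm (f' - f * c) + norm (f - p)" if "norm c \<le> 1" for f f' p c :: complex
    proof -
     have "norm (f' - p * c) \<le> norm (f' - f * c) + norm ((f - p) * c)"
      using norm_triangle_ineq[of "f' - f * c" "(f - p) * c"] by (simp add: left_diff_distrib)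
     moreover have "norm ((f - p) * c) \<le> norm (f - p) * 1" unfolding norm_mult using that by (intro mult_left_mono) auto
     ultimately show ?thesis by simp
    qed
    have i1: "integrable tmat (\<lambda>u. norm (?F (Suc k) u - ?F k u * ?p k u))"
     by (rule ib, measurable, intro n2 nm phase_integral_facts(2))
    have i2: "integrable tmat (\<lambda>u. norm (?F k u - (\<Prod>j\<in>{1..<k}. ?p j u)))"
     by (rule ib, measurable, intro n2 pn phase_integral_facts(2))
    have "(\<integral>u. norm (?F (Suc k) u - (\<Prod>j\<in>{1..<Suc k}. ?p j u)) \<partial>tmat)
     \<le> (\<integral>u. norm (?F (Suc k) u - ?F k u * ?p k u) + norm (?F k u - (\<Prod>j\<in>{1..<k}. ?p j u)) \<partial>tmat)"
    proof (rule integral_mono')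
     show "integrable tmat (\<lambda>u. norm (?F (Suc k) u - ?F k u * ?p k u) + norm (?F k u - (\<Prod>j\<in>{1..<k}. ?p j u)))"
      by (rule Bochner_Integration.integrable_add[OF i1 i2])
     fix u
     have pk: "(\<Prod>j\<in>{1..<Suc k}. ?p j u) = (\<Prod>j\<in>{1..<k}. ?p j u) * ?p k u" unfolding sk by (simp add: mult.commute)
     show "norm (?F (Suc k) u - (\<Prod>j\<in>{1..<Suc k}. ?p j u)) \<le> norm (?F (Suc k) u - ?F k u * ?p k u) + norm (?F k u - (\<Prod>j\<in>{1..<k}. ?p j u))"
      unfolding pk by (rule tri[OF phase_integral_facts(2)])
    qed simp
    also have "... = (\<integral>u. norm (?F (Suc k) u - ?F k u * ?p k u) \<partial>tmat) + (\<integral>u. norm (?F k u - (\<Prod>j\<in>{1..<k}. ?p j u)) \<partial>tmat)"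
     by (rule Bochner_Integration.integral_add[OF i1 i2])
    also have "... \<le> ?E + real k * ?E" using 1 Suc.IH Suc.prems by (intro add_mono) auto
    finally show ?thesis by (simp only: of_nat_Suc distrib_right mult_1_left)
   qed
  qed
  from this[of R] show ?thesis by simp
 qed
 then show ?thesis using that C(1,2,3) by blast
qed

end

section \<open>Moments of a block\<close>

context clt_setting begin

text \<open>The parameters of the block decomposition at scale \<open>K = log T\<close>: \<open>R\<close>
  intervals of length \<open>L\<close>, up to rounding, with gaps \<open>g\<close>.\<close>
definition admissible :: "real => real => nat => real => bool" where
 "admissible L g R K \<longleftrightarrow> 2 \<le> L \<and> 0 \<le> g \<and> g \<le> L \<and> T0 \<le> exp L \<and> L \<le> K \<and> real R * L \<le> K \<and> K \<le> (real R + 1) * L"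

text \<open>No difference of two frequencies in the blocks exceeds \<open>2 exp (R L)\<close> in norm.\<close>
definition XiM :: "real => nat => nat => nat => real" where
 "XiM L R = Xi L (2 * exp (real R * L))"

lemma mu_asymp: obtains C where "C > 0"
 "!!L g j. 2 \<le> L ==> 0 \<le> g ==> g \<le> L ==> \<bar>mu L g j - \<sigma>2 * (L - g)\<bar> \<le> C"
proof -
 obtain C where C: "C > 0" "!!\<alpha> \<gamma>. 1 \<le> \<alpha> ==> \<alpha> \<le> \<gamma> ==> \<bar>(\<Sum>q\<in>shell \<alpha> \<gamma>. v q) - \<sigma>2 * ln (\<gamma> / \<alpha>)\<bar> \<le> C"
  using sum_v_shell by blast
 have s0: "0 \<le> \<sigma>2" using A_pos vol_pos by simp
 have "\<bar>mu L g j - \<sigma>2 * (L - g)\<bar> \<le> C" if L: "2 \<le> L" "0 \<le> g" "g \<le> L" for L g j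
 proof -
  have a: "1 \<le> exp (real j * L) * exp g" unfolding exp_add[symmetric] using L by simp
  have le: "exp (real j * L) * exp g \<le> exp (real (Suc j) * L)"
   unfolding exp_add[symmetric] using L by (simp add: algebra_simps)
  have "ln (exp (real (Suc j) * L) / (exp (real j * L) * exp g)) = L - g"
   unfolding exp_add[symmetric] exp_diff[symmetric] by (simp add: algebra_simps)
  then show ?thesis using C(2)[OF a le] unfolding mu_def blk_def by (simp only:)
 qed
 then show ?thesis using that C(1) by blast
qed

lemma mu_le: obtains C where "C > 0" "!!L g j. 2 \<le> L ==> 0 \<le> g ==> g \<le> L ==> mu L g j \<le> C * L"
proof -
 obtain C where C: "C > 0" "!!L g j. 2 \<le> L ==> 0 \<le> g ==> g \<le> L ==> \<bar>mu L g j - \<sigma>2 * (L - g)\<bar> \<le> C"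
  using mu_asymp by blast
 have s0: "0 \<le> \<sigma>2" using A_pos vol_pos by simp
 have "mu L g j \<le> (C + \<sigma>2) * L" if L: "2 \<le> L" "0 \<le> g" "g \<le> L" for L g j
 proof -
  have "mu L g j \<le> C + \<sigma>2 * (L - g)" using C(2)[OF L, of j] by linarith
  also have "... \<le> C * L + \<sigma>2 * L" using L C(1) s0 by (intro add_mono mult_left_mono) (auto simp: mult_le_cancel_left1)
  finally show ?thesis by (simp only: distrib_right)
 qed
 moreover have "C + \<sigma>2 > 0" using C(1) s0 by linarith
 ultimately show ?thesis using that by blast
qed

lemma corr_sum_blk_le:
 assumes "admissible L g R K" "j < R" "j' < R"
 shows "corr_sum (blk L g j) (blk L g j') q1 q3 \<le> A * XiM L R j j'"
proof -
 have "2 * exp (real (Suc i) * L) \<le> 2 * exp (real R * L)" if "i < R" for i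
 proof -
  have "real (Suc i) * L \<le> real R * L" using that assms(1) by (intro mult_right_mono) (auto simp: admissible_def)
  then show ?thesis by simp
 qed
 then show ?thesis unfolding XiM_def using assms by (intro corr_sum_le_Xi) (auto simp: admissible_def)
qed

lemma block_cov: obtains C where "C > 0"
 "!!L g R K j j'. admissible L g R K ==> j \<in> {1..<R} ==> j' \<in> {1..<R} ==>
  (\<integral>u. cov_sum (blk L g j) u * cov_sum (blk L g j') u \<partial>tmat) \<le> C * L\<^sup>2 * XiM L R j j'"
proof (rule cov_sum_product_le)
 fix C :: real assume C: "C > 0" "!!Q Q' \<Xi>. finite Q ==> finite Q' ==> (!!q. q \<in> Q \<union> Q' ==> T0 \<le> nn q) ==>
  (!!q1 q3. q1 \<in> Q ==> q3 \<in> Q' ==> corr_sum Q Q' q1 q3 \<le> \<Xi>) ==>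
  (\<integral>u. cov_sum Q u * cov_sum Q' u \<partial>tmat) \<le> C * (\<Sum>q\<in>Q. v q) * (\<Sum>q\<in>Q'. v q) * \<Xi>"
 obtain C1 where C1: "C1 > 0" "!!L g j. 2 \<le> L ==> 0 \<le> g ==> g \<le> L ==> mu L g j \<le> C1 * L"
  using mu_le by blast
 have "(\<integral>u. cov_sum (blk L g j) u * cov_sum (blk L g j') u \<partial>tmat) \<le> (C * C1\<^sup>2 * A) * L\<^sup>2 * XiM L R j j'"
  if a: "admissible L g R K" and j: "j \<in> {1..<R}" "j' \<in> {1..<R}" for L g R K j j'
 proof -
  have L: "2 \<le> L" "0 \<le> g" "g \<le> L" "T0 \<le> exp L" "0 \<le> L" using a by (auto simp: admissible_def)
  have T: "T0 \<le> nn q" if "q \<in> blk L g j \<union> blk L g j'" for q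
   using that blk_ge_T0(1)[OF L(5) L(4) L(2)] j by auto
  have X0: "0 \<le> A * XiM L R j j'" using A_pos Xi_nonneg by (simp add: XiM_def)
  have "(\<integral>u. cov_sum (blk L g j) u * cov_sum (blk L g j') u \<partial>tmat) \<le> C * mu L g j * mu L g j' * (A * XiM L R j j')"
   unfolding mu_def by (rule C(2)[OF finite_blk finite_blk T]) (use corr_sum_blk_le[OF a] j in auto)
  also have "... \<le> C * (C1 * L) * (C1 * L) * (A * XiM L R j j')"
   using C C1 L mu_nonneg by (intro mult_right_mono[OF _ X0] mult_mono C1(2)) auto
  also have "... = (C * C1\<^sup>2 * A) * L\<^sup>2 * XiM L R j j'" by (simp add: power2_eq_square)
  finally show ?thesis .
 qed
 moreover have "C * C1\<^sup>2 * A > 0" using C(1) C1(1) A_pos by simp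
 ultimately show thesis using that by blast
qed

lemma block_third_moment: obtains C where "C > 0"
 "!!L g R K j. admissible L g R K ==> j \<in> {1..<R} ==>
  (\<integral>z. (\<Sum>q\<in>blk L g j. X q (fst z) (snd z)) ^ 3 \<partial>PP) \<le> C * (L ^ 3 + L * XiM L R j j)"
proof (rule third_moment_le)
 fix C :: real assume C: "C > 0" "!!Q \<Xi>. finite Q ==> (!!q. q \<in> Q ==> T0 \<le> nn q) ==> (!!q1. q1 \<in> Q ==> corr_sum Q Q q1 q1 \<le> \<Xi>) ==>
  (\<integral>z. (\<Sum>q\<in>Q. X q (fst z) (snd z)) ^ 3 \<partial>PP)
   \<le> 3 * ((\<Sum>q\<in>Q. v q) + 2 * (\<Sum>q\<in>Q. v q)\<^sup>2 + (\<Sum>q\<in>Q. v q) ^ 3 + C * (\<Sum>q\<in>Q. v q) * \<Xi>)"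
 obtain C1 where C1: "C1 > 0" "!!L g j. 2 \<le> L ==> 0 \<le> g ==> g \<le> L ==> mu L g j \<le> C1 * L"
  using mu_le by blast
 define D where "D = 3 * (C1 + 2 * C1\<^sup>2 + C1 ^ 3)"
 define E where "E = 3 * (C * C1 * A)"
 have DE: "D > 0" "E > 0" unfolding D_def E_def using C(1) C1(1) A_pos by (auto intro!: mult_pos_pos add_pos_pos)
 have "(\<integral>z. (\<Sum>q\<in>blk L g j. X q (fst z) (snd z)) ^ 3 \<partial>PP) \<le> (D + E) * (L ^ 3 + L * XiM L R j j)"
  if a: "admissible L g R K" and j: "j \<in> {1..<R}" for L g R K j
 proof -
  have L: "2 \<le> L" "0 \<le> g" "g \<le> L" "T0 \<le> exp L" "0 \<le> L" using a by (auto simp: admissible_def)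
  have X0: "0 \<le> XiM L R j j" using Xi_nonneg by (simp add: XiM_def)
  let ?m = "mu L g j"
  have m: "?m \<le> C1 * L" by (rule C1(2)[OF L(1-3)])
  have "(\<integral>z. (\<Sum>q\<in>blk L g j. X q (fst z) (snd z)) ^ 3 \<partial>PP) \<le> 3 * (?m + 2 * ?m\<^sup>2 + ?m ^ 3 + C * ?m * (A * XiM L R j j))"
   unfolding mu_def
   by (rule C(2)[OF finite_blk]) (use blk_ge_T0(1)[OF L(5) L(4) L(2)] corr_sum_blk_le[OF a] j in auto)
  also have "... \<le> 3 * (C1 * L + 2 * (C1 * L)\<^sup>2 + (C1 * L) ^ 3 + C * (C1 * L) * (A * XiM L R j j))"
  proof -
   have "?m\<^sup>2 \<le> (C1 * L)\<^sup>2" "?m ^ 3 \<le> (C1 * L) ^ 3" by (intro power_mono m mu_nonneg)+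
   moreover have "C * ?m * (A * XiM L R j j) \<le> C * (C1 * L) * (A * XiM L R j j)"
    using C(1) A_pos X0 m by (intro mult_right_mono mult_left_mono mult_nonneg_nonneg) auto
   ultimately show ?thesis using m by (intro mult_left_mono add_mono) auto
  qed
  also have "... \<le> D * L ^ 3 + E * (L * XiM L R j j)"
  proof -
   have "L ^ 1 \<le> L ^ 3" "L ^ 2 \<le> L ^ 3" using L by (intro power_increasing; simp)+
   then have "C1 * L \<le> C1 * L ^ 3" "2 * (C1 * L)\<^sup>2 \<le> 2 * C1\<^sup>2 * L ^ 3" using C1(1) by (auto simp: power_mult_distrib)
   then show ?thesis unfolding D_def E_def by (simp add: algebra_simps power_mult_distrib)
  qed
  also have "... \<le> (D + E) * L ^ 3 + (D + E) * (L * XiM L R j j)"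
   using DE L X0 by (intro add_mono mult_right_mono) auto
  finally show ?thesis by (simp only: distrib_left)
 qed
 moreover have "D + E > 0" using DE by simp
 ultimately show thesis using that by blast
qed

text \<open>The variance of the number of hits in block \<open>j\<close> given \<open>u\<close>.\<close>
definition block_var :: "real => real => nat => ('m => 'n => real) => real" where
 "block_var L g j u = (\<Sum>q\<in>blk L g j. v q - (v q)\<^sup>2) + cov_sum (blk L g j) u"

lemma block_var_measurable [measurable]: "block_var L g j \<in> borel_measurable tmat"
 unfolding block_var_def by measurable

lemma block_var_eq:
 assumes "admissible L g R K" "1 \<le> j"
 shows "(\<integral>x. ((\<Sum>q\<in>blk L g j. X q u x) - mu L g j)\<^sup>2 \<partial>trow) = block_var L g j u" "0 \<le> block_var L g j u"
proof -
 have L: "0 \<le> L" "T0 \<le> exp L" "0 \<le> g" using assms by (auto simp: admissible_def)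
 show 1: "(\<integral>x. ((\<Sum>q\<in>blk L g j. X q u x) - mu L g j)\<^sup>2 \<partial>trow) = block_var L g j u"
  unfolding block_var_def mu_def by (rule conditional_variance_eq[OF finite_blk blk_ge_T0(1)[OF L assms(2)]])
 show "0 \<le> block_var L g j u" unfolding 1[symmetric] by simp
qed

lemma cov_sum_integrable: "integrable tmat (cov_sum Q)" "integrable tmat (\<lambda>u. cov_sum Q u * cov_sum Q' u)"
proof -
 interpret u: prob_space "tmat :: ('m => 'n => real) measure" by (rule prob_space_tmat)
 obtain B where B: "!!u. \<bar>cov_sum Q u\<bar> \<le> B" using cov_sum_bounded by blast
 obtain B' where B': "!!u. \<bar>cov_sum Q' u\<bar> \<le> B'" using cov_sum_bounded by blast
 show "integrable tmat (cov_sum Q)" by (rule u.integrable_const_bound[where B = B]) (use B in auto)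
 have "0 \<le> B" using B[of undefined] by linarith
 then have "\<bar>cov_sum Q u * cov_sum Q' u\<bar> \<le> B * B'" for u unfolding abs_mult by (rule mult_mono[OF B B']) simp
 then show "integrable tmat (\<lambda>u. cov_sum Q u * cov_sum Q' u)"
  by (intro u.integrable_const_bound[where B = "B * B'"] AE_I2) (simp_all only: real_norm_def, measurable)
qed

text \<open>The centred cube is dominated by the cubes of the number of hits and of its mean.\<close>
lemma block_char_approx: obtains C where "C > 0"
 "!!L g R K j s. admissible L g R K ==> j \<in> {1..<R} ==>
  (\<integral>u. norm ((\<integral>x. phase b (blk L g j) s (mu L g j) u x \<partial>trow) - of_real (exp (- (s\<^sup>2 * block_var L g j u / 2)))) \<partial>tmat)
  \<le> C * (\<bar>s\<bar> ^ 3 + s ^ 4) * (L ^ 3 + L\<^sup>2 * XiM L R j j)"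
proof -
 obtain C1 where C1: "C1 > 0" "!!L g j. 2 \<le> L ==> 0 \<le> g ==> g \<le> L ==> mu L g j \<le> C1 * L"
  using mu_le by blast
 obtain C2 where C2: "C2 > 0" "!!L g R K j j'. admissible L g R K ==> j \<in> {1..<R} ==> j' \<in> {1..<R} ==>
  (\<integral>u. cov_sum (blk L g j) u * cov_sum (blk L g j') u \<partial>tmat) \<le> C2 * L\<^sup>2 * XiM L R j j'" using block_cov by blast
 obtain C3 where C3: "C3 > 0" "!!L g R K j. admissible L g R K ==> j \<in> {1..<R} ==>
  (\<integral>z. (\<Sum>q\<in>blk L g j. X q (fst z) (snd z)) ^ 3 \<partial>PP) \<le> C3 * (L ^ 3 + L * XiM L R j j)" using block_third_moment by blast
 interpret u: prob_space "tmat :: ('m => 'n => real) measure" by (rule prob_space_tmat)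
 interpret x: prob_space "trow :: ('m => real) measure" by (rule prob_space_trow)
 interpret P: prob_space PP by (rule prob_space_tP)
 define C where "C = (C3 + C1 ^ 3) + (2 * C1\<^sup>2 + 2 * C2)"
 have C: "C > 0" unfolding C_def using C1(1) C2(1) C3(1) by (intro add_pos_pos) auto
 have "(\<integral>u. norm ((\<integral>x. phase b (blk L g j) s (mu L g j) u x \<partial>trow) - of_real (exp (- (s\<^sup>2 * block_var L g j u / 2)))) \<partial>tmat)
  \<le> C * (\<bar>s\<bar> ^ 3 + s ^ 4) * (L ^ 3 + L\<^sup>2 * XiM L R j j)"
  if a: "admissible L g R K" and j: "j \<in> {1..<R}" for L g R K j s
 proof -
  have L: "2 \<le> L" "0 \<le> g" "g \<le> L" "T0 \<le> exp L" "0 \<le> L" using a by (auto simp: admissible_def)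
  have X0: "0 \<le> XiM L R j j" using Xi_nonneg by (simp add: XiM_def)
  have j1: "1 \<le> j" using j by simp
  let ?Q = "blk L g j" and ?m = "mu L g j" and ?V = "block_var L g j"
  let ?N = "\<lambda>u x. \<Sum>q\<in>?Q. X q u x"
  have m: "?m \<le> C1 * L" by (rule C1(2)[OF L(1-3)])
  have N0: "0 \<le> ?N u x" for u x by (intro sum_nonneg box_hit_nonneg)
  have Nc: "?N u x \<le> real (card ?Q)" for u x
   using sum_mono[of ?Q "\<lambda>q. X q u x" "\<lambda>_. 1"] by (simp add: box_hit_le_1)
  let ?B = "real (card ?Q) + ?m"
  have WB: "\<bar>?N u x - ?m\<bar> \<le> ?B" for u x using N0[of u x] Nc[of u x] mu_nonneg[of L g j] by linarith
  have Wm: "(\<lambda>x. ?N u x - ?m) \<in> borel_measurable trow" for u by measurable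
  have E0: "(\<integral>x. ?N u x - ?m \<partial>trow) = 0" for u
  proof -
   have "(\<integral>x. ?N u x - ?m \<partial>trow) = (\<Sum>q\<in>?Q. \<integral>x. X q u x \<partial>trow) - ?m"
    using x.prob_space by (simp add: Bochner_Integration.integral_sum box_hit_integrable_x)
   also have "(\<Sum>q\<in>?Q. \<integral>x. X q u x \<partial>trow) = ?m" unfolding mu_def
    by (intro sum.cong refl integral_X blk_ge_T0(1)[OF L(5) L(4) L(2) j1])
   finally show ?thesis by simp
  qed
  let ?T = "\<lambda>u. \<integral>x. \<bar>?N u x - ?m\<bar> ^ 3 \<partial>trow"
  have pt: "norm ((\<integral>x. phase b ?Q s ?m u x \<partial>trow) - of_real (exp (- (s\<^sup>2 * ?V u / 2)))) \<le> \<bar>s\<bar> ^ 3 * ?T u + s ^ 4 * (?V u)\<^sup>2" for u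
   using x.char_gaussian_approx[OF Wm WB E0, where s = s] unfolding block_var_eq(1)[OF a j1] phase_def .
  have Tm: "(\<lambda>(u, x). \<bar>?N u x - ?m\<bar> ^ 3) \<in> borel_measurable PP" unfolding case_prod_beta by measurable
  have TB: "norm (\<bar>?N u x - ?m\<bar> ^ 3) \<le> ?B ^ 3" for u x
   using power_mono[OF WB[of u x], of 3] by simp
  have [measurable]: "?T \<in> borel_measurable tmat" by (rule x.borel_measurable_lebesgue_integral[OF Tm])
  have Tb: "norm (?T u) \<le> ?B ^ 3" for u
   by (rule integral_norm_le_const[OF prob_space_trow _ TB]) measurable
  have iT: "integrable tmat ?T"
   by (rule u.integrable_const_bound[where B = "?B ^ 3"]) (use Tb in auto)
  have ET: "(\<integral>u. ?T u \<partial>tmat) \<le> (C3 + C1 ^ 3) * (L ^ 3 + L\<^sup>2 * XiM L R j j)"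
  proof -
   have "(\<integral>u. ?T u \<partial>tmat) = (\<integral>z. \<bar>?N (fst z) (snd z) - ?m\<bar> ^ 3 \<partial>PP)"
    by (rule integral_tP[OF Tm TB, symmetric])
   also have "... \<le> (\<integral>z. ?N (fst z) (snd z) ^ 3 + ?m ^ 3 \<partial>PP)"
   proof (rule integral_mono')
    show "integrable PP (\<lambda>z. ?N (fst z) (snd z) ^ 3 + ?m ^ 3)"
    proof (rule P.integrable_const_bound[where B = "real (card ?Q) ^ 3 + ?m ^ 3"])
     have "\<bar>?N u x ^ 3 + ?m ^ 3\<bar> \<le> real (card ?Q) ^ 3 + ?m ^ 3" for u x
      using power_mono[OF Nc[of u x] N0[of u x], of 3] N0[of u x] mu_nonneg[of L g j] by (simp add: abs_of_nonneg)
     then show "AE z in PP. norm (?N (fst z) (snd z) ^ 3 + ?m ^ 3) \<le> real (card ?Q) ^ 3 + ?m ^ 3" by simp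
    qed measurable
    fix z :: "('m => 'n => real) \<times> ('m => real)"
    have key: "\<bar>a - c\<bar> ^ 3 \<le> a ^ 3 + c ^ 3" if "0 \<le> a" "0 \<le> c" for a c :: real
    proof (cases "a \<le> c")
     case True
     have "\<bar>a - c\<bar> ^ 3 \<le> c ^ 3" by (rule power_mono) (use that True in auto)
     then show ?thesis using zero_le_power[OF that(1), of 3] by linarith
    next
     case False
     have "\<bar>a - c\<bar> ^ 3 \<le> a ^ 3" by (rule power_mono) (use that False in auto)
     then show ?thesis using zero_le_power[OF that(2), of 3] by linarith
    qed
    show "\<bar>?N (fst z) (snd z) - ?m\<bar> ^ 3 \<le> ?N (fst z) (snd z) ^ 3 + ?m ^ 3" by (rule key[OF N0 mu_nonneg])
    show "0 \<le> ?N (fst z) (snd z) ^ 3 + ?m ^ 3" by (intro add_nonneg_nonneg zero_le_power N0 mu_nonneg)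
   qed
   also have "... = (\<integral>z. ?N (fst z) (snd z) ^ 3 \<partial>PP) + ?m ^ 3"
   proof -
    have "integrable PP (\<lambda>z. ?N (fst z) (snd z) ^ 3)"
    proof (rule P.integrable_const_bound[where B = "real (card ?Q) ^ 3"])
     have "\<bar>?N u x ^ 3\<bar> \<le> real (card ?Q) ^ 3" for u x
      using power_mono[OF Nc[of u x] N0[of u x], of 3] N0[of u x] by (simp add: abs_of_nonneg)
     then show "AE z in PP. norm (?N (fst z) (snd z) ^ 3) \<le> real (card ?Q) ^ 3" by simp
    qed measurable
    then show ?thesis using P.prob_space by simp
   qed
   also have "... \<le> C3 * (L ^ 3 + L * XiM L R j j) + (C1 * L) ^ 3"
    by (intro add_mono C3(2)[OF a j] power_mono m mu_nonneg)
   also have "... \<le> C3 * (L ^ 3 + L\<^sup>2 * XiM L R j j) + C1 ^ 3 * (L ^ 3 + L\<^sup>2 * XiM L R j j)"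
   proof -
    have "L ^ 1 \<le> L ^ 2" using L by (intro power_increasing) auto
    then have "L * XiM L R j j \<le> L\<^sup>2 * XiM L R j j" using X0 by (intro mult_right_mono) auto
    moreover have "0 \<le> L\<^sup>2 * XiM L R j j" using X0 by simp
    ultimately show ?thesis using C1(1) C3(1) unfolding power_mult_distrib
     by (intro add_mono mult_left_mono) auto
   qed
   finally show ?thesis by (simp only: distrib_right)
  qed
  obtain B where B: "!!u. \<bar>cov_sum ?Q u\<bar> \<le> B" using cov_sum_bounded by blast
  have d: "0 \<le> (\<Sum>q\<in>?Q. v q - (v q)\<^sup>2) + cov_sum ?Q u" for u using block_var_eq(2)[OF a j1, of u] by (simp add: block_var_def)
  let ?c = "cov_sum ?Q"
  have V2: "(?V u)\<^sup>2 \<le> 2 * (C1 * L)\<^sup>2 + 2 * (?c u * ?c u)" for u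
  proof -
   have "(\<Sum>q\<in>?Q. v q - (v q)\<^sup>2) \<le> ?m" unfolding mu_def by (intro sum_mono) simp
   then have "?V u \<le> C1 * L + \<bar>?c u\<bar>" unfolding block_var_def using m by linarith
   then have "(?V u)\<^sup>2 \<le> (C1 * L + \<bar>?c u\<bar>)\<^sup>2" using block_var_eq(2)[OF a j1] by (intro power_mono) auto
   also have "... \<le> 2 * (C1 * L)\<^sup>2 + 2 * (?c u * ?c u)"
    using zero_le_power2[of "C1 * L - \<bar>?c u\<bar>"] by (simp add: power2_eq_square algebra_simps)
   finally show ?thesis .
  qed
  have iV: "integrable tmat (\<lambda>u. (?V u)\<^sup>2)"
  proof (rule Bochner_Integration.integrable_bound)
   show "integrable tmat (\<lambda>u. 2 * (C1 * L)\<^sup>2 + 2 * (?c u * ?c u))" using cov_sum_integrable(2)[of ?Q ?Q] by simp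
   have "\<bar>(?V u)\<^sup>2\<bar> \<le> \<bar>2 * (C1 * L)\<^sup>2 + 2 * (?c u * ?c u)\<bar>" for u using V2[of u] by simp
   then show "AE u in tmat. norm ((?V u)\<^sup>2) \<le> norm (2 * (C1 * L)\<^sup>2 + 2 * (?c u * ?c u))" by simp
  qed measurable
  have EV: "(\<integral>u. (?V u)\<^sup>2 \<partial>tmat) \<le> (2 * C1\<^sup>2 + 2 * C2) * (L ^ 3 + L\<^sup>2 * XiM L R j j)"
  proof -
   have "(\<integral>u. (?V u)\<^sup>2 \<partial>tmat) \<le> (\<integral>u. 2 * (C1 * L)\<^sup>2 + 2 * (?c u * ?c u) \<partial>tmat)"
    using cov_sum_integrable(2)[of ?Q ?Q] by (intro integral_mono iV V2) simp
   also have "... = 2 * (C1 * L)\<^sup>2 + 2 * (\<integral>u. ?c u * ?c u \<partial>tmat)"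
    using cov_sum_integrable(2)[of ?Q ?Q] u.prob_space by simp
   also have "... \<le> 2 * (C1 * L)\<^sup>2 + 2 * (C2 * L\<^sup>2 * XiM L R j j)"
    using C2(2)[OF a j j] by simp
   also have "... \<le> 2 * C1\<^sup>2 * (L ^ 3 + L\<^sup>2 * XiM L R j j) + 2 * C2 * (L ^ 3 + L\<^sup>2 * XiM L R j j)"
   proof -
    have "L ^ 2 \<le> L ^ 3" using L by (intro power_increasing) auto
    then have 1: "L\<^sup>2 \<le> L ^ 3 + L\<^sup>2 * XiM L R j j" using X0 by (simp add: add_increasing2)
    have 2: "L\<^sup>2 * XiM L R j j \<le> L ^ 3 + L\<^sup>2 * XiM L R j j" using L by simp
    have "2 * (C1 * L)\<^sup>2 = 2 * C1\<^sup>2 * L\<^sup>2" by (simp add: power_mult_distrib)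
    moreover have "2 * (C2 * L\<^sup>2 * XiM L R j j) = 2 * C2 * (L\<^sup>2 * XiM L R j j)" by simp
    moreover have "2 * C1\<^sup>2 * L\<^sup>2 \<le> 2 * C1\<^sup>2 * (L ^ 3 + L\<^sup>2 * XiM L R j j)" by (rule mult_left_mono[OF 1]) simp
    moreover have "2 * C2 * (L\<^sup>2 * XiM L R j j) \<le> 2 * C2 * (L ^ 3 + L\<^sup>2 * XiM L R j j)"
     by (rule mult_left_mono[OF 2]) (use C2(1) in simp)
    ultimately show ?thesis by linarith
   qed
   finally show ?thesis by (simp only: distrib_right)
  qed
  let ?Y = "L ^ 3 + L\<^sup>2 * XiM L R j j"
  have "(\<integral>u. norm ((\<integral>x. phase b ?Q s ?m u x \<partial>trow) - of_real (exp (- (s\<^sup>2 * ?V u / 2)))) \<partial>tmat)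
   \<le> (\<integral>u. \<bar>s\<bar> ^ 3 * ?T u + s ^ 4 * (?V u)\<^sup>2 \<partial>tmat)"
   by (rule integral_mono') (use iT iV pt in auto)
  also have "... = \<bar>s\<bar> ^ 3 * (\<integral>u. ?T u \<partial>tmat) + s ^ 4 * (\<integral>u. (?V u)\<^sup>2 \<partial>tmat)" using iT iV by simp
  also have "... \<le> \<bar>s\<bar> ^ 3 * ((C3 + C1 ^ 3) * ?Y) + s ^ 4 * ((2 * C1\<^sup>2 + 2 * C2) * ?Y)"
   by (intro add_mono mult_left_mono ET EV) auto
  also have "... \<le> \<bar>s\<bar> ^ 3 * (C * ?Y) + s ^ 4 * (C * ?Y)"
   using C1(1) C2(1) C3(1) L X0 by (intro add_mono mult_left_mono mult_right_mono) (auto simp: C_def)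
  finally show ?thesis by (simp only: distrib_left distrib_right mult.assoc mult.commute mult.left_commute)
 qed
 then show ?thesis using that C by blast
qed

end

section \<open>Gaussian approximation of the product\<close>

context clt_setting begin

lemma admissible_facts:
 assumes "admissible L g R K"
 shows "2 \<le> L" "0 \<le> L" "0 \<le> g" "g \<le> L" "T0 \<le> exp L" "2 \<le> K" "0 \<le> K" "real R * L \<le> K" "K \<le> (real R + 1) * L" "L \<le> K"
 using assms by (auto simp: admissible_def)

lemma XiM_nonneg: "0 \<le> XiM L R j j'" by (simp add: XiM_def Xi_nonneg)

lemma XiM_total: obtains C where "C > 0"
 "!!L g R K. admissible L g R K ==> (\<Sum>j\<in>{1..<R}. \<Sum>j'\<in>{1..<R}. XiM L R j j') \<le> C * K"
proof -
 obtain C where C: "C > 0" "!!L M J. 2 \<le> L ==> 1 \<le> M ==> finite J ==> (\<Sum>j\<in>J. \<Sum>j'\<in>J. Xi L M j j') \<le> C * (1 + ln M)"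
  using Xi_total_le by blast
 have "(\<Sum>j\<in>{1..<R}. \<Sum>j'\<in>{1..<R}. XiM L R j j') \<le> (2 * C) * K" if a: "admissible L g R K" for L g R K
 proof -
  note f = admissible_facts[OF a]
  have e: "1 \<le> exp (real R * L)" using f(2) by simp
  then have M: "1 \<le> 2 * exp (real R * L)" by linarith
  have "ln (2 * exp (real R * L)) = ln 2 + real R * L" by (simp add: ln_mult)
  also have "... \<le> 1 + K" using f(8) ln_le_minus_one[of 2] by simp
  finally have l: "1 + ln (2 * exp (real R * L)) \<le> 2 * K" using f(6) by linarith
  have "(\<Sum>j\<in>{1..<R}. \<Sum>j'\<in>{1..<R}. XiM L R j j') \<le> C * (1 + ln (2 * exp (real R * L)))"
   unfolding XiM_def by (rule C(2)[OF f(1) M]) simp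
  also have "... \<le> C * (2 * K)" by (rule mult_left_mono[OF l]) (use C(1) in simp)
  finally show ?thesis by simp
 qed
 moreover have "2 * C > 0" using C(1) by simp
 ultimately show ?thesis using that by blast
qed

lemma product_char_approx: obtains C where "C > 0"
 "!!L g R K s. admissible L g R K ==>
  (\<integral>u. norm ((\<Prod>j\<in>{1..<R}. \<integral>x. phase b (blk L g j) s (mu L g j) u x \<partial>trow)
   - (\<Prod>j\<in>{1..<R}. of_real (exp (- (s\<^sup>2 * block_var L g j u / 2))))) \<partial>tmat) \<le> C * ((\<bar>s\<bar> ^ 3 + s ^ 4) * (K * L\<^sup>2))"
proof -
 obtain C1 where C1: "C1 > 0"
  "!!L g R K j s. admissible L g R K ==> j \<in> {1..<R} ==>
  (\<integral>u. norm ((\<integral>x. phase b (blk L g j) s (mu L g j) u x \<partial>trow) - of_real (exp (- (s\<^sup>2 * block_var L g j u / 2)))) \<partial>tmat)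
  \<le> C1 * (\<bar>s\<bar> ^ 3 + s ^ 4) * (L ^ 3 + L\<^sup>2 * XiM L R j j)" using block_char_approx by blast
 obtain C2 where C2: "C2 > 0" "!!L g R K. admissible L g R K ==> (\<Sum>j\<in>{1..<R}. \<Sum>j'\<in>{1..<R}. XiM L R j j') \<le> C2 * K"
  using XiM_total by blast
 interpret u: prob_space "tmat :: ('m => 'n => real) measure" by (rule prob_space_tmat)
 have "(\<integral>u. norm ((\<Prod>j\<in>{1..<R}. \<integral>x. phase b (blk L g j) s (mu L g j) u x \<partial>trow)
   - (\<Prod>j\<in>{1..<R}. of_real (exp (- (s\<^sup>2 * block_var L g j u / 2))))) \<partial>tmat) \<le> (C1 * (1 + C2)) * ((\<bar>s\<bar> ^ 3 + s ^ 4) * (K * L\<^sup>2))"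
  if a: "admissible L g R K" for L g R K s
 proof -
  note f = admissible_facts[OF a]
  let ?p = "\<lambda>j u. \<integral>x. phase b (blk L g j) s (mu L g j) u x \<partial>trow"
  let ?e = "\<lambda>j u. complex_of_real (exp (- (s\<^sup>2 * block_var L g j u / 2)))"
  note [measurable] = phase_integral_facts(1)
  have e1: "norm (?e j u) \<le> 1" if "j \<in> {1..<R}" for j u
   using block_var_eq(2)[OF a, of j u] that by simp
  have i: "integrable tmat (\<lambda>u. norm (?p j u - ?e j u))" if "j \<in> {1..<R}" for j
  proof (rule u.integrable_const_bound[where B = 2])
   have "norm (?p j u - ?e j u) \<le> 2" for u
    using norm_triangle_ineq4[of "?p j u" "?e j u"] phase_integral_facts(2)[of b "blk L g j" s "mu L g j" u] e1[OF that, of u] by linarith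
   then show "AE u in tmat. norm (norm (?p j u - ?e j u)) \<le> 2" by simp
  qed measurable
  have "(\<integral>u. norm ((\<Prod>j\<in>{1..<R}. ?p j u) - (\<Prod>j\<in>{1..<R}. ?e j u)) \<partial>tmat) \<le> (\<integral>u. (\<Sum>j\<in>{1..<R}. norm (?p j u - ?e j u)) \<partial>tmat)"
  proof (rule integral_mono')
   show "integrable tmat (\<lambda>u. \<Sum>j\<in>{1..<R}. norm (?p j u - ?e j u))" by (rule Bochner_Integration.integrable_sum[OF i])
   show "norm ((\<Prod>j\<in>{1..<R}. ?p j u) - (\<Prod>j\<in>{1..<R}. ?e j u)) \<le> (\<Sum>j\<in>{1..<R}. norm (?p j u - ?e j u))" for u
    by (rule norm_prod_diff[OF phase_integral_facts(2) e1])
  qed (simp add: sum_nonneg)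
  also have "... = (\<Sum>j\<in>{1..<R}. \<integral>u. norm (?p j u - ?e j u) \<partial>tmat)" by (rule Bochner_Integration.integral_sum[OF i])
  also have "... \<le> (\<Sum>j\<in>{1..<R}. C1 * (\<bar>s\<bar> ^ 3 + s ^ 4) * (L ^ 3 + L\<^sup>2 * XiM L R j j))"
   by (intro sum_mono C1(2)[OF a])
  also have "... = C1 * (\<bar>s\<bar> ^ 3 + s ^ 4) * (real (card {1..<R}) * L ^ 3 + L\<^sup>2 * (\<Sum>j\<in>{1..<R}. XiM L R j j))"
   by (simp only: sum_distrib_left[symmetric] sum.distrib sum_constant)
  also have "... \<le> C1 * (\<bar>s\<bar> ^ 3 + s ^ 4) * (K * L\<^sup>2 + L\<^sup>2 * (C2 * K))"
  proof (rule mult_left_mono)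
   have "(\<Sum>j\<in>{1..<R}. XiM L R j j) \<le> (\<Sum>j\<in>{1..<R}. \<Sum>j'\<in>{1..<R}. XiM L R j j')"
    by (intro sum_mono member_le_sum) (auto simp: XiM_nonneg)
   also have "... \<le> C2 * K" by (rule C2(2)[OF a])
   finally have 1: "L\<^sup>2 * (\<Sum>j\<in>{1..<R}. XiM L R j j) \<le> L\<^sup>2 * (C2 * K)" by (rule mult_left_mono) simp
   have "real (card {1..<R}) * L ^ 3 \<le> real R * L ^ 3" using f(2) by (intro mult_right_mono) auto
   also have "... = (real R * L) * L\<^sup>2" by (simp add: power3_eq_cube power2_eq_square)
   also have "... \<le> K * L\<^sup>2" by (rule mult_right_mono[OF f(8)]) simp
   finally show "real (card {1..<R}) * L ^ 3 + L\<^sup>2 * (\<Sum>j\<in>{1..<R}. XiM L R j j) \<le> K * L\<^sup>2 + L\<^sup>2 * (C2 * K)" using 1 by linarith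
  qed (use C1(1) in simp)
  also have "... = (C1 * (1 + C2)) * ((\<bar>s\<bar> ^ 3 + s ^ 4) * (K * L\<^sup>2))" by (simp only: distrib_left distrib_right mult_1_left mult_1_right ac_simps)
  finally show ?thesis .
 qed
 moreover have "C1 * (1 + C2) > 0" using C1(1) C2(1) by simp
 ultimately show ?thesis using that by blast
qed

text \<open>The blocks contribute dependent terms to the variance, so the square of the whole sum is expanded
  and bounded by the total correlation.\<close>
lemma cov_total: obtains C where "C > 0"
 "!!L g R K. admissible L g R K ==> (\<integral>u. \<bar>\<Sum>j\<in>{1..<R}. cov_sum (blk L g j) u\<bar> \<partial>tmat) \<le> C * (L * sqrt K)"
proof -
 obtain C1 where C1: "C1 > 0" "!!L g R K j j'. admissible L g R K ==> j \<in> {1..<R} ==> j' \<in> {1..<R} ==>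
  (\<integral>u. cov_sum (blk L g j) u * cov_sum (blk L g j') u \<partial>tmat) \<le> C1 * L\<^sup>2 * XiM L R j j'" using block_cov by blast
 obtain C2 where C2: "C2 > 0" "!!L g R K. admissible L g R K ==> (\<Sum>j\<in>{1..<R}. \<Sum>j'\<in>{1..<R}. XiM L R j j') \<le> C2 * K"
  using XiM_total by blast
 interpret u: prob_space "tmat :: ('m => 'n => real) measure" by (rule prob_space_tmat)
 have "(\<integral>u. \<bar>\<Sum>j\<in>{1..<R}. cov_sum (blk L g j) u\<bar> \<partial>tmat) \<le> sqrt (C1 * C2) * (L * sqrt K)"
  if a: "admissible L g R K" for L g R K
 proof -
  note f = admissible_facts[OF a]
  let ?c = "\<lambda>j. cov_sum (blk L g j)"
  have "\<forall>j. \<exists>B. \<forall>u. \<bar>?c j u\<bar> \<le> B" using cov_sum_bounded by blast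
  then obtain B where B: "!!j u. \<bar>?c j u\<bar> \<le> B j" by metis
  have "(\<integral>u. \<bar>\<Sum>j\<in>{1..<R}. ?c j u\<bar> \<partial>tmat) \<le> sqrt (\<integral>u. (\<Sum>j\<in>{1..<R}. ?c j u)\<^sup>2 \<partial>tmat)"
  proof (rule u.expectation_abs_le_sqrt)
   show "\<bar>\<Sum>j\<in>{1..<R}. ?c j u\<bar> \<le> (\<Sum>j\<in>{1..<R}. B j)" for u
    by (rule order.trans[OF sum_abs], intro sum_mono B)
  qed measurable
  also have "(\<integral>u. (\<Sum>j\<in>{1..<R}. ?c j u)\<^sup>2 \<partial>tmat) = (\<Sum>j\<in>{1..<R}. \<Sum>j'\<in>{1..<R}. \<integral>u. ?c j u * ?c j' u \<partial>tmat)"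
   unfolding power2_eq_square sum_product
   by (simp add: Bochner_Integration.integral_sum cov_sum_integrable(2) Bochner_Integration.integrable_sum)
  also have "sqrt ... \<le> sqrt (C1 * L\<^sup>2 * (C2 * K))"
  proof (rule real_sqrt_le_mono)
   have "(\<Sum>j\<in>{1..<R}. \<Sum>j'\<in>{1..<R}. \<integral>u. ?c j u * ?c j' u \<partial>tmat) \<le> (\<Sum>j\<in>{1..<R}. \<Sum>j'\<in>{1..<R}. C1 * L\<^sup>2 * XiM L R j j')"
    by (intro sum_mono C1(2)[OF a])
   also have "... = C1 * L\<^sup>2 * (\<Sum>j\<in>{1..<R}. \<Sum>j'\<in>{1..<R}. XiM L R j j')" by (simp only: sum_distrib_left)
   also have "... \<le> C1 * L\<^sup>2 * (C2 * K)" using C1(1) by (intro mult_left_mono C2(2)[OF a]) auto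
   finally show "(\<Sum>j\<in>{1..<R}. \<Sum>j'\<in>{1..<R}. \<integral>u. ?c j u * ?c j' u \<partial>tmat) \<le> C1 * L\<^sup>2 * (C2 * K)" .
  qed
  also have "... = sqrt (C1 * C2) * (L * sqrt K)" using f(2) by (simp add: real_sqrt_mult)
  finally show ?thesis .
 qed
 moreover have "sqrt (C1 * C2) > 0" using C1(1) C2(1) by simp
 ultimately show ?thesis using that by blast
qed

text \<open>The mean lost in the gaps is of order \<open>R g\<close>, and the two incomplete intervals at the
  ends cost \<open>O(L)\<close>.\<close>
lemma sum_mu_asymp: obtains C where "C > 0"
 "!!L g R K. admissible L g R K ==> \<bar>(\<Sum>j\<in>{1..<R}. mu L g j) - \<sigma>2 * K\<bar> \<le> C * (real R * (1 + g) + L)"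
proof -
 obtain C where C: "C > 0" "!!L g j. 2 \<le> L ==> 0 \<le> g ==> g \<le> L ==> \<bar>mu L g j - \<sigma>2 * (L - g)\<bar> \<le> C"
  using mu_asymp by blast
 have s0: "0 \<le> \<sigma>2" using A_pos vol_pos by simp
 have "\<bar>(\<Sum>j\<in>{1..<R}. mu L g j) - \<sigma>2 * K\<bar> \<le> (C + 2 * \<sigma>2) * (real R * (1 + g) + L)" if a: "admissible L g R K" for L g R K
 proof -
  note f = admissible_facts[OF a]
  define k where "k = real (card {1..<R})"
  have k: "k \<le> real R" "real R - 1 \<le> k" "0 \<le> k" by (auto simp: k_def)
  have "\<bar>(\<Sum>j\<in>{1..<R}. mu L g j - \<sigma>2 * (L - g))\<bar> \<le> (\<Sum>j\<in>{1..<R}. C)"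
   by (rule order.trans[OF sum_abs], intro sum_mono C(2) f)
  then have 1: "\<bar>(\<Sum>j\<in>{1..<R}. mu L g j) - \<sigma>2 * (k * (L - g))\<bar> \<le> C * k"
   unfolding sum_subtractf sum_constant k_def[symmetric] by (simp only: ac_simps)
  have kL: "k * L \<le> K" "K - 2 * L \<le> k * L"
  proof -
   have "k * L \<le> real R * L" by (rule mult_right_mono[OF k(1) f(2)])
   then show "k * L \<le> K" using f(8) by linarith
   have "(real R - 1) * L \<le> k * L" by (rule mult_right_mono[OF k(2) f(2)])
   moreover have "(real R - 1) * L = (real R + 1) * L - 2 * L" by (simp add: algebra_simps)
   ultimately show "K - 2 * L \<le> k * L" using f(9) by linarith
  qed
  have kg: "0 \<le> k * g" "k * g \<le> real R * g" using k f(3) by (auto intro: mult_right_mono)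
  have e: "k * (L - g) = k * L - k * g" by (rule right_diff_distrib)
  have "\<bar>k * (L - g) - K\<bar> \<le> 2 * L + real R * g" unfolding e using kL kg f(2) by linarith
  then have "\<sigma>2 * \<bar>k * (L - g) - K\<bar> \<le> \<sigma>2 * (2 * L + real R * g)" by (rule mult_left_mono[OF _ s0])
  moreover have "\<bar>\<sigma>2 * (k * (L - g)) - \<sigma>2 * K\<bar> = \<sigma>2 * \<bar>k * (L - g) - K\<bar>"
   unfolding right_diff_distrib[symmetric] abs_mult[of \<sigma>2] abs_of_nonneg[OF s0] ..
  ultimately have 2: "\<bar>\<sigma>2 * (k * (L - g)) - \<sigma>2 * K\<bar> \<le> \<sigma>2 * (2 * L + real R * g)" by (simp only:)
  have "C * k \<le> C * (real R * (1 + g) + L)"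
  proof (rule mult_left_mono)
   have "real R * 1 \<le> real R * (1 + g)" using f(3) by (intro mult_left_mono) auto
   then show "k \<le> real R * (1 + g) + L" using k(1) f(2) by linarith
  qed (use C(1) in simp)
  moreover have "\<sigma>2 * (2 * L + real R * g) \<le> \<sigma>2 * (2 * (real R * (1 + g) + L))"
  proof (rule mult_left_mono[OF _ s0])
   have "0 \<le> 2 * real R + real R * g" using f(3) by (intro add_nonneg_nonneg mult_nonneg_nonneg) auto
   moreover have "2 * (real R * (1 + g) + L) = (2 * L + real R * g) + (2 * real R + real R * g)" by (simp add: algebra_simps)
   ultimately show "2 * L + real R * g \<le> 2 * (real R * (1 + g) + L)" by (simp only: le_add_same_cancel1)
  qed
  ultimately have "\<bar>(\<Sum>j\<in>{1..<R}. mu L g j) - \<sigma>2 * K\<bar> \<le> C * (real R * (1 + g) + L) + \<sigma>2 * (2 * (real R * (1 + g) + L))"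
   using 1 2 by linarith
  also have "... = (C + 2 * \<sigma>2) * (real R * (1 + g) + L)" by (simp add: algebra_simps)
  finally show ?thesis .
 qed
 moreover have "C + 2 * \<sigma>2 > 0" using C(1) s0 by linarith
 ultimately show ?thesis using that by blast
qed

lemma v_le_exp: assumes "1 \<le> a" "a \<le> nn q" shows "v q \<le> A / a"
proof -
 have "CARD('n) \<ge> 1" by (simp add: Suc_leI)
 then have "nn q ^ 1 \<le> nn q ^ CARD('n)" using assms by (intro power_increasing) auto
 then have "a \<le> nn q ^ CARD('n)" using assms by simp
 then show ?thesis using v_eq[of q] assms A_pos by (simp add: frac_le)
qed

lemma sum_v_variance: obtains C where "C > 0"
 "!!L g R K. admissible L g R K ==>
  \<bar>(\<Sum>j\<in>{1..<R}. \<Sum>q\<in>blk L g j. v q - (v q)\<^sup>2) - \<sigma>2 * K\<bar> \<le> C * (real R * (1 + g) + L)"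
proof -
 obtain C where C: "C > 0" "!!L g R K. admissible L g R K ==> \<bar>(\<Sum>j\<in>{1..<R}. mu L g j) - \<sigma>2 * K\<bar> \<le> C * (real R * (1 + g) + L)"
  using sum_mu_asymp by blast
 obtain C1 where C1: "C1 > 0" "!!L g j. 2 \<le> L ==> 0 \<le> g ==> g \<le> L ==> mu L g j \<le> C1 * L"
  using mu_le by blast
 have "\<bar>(\<Sum>j\<in>{1..<R}. \<Sum>q\<in>blk L g j. v q - (v q)\<^sup>2) - \<sigma>2 * K\<bar> \<le> (C + A * C1) * (real R * (1 + g) + L)"
  if a: "admissible L g R K" for L g R K
 proof -
  note f = admissible_facts[OF a]
  have e1: "1 \<le> exp L" using f by simp
  have sq: "(\<Sum>q\<in>blk L g j. (v q)\<^sup>2) \<le> A * C1" if "j \<in> {1..<R}" for j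
  proof -
   have "(\<Sum>q\<in>blk L g j. (v q)\<^sup>2) \<le> (\<Sum>q\<in>blk L g j. (A / exp L) * v q)"
    unfolding power2_eq_square
    by (intro sum_mono mult_right_mono v_le_exp[OF e1] v_nonneg blk_ge_T0(2)[OF f(2,5,3)]) (use that in auto)
   also have "... = (A / exp L) * mu L g j" unfolding mu_def by (simp only: sum_distrib_left)
   also have "... \<le> (A / exp L) * (C1 * L)" using A_pos by (intro mult_left_mono C1(2) f) auto
   also have "... = (A * C1) * (L / exp L)" by simp
   also have "... \<le> (A * C1) * 1"
   proof (rule mult_left_mono)
    have "L \<le> exp L" using exp_ge_add_one_self[of L] by linarith
    then show "L / exp L \<le> 1" by simp
   qed (use A_pos C1 in simp)
   finally show ?thesis by simp
  qed
  have "(\<Sum>j\<in>{1..<R}. \<Sum>q\<in>blk L g j. (v q)\<^sup>2) \<le> (\<Sum>j\<in>{1..<R}. A * C1)" by (rule sum_mono[OF sq])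
  also have "... \<le> (A * C1) * (real R * (1 + g) + L)"
  proof -
   have "real R * 1 \<le> real R * (1 + g)" using f(3) by (intro mult_left_mono) auto
   then have "real (card {1..<R}) \<le> real R * (1 + g) + L" using f(2) by simp
   then have "(A * C1) * real (card {1..<R}) \<le> (A * C1) * (real R * (1 + g) + L)"
    using A_pos C1(1) by (intro mult_left_mono) auto
   then show ?thesis unfolding sum_constant by (simp only: mult.commute)
  qed
  finally have 1: "(\<Sum>j\<in>{1..<R}. \<Sum>q\<in>blk L g j. (v q)\<^sup>2) \<le> (A * C1) * (real R * (1 + g) + L)" .
  have 0: "0 \<le> (\<Sum>j\<in>{1..<R}. \<Sum>q\<in>blk L g j. (v q)\<^sup>2)" by (intro sum_nonneg) simp
  have e: "(\<Sum>j\<in>{1..<R}. \<Sum>q\<in>blk L g j. v q - (v q)\<^sup>2) = (\<Sum>j\<in>{1..<R}. mu L g j) - (\<Sum>j\<in>{1..<R}. \<Sum>q\<in>blk L g j. (v q)\<^sup>2)"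
   unfolding mu_def by (simp only: sum_subtractf)
  show ?thesis unfolding e distrib_right using 0 1 C(2)[OF a] by linarith
 qed
 moreover have "C + A * C1 > 0" using C(1) C1(1) A_pos by (intro add_pos_pos mult_pos_pos)
 ultimately show ?thesis using that by blast
qed

text \<open>The exponential is 1-Lipschitz on the negative half-line, so it suffices to compare the total
  variance given \<open>u\<close> with \<open>\<sigma>2 * K\<close> in mean.\<close>
lemma product_gaussian: obtains C where "C > 0"
 "!!L g R K s. admissible L g R K ==>
  (\<integral>u. norm ((\<Prod>j\<in>{1..<R}. of_real (exp (- (s\<^sup>2 * block_var L g j u / 2)))) - (of_real (exp (- (s\<^sup>2 * (\<sigma>2 * K) / 2))) :: complex)) \<partial>tmat)
   \<le> C * (s\<^sup>2 * (L * sqrt K + (real R * (1 + g) + L)))"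
proof -
 obtain C1 where C1: "C1 > 0" "!!L g R K. admissible L g R K ==> (\<integral>u. \<bar>\<Sum>j\<in>{1..<R}. cov_sum (blk L g j) u\<bar> \<partial>tmat) \<le> C1 * (L * sqrt K)"
  using cov_total by blast
 obtain C2 where C2: "C2 > 0" "!!L g R K. admissible L g R K ==>
  \<bar>(\<Sum>j\<in>{1..<R}. \<Sum>q\<in>blk L g j. v q - (v q)\<^sup>2) - \<sigma>2 * K\<bar> \<le> C2 * (real R * (1 + g) + L)" using sum_v_variance by blast
 interpret u: prob_space "tmat :: ('m => 'n => real) measure" by (rule prob_space_tmat)
 have s0: "0 \<le> \<sigma>2" using A_pos vol_pos by simp
 have "(\<integral>u. norm ((\<Prod>j\<in>{1..<R}. of_real (exp (- (s\<^sup>2 * block_var L g j u / 2)))) - (of_real (exp (- (s\<^sup>2 * (\<sigma>2 * K) / 2))) :: complex)) \<partial>tmat)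
   \<le> (C1 + C2) * (s\<^sup>2 * (L * sqrt K + (real R * (1 + g) + L)))" if a: "admissible L g R K" for L g R K s
 proof -
  note f = admissible_facts[OF a]
  let ?c = "\<lambda>u. \<Sum>j\<in>{1..<R}. cov_sum (blk L g j) u"
  let ?Y = "real R * (1 + g) + L"
  have ic: "integrable tmat (\<lambda>u. \<bar>?c u\<bar>)"
   by (intro integrable_abs Bochner_Integration.integrable_sum cov_sum_integrable(1))
  have pt: "norm ((\<Prod>j\<in>{1..<R}. of_real (exp (- (s\<^sup>2 * block_var L g j u / 2)))) - (of_real (exp (- (s\<^sup>2 * (\<sigma>2 * K) / 2))) :: complex))
   \<le> s\<^sup>2 * (\<bar>?c u\<bar> + C2 * ?Y)" for u
  proof -
   let ?S = "\<Sum>j\<in>{1..<R}. block_var L g j u"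
   have S0: "0 \<le> ?S" by (rule sum_nonneg) (use block_var_eq(2)[OF a] in auto)
   have "(\<Prod>j\<in>{1..<R}. of_real (exp (- (s\<^sup>2 * block_var L g j u / 2)))) = (of_real (exp (- (s\<^sup>2 * ?S / 2))) :: complex)"
   proof -
    have "(\<Prod>j\<in>{1..<R}. exp (- (s\<^sup>2 * block_var L g j u / 2))) = exp (\<Sum>j\<in>{1..<R}. - (s\<^sup>2 * block_var L g j u / 2))"
     by (rule exp_sum[symmetric]) simp
    also have "(\<Sum>j\<in>{1..<R}. - (s\<^sup>2 * block_var L g j u / 2)) = - (s\<^sup>2 * ?S / 2)"
     by (simp add: sum_negf sum_distrib_left sum_divide_distrib)
    finally show ?thesis by (simp only: of_real_prod[symmetric])
   qed
   then have "norm ((\<Prod>j\<in>{1..<R}. of_real (exp (- (s\<^sup>2 * block_var L g j u / 2)))) - (of_real (exp (- (s\<^sup>2 * (\<sigma>2 * K) / 2))) :: complex))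
    = \<bar>exp (- (s\<^sup>2 * ?S / 2)) - exp (- (s\<^sup>2 * (\<sigma>2 * K) / 2))\<bar>"
    by (simp only: of_real_diff[symmetric] norm_of_real)
   also have "... \<le> \<bar>s\<^sup>2 * ?S / 2 - s\<^sup>2 * (\<sigma>2 * K) / 2\<bar>"
    by (rule norm_exp_diff_le) (use S0 s0 f in \<open>auto intro!: mult_nonneg_nonneg divide_nonneg_nonneg\<close>)
   also have "... = s\<^sup>2 * \<bar>?S - \<sigma>2 * K\<bar> / 2"
   proof -
    have "s\<^sup>2 * ?S / 2 - s\<^sup>2 * (\<sigma>2 * K) / 2 = s\<^sup>2 * (?S - \<sigma>2 * K) / 2" by (simp only: right_diff_distrib diff_divide_distrib)
    then show ?thesis by (simp only: abs_mult abs_divide abs_numeral abs_power2)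
   qed
   also have "... \<le> s\<^sup>2 * \<bar>?S - \<sigma>2 * K\<bar>" by simp
   also have "... \<le> s\<^sup>2 * (\<bar>?c u\<bar> + C2 * ?Y)"
   proof (rule mult_left_mono)
    have "?S = (\<Sum>j\<in>{1..<R}. \<Sum>q\<in>blk L g j. v q - (v q)\<^sup>2) + ?c u" unfolding block_var_def by (rule sum.distrib)
    then show "\<bar>?S - \<sigma>2 * K\<bar> \<le> \<bar>?c u\<bar> + C2 * ?Y" using C2(2)[OF a] by linarith
   qed simp
   finally show ?thesis .
  qed
  have "(\<integral>u. norm ((\<Prod>j\<in>{1..<R}. of_real (exp (- (s\<^sup>2 * block_var L g j u / 2)))) - (of_real (exp (- (s\<^sup>2 * (\<sigma>2 * K) / 2))) :: complex)) \<partial>tmat)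
   \<le> (\<integral>u. s\<^sup>2 * (\<bar>?c u\<bar> + C2 * ?Y) \<partial>tmat)"
  proof (rule integral_mono'[OF _ pt])
   show "integrable tmat (\<lambda>u. s\<^sup>2 * (\<bar>?c u\<bar> + C2 * ?Y))" using ic by simp
   show "0 \<le> s\<^sup>2 * (\<bar>?c u\<bar> + C2 * ?Y)" for u
    using C2(1) f by (intro mult_nonneg_nonneg add_nonneg_nonneg) auto
  qed
  also have "... = s\<^sup>2 * ((\<integral>u. \<bar>?c u\<bar> \<partial>tmat) + C2 * ?Y)" using ic u.prob_space by simp
  also have "... \<le> s\<^sup>2 * (C1 * (L * sqrt K) + C2 * ?Y)" by (intro mult_left_mono add_right_mono C1(2)[OF a]) simp
  also have "... \<le> s\<^sup>2 * ((C1 + C2) * (L * sqrt K) + (C1 + C2) * ?Y)"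
   using C1(1) C2(1) f by (intro mult_left_mono add_mono mult_right_mono) auto
  also have "... = (C1 + C2) * (s\<^sup>2 * (L * sqrt K + ?Y))" by (simp add: algebra_simps)
  finally show ?thesis .
 qed
 moreover have "C1 + C2 > 0" using C1(1) C2(1) by simp
 ultimately show ?thesis using that by blast
qed

text \<open>The discarded frequencies have small total mean; by pairwise independence this also bounds their
  variance.\<close>
lemma truncation: obtains C where "C > 0"
 "!!L g R K. admissible L g R K ==>
  (\<integral>z. \<bar>((\<Sum>q\<in>shell T0 (exp K). X q (fst z) (snd z)) - \<sigma>2 * K)
   - ((\<Sum>q\<in>blocks L g R. X q (fst z) (snd z)) - (\<Sum>j\<in>{1..<R}. mu L g j))\<bar> \<partial>PP) \<le> C * (1 + sqrt (real R * (1 + g) + L))"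
proof -
 obtain C1 where C1: "C1 > 0" "!!\<alpha> \<gamma>. 1 \<le> \<alpha> ==> \<alpha> \<le> \<gamma> ==> \<bar>(\<Sum>q\<in>shell \<alpha> \<gamma>. v q) - \<sigma>2 * ln (\<gamma> / \<alpha>)\<bar> \<le> C1"
  using sum_v_shell by blast
 obtain C2 where C2: "C2 > 0" "!!L g R K. admissible L g R K ==> \<bar>(\<Sum>j\<in>{1..<R}. mu L g j) - \<sigma>2 * K\<bar> \<le> C2 * (real R * (1 + g) + L)"
  using sum_mu_asymp by blast
 have s0: "0 \<le> \<sigma>2" using A_pos vol_pos by simp
 interpret P: prob_space PP by (rule prob_space_tP)
 define C3 where "C3 = C1 + \<sigma>2 * ln T0"
 have C3: "C3 > 0" unfolding C3_def using C1(1) s0 T0_ge_1 by (simp add: add_pos_nonneg)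
 define C where "C = sqrt (C3 + C2) + C3"
 have C: "C > 0" unfolding C_def using C3 C2(1) by (intro add_pos_pos) auto
 have "(\<integral>z. \<bar>((\<Sum>q\<in>shell T0 (exp K). X q (fst z) (snd z)) - \<sigma>2 * K)
   - ((\<Sum>q\<in>blocks L g R. X q (fst z) (snd z)) - (\<Sum>j\<in>{1..<R}. mu L g j))\<bar> \<partial>PP) \<le> C * (1 + sqrt (real R * (1 + g) + L))"
  if a: "admissible L g R K" for L g R K
 proof -
  note f = admissible_facts[OF a]
  let ?S = "shell T0 (exp K)" and ?U = "blocks L g R" and ?Y = "real R * (1 + g) + L"
  let ?Xz = "\<lambda>q z. X q (fst z) (snd z)"
  have Y1: "1 \<le> ?Y" using f(1,3) by (simp add: add_increasing)
  have "exp L \<le> exp K" using f(10) by simp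
  then have TK: "T0 \<le> exp K" using f(5) by linarith
  have "exp (real R * L) \<le> exp K" using f(8) by simp
  then have "shell T0 (exp (real R * L)) \<subseteq> ?S" unfolding shell_def by (intro Collect_mono impI conjI) (linarith | blast)+
  then have US: "?U \<subseteq> ?S" using blocks_subset[OF f(2,5,3)] by blast
  have sv: "\<bar>(\<Sum>q\<in>?S. v q) - \<sigma>2 * K\<bar> \<le> C3"
  proof -
   have "ln (exp K / T0) = K - ln T0" using T0_ge_1 by (subst ln_div) auto
   then have "\<bar>(\<Sum>q\<in>?S. v q) - (\<sigma>2 * K - \<sigma>2 * ln T0)\<bar> \<le> C1" using C1(2)[OF T0_ge_1 TK] by (simp only: right_diff_distrib)
   moreover have "0 \<le> \<sigma>2 * ln T0" using s0 T0_ge_1 by simp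
   ultimately show ?thesis unfolding C3_def by linarith
  qed
  have dv: "(\<Sum>q\<in>?S - ?U. v q) \<le> (C3 + C2) * ?Y"
  proof -
   have "(\<Sum>q\<in>?S - ?U. v q) = (\<Sum>q\<in>?S. v q) - (\<Sum>j\<in>{1..<R}. mu L g j)"
    unfolding sum_diff[OF finite_shell US] sum_blocks[OF f(2,3)] mu_def ..
   also have "... \<le> C3 + C2 * ?Y" using sv C2(2)[OF a] by linarith
   also have "... \<le> C3 * ?Y + C2 * ?Y" using mult_left_mono[OF Y1, of C3] C3 by simp
   finally show ?thesis by (simp only: distrib_right)
  qed
  have vp: "(\<Prod>i\<in>UNIV. integral\<^sup>L circ (near_int (b q i))) = v q" if "q \<in> ?S - ?U" for q
   unfolding v_def using that by (intro prod.cong refl integral_near_int b_nonneg b_le_half) (auto simp: shell_def)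
  have "(\<integral>z. \<bar>\<Sum>q\<in>?S - ?U. ?Xz q z - v q\<bar> \<partial>PP) \<le> sqrt (\<Sum>q\<in>?S - ?U. v q)"
  proof -
   have "(\<integral>z. \<bar>\<Sum>q\<in>?S - ?U. ?Xz q z - (\<Prod>i\<in>UNIV. integral\<^sup>L circ (near_int (b q i)))\<bar> \<partial>PP)
    \<le> sqrt (\<Sum>q\<in>?S - ?U. \<Prod>i\<in>UNIV. integral\<^sup>L circ (near_int (b q i)))"
    unfolding box_hit_def by (rule torus_variance_le(2)) (auto simp: finite_shell circle_fun_near_int)
   moreover have "(\<Sum>q\<in>?S - ?U. ?Xz q z - (\<Prod>i\<in>UNIV. integral\<^sup>L circ (near_int (b q i)))) = (\<Sum>q\<in>?S - ?U. ?Xz q z - v q)" for z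
    by (intro sum.cong refl) (simp only: vp)
   moreover have "(\<Sum>q\<in>?S - ?U. \<Prod>i\<in>UNIV. integral\<^sup>L circ (near_int (b q i))) = (\<Sum>q\<in>?S - ?U. v q)" by (intro sum.cong refl vp)
   ultimately show ?thesis by (simp only:)
  qed
  also have "... \<le> sqrt (C3 + C2) * sqrt ?Y" using real_sqrt_le_mono[OF dv] by (simp only: real_sqrt_mult)
  finally have main: "(\<integral>z. \<bar>\<Sum>q\<in>?S - ?U. ?Xz q z - v q\<bar> \<partial>PP) \<le> sqrt (C3 + C2) * sqrt ?Y" .
  have i: "integrable PP (\<lambda>z. \<bar>\<Sum>q\<in>?S - ?U. ?Xz q z - v q\<bar>)"
  proof (intro integrable_abs Bochner_Integration.integrable_sum Bochner_Integration.integrable_diff)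
   show "integrable PP (?Xz q)" for q by (rule P.integrable_const_bound[where B = 1]) (use X_bound in auto)
  qed simp
  have "(\<integral>z. \<bar>((\<Sum>q\<in>?S. ?Xz q z) - \<sigma>2 * K) - ((\<Sum>q\<in>?U. ?Xz q z) - (\<Sum>j\<in>{1..<R}. mu L g j))\<bar> \<partial>PP)
   \<le> (\<integral>z. \<bar>\<Sum>q\<in>?S - ?U. ?Xz q z - v q\<bar> + C3 \<partial>PP)"
  proof (rule integral_mono')
   fix z :: "('m => 'n => real) \<times> ('m => real)"
   have "(\<Sum>q\<in>?S - ?U. ?Xz q z - v q) = ((\<Sum>q\<in>?S. ?Xz q z) - (\<Sum>q\<in>?U. ?Xz q z)) - ((\<Sum>q\<in>?S. v q) - (\<Sum>j\<in>{1..<R}. mu L g j))"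
    unfolding sum_subtractf sum_diff[OF finite_shell US] sum_blocks[OF f(2,3), of v] mu_def ..
   then show "\<bar>((\<Sum>q\<in>?S. ?Xz q z) - \<sigma>2 * K) - ((\<Sum>q\<in>?U. ?Xz q z) - (\<Sum>j\<in>{1..<R}. mu L g j))\<bar> \<le> \<bar>\<Sum>q\<in>?S - ?U. ?Xz q z - v q\<bar> + C3"
    using sv by linarith
   show "0 \<le> \<bar>\<Sum>q\<in>?S - ?U. ?Xz q z - v q\<bar> + C3" using C3 by simp
  qed (use i in simp)
  also have "... = (\<integral>z. \<bar>\<Sum>q\<in>?S - ?U. ?Xz q z - v q\<bar> \<partial>PP) + C3" using i P.prob_space by simp
  also have "... \<le> sqrt (C3 + C2) * sqrt ?Y + C3" using main by simp
  also have "... \<le> sqrt (C3 + C2) * (1 + sqrt ?Y) + C3 * (1 + sqrt ?Y)"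
  proof (rule add_mono)
   show "sqrt (C3 + C2) * sqrt ?Y \<le> sqrt (C3 + C2) * (1 + sqrt ?Y)" using C3 C2(1) by (intro mult_left_mono) auto
   have "C3 * 1 \<le> C3 * (1 + sqrt ?Y)" using C3 Y1 by (intro mult_left_mono) auto
   then show "C3 \<le> C3 * (1 + sqrt ?Y)" by simp
  qed
  also have "... = C * (1 + sqrt ?Y)" unfolding C_def by (simp only: distrib_right)
  finally show ?thesis .
 qed
 then show ?thesis using that C by blast
qed

end

section \<open>Convergence of characteristic functions\<close>

context clt_setting begin

lemma char_bound: obtains C c g0 where "C > 0" "c > 0" "g0 > 0"
 "!!L g R K s. admissible L g R K ==> g0 \<le> g ==>
  norm ((\<integral>z. cis (s * ((\<Sum>q\<in>shell T0 (exp K). X q (fst z) (snd z)) - \<sigma>2 * K)) \<partial>PP) - of_real (exp (- (s\<^sup>2 * (\<sigma>2 * K) / 2))))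
  \<le> C * (real R * ((1 + \<bar>s\<bar>) * (K * exp (- c * g))) + (\<bar>s\<bar> ^ 3 + s ^ 4) * (K * L\<^sup>2)
    + s\<^sup>2 * (L * sqrt K + (real R * (1 + g) + L)) + \<bar>s\<bar> * (1 + sqrt (real R * (1 + g) + L)))"
proof -
 obtain C1 c g0 where C1: "C1 > 0" "c > 0" "g0 > 0"
  "!!L g R s. T0 \<le> exp L ==> g0 \<le> g ==> g \<le> L ==>
  (\<integral>u. norm ((\<integral>x. phase b (blocks L g R) s (\<Sum>j\<in>{1..<R}. mu L g j) u x \<partial>trow)
    - (\<Prod>j\<in>{1..<R}. \<integral>x. phase b (blk L g j) s (mu L g j) u x \<partial>trow)) \<partial>tmat)
  \<le> real R * (C1 * (1 + \<bar>s\<bar>) * (1 + real R * L) * exp (- c * g))" using phase_blocks_factorize by blast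
 obtain C2 where C2: "C2 > 0" "!!L g R K s. admissible L g R K ==>
  (\<integral>u. norm ((\<Prod>j\<in>{1..<R}. \<integral>x. phase b (blk L g j) s (mu L g j) u x \<partial>trow)
   - (\<Prod>j\<in>{1..<R}. of_real (exp (- (s\<^sup>2 * block_var L g j u / 2))))) \<partial>tmat) \<le> C2 * ((\<bar>s\<bar> ^ 3 + s ^ 4) * (K * L\<^sup>2))"
  using product_char_approx by blast
 obtain C3 where C3: "C3 > 0" "!!L g R K s. admissible L g R K ==>
  (\<integral>u. norm ((\<Prod>j\<in>{1..<R}. of_real (exp (- (s\<^sup>2 * block_var L g j u / 2)))) - (of_real (exp (- (s\<^sup>2 * (\<sigma>2 * K) / 2))) :: complex)) \<partial>tmat)
   \<le> C3 * (s\<^sup>2 * (L * sqrt K + (real R * (1 + g) + L)))" using product_gaussian by blast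
 obtain C4 where C4: "C4 > 0" "!!L g R K. admissible L g R K ==>
  (\<integral>z. \<bar>((\<Sum>q\<in>shell T0 (exp K). X q (fst z) (snd z)) - \<sigma>2 * K)
   - ((\<Sum>q\<in>blocks L g R. X q (fst z) (snd z)) - (\<Sum>j\<in>{1..<R}. mu L g j))\<bar> \<partial>PP) \<le> C4 * (1 + sqrt (real R * (1 + g) + L))"
  using truncation by blast
 interpret P: prob_space PP by (rule prob_space_tP)
 interpret u: prob_space "tmat :: ('m => 'n => real) measure" by (rule prob_space_tmat)
 have s0: "0 \<le> \<sigma>2" using A_pos vol_pos by simp
 define C where "C = 2 * C1 + C2 + C3 + C4"
 have C: "C > 0" "2 * C1 \<le> C" "C2 \<le> C" "C3 \<le> C" "C4 \<le> C" unfolding C_def using C1(1) C2(1) C3(1) C4(1) by auto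
 have "norm ((\<integral>z. cis (s * ((\<Sum>q\<in>shell T0 (exp K). X q (fst z) (snd z)) - \<sigma>2 * K)) \<partial>PP) - of_real (exp (- (s\<^sup>2 * (\<sigma>2 * K) / 2))))
  \<le> C * (real R * ((1 + \<bar>s\<bar>) * (K * exp (- c * g))) + (\<bar>s\<bar> ^ 3 + s ^ 4) * (K * L\<^sup>2)
    + s\<^sup>2 * (L * sqrt K + (real R * (1 + g) + L)) + \<bar>s\<bar> * (1 + sqrt (real R * (1 + g) + L)))"
  if a: "admissible L g R K" and g: "g0 \<le> g" for L g R K s
 proof -
  note f = admissible_facts[OF a]
  let ?a = "\<Sum>j\<in>{1..<R}. mu L g j"
  define e where "e = (of_real (exp (- (s\<^sup>2 * (\<sigma>2 * K) / 2))) :: complex)"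
  define F where "F u = (\<integral>x. phase b (blocks L g R) s ?a u x \<partial>trow)" for u
  define p where "p u = (\<Prod>j\<in>{1..<R}. \<integral>x. phase b (blk L g j) s (mu L g j) u x \<partial>trow)" for u
  define w where "w u = (\<Prod>j\<in>{1..<R}. of_real (exp (- (s\<^sup>2 * block_var L g j u / 2))) :: complex)" for u
  let ?D = "\<lambda>z. ((\<Sum>q\<in>shell T0 (exp K). X q (fst z) (snd z)) - \<sigma>2 * K) - ((\<Sum>q\<in>blocks L g R. X q (fst z) (snd z)) - ?a)"
  let ?S = "\<lambda>z. cis (s * ((\<Sum>q\<in>shell T0 (exp K). X q (fst z) (snd z)) - \<sigma>2 * K))"
  let ?Ph = "\<lambda>z. phase b (blocks L g R) s ?a (fst z) (snd z)"
  note pm[measurable] = phase_integral_facts(1)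
  have [measurable]: "F \<in> borel_measurable tmat" "p \<in> borel_measurable tmat" "w \<in> borel_measurable tmat"
   unfolding F_def[abs_def] p_def[abs_def] w_def[abs_def] by measurable
  have n1: "norm (F u) \<le> 1" "norm (p u) \<le> 1" "norm (w u) \<le> 1" "norm e \<le> 1" for u
  proof -
   show "norm (F u) \<le> 1" unfolding F_def by (rule phase_integral_facts(2))
   show "norm (p u) \<le> 1" unfolding p_def prod_norm[symmetric] by (rule prod_le_1) (auto intro: phase_integral_facts(2))
   show "norm (w u) \<le> 1" unfolding w_def prod_norm[symmetric]
    by (rule prod_le_1) (use block_var_eq(2)[OF a] in auto)
   show "norm e \<le> 1" unfolding e_def using s0 f by simp
  qed
  have ib: "integrable tmat (\<lambda>u. norm (h u - k u))" if "h \<in> borel_measurable tmat" "k \<in> borel_measurable tmat" "!!u. norm (h u) \<le> 1" "!!u. norm (k u) \<le> 1"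
   for h k :: "('m => 'n => real) => complex"
  proof (rule u.integrable_const_bound[where B = 2])
   have "norm (h u - k u) \<le> 2" for u using norm_triangle_ineq4[of "h u" "k u"] that(3)[of u] that(4)[of u] by linarith
   then show "AE u in tmat. norm (norm (h u - k u)) \<le> 2" by simp
   show "(\<lambda>u. norm (h u - k u)) \<in> borel_measurable tmat" using that(1,2) by measurable
  qed
  have iF: "integrable tmat F" by (rule u.integrable_const_bound[where B = 1]) (use n1 in auto)
  have phm: "(\<lambda>(u, x). phase b (blocks L g R) s ?a u x) \<in> borel_measurable PP" by (rule phase_facts(2))
  have EPh: "(\<integral>z. ?Ph z \<partial>PP) = (\<integral>u. F u \<partial>tmat)"
   unfolding F_def by (rule integral_tP[OF phm phase_facts(1)])
  have Phm: "?Ph \<in> borel_measurable PP" using phm by (simp add: case_prod_beta')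
  have iPh: "integrable PP ?Ph" by (rule P.integrable_const_bound[OF _ Phm, where B = 1]) (rule AE_I2, rule phase_facts(1))
  have iS: "integrable PP ?S" by (rule P.integrable_const_bound[where B = 1]) auto
  have iD: "integrable PP (\<lambda>z. \<bar>?D z\<bar>)"
  proof -
   have "integrable PP (\<lambda>z. X q (fst z) (snd z))" for q by (rule P.integrable_const_bound[where B = 1]) (use X_bound in auto)
   then show ?thesis by (intro integrable_abs Bochner_Integration.integrable_diff Bochner_Integration.integrable_sum) auto
  qed
  have 1: "norm ((\<integral>z. ?S z \<partial>PP) - (\<integral>z. ?Ph z \<partial>PP)) \<le> C4 * (\<bar>s\<bar> * (1 + sqrt (real R * (1 + g) + L)))"
  proof -
   have "norm ((\<integral>z. ?S z \<partial>PP) - (\<integral>z. ?Ph z \<partial>PP)) = norm (\<integral>z. ?S z - ?Ph z \<partial>PP)"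
    by (simp only: Bochner_Integration.integral_diff[OF iS iPh])
   also have "... \<le> (\<integral>z. norm (?S z - ?Ph z) \<partial>PP)" by (rule integral_norm_bound)
   also have "... \<le> (\<integral>z. \<bar>s\<bar> * \<bar>?D z\<bar> \<partial>PP)"
   proof (rule integral_mono')
    fix z
    have "norm (?S z - ?Ph z) \<le> \<bar>s * ((\<Sum>q\<in>shell T0 (exp K). X q (fst z) (snd z)) - \<sigma>2 * K) - s * ((\<Sum>q\<in>blocks L g R. X q (fst z) (snd z)) - ?a)\<bar>"
     unfolding phase_def by (rule norm_cis_diff_le)
    then show "norm (?S z - ?Ph z) \<le> \<bar>s\<bar> * \<bar>?D z\<bar>" by (simp only: right_diff_distrib[symmetric] abs_mult)
   qed (use iD in auto)
   also have "... = \<bar>s\<bar> * (\<integral>z. \<bar>?D z\<bar> \<partial>PP)" by (rule Bochner_Integration.integral_mult_right_zero)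
   also have "... \<le> \<bar>s\<bar> * (C4 * (1 + sqrt (real R * (1 + g) + L)))" by (rule mult_left_mono[OF C4(2)[OF a]]) simp
   finally show ?thesis by (simp only: mult.left_commute)
  qed
  have 2: "norm ((\<integral>u. F u \<partial>tmat) - e) \<le> (\<integral>u. norm (F u - p u) \<partial>tmat) + (\<integral>u. norm (p u - w u) \<partial>tmat) + (\<integral>u. norm (w u - e) \<partial>tmat)"
  proof -
   have "norm ((\<integral>u. F u \<partial>tmat) - e) = norm (\<integral>u. F u - e \<partial>tmat)"
    using iF u.prob_space by simp
   also have "... \<le> (\<integral>u. norm (F u - e) \<partial>tmat)" by (rule integral_norm_bound)
   also have "... \<le> (\<integral>u. norm (F u - p u) + norm (p u - w u) + norm (w u - e) \<partial>tmat)"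
   proof (rule integral_mono')
    show "integrable tmat (\<lambda>u. norm (F u - p u) + norm (p u - w u) + norm (w u - e))"
     by (intro Bochner_Integration.integrable_add ib n1) measurable
    show "norm (F u - e) \<le> norm (F u - p u) + norm (p u - w u) + norm (w u - e)" for u
    proof -
     have "F u - e = (F u - p u) + (p u - w u) + (w u - e)" by simp
     then show ?thesis by (metis norm_triangle_ineq norm_triangle_mono order_refl)
    qed
   qed simp
   also have "... = (\<integral>u. norm (F u - p u) \<partial>tmat) + (\<integral>u. norm (p u - w u) \<partial>tmat) + (\<integral>u. norm (w u - e) \<partial>tmat)"
   proof -
    have i: "integrable tmat (\<lambda>u. norm (F u - p u))" "integrable tmat (\<lambda>u. norm (p u - w u))" "integrable tmat (\<lambda>u. norm (w u - e))"
     by (rule ib, measurable, rule n1, rule n1)+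
    show ?thesis by (simp only: Bochner_Integration.integral_add i Bochner_Integration.integrable_add)
   qed
   finally show ?thesis .
  qed
  have 3: "(\<integral>u. norm (F u - p u) \<partial>tmat) \<le> 2 * C1 * (real R * ((1 + \<bar>s\<bar>) * (K * exp (- c * g))))"
  proof -
   have "(\<integral>u. norm (F u - p u) \<partial>tmat) \<le> real R * (C1 * (1 + \<bar>s\<bar>) * (1 + real R * L) * exp (- c * g))"
    unfolding F_def p_def by (rule C1(4)[OF f(5) g f(4)])
   also have "... \<le> real R * (C1 * (1 + \<bar>s\<bar>) * (2 * K) * exp (- c * g))"
    using f(6,8) C1(1) by (intro mult_left_mono mult_right_mono) auto
   finally show ?thesis by (simp only: ac_simps)
  qed
  have 4: "(\<integral>u. norm (p u - w u) \<partial>tmat) \<le> C2 * ((\<bar>s\<bar> ^ 3 + s ^ 4) * (K * L\<^sup>2))"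
   unfolding p_def w_def by (rule C2(2)[OF a])
  have 5: "(\<integral>u. norm (w u - e) \<partial>tmat) \<le> C3 * (s\<^sup>2 * (L * sqrt K + (real R * (1 + g) + L)))"
   unfolding w_def e_def by (rule C3(2)[OF a])
  have Y0: "0 \<le> real R * (1 + g) + L" using f by simp
  have m: "C1' * y \<le> C * y" if "C1' \<le> C" "0 \<le> y" for C1' y by (rule mult_right_mono[OF that])
  have n0: "0 \<le> real R * ((1 + \<bar>s\<bar>) * (K * exp (- c * g)))" "0 \<le> (\<bar>s\<bar> ^ 3 + s ^ 4) * (K * L\<^sup>2)"
   "0 \<le> s\<^sup>2 * (L * sqrt K + (real R * (1 + g) + L))" "0 \<le> \<bar>s\<bar> * (1 + sqrt (real R * (1 + g) + L))"
   using f Y0 by (auto intro!: mult_nonneg_nonneg add_nonneg_nonneg)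
  have "norm ((\<integral>z. ?S z \<partial>PP) - e) \<le> norm ((\<integral>z. ?S z \<partial>PP) - (\<integral>z. ?Ph z \<partial>PP)) + norm ((\<integral>z. ?Ph z \<partial>PP) - e)"
   using norm_triangle_ineq[of "(\<integral>z. ?S z \<partial>PP) - (\<integral>z. ?Ph z \<partial>PP)" "(\<integral>z. ?Ph z \<partial>PP) - e"] by simp
  then show ?thesis unfolding EPh e_def[symmetric] distrib_left[of C]
   using 1[unfolded EPh] 2 3 4 5 m[OF C(2) n0(1)] m[OF C(3) n0(2)] m[OF C(4) n0(3)] m[OF C(5) n0(4)] by linarith
 qed
 then show ?thesis using that C(1) C1(2,3) by blast
qed

lemma error_term_tendsto:
 fixes a c C :: real assumes "a > 0" "c > 0"
 shows "((\<lambda>K. C * (K powr (4/5) * ((1 + a * K powr (-1/2)) * (K * exp (- c * K powr (1/10))))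
   + ((a * K powr (-1/2)) ^ 3 + (a * K powr (-1/2)) ^ 4) * (K * (K powr (1/5))\<^sup>2)
   + (a * K powr (-1/2))\<^sup>2 * (K powr (1/5) * sqrt K + (K powr (4/5) * (1 + K powr (1/10)) + K powr (1/5)))
   + (a * K powr (-1/2)) * (1 + sqrt (K powr (4/5) * (1 + K powr (1/10)) + K powr (1/5))))) \<longlongrightarrow> 0) at_top"
 using assms by real_asymp

text \<open>The exponents must satisfy \<open>0 < 1/10 < 1/5 < 1/4\<close>: gaps long enough for the
  exponential decoupling rate, short compared with the blocks, and blocks short enough for third moments and
  for the random part of the variance.\<close>
lemma eventually_admissible:
 "\<forall>\<^sub>F K in at_top. admissible (K powr (1/5)) (K powr (1/10)) (nat \<lfloor>K / K powr (1/5)\<rfloor>) K \<and> g0 \<le> K powr (1/10)"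
proof -
 have 1: "\<forall>\<^sub>F K::real in at_top. 2 \<le> K powr (1/5)" by real_asymp
 have 2: "\<forall>\<^sub>F K::real in at_top. T0 \<le> exp (K powr (1/5))" by real_asymp
 have 3: "\<forall>\<^sub>F K::real in at_top. K powr (1/10) \<le> K powr (1/5)" by real_asymp
 have 4: "\<forall>\<^sub>F K::real in at_top. K powr (1/5) \<le> K" by real_asymp
 have 5: "\<forall>\<^sub>F K::real in at_top. g0 \<le> K powr (1/10)" by real_asymp
 show ?thesis using 1 2 3 4 5
 proof eventually_elim
  case (elim K)
  let ?L = "K powr (1/5)"
  have K: "0 \<le> K / ?L" "0 < ?L" using elim by auto
  let ?R = "nat \<lfloor>K / ?L\<rfloor>"
  have "0 \<le> \<lfloor>K / ?L\<rfloor>" using K(1) by (simp only: zero_le_floor)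
  then have re: "real ?R = of_int \<lfloor>K / ?L\<rfloor>" by (rule of_nat_nat)
  have r: "real ?R \<le> K / ?L" "K / ?L \<le> real ?R + 1" unfolding re by linarith+
  have "real ?R * ?L \<le> K / ?L * ?L" "K / ?L * ?L \<le> (real ?R + 1) * ?L" by (rule mult_right_mono[OF r(1)] mult_right_mono[OF r(2)], simp)+
  moreover have "K / ?L * ?L = K" using K(2) by simp
  ultimately have "real ?R * ?L \<le> K" "K \<le> (real ?R + 1) * ?L" by (simp_all only:)
  then show ?case unfolding admissible_def using elim by simp
 qed
qed

lemma char_tendsto:
 "((\<lambda>K. \<integral>z. cis (\<tau> / sqrt (\<sigma>2 * K) * ((\<Sum>q\<in>shell T0 (exp K). X q (fst z) (snd z)) - \<sigma>2 * K)) \<partial>PP)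
  \<longlongrightarrow> of_real (exp (- (\<tau>\<^sup>2) / 2))) at_top"
proof -
 obtain C c g0 where C: "C > 0" "c > 0" "g0 > 0"
 "!!L g R K s. admissible L g R K ==> g0 \<le> g ==>
  norm ((\<integral>z. cis (s * ((\<Sum>q\<in>shell T0 (exp K). X q (fst z) (snd z)) - \<sigma>2 * K)) \<partial>PP) - of_real (exp (- (s\<^sup>2 * (\<sigma>2 * K) / 2))))
  \<le> C * (real R * ((1 + \<bar>s\<bar>) * (K * exp (- c * g))) + (\<bar>s\<bar> ^ 3 + s ^ 4) * (K * L\<^sup>2)
    + s\<^sup>2 * (L * sqrt K + (real R * (1 + g) + L)) + \<bar>s\<bar> * (1 + sqrt (real R * (1 + g) + L)))"
  using char_bound by blast
 have sp: "0 < \<sigma>2" using A_pos vol_pos by simp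
 \<comment> \<open>The summand \<open>1\<close> keeps \<open>a\<close> positive when \<open>\<tau> =
   0\<close>.\<close>
 define a where "a = 1 + \<bar>\<tau>\<bar> / sqrt \<sigma>2"
 have a: "a > 0" unfolding a_def using sp by (simp add: add_pos_nonneg)
 show ?thesis
 proof (rule LIM_zero_cancel, rule Lim_null_comparison[OF _ error_term_tendsto[OF a C(2), of C]])
  show "\<forall>\<^sub>F K in at_top. norm ((\<integral>z. cis (\<tau> / sqrt (\<sigma>2 * K) * ((\<Sum>q\<in>shell T0 (exp K). X q (fst z) (snd z)) - \<sigma>2 * K)) \<partial>PP)
    - of_real (exp (- (\<tau>\<^sup>2) / 2))) \<le> C * (K powr (4/5) * ((1 + a * K powr (-1/2)) * (K * exp (- c * K powr (1/10))))
   + ((a * K powr (-1/2)) ^ 3 + (a * K powr (-1/2)) ^ 4) * (K * (K powr (1/5))\<^sup>2)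
   + (a * K powr (-1/2))\<^sup>2 * (K powr (1/5) * sqrt K + (K powr (4/5) * (1 + K powr (1/10)) + K powr (1/5)))
   + (a * K powr (-1/2)) * (1 + sqrt (K powr (4/5) * (1 + K powr (1/10)) + K powr (1/5))))"
   using eventually_admissible[of g0]
  proof eventually_elim
   case (elim K)
   let ?L = "K powr (1/5)" and ?g = "K powr (1/10)" and ?R = "nat \<lfloor>K / K powr (1/5)\<rfloor>" and ?s = "\<tau> / sqrt (\<sigma>2 * K)" and ?h = "a * K powr (-1/2)"
   have ad: "admissible ?L ?g ?R K" using elim by blast
   note f = admissible_facts[OF ad]
   have Kp: "0 < K" using f(6) by linarith
   have R: "real ?R \<le> K powr (4/5)"
   proof -
    have "real ?R \<le> K / ?L" using Kp by (simp add: of_nat_nat)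
    also have "K / ?L = K powr 1 / ?L" using Kp by simp
    also have "... = K powr (4/5)" unfolding powr_diff[symmetric] by simp
    finally show ?thesis .
   qed
   have s: "\<bar>?s\<bar> \<le> ?h"
   proof -
    have "K powr (-1/2) = 1 / sqrt K" using Kp by (simp add: powr_minus_divide powr_half_sqrt[symmetric])
    moreover have "\<bar>sqrt (\<sigma>2 * K)\<bar> = sqrt \<sigma>2 * sqrt K"
     unfolding real_sqrt_mult[of \<sigma>2 K] using A_pos vol_pos Kp by (intro abs_of_nonneg mult_nonneg_nonneg real_sqrt_ge_zero) auto
    ultimately have e: "\<bar>?s\<bar> = (\<bar>\<tau>\<bar> / sqrt \<sigma>2) * K powr (-1/2)" by (simp only: abs_divide) simp
    show ?thesis unfolding e a_def by (rule mult_right_mono) auto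
   qed
   have s2: "?s\<^sup>2 \<le> ?h\<^sup>2" "\<bar>?s\<bar> ^ 3 \<le> ?h ^ 3" "?s ^ 4 \<le> ?h ^ 4"
   proof -
    have gen: "x\<^sup>2 \<le> h\<^sup>2 \<and> \<bar>x\<bar> ^ 3 \<le> h ^ 3 \<and> x ^ 4 \<le> h ^ 4" if "\<bar>x\<bar> \<le> h" for x h :: real
     using power_mono[OF that, of 2] power_mono[OF that, of 3] power_mono[OF that, of 4] by (simp add: power_even_abs)
    show "?s\<^sup>2 \<le> ?h\<^sup>2" "\<bar>?s\<bar> ^ 3 \<le> ?h ^ 3" "?s ^ 4 \<le> ?h ^ 4" using gen[OF s] by blast+
   qed
   have ss: "?s\<^sup>2 * (\<sigma>2 * K) / 2 = \<tau>\<^sup>2 / 2"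
   proof -
    have "(sqrt (\<sigma>2 * K))\<^sup>2 = \<sigma>2 * K" using sp Kp by simp
    then have "?s\<^sup>2 = \<tau>\<^sup>2 / (\<sigma>2 * K)" by (simp only: power_divide)
    then show ?thesis using A_pos vol_pos Kp by simp
   qed
   have Y: "real ?R * (1 + ?g) + ?L \<le> K powr (4/5) * (1 + ?g) + ?L"
    by (rule add_right_mono, rule mult_right_mono[OF R]) simp
   have Y0: "0 \<le> real ?R * (1 + ?g) + ?L" by simp
   have h0: "0 \<le> ?h" using a by simp
   have "norm ((\<integral>z. cis (?s * ((\<Sum>q\<in>shell T0 (exp K). X q (fst z) (snd z)) - \<sigma>2 * K)) \<partial>PP) - of_real (exp (- (?s\<^sup>2 * (\<sigma>2 * K) / 2))))
    \<le> C * (real ?R * ((1 + \<bar>?s\<bar>) * (K * exp (- c * ?g))) + (\<bar>?s\<bar> ^ 3 + ?s ^ 4) * (K * ?L\<^sup>2)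
    + ?s\<^sup>2 * (?L * sqrt K + (real ?R * (1 + ?g) + ?L)) + \<bar>?s\<bar> * (1 + sqrt (real ?R * (1 + ?g) + ?L)))"
    by (rule C(4)[OF ad]) (use elim in blast)
   also have "... \<le> C * (K powr (4/5) * ((1 + ?h) * (K * exp (- c * ?g))) + (?h ^ 3 + ?h ^ 4) * (K * ?L\<^sup>2)
    + ?h\<^sup>2 * (?L * sqrt K + (K powr (4/5) * (1 + ?g) + ?L)) + ?h * (1 + sqrt (K powr (4/5) * (1 + ?g) + ?L)))"
   proof (rule mult_left_mono, intro add_mono)
    show "real ?R * ((1 + \<bar>?s\<bar>) * (K * exp (- c * ?g))) \<le> K powr (4/5) * ((1 + ?h) * (K * exp (- c * ?g)))"
     by (rule mult_mono[OF R mult_right_mono]) (use s Kp in auto)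
    show "(\<bar>?s\<bar> ^ 3 + ?s ^ 4) * (K * ?L\<^sup>2) \<le> (?h ^ 3 + ?h ^ 4) * (K * ?L\<^sup>2)"
     by (rule mult_right_mono[OF add_mono[OF s2(2,3)]]) (use Kp in auto)
    show "?s\<^sup>2 * (?L * sqrt K + (real ?R * (1 + ?g) + ?L)) \<le> ?h\<^sup>2 * (?L * sqrt K + (K powr (4/5) * (1 + ?g) + ?L))"
     by (rule mult_mono[OF s2(1) add_left_mono[OF Y]]) (use Kp in auto)
    show "\<bar>?s\<bar> * (1 + sqrt (real ?R * (1 + ?g) + ?L)) \<le> ?h * (1 + sqrt (K powr (4/5) * (1 + ?g) + ?L))"
     by (rule mult_mono[OF s add_left_mono[OF real_sqrt_le_mono[OF Y]] h0]) (use Y0 in auto)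
   qed (use C(1) in simp)
   finally show ?case unfolding ss by simp
  qed
 qed
qed

end

section \<open>From hits to solutions\<close>

text \<open>Functions of the index pairs, on which product measures live, become matrices and vectors.\<close>
definition torus_point :: "(('m::finite => 'n::finite => real) \<times> ('m => real)) => (real ^ 'n ^ 'm) \<times> (real ^ 'm)" where
 "torus_point z = ((\<chi> i j. fst z i j), (\<chi> i. snd z i))"

lemma Basis_matrix_vector:
 "(Basis :: ((real ^ 'n ^ 'm) \<times> (real ^ 'm)) set) = (\<lambda>(i, j). (axis i (axis j 1), 0)) ` UNIV \<union> (\<lambda>i. (0, axis i 1)) ` UNIV"
 by (auto simp: Basis_prod_def Basis_vec_def)

lemma ball_Basis_matrix_vector:
 fixes P :: "((real ^ 'n ^ 'm) \<times> (real ^ 'm)) => bool"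
 shows "(\<forall>b\<in>Basis. P b) \<longleftrightarrow> (\<forall>i j. P (axis i (axis j 1), 0)) \<and> (\<forall>i. P (0, axis i 1))"
 unfolding Basis_matrix_vector ball_Un by (simp add: split_paired_All)

lemma prod_Basis_matrix_vector:
 fixes F :: "((real ^ 'n ^ 'm) \<times> (real ^ 'm)) => 'c::comm_monoid_mult"
 shows "(\<Prod>b\<in>Basis. F b) = (\<Prod>i\<in>UNIV. \<Prod>j\<in>UNIV. F (axis i (axis j 1), 0)) * (\<Prod>i\<in>UNIV. F (0, axis i 1))"
proof -
 have 1: "inj (\<lambda>(i :: 'm, j :: 'n). (axis i (axis j (1::real)), 0 :: real ^ 'm))"
  by (auto simp: inj_on_def axis_eq_axis)
 have 2: "inj (\<lambda>i :: 'm. (0 :: real ^ 'n ^ 'm, axis i (1::real)))"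
  by (auto simp: inj_on_def axis_eq_axis)
 have d: "(\<lambda>(i :: 'm, j :: 'n). (axis i (axis j (1::real)), 0 :: real ^ 'm)) ` UNIV \<inter> (\<lambda>i :: 'm. (0 :: real ^ 'n ^ 'm, axis i (1::real))) ` UNIV = {}"
  by (auto simp: axis_eq_0_iff)
 show ?thesis unfolding Basis_matrix_vector
  by (subst prod.union_disjoint[OF _ _ d], simp, simp, subst prod.reindex[OF 1], subst prod.reindex[OF 2])
   (simp add: prod.cartesian_product case_prod_unfold)
qed

lemma torus_point_inner:
 "torus_point z \<bullet> (axis i (axis j 1), 0) = fst z i j" "torus_point z \<bullet> (0, axis i 1) = snd z i"
 by (simp_all add: torus_point_def inner_prod_def inner_axis)

lemma measurable_torus_point [measurable]: "torus_point \<in> borel_measurable (tmat \<Otimes>\<^sub>M trow :: (('m::finite => 'n::finite => real) \<times> ('m => real)) measure)"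
proof -
 have m: "(\<lambda>z. fst z i j) \<in> borel_measurable (tmat \<Otimes>\<^sub>M trow :: (('m => 'n => real) \<times> ('m => real)) measure)" for i j
  by (rule measurable_compose[OF measurable_compose[OF measurable_fst tmat_component_measurable] trow_component_measurable])
 have m': "(\<lambda>z. snd z i) \<in> borel_measurable (tmat \<Otimes>\<^sub>M trow :: (('m => 'n => real) \<times> ('m => real)) measure)" for i
  by (rule measurable_compose[OF measurable_snd trow_component_measurable])
 show ?thesis
 proof (rule borel_measurable_euclidean_space[THEN iffD2])
  show "\<forall>b\<in>Basis. (\<lambda>z. torus_point z \<bullet> b) \<in> borel_measurable (tmat \<Otimes>\<^sub>M trow :: (('m => 'n => real) \<times> ('m => real)) measure)"
   unfolding ball_Basis_matrix_vector torus_point_inner by (intro conjI allI m m')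
 qed
qed

text \<open>Boxes with arbitrary measurable sides, needed because the fundamental cube is half-open.\<close>
lemma emeasure_lborel_box_set:
 fixes S :: "'a::euclidean_space => real set"
 assumes [measurable]: "!!b. b \<in> Basis ==> S b \<in> sets borel"
 shows "emeasure lborel {v. \<forall>b\<in>Basis. v \<bullet> b \<in> S b} = (\<Prod>b\<in>Basis. emeasure lborel (S b))"
proof -
 have m: "{v. \<forall>b\<in>Basis. v \<bullet> b \<in> S b} \<in> sets (lborel :: 'a measure)"
 proof -
  have "{v :: 'a. v \<bullet> b \<in> S b} \<in> sets borel" if "b \<in> Basis" for b
  proof -
   have "(\<lambda>v :: 'a. v \<bullet> b) -` S b \<inter> space borel \<in> sets borel" by (rule measurable_sets[OF _ assms[OF that]]) simp
   then show ?thesis by (simp add: vimage_def)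
  qed
  then have "(\<Inter>b\<in>Basis. {v :: 'a. v \<bullet> b \<in> S b}) \<in> sets borel" by (intro sets.finite_INT) auto
  moreover have "(\<Inter>b\<in>Basis. {v :: 'a. v \<bullet> b \<in> S b}) = {v. \<forall>b\<in>Basis. v \<bullet> b \<in> S b}" by auto
  ultimately show ?thesis by simp
 qed
 have "emeasure lborel {v. \<forall>b\<in>Basis. v \<bullet> b \<in> S b} = (\<integral>\<^sup>+v. indicator {v. \<forall>b\<in>Basis. v \<bullet> b \<in> S b} v \<partial>lborel)"
  using m by simp
 also have "... = (\<integral>\<^sup>+v. (\<Prod>b\<in>Basis. indicator (S b) (v \<bullet> b)) \<partial>lborel)"
 proof (intro nn_integral_cong)
  fix v :: 'a
  show "indicator {v. \<forall>b\<in>Basis. v \<bullet> b \<in> S b} v = (\<Prod>b\<in>Basis. indicator (S b) (v \<bullet> b) :: ennreal)"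
  proof (cases "\<forall>b\<in>Basis. v \<bullet> b \<in> S b")
   case False
   then obtain b where b: "b \<in> Basis" "v \<bullet> b \<notin> S b" by blast
   have "(\<Prod>b\<in>Basis. indicator (S b) (v \<bullet> b) :: ennreal) = 0"
    by (rule prod_zero[OF finite_Basis bexI[OF _ b(1)]]) (use b(2) in simp)
   then show ?thesis using False by simp
  qed simp
 qed
 also have "... = (\<Prod>b\<in>Basis. \<integral>\<^sup>+x. indicator (S b) x \<partial>lborel)"
  by (rule nn_integral_lborel_prod) auto
 also have "... = (\<Prod>b\<in>Basis. emeasure lborel (S b))" by (intro prod.cong refl) simp
 finally show ?thesis .
qed

lemma torus_measure_eq_distr:
 "torus_measure = distr (tmat \<Otimes>\<^sub>M trow) borel (torus_point :: _ => (real ^ 'n ^ 'm) \<times> (real ^ 'm))"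
proof (rule measure_eqI_generator_eq)
 let ?M = "distr (tmat \<Otimes>\<^sub>M trow) borel (torus_point :: _ => (real ^ 'n ^ 'm) \<times> (real ^ 'm))"
 let ?E = "range (\<lambda>(a, b). box a b :: ((real ^ 'n ^ 'm) \<times> (real ^ 'm)) set)"
 show "Int_stable ?E" by (auto simp: Int_stable_def box_Int_box)
 show "?E \<subseteq> Pow UNIV" by simp
 show "sets torus_measure = sigma_sets UNIV ?E" by (simp add: torus_measure_def borel_eq_box)
 show "sets ?M = sigma_sets UNIV ?E" by (simp add: borel_eq_box)
 let ?A = "\<lambda>n::nat. box (- (real n *\<^sub>R One)) (real n *\<^sub>R One) :: ((real ^ 'n ^ 'm) \<times> (real ^ 'm)) set"
 show "range ?A \<subseteq> ?E" "(\<Union>i. ?A i) = UNIV" unfolding UN_box_eq_UNIV by auto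
 interpret T: prob_space "torus_measure :: ((real ^ 'n ^ 'm) \<times> (real ^ 'm)) measure" by (rule prob_space_torus_measure)
 show "emeasure torus_measure (?A i) \<noteq> \<infinity>" for i by simp
 show "emeasure torus_measure Y = emeasure ?M Y" if Y_box: "Y \<in> ?E" for Y
 proof -
  obtain c where "Y = (\<lambda>(a, b). box a b) c" using Y_box unfolding image_def by blast
  then obtain l r where Y: "Y = box l r" by (simp add: case_prod_unfold)
  define S where "S b = {0..<1} \<inter> {l \<bullet> b<..<r \<bullet> b}" for b
  have "torus_cube \<inter> Y = {v. \<forall>b\<in>Basis. v \<bullet> b \<in> S b}"
   unfolding Y S_def
   by (auto simp: mem_box ball_Basis_matrix_vector torus_cube_def inner_prod_def inner_axis)
  moreover have "emeasure torus_measure Y = emeasure lborel (torus_cube \<inter> Y)"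
   unfolding torus_measure_def using Y by (simp add: emeasure_torus_cube divide_ennreal_def)
  ultimately have "emeasure torus_measure Y = (\<Prod>b\<in>Basis. emeasure lborel (S b))"
   using emeasure_lborel_box_set[of S] by (simp add: S_def)
  also have "... = emeasure ?M Y"
  proof -
   interpret c: prob_space circ by (rule prob_space_circ)
   interpret cn: product_sigma_finite "\<lambda>_ :: 'n. circ"
    by (intro product_sigma_finite.intro prob_space_imp_sigma_finite prob_space_circ)
   interpret cm: product_sigma_finite "\<lambda>_ :: 'm. circ"
    by (intro product_sigma_finite.intro prob_space_imp_sigma_finite prob_space_circ)
   interpret tm: product_sigma_finite "\<lambda>_ :: 'm. trow :: ('n => real) measure"
    by (intro product_sigma_finite.intro prob_space_imp_sigma_finite prob_space_trow)
   interpret x: prob_space "trow :: ('m => real) measure" by (rule prob_space_trow)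
   let ?I = "\<lambda>b. {l \<bullet> b<..<r \<bullet> b}"
   let ?U = "\<Pi>\<^sub>E i\<in>UNIV. \<Pi>\<^sub>E j\<in>UNIV. ?I (axis i (axis j 1), 0)" and ?V = "\<Pi>\<^sub>E i\<in>UNIV. ?I (0, axis i 1)"
   have row: "(\<Pi>\<^sub>E j\<in>UNIV. ?I (axis i (axis j 1), 0)) \<in> sets (trow :: ('n => real) measure)" for i :: 'm
    unfolding trow_def by (rule sets_PiM_I_finite) auto
   have Us: "?U \<in> sets (tmat :: ('m => 'n => real) measure)" unfolding tmat_def by (rule sets_PiM_I_finite) (auto intro: row)
   have Vs: "?V \<in> sets (trow :: ('m => real) measure)" unfolding trow_def by (rule sets_PiM_I_finite) auto
   have "torus_point -` Y \<inter> space (tmat \<Otimes>\<^sub>M trow) = ?U \<times> ?V"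
   proof -
    have "torus_point z \<in> Y \<longleftrightarrow> (\<forall>i j. fst z i j \<in> ?I (axis i (axis j 1), 0)) \<and> (\<forall>i. snd z i \<in> ?I (0, axis i 1))" for z
     unfolding Y mem_box ball_Basis_matrix_vector torus_point_inner greaterThanLessThan_iff ..
    then have "z \<in> torus_point -` Y \<inter> space (tmat \<Otimes>\<^sub>M trow) \<longleftrightarrow> z \<in> ?U \<times> ?V" for z
     by (simp add: mem_Times_iff space_pair_measure tmat_def trow_def space_PiM PiE_iff)
    then show ?thesis by (rule set_eqI)
   qed
   then have "emeasure ?M Y = emeasure tmat ?U * emeasure trow ?V"
    using x.emeasure_pair_measure_Times[OF Us Vs] by (subst emeasure_distr) (auto simp: Y)
   also have "emeasure tmat ?U = (\<Prod>i\<in>UNIV. \<Prod>j\<in>UNIV. emeasure circ (?I (axis i (axis j 1), 0)))"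
   proof -
    have "emeasure (trow :: ('n => real) measure) (\<Pi>\<^sub>E j\<in>UNIV. ?I (axis i (axis j 1), 0)) = (\<Prod>j\<in>UNIV. emeasure circ (?I (axis i (axis j 1), 0)))" for i :: 'm
     unfolding trow_def by (rule cn.emeasure_PiM) auto
    then show ?thesis unfolding tmat_def by (subst tm.emeasure_PiM) (simp_all only: finite row)
   qed
   also have "emeasure trow ?V = (\<Prod>i\<in>UNIV. emeasure circ (?I (0, axis i 1)))"
    unfolding trow_def by (rule cm.emeasure_PiM) auto
   finally show ?thesis unfolding prod_Basis_matrix_vector S_def by (simp only: emeasure_circ borel_open open_greaterThanLessThan)
  qed
  finally show ?thesis .
 qed
qed

lemma card_near_integers:
 fixes y B :: real assumes "0 \<le> B"
 shows "finite {k::int. \<bar>of_int k + y\<bar> < B}" "real (card {k::int. \<bar>of_int k + y\<bar> < B}) \<le> 2 * B + 1"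
proof -
 let ?J = "{\<lceil>- y - B\<rceil>..\<lfloor>- y + B\<rfloor>}"
 have s: "{k::int. \<bar>of_int k + y\<bar> < B} \<subseteq> ?J"
 proof
  fix k :: int assume "k \<in> {k. \<bar>of_int k + y\<bar> < B}"
  then have "\<bar>real_of_int k + y\<bar> < B" by simp
  then have "- y - B \<le> real_of_int k" "real_of_int k \<le> - y + B" by linarith+
  then show "k \<in> ?J" by (simp add: ceiling_le_iff le_floor_iff)
 qed
 then show "finite {k::int. \<bar>of_int k + y\<bar> < B}" by (rule finite_subset) simp
 have "card {k::int. \<bar>of_int k + y\<bar> < B} \<le> card ?J" by (rule card_mono[OF _ s]) simp
 moreover have "real (card ?J) \<le> 2 * B + 1"
 proof -
  have "real_of_int (\<lfloor>- y + B\<rfloor> + 1 - \<lceil>- y - B\<rceil>) \<le> 2 * B + 1"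
   using of_int_floor_le[of "- y + B"] le_of_int_ceiling[of "- y - B"] by linarith
  then show ?thesis using assms by (cases "0 \<le> \<lfloor>- y + B\<rfloor> + 1 - \<lceil>- y - B\<rceil>") auto
 qed
 ultimately show "real (card {k::int. \<bar>of_int k + y\<bar> < B}) \<le> 2 * B + 1" by linarith
qed

lemma card_near_integers_eq:
 fixes y B :: real assumes "B \<le> 1/2"
 shows "real (card {k::int. \<bar>of_int k + y\<bar> < B}) = near_int B y"
proof (cases "\<exists>k::int. \<bar>of_int k + y\<bar> < B")
 case True
 then obtain k :: int where k: "\<bar>of_int k + y\<bar> < B" by blast
 have "{k::int. \<bar>of_int k + y\<bar> < B} = {k}"
 proof (rule equalityI)
  show "{k::int. \<bar>of_int k + y\<bar> < B} \<subseteq> {k}"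
  proof
   fix k' :: int assume "k' \<in> {k. \<bar>of_int k + y\<bar> < B}"
   then have "\<bar>real_of_int k' + y\<bar> < B" by simp
   then have "\<bar>real_of_int (k' - k)\<bar> < 1" using k assms by simp
   then have "k' - k = 0" by linarith
   then show "k' \<in> {k}" by simp
  qed
 qed (use k in simp)
 then show ?thesis using True by (simp add: near_int_def)
qed (simp add: near_int_def)

lemma card_int_vec_Pi:
 fixes S :: "'m::finite => int set"
 shows "card {p :: int ^ 'm. \<forall>i. p $ i \<in> S i} = (\<Prod>i\<in>UNIV. card (S i))"
proof -
 have "bij_betw vec_lambda (\<Pi>\<^sub>E i\<in>UNIV. S i) {p :: int ^ 'm. \<forall>i. p $ i \<in> S i}"
  by (rule bij_betwI[where g = vec_nth]) (auto simp: PiE_iff)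
 then have "card {p :: int ^ 'm. \<forall>i. p $ i \<in> S i} = card (\<Pi>\<^sub>E i\<in>UNIV. S i)" by (rule bij_betw_same_card[symmetric])
 also have "... = (\<Prod>i\<in>UNIV. card (S i))" by (rule card_PiE) simp
 finally show ?thesis .
qed

context clt_setting begin

abbreviation \<Delta> :: "real => (('m => 'n => real) \<times> ('m => real)) => real" where
 "\<Delta> T z \<equiv> real (Delta N \<theta> \<omega> (fst (torus_point z)) (snd (torus_point z)) T)"

lemma Delta_eq_sum:
 "\<Delta> T z = (\<Sum>q\<in>{q. q \<noteq> 0 \<and> nn q < T}. \<Prod>i\<in>UNIV. real (card {k::int. \<bar>of_int k + (rdot (fst z i) q + snd z i)\<bar> < b q i}))"
proof -
 let ?Q = "{q. q \<noteq> 0 \<and> nn q < T}"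
 let ?S = "\<lambda>q i. {k::int. \<bar>of_int k + (rdot (fst z i) q + snd z i)\<bar> < b q i}"
 let ?P = "\<lambda>q. {p :: int ^ 'm. \<forall>i. p $ i \<in> ?S q i}"
 have "solutions N \<theta> \<omega> (fst (torus_point z)) (snd (torus_point z)) T = prod.swap ` (SIGMA q:?Q. ?P q)"
 proof -
  have "(p, q) \<in> solutions N \<theta> \<omega> (fst (torus_point z)) (snd (torus_point z)) T \<longleftrightarrow> (q, p) \<in> (SIGMA q:?Q. ?P q)" for p q
   using nn_pos[of q] by (auto simp: solutions_def torus_point_def rdot_def b_def nn_def add.assoc)
  then show ?thesis by (auto simp: image_iff)
 qed
 then have "Delta N \<theta> \<omega> (fst (torus_point z)) (snd (torus_point z)) T = card (SIGMA q:?Q. ?P q)"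
  unfolding Delta_def by (simp add: card_image)
 also have "... = (\<Sum>q\<in>?Q. card (?P q))"
 proof (rule card_SigmaI)
  show "finite ?Q" by (rule finite_subset[OF _ finite_nn_less[of T]]) auto
  have "finite (?P q)" for q
  proof -
   have "?P q \<subseteq> vec_lambda ` (\<Pi>\<^sub>E i\<in>UNIV. ?S q i)"
   proof
    fix p assume "p \<in> ?P q"
    then have "vec_nth p \<in> (\<Pi>\<^sub>E i\<in>UNIV. ?S q i)" by auto
    then have "vec_lambda (vec_nth p) \<in> vec_lambda ` (\<Pi>\<^sub>E i\<in>UNIV. ?S q i)" by (rule imageI)
    then show "p \<in> vec_lambda ` (\<Pi>\<^sub>E i\<in>UNIV. ?S q i)" by (simp only: vec_nth_inverse)
   qed
   moreover have "finite (\<Pi>\<^sub>E i\<in>UNIV. ?S q i)" by (rule finite_PiE) (auto intro: card_near_integers(1)[OF b_nonneg])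
   ultimately show ?thesis by (rule finite_subset[OF _ finite_imageI])
  qed
  then show "\<forall>q\<in>?Q. finite (?P q)" by blast
 qed
 also have "... = (\<Sum>q\<in>?Q. \<Prod>i\<in>UNIV. card (?S q i))" by (simp only: card_int_vec_Pi)
 finally show ?thesis by simp
qed

text \<open>Frequencies of norm at least \<open>T0\<close> admit at most one solution, and the finitely many
  smaller ones contribute a bounded number.\<close>
lemma Delta_near_hits: obtains C where "0 \<le> C"
 "!!T z. T0 \<le> T ==> \<bar>\<Delta> T z - (\<Sum>q\<in>shell T0 T. X q (fst z) (snd z))\<bar> \<le> C"
proof -
 let ?Q0 = "{q. q \<noteq> 0 \<and> nn q < T0}"
 define C where "C = (\<Sum>q\<in>?Q0. \<Prod>i\<in>UNIV. 2 * b q i + 1)"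
 have C0: "0 \<le> C" unfolding C_def by (intro sum_nonneg prod_nonneg ballI add_nonneg_nonneg) (auto simp: b_nonneg)
 have "\<bar>\<Delta> T z - (\<Sum>q\<in>shell T0 T. X q (fst z) (snd z))\<bar> \<le> C" if T: "T0 \<le> T" for T z
 proof -
  let ?c = "\<lambda>q. \<Prod>i\<in>UNIV. real (card {k::int. \<bar>of_int k + (rdot (fst z i) q + snd z i)\<bar> < b q i})"
  have nz: "q \<noteq> 0" if "T0 \<le> nn q" for q
  proof
   assume "q = 0"
   then have "of_int_vec q = (0 :: real ^ 'n)" by (simp add: vec_eq_iff)
   then have "nn q = 0" unfolding nn_def by (simp only: N_zero)
   then show False using that T0_ge_1 by simp
  qed
  have sp: "{q. q \<noteq> 0 \<and> nn q < T} = ?Q0 \<union> shell T0 T" using T nz by (auto simp: shell_def)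
  have f0: "finite ?Q0" by (rule finite_subset[OF _ finite_nn_less[of T0]]) auto
  have "\<Delta> T z = (\<Sum>q\<in>?Q0. ?c q) + (\<Sum>q\<in>shell T0 T. ?c q)"
   unfolding Delta_eq_sum sp by (rule sum.union_disjoint[OF f0 finite_shell]) (auto simp: shell_def)
  moreover have "(\<Sum>q\<in>shell T0 T. ?c q) = (\<Sum>q\<in>shell T0 T. X q (fst z) (snd z))"
   unfolding box_hit_def torus_prod_def
   by (intro sum.cong prod.cong refl card_near_integers_eq b_le_half) (auto simp: shell_def)
  moreover have "0 \<le> (\<Sum>q\<in>?Q0. ?c q)" by (intro sum_nonneg prod_nonneg) auto
  moreover have "(\<Sum>q\<in>?Q0. ?c q) \<le> C" unfolding C_def
   by (intro sum_mono prod_mono conjI card_near_integers(2)[OF b_nonneg]) auto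
  ultimately show ?thesis by linarith
 qed
 then show ?thesis using that C0 by blast
qed

lemma measurable_Delta: "(\<lambda>z. \<Delta> T z) \<in> borel_measurable PP"
proof -
 have n: "is_norm N" by (rule is_norm)
 have "(\<lambda>(u, x). real (Delta N \<theta> \<omega> u x T)) \<in> borel_measurable borel"
  using borel_measurable_Delta[OF n, of \<theta> \<omega> T] by (simp add: torus_measure_def measurable_def uniform_measure_def)
 from measurable_compose[OF measurable_torus_point this] show ?thesis by (simp add: case_prod_beta)
qed

lemma char_Delta_tendsto:
 "((\<lambda>K. \<integral>z. cis (\<tau> / sqrt (\<sigma>2 * K) * (\<Delta> (exp K) z - \<sigma>2 * K)) \<partial>PP) \<longlongrightarrow> of_real (exp (- (\<tau>\<^sup>2) / 2))) at_top"
proof -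
 obtain C where C: "0 \<le> C" "!!T z. T0 \<le> T ==> \<bar>\<Delta> T z - (\<Sum>q\<in>shell T0 T. X q (fst z) (snd z))\<bar> \<le> C"
  using Delta_near_hits by blast
 interpret P: prob_space PP by (rule prob_space_tP)
 have sp: "0 < \<sigma>2" using A_pos vol_pos by simp
 note [measurable] = measurable_Delta
 let ?F = "\<lambda>K. \<integral>z. cis (\<tau> / sqrt (\<sigma>2 * K) * (\<Delta> (exp K) z - \<sigma>2 * K)) \<partial>PP"
 let ?G = "\<lambda>K. \<integral>z. cis (\<tau> / sqrt (\<sigma>2 * K) * ((\<Sum>q\<in>shell T0 (exp K). X q (fst z) (snd z)) - \<sigma>2 * K)) \<partial>PP"
 have "((\<lambda>K. ?F K - ?G K) \<longlongrightarrow> 0) at_top"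
 proof (rule Lim_null_comparison)
  show "\<forall>\<^sub>F K in at_top. norm (?F K - ?G K) \<le> \<bar>\<tau> / sqrt (\<sigma>2 * K)\<bar> * C"
  proof -
   have "\<forall>\<^sub>F K::real in at_top. T0 \<le> exp K" by real_asymp
   then show ?thesis
   proof eventually_elim
    case (elim K)
    let ?s = "\<tau> / sqrt (\<sigma>2 * K)"
    let ?f = "\<lambda>z. cis (?s * (\<Delta> (exp K) z - \<sigma>2 * K))" and ?g = "\<lambda>z. cis (?s * ((\<Sum>q\<in>shell T0 (exp K). X q (fst z) (snd z)) - \<sigma>2 * K))"
    have i: "integrable PP ?f" "integrable PP ?g" by (rule P.integrable_const_bound[where B = 1], simp, measurable)+
    have "norm (?F K - ?G K) = norm (\<integral>z. ?f z - ?g z \<partial>PP)" by (simp only: Bochner_Integration.integral_diff[OF i])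
    also have "... \<le> \<bar>?s\<bar> * C"
    proof (rule integral_norm_le_const[OF prob_space_tP])
     show "(\<lambda>z. ?f z - ?g z) \<in> borel_measurable PP" by measurable
     fix z :: "('m => 'n => real) \<times> ('m => real)"
     have "norm (?f z - ?g z) \<le> \<bar>?s * (\<Delta> (exp K) z - \<sigma>2 * K) - ?s * ((\<Sum>q\<in>shell T0 (exp K). X q (fst z) (snd z)) - \<sigma>2 * K)\<bar>"
      by (rule norm_cis_diff_le)
     also have "... = \<bar>?s\<bar> * \<bar>\<Delta> (exp K) z - (\<Sum>q\<in>shell T0 (exp K). X q (fst z) (snd z))\<bar>"
      by (simp only: right_diff_distrib[symmetric] abs_mult) simp
     also have "... \<le> \<bar>?s\<bar> * C" by (rule mult_left_mono[OF C(2)[OF elim]]) simp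
     finally show "norm (?f z - ?g z) \<le> \<bar>?s\<bar> * C" .
    qed
    finally show ?case .
   qed
  qed
  have "((\<lambda>K. \<tau> / sqrt (\<sigma>2 * K)) \<longlongrightarrow> 0) at_top"
   by (rule tendsto_divide_0[OF tendsto_const], rule filterlim_at_top_imp_at_infinity,
     rule filterlim_compose[OF sqrt_at_top], rule filterlim_tendsto_pos_mult_at_top[OF tendsto_const sp filterlim_ident])
  then show "((\<lambda>K. \<bar>\<tau> / sqrt (\<sigma>2 * K)\<bar> * C) \<longlongrightarrow> 0) at_top"
   by (intro tendsto_mult_left_zero tendsto_rabs_zero)
 qed
 from tendsto_add[OF this char_tendsto[of \<tau>]] show ?thesis by simp
qed

lemma sigma_const_eq: "sigma_const N \<theta> = sqrt \<sigma>2"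
 by (simp add: sigma_const_def A_def vol_def)

lemma weak_convergence:
 "weak_conv_along
   (\<lambda>T. distr torus_measure borel
    (\<lambda>(u, x). (real (Delta N \<theta> \<omega> u x T) - (sigma_const N \<theta>)\<^sup>2 * ln T) / (sigma_const N \<theta> * sqrt (ln T))))
   std_normal_distribution at_top"
proof -
 let ?f = "\<lambda>T v. (real (Delta N \<theta> \<omega> (fst v) (snd v) T) - (sigma_const N \<theta>)\<^sup>2 * ln T) / (sigma_const N \<theta> * sqrt (ln T))"
 let ?\<mu> = "\<lambda>T. distr torus_measure borel (?f T)"
 have n: "is_norm N" by (rule is_norm)
 have sp: "0 < \<sigma>2" using A_pos vol_pos by simp
 have mf: "?f T \<in> borel_measurable torus_measure" for T
  using borel_measurable_Delta[OF n, of \<theta> \<omega> T] by (simp add: case_prod_unfold)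
 have mf': "?f T \<in> borel_measurable borel" for T
  using mf[of T] by (simp add: torus_measure_def measurable_def uniform_measure_def)
 have rd: "real_distribution (?\<mu> T)" for T
  using prob_space.prob_space_distr[OF prob_space_torus_measure mf] by (intro real_distribution.intro real_distribution_axioms.intro) auto
 have ch: "char (?\<mu> T) \<tau> = (\<integral>z. cis (\<tau> / sqrt (\<sigma>2 * ln T) * (\<Delta> (exp (ln T)) z - \<sigma>2 * ln T)) \<partial>PP)" if "0 < T" for T \<tau>
 proof -
  have "char (?\<mu> T) \<tau> = (\<integral>v. iexp (\<tau> * ?f T v) \<partial>torus_measure)"
   unfolding char_def by (rule integral_distr[OF mf]) measurable
  also have "... = (\<integral>z. iexp (\<tau> * ?f T (torus_point z)) \<partial>PP)"
   unfolding torus_measure_eq_distr by (rule integral_distr[OF measurable_torus_point]) (use mf' in measurable)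
  also have "... = (\<integral>z. cis (\<tau> / sqrt (\<sigma>2 * ln T) * (\<Delta> (exp (ln T)) z - \<sigma>2 * ln T)) \<partial>PP)"
  proof (rule Bochner_Integration.integral_cong[OF refl])
   fix z
   have s: "(sqrt \<sigma>2)\<^sup>2 = \<sigma>2" using sp by simp
   show "iexp (\<tau> * ?f T (torus_point z)) = cis (\<tau> / sqrt (\<sigma>2 * ln T) * (\<Delta> (exp (ln T)) z - \<sigma>2 * ln T))"
    unfolding cis_conv_exp sigma_const_eq s real_sqrt_mult[of \<sigma>2 "ln T"] exp_ln[OF that] by simp
  qed
  finally show ?thesis .
 qed
 have lim: "((\<lambda>T. char (?\<mu> T) \<tau>) \<longlongrightarrow> char std_normal_distribution \<tau>) at_top" for \<tau>
 proof -
  have "((\<lambda>T. \<integral>z. cis (\<tau> / sqrt (\<sigma>2 * ln T) * (\<Delta> (exp (ln T)) z - \<sigma>2 * ln T)) \<partial>PP) \<longlongrightarrow> of_real (exp (- (\<tau>\<^sup>2) / 2))) at_top"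
   by (rule filterlim_compose[OF char_Delta_tendsto[of \<tau>] ln_at_top])
  then have "((\<lambda>T. char (?\<mu> T) \<tau>) \<longlongrightarrow> of_real (exp (- (\<tau>\<^sup>2) / 2))) at_top"
  proof (rule Lim_transform_eventually)
   show "\<forall>\<^sub>F T in at_top. (\<integral>z. cis (\<tau> / sqrt (\<sigma>2 * ln T) * (\<Delta> (exp (ln T)) z - \<sigma>2 * ln T)) \<partial>PP) = char (?\<mu> T) \<tau>"
    using eventually_gt_at_top[of 0] by eventually_elim (simp only: ch)
  qed
  then show ?thesis unfolding char_std_normal_distribution .
 qed
 have "((\<lambda>T. cdf (?\<mu> T) x) \<longlongrightarrow> cdf std_normal_distribution x) at_top" if x: "isCont (cdf std_normal_distribution) x" for x
 proof (rule tendsto_at_topI_sequentially)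
  fix Z :: "nat => real" assume Z: "filterlim Z at_top sequentially"
  have "weak_conv_m (\<lambda>k. ?\<mu> (Z k)) std_normal_distribution"
  proof (rule levy_continuity[OF rd])
   show "real_distribution std_normal_distribution" by (rule real_dist_normal_dist)
   show "(\<lambda>k. char (?\<mu> (Z k)) \<tau>) \<longlonglongrightarrow> char std_normal_distribution \<tau>" for \<tau>
    by (rule filterlim_compose[OF lim Z])
  qed
  then show "(\<lambda>k. cdf (?\<mu> (Z k)) x) \<longlonglongrightarrow> cdf std_normal_distribution x"
   using x by (simp add: weak_conv_m_def weak_conv_def)
 qed
 then show ?thesis unfolding weak_conv_along_def case_prod_unfold by blast
qed

end

theorem theorem1p1:
  fixes \<theta> \<omega> :: "real ^ 'm" and N :: "real ^ 'n \<Rightarrow> real"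
  assumes "CARD('m) \<ge> 2" and "CARD('n) \<ge> 1"
    and "\<And>i. \<theta> $ i > 0"
    and "\<And>i. \<omega> $ i > 0"
    and "(\<Sum>i\<in>UNIV. \<omega> $ i) = real CARD('n)"
    and "is_norm N"
  shows "sigma_const N \<theta> > 0 \<and>
    weak_conv_along
      (\<lambda>T. distr torus_measure borel
         (\<lambda>(u, x). (real (Delta N \<theta> \<omega> u x T) - (sigma_const N \<theta>)\<^sup>2 * ln T) / (sigma_const N \<theta> * sqrt (ln T))))
      std_normal_distribution at_top"
proof -
  interpret clt_setting N \<theta> \<omega> by unfold_locales (use assms in auto)
  have "0 < \<sigma>2" using A_pos vol_pos by simp
  then have "sigma_const N \<theta> > 0" unfolding sigma_const_eq by simp
  then show ?thesis using weak_convergence by blast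
qed

end
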